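(* Let $\lambda=(\lambda_1>\lambda_2>\dots>\lambda_n>0)$ be a generic positive spectrum, let $N=n(n-1)/2$, and let $F:\mathcal{O}(\lambda)\to\mathbb{R}^{N}$ be the Gelfand--Cetlin map. Let $\Lambda$ be a value of $F$ such that the equalities in the Gelfand--Cetlin triangle of $\Lambda$ form exactly $s\ge1$ diamonds, of sizes $l_1,\dots,l_s\ge2$ respectively, which do not intersect each other (a multiple-diamond singularity). Then the fiber $F^{-1}(\Lambda)$ is a Lagrangian submanifold of $\mathcal{O}(\lambda)$ (of dimension $N$, the same as regular fibers), diffeomorphic to $$SU(l_1)\times\cdots\times SU(l_s)\times\mathbb{T}^{\,N-\sum_{i=1}^s(l_i^2-1)},$$ where $\mathbb{T}^m=U(1)^m$.
   Context: $\mathcal{O}(\lambda)$ is the set of Hermitian $n\times n$ complex matrices with spectrum $\lambda$, with the Kirillov--Kostant--Souriau symplectic form $\omega_A([H_1,A],[H_2,A])=\sqrt{-1}\,\mathrm{tr}(A[H_1,H_2])$ for $H_1,H_2$ skew-Hermitian (where $T_A\mathcal{O}(\lambda)=\{[B,A]:B\in\mathfrak{u}(n)\}$). For $A\in\mathcal{O}(\lambda)$ let $A_k$ be its upper-left $k\times k$ submatrix, with eigenvalues $F_{1,k}(A)\ge\dots\ge F_{k,k}(A)$; the Gelfand--Cetlin map is $F=(F_{i,j})_{1\le i\le j<n}$. The Gelfand--Cetlin triangle of $\Lambda=(\lambda_{i,j})_{1\le i\le j<n}$ is the array $\lambda_{i,j}$, $1\le i\le j\le n$, with $\lambda_{i,n}:=\lambda_i$,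 satisfying $\lambda_{i,j+1}\ge\lambda_{i,j}\ge\lambda_{i+1,j+1}$. A diamond of size $l\ge2$ is a set of positions in this triangle consisting, for some $i,k$ with $i\ge1$, $i+l-1\le k$, $k+l-1\le n$, of the positions $(a,j)$ with $k-l+1\le j\le k$ and $i\le a\le i+l-1-(k-j)$, together with the positions $(a,j)$ with $k\le j\le k+l-1$ and $i+(j-k)\le a\le i+l-1$ (so row $j$ contains $l-|k-j|$ of its positions). That the equalities of $\Lambda$ form exactly $s$ non-intersecting diamonds means: there are $s$ pairwise disjoint diamonds such that, for neighbouring positions $(i,j),(i,j+1)$ or $(i,j),(i+1,j+1)$ or $(i,j),(i+1,j)$, the two entries are equal if and only if both positions belong to the same diamond. *)

theory Defs
  imports
    "HOL-Analysis.Analysis"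
    "HOL-Analysis.Finite_Function_Topology"
    "Jordan_Normal_Form.Char_Poly"
    "Jordan_Normal_Form.Schur_Decomposition"
begin

section \<open>Smooth maps and submanifolds\<close>

text \<open>
  All spaces of matrices, of tuples and of coordinates live in types of finitely supported
  families \<open>('i, 'b) poly_mapping\<close>, which \<open>HOL-Analysis\<close> makes normed vector spaces; this allows
  dimensions to be ordinary natural numbers. The subsets considered below all lie in a
  finite-dimensional coordinate subspace. Since the projection onto such a subspace is bounded and
  linear, a map locally extends smoothly to the subspace iff it does to the whole type, so the
  notions below are the usual ones for subsets of Euclidean space.
\<close>

text \<open>For \<open>S\<close> open in a finite-dimensional space this is the usual notion of class \<open>C\<^sup>k\<close>.\<close>

fun Ck_on :: "nat \<Rightarrow> 'a::real_normed_vector set \<Rightarrow> ('a \<Rightarrow> 'b::real_normed_vector) \<Rightarrow> bool" where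
  "Ck_on 0 S f \<longleftrightarrow> continuous_on S f"
| "Ck_on (Suc k) S f \<longleftrightarrow>
     (\<forall>x\<in>S. f differentiable (at x)) \<and>
     (\<forall>v. Ck_on k S (\<lambda>x. frechet_derivative f (at x) v))"

definition smooth_on :: "'a::real_normed_vector set \<Rightarrow> ('a \<Rightarrow> 'b::real_normed_vector) \<Rightarrow> bool" where
  "smooth_on S f \<longleftrightarrow> (\<forall>k. Ck_on k S f)"

text \<open>Smoothness on an arbitrary subset: local extendability to smooth maps on open sets.\<close>

definition smooth_map_on ::
    "'a::real_normed_vector set \<Rightarrow> ('a \<Rightarrow> 'b::real_normed_vector) \<Rightarrow> bool" where
  "smooth_map_on X f \<longleftrightarrow>
     (\<forall>x\<in>X. \<exists>U g. open U \<and> x \<in> U \<and> smooth_on U g \<and> (\<forall>y\<in>U \<inter> X. g y = f y))"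

definition diffeomorphic ::
    "'a::real_normed_vector set \<Rightarrow> 'b::real_normed_vector set \<Rightarrow> bool" where
  "diffeomorphic X Y \<longleftrightarrow>
     (\<exists>f g. smooth_map_on X f \<and> smooth_map_on Y g \<and> f ` X \<subseteq> Y \<and> g ` Y \<subseteq> X \<and>
            (\<forall>x\<in>X. g (f x) = x) \<and> (\<forall>y\<in>Y. f (g y) = y))"

text \<open>The product \<open>X 0 \<times> \<dots> \<times> X (m - 1)\<close>, realised by families vanishing outside \<open>{..<m}\<close>.\<close>

definition finprod_set :: "nat \<Rightarrow> (nat \<Rightarrow> 'a::zero set) \<Rightarrow> (nat, 'a) poly_mapping set" where
  "finprod_set m X = {x. Poly_Mapping.keys x \<subseteq> {..<m} \<and> (\<forall>r<m. Poly_Mapping.lookup x r \<in> X r)}"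

definition Rn :: "nat \<Rightarrow> (nat, real) poly_mapping set" where
  "Rn d = finprod_set d (\<lambda>_. UNIV)"

definition submanifold :: "nat \<Rightarrow> 'a::real_normed_vector set \<Rightarrow> bool" where
  "submanifold d M \<longleftrightarrow>
     (\<forall>p\<in>M. \<exists>W V. open W \<and> p \<in> W \<and> openin (top_of_set (Rn d)) V \<and> diffeomorphic (M \<inter> W) V)"

definition tangent_space :: "'a::real_normed_vector set \<Rightarrow> 'a \<Rightarrow> 'a set" where
  "tangent_space M p =
     {v. \<exists>\<epsilon>>0. \<exists>\<gamma> :: real \<Rightarrow> 'a. smooth_on {-\<epsilon><..<\<epsilon>} \<gamma> \<and> \<gamma> ` {-\<epsilon><..<\<epsilon>} \<subseteq> M \<and>
        \<gamma> 0 = p \<and> (\<gamma> has_vector_derivative v) (at 0)}"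

section \<open>Matrices\<close>

text \<open>The family of entries of a matrix, extended by zero.\<close>

definition entries :: "complex mat \<Rightarrow> (nat \<times> nat, complex) poly_mapping" where
  "entries A = Abs_poly_mapping
     (\<lambda>(i, j). if i < dim_row A \<and> j < dim_col A then A $$ (i, j) else 0)"

definition trace_mat :: "complex mat \<Rightarrow> complex" where
  "trace_mat A = sum_list (diag_mat A)"

definition commutator :: "complex mat \<Rightarrow> complex mat \<Rightarrow> complex mat" where
  "commutator A B = A * B - B * A"

definition hermitian_mats :: "nat \<Rightarrow> complex mat set" where
  "hermitian_mats n = {A \<in> carrier_mat n n. mat_adjoint A = A}"

definition skew_hermitian_mats :: "nat \<Rightarrow> complex mat set" where
  "skew_hermitian_mats n = {A \<in> carrier_mat n n. mat_adjoint A = - A}"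

definition SU :: "nat \<Rightarrow> complex mat set" where
  "SU l = {U \<in> carrier_mat l l. U * mat_adjoint U = 1\<^sub>m l \<and> Determinant.det U = 1}"

section \<open>Coadjoint orbits and the Gelfand--Cetlin map\<close>

text \<open>
  As in the literature, spectra, Gelfand--Cetlin indices and positions are numbered from 1
  (whereas matrix entries are indexed from 0).
\<close>

definition orbit :: "nat \<Rightarrow> (nat \<Rightarrow> real) \<Rightarrow> complex mat set" where
  "orbit n lam = {A \<in> hermitian_mats n.
     proots (char_poly A) = image_mset (\<lambda>i. complex_of_real (lam i)) (mset_set {1..n})}"

definition orbit_tangent :: "nat \<Rightarrow> complex mat \<Rightarrow> complex mat set" where
  "orbit_tangent n A = {commutator B A | B. B \<in> skew_hermitian_mats n}"

text \<open>The value does not depend on the choice of \<open>H1\<close> and \<open>H2\<close>, see \<open>kks_form_commutator\<close> below.\<close>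

definition kks_form :: "nat \<Rightarrow> complex mat \<Rightarrow> complex mat \<Rightarrow> complex mat \<Rightarrow> complex" where
  "kks_form n A X Y = (THE w. \<exists>H1\<in>skew_hermitian_mats n. \<exists>H2\<in>skew_hermitian_mats n.
     X = commutator H1 A \<and> Y = commutator H2 A \<and> w = \<i> * trace_mat (A * commutator H1 H2))"

lemma trace_mat_mult_commute:
  assumes "A \<in> carrier_mat n n" "B \<in> carrier_mat n n"
  shows "trace_mat (A * B) = trace_mat (B * A)"
proof -
  have expand: "trace_mat (C * D) = (\<Sum>i<n. \<Sum>j<n. C $$ (i, j) * D $$ (j, i))"
    if "C \<in> carrier_mat n n" "D \<in> carrier_mat n n" for C D
    using that
    by (auto simp: trace_mat_def diag_mat_def sum_list_sum_nth scalar_prod_def atLeast0LessThan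
             intro!: sum.cong)
  have "(\<Sum>i<n. \<Sum>j<n. A $$ (i, j) * B $$ (j, i)) = (\<Sum>j<n. \<Sum>i<n. B $$ (j, i) * A $$ (i, j))"
    by (subst sum.swap) (simp only: mult.commute)
  then show ?thesis
    using assms by (simp only: expand)
qed

lemma trace_mat_minus:
  assumes "A \<in> carrier_mat n n" "B \<in> carrier_mat n n"
  shows "trace_mat (A - B) = trace_mat A - trace_mat B"
proof -
  have expand: "trace_mat C = (\<Sum>i<n. C $$ (i, i))" if "C \<in> carrier_mat n n" for C
    using that by (simp add: trace_mat_def diag_mat_def sum_list_sum_nth atLeast0LessThan)
  have "(\<Sum>i<n. (A - B) $$ (i, i)) = (\<Sum>i<n. A $$ (i, i) - B $$ (i, i))"
    using assms by (intro sum.cong) auto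
  then show ?thesis
    using assms by (simp add: expand[of A] expand[of B] expand[of "A - B"] minus_carrier_mat sum_subtractf)
qed

lemma kks_form_commutator:
  assumes A: "A \<in> carrier_mat n n"
    and H: "H1 \<in> skew_hermitian_mats n" "H2 \<in> skew_hermitian_mats n"
  shows "kks_form n A (commutator H1 A) (commutator H2 A) = \<i> * trace_mat (A * commutator H1 H2)"
proof -
  have left: "trace_mat (A * commutator K1 K2) = - trace_mat (commutator K1 A * K2)" (is ?l)
   and right: "trace_mat (A * commutator K1 K2) = trace_mat (K1 * commutator K2 A)" (is ?r)
    if K: "K1 \<in> carrier_mat n n" "K2 \<in> carrier_mat n n" for K1 K2
  proof -
    note mult_carrier = mult_carrier_mat[of _ n n _ n]
    have 1: "trace_mat (A * commutator K1 K2) = trace_mat (A * (K1 * K2)) - trace_mat (A * (K2 * K1))"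
      unfolding commutator_def
      by (simp only: mult_minus_distrib_mat[of _ n n _ n] trace_mat_minus[of _ n] A K mult_carrier)
    have 2: "trace_mat (commutator K1 A * K2) = trace_mat (K1 * A * K2) - trace_mat (A * K1 * K2)"
      unfolding commutator_def
      by (simp only: minus_mult_distrib_mat[of _ n n _ _ n] trace_mat_minus[of _ n] A K mult_carrier)
    have 3: "trace_mat (K1 * commutator K2 A) = trace_mat (K1 * (K2 * A)) - trace_mat (K1 * (A * K2))"
      unfolding commutator_def
      by (simp only: mult_minus_distrib_mat[of _ n n _ n] trace_mat_minus[of _ n] A K mult_carrier)
    have 4: "trace_mat (K1 * (A * K2)) = trace_mat (A * (K2 * K1))"
      using trace_mat_mult_commute[of K1 n "A * K2"] assoc_mult_mat[OF A K(2) K(1)]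
      by (simp only: A K mult_carrier)
    have 5: "trace_mat (K1 * (K2 * A)) = trace_mat (A * (K1 * K2))"
      using trace_mat_mult_commute[of "K1 * K2" n A] assoc_mult_mat[OF K A]
      by (simp only: A K mult_carrier)
    have 6: "K1 * A * K2 = K1 * (A * K2)" "A * K1 * K2 = A * (K1 * K2)"
      using assoc_mult_mat[OF K(1) A K(2)] assoc_mult_mat[OF A K] by auto
    show ?l using 1 2 4 unfolding 6 by simp
    show ?r using 1 3 4 5 by simp
  qed
  have carrier: "K \<in> carrier_mat n n" if "K \<in> skew_hermitian_mats n" for K
    using that by (simp add: skew_hermitian_mats_def)
  have unique: "trace_mat (A * commutator K1 K2) = trace_mat (A * commutator H1 H2)"
    if K: "K1 \<in> skew_hermitian_mats n" "K2 \<in> skew_hermitian_mats n"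
      and eq: "commutator H1 A = commutator K1 A" "commutator H2 A = commutator K2 A" for K1 K2
  proof -
    note c = carrier[OF K(1)] carrier[OF K(2)] carrier[OF H(1)] carrier[OF H(2)]
    have "trace_mat (A * commutator K1 K2) = trace_mat (A * commutator H1 K2)"
      by (simp only: left[OF c(1,2)] left[OF c(3,2)] eq)
    also have "\<dots> = trace_mat (A * commutator H1 H2)"
      by (simp only: right[OF c(3,2)] right[OF c(3,4)] eq)
    finally show ?thesis .
  qed
  show ?thesis
    unfolding kks_form_def
  proof (rule the_equality)
    show "\<exists>H1'\<in>skew_hermitian_mats n. \<exists>H2'\<in>skew_hermitian_mats n.
      commutator H1 A = commutator H1' A \<and> commutator H2 A = commutator H2' A \<and>
      \<i> * trace_mat (A * commutator H1 H2) = \<i> * trace_mat (A * commutator H1' H2')"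
      using H by blast
  qed (auto simp: unique)
qed

definition upper_left :: "nat \<Rightarrow> complex mat \<Rightarrow> complex mat" where
  "upper_left k A = Matrix.mat k k (\<lambda>ij. A $$ ij)"

text \<open>Eigenvalues with multiplicity in decreasing order; for Hermitian matrices they are real.\<close>

definition eigenvalues_desc :: "complex mat \<Rightarrow> real list" where
  "eigenvalues_desc A = rev (sorted_list_of_multiset (image_mset Re (proots (char_poly A))))"

definition gc_map :: "nat \<Rightarrow> complex mat \<Rightarrow> nat \<times> nat \<Rightarrow> real" where
  "gc_map n A = (\<lambda>(i, j)\<in>{(i, j). 1 \<le> i \<and> i \<le> j \<and> j < n}.
     eigenvalues_desc (upper_left j A) ! (i - 1))"

definition gc_fiber :: "nat \<Rightarrow> (nat \<Rightarrow> real) \<Rightarrow> (nat \<times> nat \<Rightarrow> real) \<Rightarrow> complex mat set" where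
  "gc_fiber n lam Lam = {A \<in> orbit n lam. gc_map n A = Lam}"

definition mat_tangent :: "nat \<Rightarrow> complex mat set \<Rightarrow> complex mat \<Rightarrow> complex mat set" where
  "mat_tangent n L A = {X \<in> carrier_mat n n. entries X \<in> tangent_space (entries ` L) (entries A)}"

text \<open>
  As the orbit is an embedded submanifold of the space of matrices, its (embedded) submanifolds
  are the submanifolds of the space of matrices contained in it.
\<close>

definition orbit_submanifold :: "nat \<Rightarrow> (nat \<Rightarrow> real) \<Rightarrow> nat \<Rightarrow> complex mat set \<Rightarrow> bool" where
  "orbit_submanifold n lam d L \<longleftrightarrow> L \<subseteq> orbit n lam \<and> submanifold d (entries ` L)"

text \<open>Each tangent space is its own orthogonal complement with respect to the symplectic form.\<close>

definition lagrangian :: "nat \<Rightarrow> complex mat set \<Rightarrow> bool" where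
  "lagrangian n L \<longleftrightarrow> (\<forall>A\<in>L.
     {X \<in> orbit_tangent n A. \<forall>Y\<in>mat_tangent n L A. kks_form n A X Y = 0} = mat_tangent n L A)"

section \<open>Diamonds in the Gelfand--Cetlin triangle\<close>

definition gc_triangle ::
    "nat \<Rightarrow> (nat \<Rightarrow> real) \<Rightarrow> (nat \<times> nat \<Rightarrow> real) \<Rightarrow> nat \<times> nat \<Rightarrow> real" where
  "gc_triangle n lam Lam = (\<lambda>(i, j). if j = n then lam i else Lam (i, j))"

text \<open>The inequalities are rearranged to avoid truncated subtraction.\<close>

definition diamond_at :: "nat \<Rightarrow> nat \<Rightarrow> nat \<Rightarrow> (nat \<times> nat) set" where
  "diamond_at l i k =
     {(a, j). k + 1 \<le> j + l \<and> j \<le> k \<and> i \<le> a \<and> a + 1 + k \<le> i + l + j} \<union>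
     {(a, j). k \<le> j \<and> j + 1 \<le> k + l \<and> i + j \<le> a + k \<and> a + 1 \<le> i + l}"

definition is_diamond :: "nat \<Rightarrow> nat \<Rightarrow> (nat \<times> nat) set \<Rightarrow> bool" where
  "is_diamond n l D \<longleftrightarrow> l \<ge> 2 \<and>
     (\<exists>i k. 1 \<le> i \<and> i + l \<le> k + 1 \<and> k + l \<le> n + 1 \<and> D = diamond_at l i k)"

definition triangle_neighbours :: "nat \<Rightarrow> nat \<times> nat \<Rightarrow> nat \<times> nat \<Rightarrow> bool" where
  "triangle_neighbours n p q \<longleftrightarrow>
     p \<in> {(i, j). 1 \<le> i \<and> i \<le> j \<and> j \<le> n} \<and> q \<in> {(i, j). 1 \<le> i \<and> i \<le> j \<and> j \<le> n} \<and>
     (case p of (i, j) \<Rightarrow> q = (i, j + 1) \<or> q = (i + 1, j + 1) \<or> q = (i + 1, j))"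

text \<open>The equalities in the triangle \<open>T\<close> form exactly \<open>s\<close> disjoint diamonds of sizes \<open>l 0, \<dots>, l (s - 1)\<close>.\<close>

definition equalities_form_diamonds ::
    "nat \<Rightarrow> (nat \<times> nat \<Rightarrow> real) \<Rightarrow> nat \<Rightarrow> (nat \<Rightarrow> nat) \<Rightarrow> bool" where
  "equalities_form_diamonds n T s l \<longleftrightarrow>
     (\<exists>D. (\<forall>r<s. is_diamond n (l r) (D r)) \<and> disjoint_family_on D {..<s} \<and>
          (\<forall>p q. triangle_neighbours n p q \<longrightarrow>
             (T p = T q \<longleftrightarrow> (\<exists>r<s. p \<in> D r \<and> q \<in> D r))))"

end

(* Extended by diamonds of size 1, the given diamonds partition the triangle. For a matrix A in the fiber, the
   eigenspace of the leading j x j block A_j for the value of a diamond has as dimension the width of the diamond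
   in row j. It grows by one vector per row up to the widest row of the diamond and then shrinks by one vector per
   row. The vector that enters is determined by the previous rows; the vector that leaves is the normalised
   component of the new column, whose norm is prescribed by the characteristic polynomials (by interlacing, it is
   nonzero exactly in the shrinking half) and whose direction is free. Hence the fiber is parametrised by the
   unitary matrix from the entering to the leaving vectors of each diamond; a diamond reaching row n loses its
   last vector only after row n, so that only the special unitary part of its matrix remains. Of the size 1
   diamonds only phases survive. All these data are smooth, in fact rational, in A.

   The tangent space at A consists of the Hermitian Y whose leading blocks Y_j have zero compression to every
   eigenspace of A_j. Equivalently, it is spanned by the commutators [B, A] with B skew-Hermitian of size j < n
   commuting with A_j; as trace (Y B) = 0 for such Y and B, both descriptions together show that the fiber is
   Lagrangian. *)

theory Submission
  imports Defs
begin

section \<open>Calculus of smooth maps\<close>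

text \<open>Spectral projections usually come from contour integrals, hence only locally. Here the
  recursion \<open>step\<close> yields them row by row, and all its denominators are constants: by
  uniqueness of partial fractions the corner entries and the squared norms of the components of the
  columns agree on the whole fiber, so they are read off one point \<open>A0\<close>. The
  parametrisation and its inverse thus become polynomial in the entries and their conjugates and are
  smooth on the whole ambient space. The torus has one circle for each diamond, of size 1 or more,
  that ends before row n. The spectrum being simple, exactly n diamonds reach row n; the squares of
  the sizes of all diamonds add up to n (n + 1) / 2, whence the dimension N. That the two
  descriptions of the tangent space agree comes down to a linear system. If Y vanishes on the
  leading block of size j, the next row gives one real equation for each growing diamond; the
  unknowns are the new corner and one real part for each shrinking diamond. There are as many
  equations as unknowns, and the matrix is a bordered Cauchy matrix, hence invertible.\<close>

lemma Ck_on_imp_continuous_on: "Ck_on k S f \<Longrightarrow> continuous_on S f"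
  by (cases k) (auto intro!: continuous_at_imp_continuous_on differentiable_imp_continuous_within)

lemma Ck_on_subset: "Ck_on k S f \<Longrightarrow> T \<subseteq> S \<Longrightarrow> Ck_on k T f"
  by (induction k arbitrary: f) (auto intro: continuous_on_subset)

lemma Ck_on_SucD: "Ck_on (Suc k) S f \<Longrightarrow> Ck_on k S f"
proof (induction k arbitrary: f)
  case 0
  then show ?case using Ck_on_imp_continuous_on by fastforce
qed auto

text \<open>Openness enters because an equality on \<open>S\<close> carries a derivative over only
  at interior points.\<close>

lemma Ck_on_cong:
  assumes "open S" "\<And>x. x \<in> S \<Longrightarrow> f x = g x" "Ck_on k S f"
  shows "Ck_on k S g"
  using assms(2,3)
proof (induction k arbitrary: f g)
  case 0
  then show ?case by (auto cong: continuous_on_cong)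
next
  case (Suc k)
  have *: "(g has_derivative frechet_derivative f (at x)) (at x)" if "x \<in> S" for x
  proof -
    have "(f has_derivative frechet_derivative f (at x)) (at x)"
      using Suc.prems that by (auto simp: frechet_derivative_works)
    then show ?thesis
      by (rule has_derivative_transform_within_open[OF _ assms(1) that]) (use Suc.prems in auto)
  qed
  then have "frechet_derivative g (at x) = frechet_derivative f (at x)" if "x \<in> S" for x
    using frechet_derivative_at that by metis
  then show ?case
    using * Suc.prems Suc.IH[of "\<lambda>x. frechet_derivative f (at x) v" "\<lambda>x. frechet_derivative g (at x) v" for v]
    by (auto simp: differentiable_def)
qed

text \<open>Together with \<open>Ck_on_SucE\<close> this frees the inductions below from the fixed
  choice \<open>frechet_derivative\<close>: any family of derivatives supplied by the usual rules
  will do.\<close>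

lemma Ck_on_SucI:
  assumes "open S" "\<And>x. x \<in> S \<Longrightarrow> (f has_derivative f' x) (at x)" "\<And>v. Ck_on k S (\<lambda>x. f' x v)"
  shows "Ck_on (Suc k) S f"
proof -
  have "frechet_derivative f (at x) = f' x" if "x \<in> S" for x
    using frechet_derivative_at assms(2) that by metis
  then show ?thesis
    using assms by (auto simp: differentiable_def intro: Ck_on_cong[OF assms(1) _ assms(3)])
qed

lemma Ck_on_SucE:
  assumes "Ck_on (Suc k) S f"
  obtains f' where "\<And>x. x \<in> S \<Longrightarrow> (f has_derivative f' x) (at x)" "\<And>v. Ck_on k S (\<lambda>x. f' x v)"
  using that[of "\<lambda>x. frechet_derivative f (at x)"] assms by (auto simp: frechet_derivative_works)

lemma Ck_on_const: "open S \<Longrightarrow> Ck_on k S (\<lambda>x. c)"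
proof (induction k arbitrary: c)
  case (Suc k)
  show ?case by (rule Ck_on_SucI[where f'="\<lambda>x v. 0"]) (use Suc in auto)
qed auto

lemma Ck_on_bounded_linear: "open S \<Longrightarrow> bounded_linear f \<Longrightarrow> Ck_on k S f"
proof (cases k)
  case 0
  assume "bounded_linear f" then show ?thesis using 0 by (auto intro: linear_continuous_on)
next
  case (Suc m)
  assume *: "open S" "bounded_linear f"
  show ?thesis unfolding Suc
    by (rule Ck_on_SucI[where f'="\<lambda>x. f"]) (use * in \<open>auto intro: Ck_on_const bounded_linear_imp_has_derivative\<close>)
qed

lemma Ck_on_linear_compose:
  "open S \<Longrightarrow> bounded_linear h \<Longrightarrow> Ck_on k S f \<Longrightarrow> Ck_on k S (\<lambda>x. h (f x))"
proof (induction k arbitrary: f)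
  case 0
  then show ?case by (auto intro: continuous_on_compose2[OF linear_continuous_on[of h UNIV]])
next
  case (Suc k)
  from Suc.prems(3) obtain f' where f': "\<And>x. x \<in> S \<Longrightarrow> (f has_derivative f' x) (at x)"
    "\<And>v. Ck_on k S (\<lambda>x. f' x v)" by (rule Ck_on_SucE) blast
  show ?case
    by (rule Ck_on_SucI[where f'="\<lambda>x v. h (f' x v)"])
       (use Suc f' in \<open>auto intro: bounded_linear.has_derivative\<close>)
qed

lemma Ck_on_compose_linear:
  "open S \<Longrightarrow> open T \<Longrightarrow> bounded_linear h \<Longrightarrow> h ` S \<subseteq> T \<Longrightarrow> Ck_on k T f \<Longrightarrow> Ck_on k S (\<lambda>x. f (h x))"
proof (induction k arbitrary: f)
  case 0
  then show ?case
    by (auto intro: continuous_on_compose2[of T f] linear_continuous_on)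
next
  case (Suc k)
  from Suc.prems(5) obtain f' where f': "\<And>x. x \<in> T \<Longrightarrow> (f has_derivative f' x) (at x)"
    "\<And>v. Ck_on k T (\<lambda>x. f' x v)" by (rule Ck_on_SucE) blast
  show ?case
  proof (rule Ck_on_SucI[where f'="\<lambda>x v. f' (h x) (h v)"])
    fix x assume "x \<in> S"
    then have "(f has_derivative f' (h x)) (at (h x))" using Suc.prems f' by auto
    then show "((\<lambda>x. f (h x)) has_derivative (\<lambda>v. f' (h x) (h v))) (at x)"
      using has_derivative_compose[OF bounded_linear_imp_has_derivative[OF Suc.prems(3)]] by auto
  next
    show "Ck_on k S (\<lambda>x. f' (h x) (h v))" for v
      by (rule Suc.IH[OF Suc.prems(1-4), of "\<lambda>y. f' y (h v)"]) (rule f')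
  qed (use Suc in auto)
qed

lemma Ck_on_add: "open S \<Longrightarrow> Ck_on k S f \<Longrightarrow> Ck_on k S g \<Longrightarrow> Ck_on k S (\<lambda>x. f x + g x)"
proof (induction k arbitrary: f g)
  case 0
  then show ?case by (auto intro: continuous_intros)
next
  case (Suc k)
  from Suc.prems(2) obtain f' where f': "\<And>x. x \<in> S \<Longrightarrow> (f has_derivative f' x) (at x)"
    "\<And>v. Ck_on k S (\<lambda>x. f' x v)" by (rule Ck_on_SucE) blast
  from Suc.prems(3) obtain g' where g': "\<And>x. x \<in> S \<Longrightarrow> (g has_derivative g' x) (at x)"
    "\<And>v. Ck_on k S (\<lambda>x. g' x v)" by (rule Ck_on_SucE) blast
  show ?case
    by (rule Ck_on_SucI[where f'="\<lambda>x v. f' x v + g' x v"])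
       (use Suc f' g' in \<open>auto intro: has_derivative_add\<close>)
qed

lemma Ck_on_bilinear:
  assumes "bounded_bilinear B"
  shows "open S \<Longrightarrow> Ck_on k S f \<Longrightarrow> Ck_on k S g \<Longrightarrow> Ck_on k S (\<lambda>x. B (f x) (g x))"
proof (induction k arbitrary: f g)
  case 0
  then show ?case by (auto intro: bounded_bilinear.continuous_on[OF assms])
next
  case (Suc k)
  from Suc.prems(2) obtain f' where f': "\<And>x. x \<in> S \<Longrightarrow> (f has_derivative f' x) (at x)"
    "\<And>v. Ck_on k S (\<lambda>x. f' x v)" by (rule Ck_on_SucE) blast
  from Suc.prems(3) obtain g' where g': "\<And>x. x \<in> S \<Longrightarrow> (g has_derivative g' x) (at x)"
    "\<And>v. Ck_on k S (\<lambda>x. g' x v)" by (rule Ck_on_SucE) blast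
  show ?case
    by (rule Ck_on_SucI[where f'="\<lambda>x v. B (f x) (g' x v) + B (f' x v) (g x)"])
       (use Suc.prems(1) Suc.IH f' g' Ck_on_SucD[OF Suc.prems(2)] Ck_on_SucD[OF Suc.prems(3)] in
         \<open>auto intro: bounded_bilinear.FDERIV[OF assms] Ck_on_add\<close>)
qed

text \<open>The derivative of the inverse is a product of the inverse itself with the derivative of
  \<open>f\<close>, so the induction hypothesis at order \<open>k\<close> yields order
  \<open>k + 1\<close>.\<close>

lemma Ck_on_inverse:
  fixes f :: "'a::real_normed_vector \<Rightarrow> 'b::real_normed_field"
  shows "open S \<Longrightarrow> Ck_on k S f \<Longrightarrow> \<forall>x\<in>S. f x \<noteq> 0 \<Longrightarrow> Ck_on k S (\<lambda>x. inverse (f x))"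
proof (induction k arbitrary: f)
  case 0
  then show ?case by (auto intro: continuous_on_inverse)
next
  case (Suc k)
  from Suc.prems(2) obtain f' where f': "\<And>x. x \<in> S \<Longrightarrow> (f has_derivative f' x) (at x)"
    "\<And>v. Ck_on k S (\<lambda>x. f' x v)" by (rule Ck_on_SucE) blast
  have inv: "Ck_on k S (\<lambda>x. inverse (f x))"
    by (rule Suc.IH[OF Suc.prems(1) Ck_on_SucD[OF Suc.prems(2)] Suc.prems(3)])
  show ?case
  proof (rule Ck_on_SucI[where f'="\<lambda>x v. - (inverse (f x) * f' x v * inverse (f x))"])
    show "Ck_on k S (\<lambda>x. - (inverse (f x) * f' x v * inverse (f x)))" for v
      by (intro Ck_on_linear_compose[where h="uminus"] bounded_linear_minus[OF bounded_linear_ident]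
            Ck_on_bilinear[OF bounded_bilinear_mult] inv f' Suc.prems(1))
  qed (use Suc.prems f' in \<open>auto intro: has_derivative_inverse\<close>)
qed

lemma Ck_on_lincomb:
  "open S \<Longrightarrow> (\<And>h e. (h, e) \<in> set xs \<Longrightarrow> Ck_on k S h) \<Longrightarrow>
   Ck_on k S (\<lambda>x. \<Sum>(h, e)\<leftarrow>xs. h x *\<^sub>R e)"
proof (induction xs)
  case (Cons a xs)
  then show ?case
    by (cases a) (auto intro!: Ck_on_add Ck_on_bilinear[OF bounded_bilinear_scaleR] Ck_on_const)
qed (auto intro: Ck_on_const)

text \<open>As \<^const>\<open>Ck_on\<close> only controls directional derivatives, the chain rule needs an inner map of
  finite rank.\<close>

lemma Ck_on_compose:
  fixes xs :: "(('a::real_normed_vector \<Rightarrow> real) \<times> 'b::real_normed_vector) list"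
  defines "p \<equiv> \<lambda>x. \<Sum>(h, e)\<leftarrow>xs. h x *\<^sub>R e"
  assumes S: "open S" and T: "open T" and p: "p ` S \<subseteq> T"
  shows "Ck_on k T g \<Longrightarrow> (\<And>h e. (h, e) \<in> set xs \<Longrightarrow> Ck_on k S h) \<Longrightarrow> Ck_on k S (\<lambda>x. g (p x))"
proof (induction k arbitrary: g)
  case 0
  have "continuous_on S p"
    using Ck_on_lincomb[OF S, of xs 0] 0 unfolding p_def by auto
  then show ?case using 0 p by (auto intro: continuous_on_compose2)
next
  case (Suc k)
  from Suc.prems(1) obtain g' where g': "\<And>x. x \<in> T \<Longrightarrow> (g has_derivative g' x) (at x)"
    "\<And>v. Ck_on k T (\<lambda>x. g' x v)" by (rule Ck_on_SucE) blast
  define xs' where "xs' = map (\<lambda>(h, e). (\<lambda>x. frechet_derivative h (at x), e)) xs"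
  have pder: "(p has_derivative (\<lambda>v. \<Sum>(h, e)\<leftarrow>xs. frechet_derivative h (at x) v *\<^sub>R e)) (at x)"
    if x: "x \<in> S" for x
    using Suc.prems(2) unfolding p_def
  proof (induction xs)
    case (Cons a xs)
    obtain h e where a: "a = (h, e)" by (cases a)
    have "(h has_derivative frechet_derivative h (at x)) (at x)"
      using Cons.prems[of h e] x by (auto simp: a frechet_derivative_works)
    then have "((\<lambda>x. h x *\<^sub>R e) has_derivative (\<lambda>v. frechet_derivative h (at x) v *\<^sub>R e)) (at x)"
      by (rule has_derivative_scaleR_left)
    then show ?case using Cons by (auto simp: a intro!: has_derivative_add)
  qed auto
  show ?case
  proof (rule Ck_on_SucI[where f'="\<lambda>x v. g' (p x) (\<Sum>(h, e)\<leftarrow>xs. frechet_derivative h (at x) v *\<^sub>R e)"])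
    show "((\<lambda>x. g (p x)) has_derivative (\<lambda>v. g' (p x) (\<Sum>(h, e)\<leftarrow>xs. frechet_derivative h (at x) v *\<^sub>R e))) (at x)"
      if "x \<in> S" for x
      using has_derivative_compose[OF pder[OF that] g'(1)] p that by auto
    fix v
    \<comment> \<open>By linearity only the derivatives of \<open>g\<close> in the finitely many
      fixed directions \<open>e\<close> occur, and these are what \<open>Ck_on\<close>
      controls.\<close>
    have lin: "g' (p x) (\<Sum>(h, e)\<leftarrow>ys. frechet_derivative h (at x) v *\<^sub>R e) =
        (\<Sum>(h, e)\<leftarrow>ys. frechet_derivative h (at x) v *\<^sub>R g' (p x) e)" if "x \<in> S" for x and ys :: "(('a \<Rightarrow> real) \<times> 'b) list"
    proof -
      interpret bounded_linear "g' (p x)" using g'(1) p that has_derivative_bounded_linear by blast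
      show ?thesis by (induction ys) (auto simp: zero add scaleR)
    qed
    have "Ck_on k S (\<lambda>x. \<Sum>(h, e)\<leftarrow>ys. frechet_derivative h (at x) v *\<^sub>R g' (p x) e)"
      if "set ys \<subseteq> set xs" for ys
      using that
    proof (induction ys)
      case (Cons a ys)
      obtain h e where a: "a = (h, e)" by (cases a)
      have "Ck_on k S (\<lambda>x. g' (p x) e)"
        using Suc.IH[OF g'(2)] Ck_on_SucD[OF Suc.prems(2)] by auto
      moreover have "Ck_on k S (\<lambda>x. frechet_derivative h (at x) v)"
        using Suc.prems(2)[of h e] Cons.prems a by auto
      ultimately show ?case using Cons
        by (auto simp: a intro!: Ck_on_add Ck_on_bilinear[OF bounded_bilinear_scaleR] S)
    qed (auto intro: Ck_on_const S)
    then show "Ck_on k S (\<lambda>x. g' (p x) (\<Sum>(h, e)\<leftarrow>xs. frechet_derivative h (at x) v *\<^sub>R e))"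
      by (rule Ck_on_cong[OF S, rotated]) (auto simp: lin)
  qed (use S in auto)
qed

section \<open>Closure properties of smooth functions on open sets\<close>

named_theorems smooth

lemma smooth_onI: "(\<And>k. Ck_on k S f) \<Longrightarrow> smooth_on S f"
  and smooth_onD: "smooth_on S f \<Longrightarrow> Ck_on k S f"
  by (auto simp: smooth_on_def)

lemma smooth_on_imp_continuous_on: "smooth_on S f \<Longrightarrow> continuous_on S f"
  using Ck_on_imp_continuous_on smooth_onD by blast

lemma smooth_on_imp_differentiable: "smooth_on S f \<Longrightarrow> x \<in> S \<Longrightarrow> f differentiable at x"
  using smooth_onD[of S f "Suc 0"] by simp

lemma smooth_on_subset: "smooth_on S f \<Longrightarrow> T \<subseteq> S \<Longrightarrow> smooth_on T f"
  by (auto simp: smooth_on_def intro: Ck_on_subset)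

lemma smooth_on_cong:
  "open S \<Longrightarrow> (\<And>x. x \<in> S \<Longrightarrow> f x = g x) \<Longrightarrow> smooth_on S f \<Longrightarrow> smooth_on S g"
  by (auto simp: smooth_on_def intro: Ck_on_cong)

lemma smooth_on_const [smooth]: "open S \<Longrightarrow> smooth_on S (\<lambda>x. c)"
  by (auto simp: smooth_on_def intro: Ck_on_const)

lemma smooth_on_bounded_linear: "open S \<Longrightarrow> bounded_linear f \<Longrightarrow> smooth_on S f"
  by (auto simp: smooth_on_def intro: Ck_on_bounded_linear)

lemma smooth_on_ident [smooth]: "open S \<Longrightarrow> smooth_on S (\<lambda>x. x)"
  by (auto intro: smooth_on_bounded_linear bounded_linear_ident)

lemma smooth_on_linear_compose:
  "open S \<Longrightarrow> bounded_linear h \<Longrightarrow> smooth_on S f \<Longrightarrow> smooth_on S (\<lambda>x. h (f x))"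
  by (auto simp: smooth_on_def intro: Ck_on_linear_compose)

lemma smooth_on_compose_linear:
  "open S \<Longrightarrow> open T \<Longrightarrow> bounded_linear h \<Longrightarrow> h ` S \<subseteq> T \<Longrightarrow> smooth_on T f \<Longrightarrow> smooth_on S (\<lambda>x. f (h x))"
  unfolding smooth_on_def using Ck_on_compose_linear by blast

lemma smooth_on_add [smooth]:
  "open S \<Longrightarrow> smooth_on S f \<Longrightarrow> smooth_on S g \<Longrightarrow> smooth_on S (\<lambda>x. f x + g x)"
  by (auto simp: smooth_on_def intro: Ck_on_add)

lemma smooth_on_minus [smooth]: "open S \<Longrightarrow> smooth_on S f \<Longrightarrow> smooth_on S (\<lambda>x. - f x)"
  by (rule smooth_on_linear_compose[where h=uminus]) (auto intro: bounded_linear_minus bounded_linear_ident)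

lemma smooth_on_diff [smooth]:
  "open S \<Longrightarrow> smooth_on S f \<Longrightarrow> smooth_on S g \<Longrightarrow> smooth_on S (\<lambda>x. f x - g x)"
  using smooth_on_add[of S f "\<lambda>x. - g x"] smooth_on_minus[of S g] by simp

lemma smooth_on_sum [smooth]:
  "open S \<Longrightarrow> (\<And>i. i \<in> I \<Longrightarrow> smooth_on S (f i)) \<Longrightarrow> smooth_on S (\<lambda>x. \<Sum>i\<in>I. f i x)"
  by (induction I rule: infinite_finite_induct) (auto intro: smooth_on_const smooth_on_add)

lemma smooth_on_mult [smooth]:
  fixes f :: "'a::real_normed_vector \<Rightarrow> 'b::real_normed_algebra"
  shows "open S \<Longrightarrow> smooth_on S f \<Longrightarrow> smooth_on S g \<Longrightarrow> smooth_on S (\<lambda>x. f x * g x)"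
  by (auto simp: smooth_on_def intro: Ck_on_bilinear[OF bounded_bilinear_mult])

lemma smooth_on_prod [smooth]:
  fixes f :: "'i \<Rightarrow> 'a::real_normed_vector \<Rightarrow> 'b::{real_normed_algebra_1,comm_monoid_mult}"
  shows "open S \<Longrightarrow> (\<And>i. i \<in> I \<Longrightarrow> smooth_on S (f i)) \<Longrightarrow> smooth_on S (\<lambda>x. \<Prod>i\<in>I. f i x)"
  by (induction I rule: infinite_finite_induct) (auto intro: smooth_on_const smooth_on_mult)

lemma smooth_on_divide [smooth]:
  fixes f :: "'a::real_normed_vector \<Rightarrow> 'b::real_normed_field"
  assumes "open S" "smooth_on S f" "smooth_on S g" "\<And>x. x \<in> S \<Longrightarrow> g x \<noteq> 0"
  shows "smooth_on S (\<lambda>x. f x / g x)"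
proof -
  have "smooth_on S (\<lambda>x. inverse (g x))"
    using assms by (auto simp: smooth_on_def intro: Ck_on_inverse)
  then show ?thesis using assms by (auto simp: divide_inverse intro: smooth_on_mult)
qed

lemma smooth_on_cnj [smooth]: "open S \<Longrightarrow> smooth_on S f \<Longrightarrow> smooth_on S (\<lambda>x. cnj (f x))"
  by (rule smooth_on_linear_compose[OF _ bounded_linear_cnj])

lemma smooth_on_Re [smooth]: "open S \<Longrightarrow> smooth_on S f \<Longrightarrow> smooth_on S (\<lambda>x. Re (f x))"
  by (rule smooth_on_linear_compose[OF _ bounded_linear_Re])

lemma smooth_on_Im [smooth]: "open S \<Longrightarrow> smooth_on S f \<Longrightarrow> smooth_on S (\<lambda>x. Im (f x))"
  by (rule smooth_on_linear_compose[OF _ bounded_linear_Im])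

lemma smooth_on_complex_of_real [smooth]:
  "open S \<Longrightarrow> smooth_on S f \<Longrightarrow> smooth_on S (\<lambda>x. complex_of_real (f x))"
  by (rule smooth_on_linear_compose[OF _ bounded_linear_of_real])

lemma smooth_on_Pair [smooth]:
  assumes "open S" "smooth_on S f" "smooth_on S g"
  shows "smooth_on S (\<lambda>x. (f x, g x))"
proof -
  have 1: "bounded_linear (\<lambda>y. (y, 0))" "bounded_linear (\<lambda>y. (0, y))"
    by (auto intro: bounded_linear_Pair bounded_linear_ident bounded_linear_zero)
  have "smooth_on S (\<lambda>x. (f x, 0) + (0, g x))"
    by (intro smooth_on_add smooth_on_linear_compose[OF _ 1(1)] smooth_on_linear_compose[OF _ 1(2)] assms)
  then show ?thesis by simp
qed

lemma smooth_on_fst [smooth]: "open S \<Longrightarrow> smooth_on S f \<Longrightarrow> smooth_on S (\<lambda>x. fst (f x))"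
  by (rule smooth_on_linear_compose[OF _ bounded_linear_fst])

lemma smooth_on_snd [smooth]: "open S \<Longrightarrow> smooth_on S f \<Longrightarrow> smooth_on S (\<lambda>x. snd (f x))"
  by (rule smooth_on_linear_compose[OF _ bounded_linear_snd])

text \<open>The norm of a finitely supported family is the l1 norm. Allowing a set \<open>I\<close>
  larger than the support lets an arbitrary index be included in the sum.\<close>

lemma norm_poly_mapping_sum:
  assumes "finite I" "Poly_Mapping.keys x \<subseteq> I"
  shows "norm x = (\<Sum>i\<in>I. norm (Poly_Mapping.lookup x i))"
  unfolding norm_poly_mapping_def dist_poly_mapping_def
  by (rule sum.mono_neutral_cong_left) (use assms in \<open>auto simp: in_keys_iff\<close>)

lemma bounded_linear_lookup: "bounded_linear (\<lambda>x. Poly_Mapping.lookup x i)"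
proof (rule bounded_linear_intro[where K=1])
  fix x :: "'a \<Rightarrow>\<^sub>0 'b"
  have "norm (Poly_Mapping.lookup x i) \<le> (\<Sum>i\<in>insert i (Poly_Mapping.keys x). norm (Poly_Mapping.lookup x i))"
    by (rule member_le_sum) auto
  then show "norm (Poly_Mapping.lookup x i) \<le> norm x * 1"
    by (subst norm_poly_mapping_sum[where I="insert i (Poly_Mapping.keys x)"]) auto
qed (auto simp: lookup_add scaleR_poly_mapping_def)

lemma bounded_linear_single:
  "bounded_linear (Poly_Mapping.single i :: 'b::real_normed_vector \<Rightarrow> 'a \<Rightarrow>\<^sub>0 'b)"
proof (rule bounded_linear_intro[where K=1])
  fix x :: 'b and r :: real
  show "Poly_Mapping.single i (r *\<^sub>R x) = r *\<^sub>R Poly_Mapping.single i x"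
    by (rule poly_mapping_eqI) (auto simp: scaleR_poly_mapping_def lookup_single when_def)
  show "norm (Poly_Mapping.single i x) \<le> norm x * 1"
    by (subst norm_poly_mapping_sum[where I="{i}"]) auto
qed (auto simp: single_add)

lemma smooth_on_lookup [smooth]:
  "open S \<Longrightarrow> smooth_on S f \<Longrightarrow> smooth_on S (\<lambda>x. Poly_Mapping.lookup (f x) i)"
  by (rule smooth_on_linear_compose[OF _ bounded_linear_lookup])

lemma smooth_on_single [smooth]:
  "open S \<Longrightarrow> smooth_on S f \<Longrightarrow> smooth_on S (\<lambda>x. Poly_Mapping.single i (f x))"
  by (rule smooth_on_linear_compose[OF _ bounded_linear_single])

section \<open>Submanifolds\<close>

text \<open>Some bounded linear map of finite rank fixes \<open>X\<close> pointwise. It is given as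
  an explicit list of functionals and vectors, the form in which \<open>Ck_on_compose\<close>
  accepts an inner map.\<close>

definition finite_rank :: "'a::real_normed_vector set \<Rightarrow> bool" where
  "finite_rank X \<longleftrightarrow> (\<exists>xs :: (('a \<Rightarrow> real) \<times> 'a) list.
     (\<forall>(h, e)\<in>set xs. bounded_linear h) \<and> (\<forall>y\<in>X. y = (\<Sum>(h, e)\<leftarrow>xs. h y *\<^sub>R e)))"

lemma finite_rankE:
  assumes "finite_rank X"
  obtains xs where "\<And>h e. (h, e) \<in> set xs \<Longrightarrow> bounded_linear h"
    "\<And>y. y \<in> X \<Longrightarrow> (\<Sum>(h, e)\<leftarrow>xs. h y *\<^sub>R e) = y"
proof -
  obtain xs where A: "\<forall>(h, e)\<in>set xs. bounded_linear h"
    and B: "\<forall>y\<in>X. y = (\<Sum>(h, e)\<leftarrow>xs. h y *\<^sub>R e)"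
    using assms unfolding finite_rank_def by blast
  show ?thesis
  proof (rule that[of xs])
    show "bounded_linear h" if "(h, e) \<in> set xs" for h e using A that by blast
    show "(\<Sum>(h, e)\<leftarrow>xs. h y *\<^sub>R e) = y" if "y \<in> X" for y
      by (rule sym) (rule B[rule_format, OF that])
  qed
qed

lemma finite_rankI:
  assumes "\<And>h e. (h, e) \<in> set xs \<Longrightarrow> bounded_linear h"
    "\<And>y. y \<in> X \<Longrightarrow> (\<Sum>(h, e)\<leftarrow>xs. h y *\<^sub>R e) = y"
  shows "finite_rank X"
proof -
  have "\<forall>(h, e)\<in>set xs. bounded_linear h" using assms(1) by blast
  moreover have "\<forall>y\<in>X. y = (\<Sum>(h, e)\<leftarrow>xs. h y *\<^sub>R e)"
    by (rule ballI, rule sym) (rule assms(2))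
  ultimately show ?thesis unfolding finite_rank_def by blast
qed

lemma finite_rank_subset: "finite_rank Y \<Longrightarrow> X \<subseteq> Y \<Longrightarrow> finite_rank X"
  unfolding finite_rank_def by blast

lemma finite_rank_real: "finite_rank (X :: real set)"
  unfolding finite_rank_def
  by (rule exI[of _ "[(\<lambda>x. x, 1)]"]) (auto intro: bounded_linear_ident)

lemma finite_rank_complex: "finite_rank (X :: complex set)"
  unfolding finite_rank_def
  by (rule exI[of _ "[(Re, 1), (Im, \<i>)]"])
     (auto intro: bounded_linear_Re bounded_linear_Im simp: complex_eq_iff)

text \<open>Glues finite-rank maps on the coordinates \<open>p i\<close> along the embeddings
  \<open>q i\<close> that rebuild a point from its coordinates.\<close>

lemma finite_rank_sum:
  assumes "finite I" "\<And>i. i \<in> I \<Longrightarrow> bounded_linear (q i)" "\<And>i. i \<in> I \<Longrightarrow> bounded_linear (p i)"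
    "\<And>i. i \<in> I \<Longrightarrow> finite_rank (p i ` X)" "\<And>y. y \<in> X \<Longrightarrow> y = (\<Sum>i\<in>I. q i (p i y))"
  shows "finite_rank X"
proof -
  have "\<exists>xs. (\<forall>(h, e)\<in>set xs. bounded_linear h) \<and>
      (\<forall>y\<in>X. (\<Sum>i\<in>I. q i (p i y)) = (\<Sum>(h, e)\<leftarrow>xs. h y *\<^sub>R e))"
    using assms(1-4)
  proof (induction I rule: finite_induct)
    case empty
    show ?case by (rule exI[of _ "[]"]) auto
  next
    case (insert i I)
    have "\<exists>xs. (\<forall>(h, e)\<in>set xs. bounded_linear h) \<and>
      (\<forall>y\<in>X. (\<Sum>i\<in>I. q i (p i y)) = (\<Sum>(h, e)\<leftarrow>xs. h y *\<^sub>R e))"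
      by (rule insert.IH) (use insert.prems in auto)
    then obtain xs where xs0: "\<forall>(h, e)\<in>set xs. bounded_linear h"
      "\<forall>y\<in>X. (\<Sum>i\<in>I. q i (p i y)) = (\<Sum>(h, e)\<leftarrow>xs. h y *\<^sub>R e)" by blast
    have xs: "\<And>h e. (h, e)\<in>set xs \<Longrightarrow> bounded_linear h"
      "\<And>y. y\<in>X \<Longrightarrow> (\<Sum>i\<in>I. q i (p i y)) = (\<Sum>(h, e)\<leftarrow>xs. h y *\<^sub>R e)"
      using xs0 by auto
    obtain ys where ys: "\<And>h e. (h, e)\<in>set ys \<Longrightarrow> bounded_linear h"
      "\<And>z. z \<in> p i ` X \<Longrightarrow> (\<Sum>(h, e)\<leftarrow>ys. h z *\<^sub>R e) = z"
      by (rule finite_rankE[OF insert.prems(3)[OF insertI1]]) (rule that; assumption)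
    interpret q: bounded_linear "q i" using insert.prems by auto
    interpret p: bounded_linear "p i" using insert.prems by auto
    define zs where "zs = map (\<lambda>(h, e). (\<lambda>y. h (p i y), q i e)) ys"
    have lin: "q i (\<Sum>(h, e)\<leftarrow>ys. h (p i y) *\<^sub>R e) = (\<Sum>(h, e)\<leftarrow>zs. h y *\<^sub>R e)" for y
      unfolding zs_def by (induction ys) (auto simp: q.zero q.add q.scaleR)
    have "\<forall>(h, e)\<in>set (zs @ xs). bounded_linear h"
      using xs(1) ys(1) bounded_linear_compose[OF _ insert.prems(2)[of i]]
      by (fastforce simp: zs_def)
    moreover have "\<forall>y\<in>X. (\<Sum>i\<in>insert i I. q i (p i y)) = (\<Sum>(h, e)\<leftarrow>zs @ xs. h y *\<^sub>R e)"
    proof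
      fix y assume y: "y \<in> X"
      have "q i (p i y) = (\<Sum>(h, e)\<leftarrow>zs. h y *\<^sub>R e)"
        using lin[of y] ys(2)[of "p i y"] y by simp
      then show "(\<Sum>i\<in>insert i I. q i (p i y)) = (\<Sum>(h, e)\<leftarrow>zs @ xs. h y *\<^sub>R e)"
        using insert.hyps xs(2)[OF y] by simp
    qed
    ultimately show ?case by blast
  qed
  then obtain xs where xs: "\<forall>(h, e)\<in>set xs. bounded_linear h"
      "\<forall>y\<in>X. (\<Sum>i\<in>I. q i (p i y)) = (\<Sum>(h, e)\<leftarrow>xs. h y *\<^sub>R e)" by blast
  show ?thesis
  proof (rule finite_rankI[of xs])
    show "bounded_linear h" if "(h, e) \<in> set xs" for h e using xs(1) that by blast
    show "(\<Sum>(h, e)\<leftarrow>xs. h y *\<^sub>R e) = y" if "y \<in> X" for y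
      using xs(2)[rule_format, OF that] assms(5)[OF that] by (rule trans[OF sym sym])
  qed
qed

lemma finite_rank_Times:
  assumes "finite_rank X" "finite_rank Y"
  shows "finite_rank (X \<times> Y)"
proof -
  obtain xs where xs: "\<And>h e. (h, e) \<in> set xs \<Longrightarrow> bounded_linear h"
      "\<And>y. y \<in> X \<Longrightarrow> (\<Sum>(h, e)\<leftarrow>xs. h y *\<^sub>R e) = y"
    by (rule finite_rankE[OF assms(1)]) (rule that; assumption)
  obtain ys where ys: "\<And>h e. (h, e) \<in> set ys \<Longrightarrow> bounded_linear h"
      "\<And>y. y \<in> Y \<Longrightarrow> (\<Sum>(h, e)\<leftarrow>ys. h y *\<^sub>R e) = y"
    by (rule finite_rankE[OF assms(2)]) (rule that; assumption)
  define xs' where "xs' = map (\<lambda>(h, e). (\<lambda>y :: 'a \<times> 'b. h (fst y), (e, 0 :: 'b))) xs"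
  define ys' where "ys' = map (\<lambda>(h, e). (\<lambda>y :: 'a \<times> 'b. h (snd y), (0 :: 'a, e))) ys"
  have 1: "(\<Sum>(h, e)\<leftarrow>xs'. h y *\<^sub>R e) = (\<Sum>(h, e)\<leftarrow>xs. h (fst y) *\<^sub>R e, 0)" for y
    unfolding xs'_def by (induction xs) (auto simp: zero_prod_def)
  have 2: "(\<Sum>(h, e)\<leftarrow>ys'. h y *\<^sub>R e) = (0, \<Sum>(h, e)\<leftarrow>ys. h (snd y) *\<^sub>R e)" for y
    unfolding ys'_def by (induction ys) (auto simp: zero_prod_def)
  have "bounded_linear h" if "(h, e) \<in> set (xs' @ ys')" for h e
    using that by (auto simp: xs'_def ys'_def dest!: xs(1) ys(1)
        intro: bounded_linear_compose[OF _ bounded_linear_fst] bounded_linear_compose[OF _ bounded_linear_snd])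
  moreover have "(\<Sum>(h, e)\<leftarrow>xs' @ ys'. h y *\<^sub>R e) = y" if "y \<in> X \<times> Y" for y
    using that xs(2) ys(2) by (cases y) (simp add: 1 2)
  ultimately show ?thesis by (rule finite_rankI)
qed

lemma poly_mapping_sum_single:
  assumes "finite I" "Poly_Mapping.keys x \<subseteq> I"
  shows "x = (\<Sum>i\<in>I. Poly_Mapping.single i (Poly_Mapping.lookup x i))"
proof (rule poly_mapping_eqI)
  fix k
  show "Poly_Mapping.lookup x k =
      Poly_Mapping.lookup (\<Sum>i\<in>I. Poly_Mapping.single i (Poly_Mapping.lookup x i)) k"
    using assms by (auto simp: lookup_sum lookup_single when_def in_keys_iff subset_iff)
qed

lemma finite_rank_poly_mapping:
  assumes "finite I" "\<And>x. x \<in> X \<Longrightarrow> Poly_Mapping.keys x \<subseteq> I"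
    "\<And>i. i \<in> I \<Longrightarrow> finite_rank ((\<lambda>x. Poly_Mapping.lookup x i) ` X)"
  shows "finite_rank X"
proof (rule finite_rank_sum[where I=I and q=Poly_Mapping.single and p="\<lambda>i x. Poly_Mapping.lookup x i"])
  show "y = (\<Sum>i\<in>I. Poly_Mapping.single i (Poly_Mapping.lookup y i))" if "y \<in> X" for y
    using poly_mapping_sum_single[OF assms(1) assms(2)[OF that]] .
qed (use assms in \<open>auto intro: bounded_linear_single bounded_linear_lookup\<close>)

lemma finite_rank_finprod_set:
  assumes "\<And>i. i < m \<Longrightarrow> finite_rank (X i)"
  shows "finite_rank (finprod_set m X)"
proof (rule finite_rank_poly_mapping[of "{..<m}"])
  fix i assume i: "i \<in> {..<m}"
  then have "(\<lambda>x. Poly_Mapping.lookup x i) ` finprod_set m X \<subseteq> X i"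
    by (auto simp: finprod_set_def)
  then show "finite_rank ((\<lambda>x. Poly_Mapping.lookup x i) ` finprod_set m X)"
    using assms i finite_rank_subset by blast
next
  show "Poly_Mapping.keys x \<subseteq> {..<m}" if "x \<in> finprod_set m X" for x
    using that unfolding finprod_set_def by blast
qed simp

lemma finite_rank_Rn: "finite_rank (Rn d)"
  unfolding Rn_def by (rule finite_rank_finprod_set) (rule finite_rank_real)

section \<open>Smooth maps between arbitrary subsets, diffeomorphisms and charts\<close>

lemma smooth_map_onE:
  assumes "smooth_map_on X f" "x \<in> X"
  obtains U g where "open U" "x \<in> U" "smooth_on U g" "\<And>y. y \<in> U \<Longrightarrow> y \<in> X \<Longrightarrow> g y = f y"
proof -
  have "\<exists>U g. open U \<and> x \<in> U \<and> smooth_on U g \<and> (\<forall>y\<in>U \<inter> X. g y = f y)"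
    using assms unfolding smooth_map_on_def by (rule bspec)
  then show ?thesis
  proof (elim exE conjE)
    fix U g assume U: "open U" "x \<in> U" "smooth_on U g" and *: "\<forall>y\<in>U \<inter> X. g y = f y"
    show ?thesis by (rule that[OF U]) (use * in simp)
  qed
qed

lemma smooth_map_on_localI:
  assumes "\<And>x. x \<in> X \<Longrightarrow> open (U x) \<and> x \<in> U x \<and> smooth_on (U x) (g x)"
    "\<And>x y. x \<in> X \<Longrightarrow> y \<in> U x \<Longrightarrow> y \<in> X \<Longrightarrow> g x y = f y"
  shows "smooth_map_on X f"
  unfolding smooth_map_on_def
proof (rule ballI)
  fix x assume x: "x \<in> X"
  show "\<exists>U g. open U \<and> x \<in> U \<and> smooth_on U g \<and> (\<forall>y\<in>U \<inter> X. g y = f y)"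
    by (rule exI[of _ "U x"], rule exI[of _ "g x"]) (use assms(1)[OF x] assms(2)[OF x] in simp)
qed

lemma smooth_map_onI:
  assumes "open U" "smooth_on U g" "X \<subseteq> U" "\<And>x. x \<in> X \<Longrightarrow> g x = f x"
  shows "smooth_map_on X f"
  by (rule smooth_map_on_localI[where U="\<lambda>_. U" and g="\<lambda>_. g"]) (use assms in auto)

lemma smooth_map_on_subset:
  assumes "smooth_map_on X f" "Y \<subseteq> X"
  shows "smooth_map_on Y f"
  unfolding smooth_map_on_def
proof (rule ballI)
  fix x assume "x \<in> Y"
  with assms(2) have xX: "x \<in> X" by blast
  obtain U g where U: "open U" "x \<in> U" "smooth_on U g" "\<And>y. y \<in> U \<Longrightarrow> y \<in> X \<Longrightarrow> g y = f y"
    by (rule smooth_map_onE[OF assms(1) xX]) (rule that; assumption)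
  then show "\<exists>U g. open U \<and> x \<in> U \<and> smooth_on U g \<and> (\<forall>y\<in>U \<inter> Y. g y = f y)"
    by (intro exI[of _ U] exI[of _ g] conjI ballI U(1-3)) (rule U(4), use assms(2) in auto)
qed

lemma smooth_map_on_imp_continuous_on:
  assumes "smooth_map_on X f"
  shows "continuous_on X f"
  unfolding continuous_on_def
proof
  fix x assume x: "x \<in> X"
  obtain U g where U: "open U" "x \<in> U" "smooth_on U g" "\<And>y. y \<in> U \<Longrightarrow> y \<in> X \<Longrightarrow> g y = f y"
    by (rule smooth_map_onE[OF assms x]) (rule that; assumption)
  have "isCont g x"
    by (rule bspec[OF iffD1[OF continuous_on_eq_continuous_at[OF U(1)] smooth_on_imp_continuous_on[OF U(3)]] U(2)])
  then have g: "(g \<longlongrightarrow> g x) (at x within X)"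
    by (rule iffD1[OF continuous_within continuous_at_imp_continuous_at_within])
  have "\<forall>\<^sub>F y in at x within X. g y = f y"
    unfolding eventually_at_topological
  proof (intro exI[of _ U] conjI impI ballI)
    show "g y = f y" if "y \<in> U" "y \<in> X" for y using U(4) that by simp
  qed (rule U)+
  from tendsto_cong[OF this] g have "(f \<longlongrightarrow> g x) (at x within X)" by (rule iffD1)
  moreover have "g x = f x" using U(2,4) x by simp
  ultimately show "(f \<longlongrightarrow> f x) (at x within X)" by simp
qed

text \<open>The local extension of \<open>f\<close> may leave every finite-dimensional subspace.
  Composing it with the finite-rank map that fixes \<open>Y\<close> changes nothing on
  \<open>X\<close> and makes the chain rule \<open>Ck_on_compose\<close> applicable.\<close>

lemma smooth_map_on_compose:
  assumes f: "smooth_map_on X f" and g: "smooth_map_on Y g" and fX: "f ` X \<subseteq> Y" and Y: "finite_rank Y"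
  shows "smooth_map_on X (\<lambda>x. g (f x))"
  unfolding smooth_map_on_def
proof
  fix x assume x: "x \<in> X"
  obtain U f1 where U: "open U" "x \<in> U" "smooth_on U f1" "\<And>y. y \<in> U \<Longrightarrow> y \<in> X \<Longrightarrow> f1 y = f y"
    by (rule smooth_map_onE[OF f x]) (rule that; assumption)
  have xX: "f x \<in> Y" using fX x by blast
  obtain V g1 where V: "open V" "f x \<in> V" "smooth_on V g1" "\<And>y. y \<in> V \<Longrightarrow> y \<in> Y \<Longrightarrow> g1 y = g y"
    by (rule smooth_map_onE[OF g xX]) (rule that; assumption)
  obtain xs where xs: "\<And>h e. (h, e) \<in> set xs \<Longrightarrow> bounded_linear h"
      "\<And>y. y \<in> Y \<Longrightarrow> (\<Sum>(h, e)\<leftarrow>xs. h y *\<^sub>R e) = y"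
    by (rule finite_rankE[OF Y]) (rule that; assumption)
  define xs' where "xs' = map (\<lambda>(h, e). (\<lambda>y. h (f1 y), e)) xs"
  define p where "p = (\<lambda>x. \<Sum>(h, e)\<leftarrow>xs'. h x *\<^sub>R e)"
  have sm: "smooth_on U h" if he: "(h, e) \<in> set xs'" for h e
  proof -
    obtain h' where h': "(h', e) \<in> set xs" "h = (\<lambda>y. h' (f1 y))"
      using he by (auto simp: xs'_def)
    show ?thesis unfolding h'(2) by (rule smooth_on_linear_compose[OF U(1) xs(1)[OF h'(1)] U(3)])
  qed
  have "(\<Sum>(h, e)\<leftarrow>xs'. h y *\<^sub>R e) = (\<Sum>(h, e)\<leftarrow>xs. h (f1 y) *\<^sub>R e)" for y
    unfolding xs'_def by (induction xs) auto
  then have pf: "p y = f y" if "y \<in> U \<inter> X" for y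
    using that xs(2)[of "f y"] fX U(4)[of y] by (auto simp: p_def)
  have "continuous_on U p"
    unfolding p_def
    by (rule Ck_on_imp_continuous_on[where k=0], rule Ck_on_lincomb[OF U(1)], rule smooth_onD, rule sm)
  then have op: "open (U \<inter> p -` V)"
    using U(1) V(1) continuous_open_preimage by blast
  have "smooth_on (U \<inter> p -` V) (\<lambda>y. g1 (p y))"
    unfolding p_def
  proof (intro smooth_onI Ck_on_compose[where T=V])
    show "Ck_on k (U \<inter> (\<lambda>x. \<Sum>(h, e)\<leftarrow>xs'. h x *\<^sub>R e) -` V) h" if "(h, e) \<in> set xs'" for h e k
      by (rule Ck_on_subset[OF smooth_onD[OF sm[OF that]]]) auto
  qed (use op V(1) smooth_onD[OF V(3)] in \<open>auto simp: p_def\<close>)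
  then show "\<exists>U ga. open U \<and> x \<in> U \<and> smooth_on U ga \<and> (\<forall>y\<in>U \<inter> X. ga y = g (f y))"
    by (intro exI[of _ "U \<inter> p -` V"] exI[of _ "\<lambda>y. g1 (p y)"])
       (use op U(2) V(2) x pf fX in \<open>auto intro!: V(4)\<close>)
qed

lemma diffeomorphicI:
  "smooth_map_on X f \<Longrightarrow> smooth_map_on Y g \<Longrightarrow> (\<And>x. x \<in> X \<Longrightarrow> f x \<in> Y) \<Longrightarrow> (\<And>y. y \<in> Y \<Longrightarrow> g y \<in> X) \<Longrightarrow>
   (\<And>x. x \<in> X \<Longrightarrow> g (f x) = x) \<Longrightarrow> (\<And>y. y \<in> Y \<Longrightarrow> f (g y) = y) \<Longrightarrow> diffeomorphic X Y"
  unfolding diffeomorphic_def by (intro exI[of _ f] exI[of _ g]) auto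

lemma diffeomorphicE:
  assumes "diffeomorphic X Y"
  obtains f g where "smooth_map_on X f" "smooth_map_on Y g" "\<And>x. x \<in> X \<Longrightarrow> f x \<in> Y"
    "\<And>y. y \<in> Y \<Longrightarrow> g y \<in> X" "\<And>x. x \<in> X \<Longrightarrow> g (f x) = x" "\<And>y. y \<in> Y \<Longrightarrow> f (g y) = y"
  using assms unfolding diffeomorphic_def
proof (elim exE conjE)
  fix f g assume fg: "smooth_map_on X f" "smooth_map_on Y g" "f ` X \<subseteq> Y" "g ` Y \<subseteq> X"
    "\<forall>x\<in>X. g (f x) = x" "\<forall>y\<in>Y. f (g y) = y"
  show thesis by (rule that[OF fg(1,2)]) (use fg(3-) in auto)
qed

text \<open>The submanifold condition at a single point. In a group, one chart at the identity can
  then be carried to every other point by translation.\<close>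

definition chart_at :: "nat \<Rightarrow> 'a::real_normed_vector set \<Rightarrow> 'a \<Rightarrow> bool" where
  "chart_at d M p \<longleftrightarrow>
     (\<exists>W V. open W \<and> p \<in> W \<and> openin (top_of_set (Rn d)) V \<and> diffeomorphic (M \<inter> W) V)"

lemma submanifold_iff_chart_at: "submanifold d M \<longleftrightarrow> (\<forall>p\<in>M. chart_at d M p)"
  unfolding submanifold_def chart_at_def ..

lemma chart_at_diffeomorphic:
  assumes f: "smooth_map_on X f" and g: "smooth_map_on Y g"
    and im: "\<And>x. x \<in> X \<Longrightarrow> f x \<in> Y" "\<And>y. y \<in> Y \<Longrightarrow> g y \<in> X"
    and inv: "\<And>x. x \<in> X \<Longrightarrow> g (f x) = x" "\<And>y. y \<in> Y \<Longrightarrow> f (g y) = y"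
    and Y: "finite_rank Y" and p: "p \<in> X" and chart: "chart_at d Y (f p)"
  shows "chart_at d X p"
proof -
  obtain W V where W: "open W" "f p \<in> W" and V: "openin (top_of_set (Rn d)) V"
    and YW: "diffeomorphic (Y \<inter> W) V"
    using chart unfolding chart_at_def by blast
  obtain u v where uv: "smooth_map_on (Y \<inter> W) u" "smooth_map_on V v"
    "\<And>x. x \<in> Y \<inter> W \<Longrightarrow> u x \<in> V" "\<And>y. y \<in> V \<Longrightarrow> v y \<in> Y \<inter> W"
    "\<And>x. x \<in> Y \<inter> W \<Longrightarrow> v (u x) = x" "\<And>y. y \<in> V \<Longrightarrow> u (v y) = y"
    by (rule diffeomorphicE[OF YW]) (rule that; assumption)
  have "openin (top_of_set X) (X \<inter> f -` W)"
    using smooth_map_on_imp_continuous_on[OF f] W(1) by (rule continuous_openin_preimage_gen)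
  then obtain W' where W': "open W'" "X \<inter> f -` W = X \<inter> W'"
    unfolding openin_open by auto
  have "diffeomorphic (X \<inter> W') V"
  proof (rule diffeomorphicI[where f="\<lambda>x. u (f x)" and g="\<lambda>y. g (v y)"])
    show "smooth_map_on (X \<inter> W') (\<lambda>x. u (f x))"
      by (rule smooth_map_on_compose[OF smooth_map_on_subset[OF f] uv(1)])
         (use im W'(2) finite_rank_subset[OF Y Int_lower1] in auto)
    show "smooth_map_on V (\<lambda>y. g (v y))"
      by (rule smooth_map_on_compose[OF uv(2) g _ Y]) (use uv in auto)
    show "u (f x) \<in> V" "g (v (u (f x))) = x" if "x \<in> X \<inter> W'" for x
    proof -
      have "f x \<in> Y \<inter> W" using that W'(2) im by auto
      then show "u (f x) \<in> V" "g (v (u (f x))) = x"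
        using that uv(3,5) inv by (auto simp: image_subset_iff)
    qed
    show "g (v y) \<in> X \<inter> W'" "u (f (g (v y))) = y" if "y \<in> V" for y
    proof -
      have "v y \<in> Y" "v y \<in> W" using that uv(4) by auto
      then show "g (v y) \<in> X \<inter> W'" "u (f (g (v y))) = y"
        using W'(2) im inv uv(6) that by auto
    qed
  qed
  then show ?thesis
    unfolding chart_at_def using W' V W(2) p by blast
qed

lemma submanifold_diffeomorphic:
  assumes "diffeomorphic X Y" "submanifold d Y" "finite_rank Y"
  shows "submanifold d X"
proof -
  obtain f g where fg: "smooth_map_on X f" "smooth_map_on Y g" "\<And>x. x \<in> X \<Longrightarrow> f x \<in> Y"
    "\<And>y. y \<in> Y \<Longrightarrow> g y \<in> X" "\<And>x. x \<in> X \<Longrightarrow> g (f x) = x" "\<And>y. y \<in> Y \<Longrightarrow> f (g y) = y"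
    by (rule diffeomorphicE[OF assms(1)]) (rule that; assumption)
  show ?thesis
    unfolding submanifold_iff_chart_at
  proof
    fix p assume p: "p \<in> X"
    show "chart_at d X p"
    proof (rule chart_at_diffeomorphic[OF fg(1,2) _ _ _ _ assms(3) p])
      show "chart_at d Y (f p)" using assms(2) p fg(3) by (auto simp: submanifold_iff_chart_at)
    qed (use fg in auto)
  qed
qed

lemma smooth_map_on_linear:
  "bounded_linear f \<Longrightarrow> smooth_map_on X f"
  by (rule smooth_map_onI[of UNIV f]) (auto intro: smooth_on_bounded_linear)

lemma smooth_map_on_map_prod:
  assumes "smooth_map_on X f" "smooth_map_on Y g"
  shows "smooth_map_on (X \<times> Y) (map_prod f g)"
  unfolding smooth_map_on_def
proof
  fix p assume "p \<in> X \<times> Y"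
  then obtain x y where p: "p = (x, y)" "x \<in> X" "y \<in> Y" by auto
  obtain U f1 where U: "open U" "x \<in> U" "smooth_on U f1" "\<And>y. y \<in> U \<Longrightarrow> y \<in> X \<Longrightarrow> f1 y = f y"
    by (rule smooth_map_onE[OF assms(1) p(2)]) (rule that; assumption)
  obtain V g1 where V: "open V" "y \<in> V" "smooth_on V g1" "\<And>z. z \<in> V \<Longrightarrow> z \<in> Y \<Longrightarrow> g1 z = g z"
    by (rule smooth_map_onE[OF assms(2) p(3)]) (rule that; assumption)
  have op: "open (U \<times> V)" using U V by (auto intro: open_Times)
  have "smooth_on (U \<times> V) (\<lambda>z. (f1 (fst z), g1 (snd z)))"
    by (intro smooth_on_Pair op smooth_on_compose_linear[OF op U(1) bounded_linear_fst _ U(3)]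
        smooth_on_compose_linear[OF op V(1) bounded_linear_snd _ V(3)]) auto
  then show "\<exists>U h. open U \<and> p \<in> U \<and> smooth_on U h \<and> (\<forall>z\<in>U \<inter> X \<times> Y. h z = map_prod f g z)"
    by (intro exI[of _ "U \<times> V"] exI[of _ "\<lambda>z. (f1 (fst z), g1 (snd z))"]) (use op U V p in auto)
qed

lemma bounded_linear_sum_single:
  "(\<And>i. i \<in> I \<Longrightarrow> bounded_linear (h i)) \<Longrightarrow>
   bounded_linear (\<lambda>x. \<Sum>i\<in>I. Poly_Mapping.single (k i) (h i x))"
  by (intro bounded_linear_sum bounded_linear_compose[OF bounded_linear_single])

lemma Rn_iff: "x \<in> Rn d \<longleftrightarrow> (\<forall>i\<ge>d. Poly_Mapping.lookup x i = 0)"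
  by (auto simp: Rn_def finprod_set_def in_keys_iff subset_iff) (meson leI)

lemma lookup_sum_single:
  assumes "finite I" "inj_on k I" "i \<in> I"
  shows "Poly_Mapping.lookup (\<Sum>i\<in>I. Poly_Mapping.single (k i) (h i)) (k i) = h i"
proof -
  have "Poly_Mapping.lookup (\<Sum>i\<in>I. Poly_Mapping.single (k i) (h i)) (k i) =
      (\<Sum>j\<in>I. if j = i then h j else 0)"
    unfolding lookup_sum by (rule sum.cong) (use assms in \<open>auto simp: lookup_single when_def inj_on_def\<close>)
  then show ?thesis using assms by simp
qed

lemma lookup_sum_single_notin:
  assumes "j \<notin> k ` I"
  shows "Poly_Mapping.lookup (\<Sum>i\<in>I. Poly_Mapping.single (k i) (h i)) j = 0"
  unfolding lookup_sum by (rule sum.neutral) (use assms in \<open>auto simp: lookup_single when_def\<close>)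

lemma submanifold_Times:
  fixes X :: "'a::real_normed_vector set" and Y :: "'b::real_normed_vector set"
  assumes "submanifold d X" "submanifold e Y"
  shows "submanifold (d + e) (X \<times> Y)"
  unfolding submanifold_def
proof
  fix p assume "p \<in> X \<times> Y"
  then obtain x y where p: "p = (x, y)" "x \<in> X" "y \<in> Y" by auto
  obtain W V where W: "open W" "x \<in> W" "openin (top_of_set (Rn d)) V" "diffeomorphic (X \<inter> W) V"
    using assms(1) p unfolding submanifold_def by blast
  obtain W' V' where W': "open W'" "y \<in> W'" "openin (top_of_set (Rn e)) V'" "diffeomorphic (Y \<inter> W') V'"
    using assms(2) p unfolding submanifold_def by blast
  obtain f g where f: "smooth_map_on (X \<inter> W) f" "smooth_map_on V g" "\<And>x. x \<in> X \<inter> W \<Longrightarrow> f x \<in> V"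
    "\<And>y. y \<in> V \<Longrightarrow> g y \<in> X \<inter> W" "\<And>x. x \<in> X \<inter> W \<Longrightarrow> g (f x) = x" "\<And>y. y \<in> V \<Longrightarrow> f (g y) = y"
    by (rule diffeomorphicE[OF W(4)]) (rule that; assumption)
  obtain f' g' where f': "smooth_map_on (Y \<inter> W') f'" "smooth_map_on V' g'" "\<And>x. x \<in> Y \<inter> W' \<Longrightarrow> f' x \<in> V'"
    "\<And>y. y \<in> V' \<Longrightarrow> g' y \<in> Y \<inter> W'" "\<And>x. x \<in> Y \<inter> W' \<Longrightarrow> g' (f' x) = x" "\<And>y. y \<in> V' \<Longrightarrow> f' (g' y) = y"
    by (rule diffeomorphicE[OF W'(4)]) (rule that; assumption)
  \<comment> \<open>\<open>a\<close> concatenates coordinate vectors of lengths \<open>d\<close> and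
    \<open>e\<close>, and \<open>b\<close> cuts them apart again; the two are inverse to each other
    only between \<open>Rn d \<times> Rn e\<close> and \<open>Rn (d + e)\<close>.\<close>
  define a where "a = (\<lambda>z :: (nat \<Rightarrow>\<^sub>0 real) \<times> (nat \<Rightarrow>\<^sub>0 real).
      (\<Sum>i<d. Poly_Mapping.single i (Poly_Mapping.lookup (fst z) i)) +
      (\<Sum>i<e. Poly_Mapping.single (d + i) (Poly_Mapping.lookup (snd z) i)))"
  define b where "b = (\<lambda>z :: nat \<Rightarrow>\<^sub>0 real.
      (\<Sum>i<d. Poly_Mapping.single i (Poly_Mapping.lookup z i),
       \<Sum>i<e. Poly_Mapping.single i (Poly_Mapping.lookup z (d + i))))"
  have bl: "bounded_linear a" "bounded_linear b"
    unfolding a_def b_def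
    by (intro bounded_linear_add bounded_linear_Pair bounded_linear_sum_single
         bounded_linear_compose[OF bounded_linear_lookup] bounded_linear_fst bounded_linear_snd
         bounded_linear_lookup)+
  have la: "Poly_Mapping.lookup (a z) i = (if i < d then Poly_Mapping.lookup (fst z) i
      else if i < d + e then Poly_Mapping.lookup (snd z) (i - d) else 0)" for z i
  proof -
    have 1: "Poly_Mapping.lookup (\<Sum>i<d. Poly_Mapping.single i (Poly_Mapping.lookup (fst z) i)) i =
        (if i < d then Poly_Mapping.lookup (fst z) i else 0)"
      using lookup_sum_single[of "{..<d}" "\<lambda>i. i" i "Poly_Mapping.lookup (fst z)"]
        lookup_sum_single_notin[of i "\<lambda>i. i" "{..<d}" "Poly_Mapping.lookup (fst z)"] by auto
    have "i \<notin> (+) d ` {..<e}" if "\<not> (d \<le> i \<and> i < d + e)" using that by auto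
    then have 2: "Poly_Mapping.lookup (\<Sum>i<e. Poly_Mapping.single (d + i) (Poly_Mapping.lookup (snd z) i)) i =
        (if d \<le> i \<and> i < d + e then Poly_Mapping.lookup (snd z) (i - d) else 0)"
      using lookup_sum_single[of "{..<e}" "(+) d" "i - d" "Poly_Mapping.lookup (snd z)"]
        lookup_sum_single_notin[of i "(+) d" "{..<e}" "Poly_Mapping.lookup (snd z)"] by auto
    show ?thesis unfolding a_def lookup_add 1 2 by auto
  qed
  have lb: "Poly_Mapping.lookup (fst (b z)) i = (if i < d then Poly_Mapping.lookup z i else 0)"
     "Poly_Mapping.lookup (snd (b z)) i = (if i < e then Poly_Mapping.lookup z (d + i) else 0)" for z i
    using lookup_sum_single[of "{..<d}" "\<lambda>i. i" i "Poly_Mapping.lookup z"]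
        lookup_sum_single_notin[of i "\<lambda>i. i" "{..<d}" "Poly_Mapping.lookup z"]
      lookup_sum_single[of "{..<e}" "\<lambda>i. i" i "\<lambda>i. Poly_Mapping.lookup z (d + i)"]
        lookup_sum_single_notin[of i "\<lambda>i. i" "{..<e}" "\<lambda>i. Poly_Mapping.lookup z (d + i)"]
    by (auto simp: b_def)
  have ba: "b (a z) = z" if "z \<in> Rn d \<times> Rn e" for z
    using that by (auto intro!: prod_eqI poly_mapping_eqI simp: la lb Rn_iff)
  have ab: "a (b z) = z" if "z \<in> Rn (d + e)" for z
    using that by (auto intro!: poly_mapping_eqI simp: la lb Rn_iff)
  have aR: "a z \<in> Rn (d + e)" for z by (auto simp: la Rn_iff)
  have bR: "b z \<in> Rn d \<times> Rn e" for z
    by (cases "b z") (use lb[of z] in \<open>auto simp: Rn_iff\<close>)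
  have VR: "V \<subseteq> Rn d" "V' \<subseteq> Rn e" using W(3) W'(3) by (auto dest: openin_imp_subset)
  obtain Q Q' where Q: "open Q" "V = Rn d \<inter> Q" "open Q'" "V' = Rn e \<inter> Q'"
    using W(3) W'(3) by (auto simp: openin_open)
  define V2 where "V2 = Rn (d + e) \<inter> b -` (Q \<times> Q')"
  have "open (b -` (Q \<times> Q'))"
    using continuous_open_vimage[of "Q \<times> Q'" b] Q bl(2) linear_continuous_at open_Times by blast
  then have V2: "openin (top_of_set (Rn (d + e))) V2"
    unfolding V2_def by blast
  have V2_iff: "z \<in> V2 \<longleftrightarrow> z \<in> Rn (d + e) \<and> b z \<in> V \<times> V'" for z
    unfolding V2_def Q using bR[of z] by (cases "b z") auto
  have fr: "finite_rank (V \<times> V')"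
    by (intro finite_rank_Times finite_rank_subset[OF finite_rank_Rn VR(1)] finite_rank_subset[OF finite_rank_Rn VR(2)])
  have eq: "(X \<times> Y) \<inter> (W \<times> W') = (X \<inter> W) \<times> (Y \<inter> W')" by auto
  have "diffeomorphic ((X \<times> Y) \<inter> (W \<times> W')) V2"
    unfolding eq
  proof (rule diffeomorphicI[where f="\<lambda>z. a (map_prod f f' z)" and g="\<lambda>z. map_prod g g' (b z)"])
    show "smooth_map_on ((X \<inter> W) \<times> (Y \<inter> W')) (\<lambda>z. a (map_prod f f' z))"
      by (rule smooth_map_on_compose[OF smooth_map_on_map_prod[OF f(1) f'(1)]
            smooth_map_on_linear[OF bl(1)] _ fr]) (use f f' in \<open>auto simp: image_subset_iff\<close>)
    show "smooth_map_on V2 (\<lambda>z. map_prod g g' (b z))"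
      by (rule smooth_map_on_compose[OF smooth_map_on_linear[OF bl(2)]
            smooth_map_on_map_prod[OF f(2) f'(2)] _ fr]) (use V2_iff in auto)
    fix z assume z: "z \<in> (X \<inter> W) \<times> (Y \<inter> W')"
    then have m: "map_prod f f' z \<in> V \<times> V'" using f(3) f'(3) by (auto simp: image_subset_iff)
    then have e: "b (a (map_prod f f' z)) = map_prod f f' z" using VR by (intro ba) auto
    show "a (map_prod f f' z) \<in> V2" unfolding V2_iff e using aR m by blast
    show "map_prod g g' (b (a (map_prod f f' z))) = z" unfolding e using z f(5) f'(5) by auto
  next
    fix z assume z: "z \<in> V2"
    then have "b z \<in> V \<times> V'" by (simp add: V2_iff)
    then have "map_prod g g' (b z) \<in> (X \<inter> W) \<times> (Y \<inter> W')" "map_prod f f' (map_prod g g' (b z)) = b z"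
      using f(4,6) f'(4,6) by auto
    then show "map_prod g g' (b z) \<in> (X \<inter> W) \<times> (Y \<inter> W')" "a (map_prod f f' (map_prod g g' (b z))) = z"
      using ab z by (auto simp: V2_iff)
  qed
  then show "\<exists>W V. open W \<and> p \<in> W \<and> openin (top_of_set (Rn (d + e))) V \<and> diffeomorphic (X \<times> Y \<inter> W) V"
    using V2 W W' p by (intro exI[of _ "W \<times> W'"] exI[of _ V2]) (auto intro: open_Times)
qed

lemma submanifold_finprod_set:
  fixes X :: "nat \<Rightarrow> 'a::real_normed_vector set"
  assumes "\<And>r. r < m \<Longrightarrow> submanifold (d r) (X r)" "\<And>r. r < m \<Longrightarrow> finite_rank (X r)"
  shows "submanifold (\<Sum>r<m. d r) (finprod_set m X)"
  using assms
proof (induction m)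
  case 0
  have "finprod_set 0 X = {0}" "Rn 0 = {0}"
    by (auto simp: finprod_set_def Rn_def)
  moreover have "openin (top_of_set {0}) {0 :: nat \<Rightarrow>\<^sub>0 real}"
    unfolding openin_open by (intro exI[of _ UNIV]) auto
  ultimately show ?case
    unfolding submanifold_def
    by (auto intro!: exI[of _ UNIV] exI[of _ "{0 :: nat \<Rightarrow>\<^sub>0 real}"] diffeomorphicI[where f="\<lambda>_. 0" and g="\<lambda>_. 0"]
        smooth_map_onI[of UNIV] smooth_on_const)
next
  case (Suc m)
  \<comment> \<open>\<open>f\<close> splits off the last factor and \<open>g\<close> puts it back,
    which reduces the claim to a product of two sets.\<close>
  define f where "f = (\<lambda>x :: nat \<Rightarrow>\<^sub>0 'a. (\<Sum>i<m. Poly_Mapping.single i (Poly_Mapping.lookup x i), Poly_Mapping.lookup x m))"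
  define g where "g = (\<lambda>z :: (nat \<Rightarrow>\<^sub>0 'a) \<times> 'a. fst z + Poly_Mapping.single m (snd z))"
  have lf: "Poly_Mapping.lookup (fst (f x)) i = (if i < m then Poly_Mapping.lookup x i else 0)" for x i
    using lookup_sum_single[of "{..<m}" "\<lambda>i. i" i "Poly_Mapping.lookup x"]
      lookup_sum_single_notin[of i "\<lambda>i. i" "{..<m}" "Poly_Mapping.lookup x"]
    by (auto simp: f_def)
  have lg: "Poly_Mapping.lookup (g z) i = Poly_Mapping.lookup (fst z) i + (if i = m then snd z else 0)" for z i
    by (auto simp: g_def lookup_add lookup_single when_def)
  have iff: "x \<in> finprod_set k X \<longleftrightarrow>
      (\<forall>i. if i < k then Poly_Mapping.lookup x i \<in> X i else Poly_Mapping.lookup x i = 0)" for x k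
    by (auto simp: finprod_set_def in_keys_iff subset_iff)
  have "diffeomorphic (finprod_set (Suc m) X) (finprod_set m X \<times> X m)"
  proof (rule diffeomorphicI[where f=f and g=g])
    show "smooth_map_on (finprod_set (Suc m) X) f" "smooth_map_on (finprod_set m X \<times> X m) g"
      unfolding f_def g_def
      by (intro smooth_map_on_linear bounded_linear_add bounded_linear_Pair bounded_linear_sum_single
         bounded_linear_compose[OF bounded_linear_single] bounded_linear_fst bounded_linear_snd
         bounded_linear_lookup)+
    fix x assume x: "x \<in> finprod_set (Suc m) X"
    have "fst (f x) \<in> finprod_set m X" "snd (f x) \<in> X m"
      using x[unfolded iff, rule_format, of m] x unfolding iff lf by (auto simp: f_def split: if_splits)
    then show "f x \<in> finprod_set m X \<times> X m" by (metis mem_Times_iff)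
    show "g (f x) = x"
    proof (rule poly_mapping_eqI)
      fix i
      have "Poly_Mapping.lookup x i = 0" if "\<not> i < Suc m" using x that iff by metis
      then show "Poly_Mapping.lookup (g (f x)) i = Poly_Mapping.lookup x i"
        unfolding lg lf by (auto simp: f_def)
    qed
  next
    fix z assume "z \<in> finprod_set m X \<times> X m"
    then have z: "fst z \<in> finprod_set m X" "snd z \<in> X m" by auto
    have zm: "Poly_Mapping.lookup (fst z) i = 0" if "i \<ge> m" for i
      using z(1)[unfolded iff, rule_format, of i] that by auto
    show "g z \<in> finprod_set (Suc m) X"
      unfolding iff lg using z zm by (auto simp: iff less_Suc_eq)
    show "f (g z) = z"
    proof (rule prod_eqI)
      show "fst (f (g z)) = fst z" using zm by (auto intro!: poly_mapping_eqI simp: lf lg)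
      show "snd (f (g z)) = snd z" using zm by (simp add: f_def lg)
    qed
  qed
  moreover have "submanifold ((\<Sum>r<m. d r) + d m) (finprod_set m X \<times> X m)"
    by (rule submanifold_Times) (use Suc in auto)
  moreover have "finite_rank (finprod_set m X \<times> X m)"
    by (intro finite_rank_Times finite_rank_finprod_set Suc.prems) auto
  ultimately show ?case using submanifold_diffeomorphic by (auto simp: add.commute)
qed

section \<open>Matrices\<close>

subsection \<open>Adjoints\<close>

lemma mat_adjoint_dim [simp]:
  "dim_row (mat_adjoint A) = dim_col A" "dim_col (mat_adjoint A) = dim_row A"
  by (auto simp: mat_adjoint_def)

lemma mat_adjoint_carrier [simp, intro]: "A \<in> carrier_mat n m \<Longrightarrow> mat_adjoint A \<in> carrier_mat m n"
  by auto

lemma mat_adjoint_index [simp]: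
  "i < dim_col A \<Longrightarrow> j < dim_row A \<Longrightarrow> mat_adjoint A $$ (i, j) = cnj (A $$ (j, i))" for A :: "complex mat"
  by (auto simp: mat_adjoint_def mat_of_rows_def conjugate_vec_def)

lemma index_mult_mat_sum:
  assumes "A \<in> carrier_mat n m" "B \<in> carrier_mat m k" "i < n" "j < k"
  shows "(A * B) $$ (i, j) = (\<Sum>a<m. A $$ (i, a) * B $$ (a, j))"
  using assms by (auto simp: scalar_prod_def atLeast0LessThan intro!: sum.cong)

lemma mat_adjoint_mult:
  fixes A B :: "complex mat"
  assumes "A \<in> carrier_mat n m" "B \<in> carrier_mat m k"
  shows "mat_adjoint (A * B) = mat_adjoint B * mat_adjoint A"
proof (rule eq_matI)
  fix i j assume "i < dim_row (mat_adjoint B * mat_adjoint A)" "j < dim_col (mat_adjoint B * mat_adjoint A)"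
  then have "i < k" "j < n" using assms by auto
  moreover have "mat_adjoint (A * B) $$ (i, j) = cnj ((A * B) $$ (j, i))"
    by (rule mat_adjoint_index) (use assms calculation in auto)
  ultimately show "mat_adjoint (A * B) $$ (i, j) = (mat_adjoint B * mat_adjoint A) $$ (i, j)"
    using assms index_mult_mat_sum[OF assms, of j i]
      index_mult_mat_sum[OF mat_adjoint_carrier[OF assms(2)] mat_adjoint_carrier[OF assms(1)], of i j]
    by (auto simp: mult.commute intro!: sum.cong)
qed (use assms in auto)

lemma mat_adjoint_adjoint [simp]: "mat_adjoint (mat_adjoint A) = A" for A :: "complex mat"
  by (rule eq_matI) auto

lemma mat_adjoint_one [simp]: "mat_adjoint (1\<^sub>m n) = (1\<^sub>m n :: complex mat)"
  by (rule eq_matI) auto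

lemma mat_adjoint_add:
  "A \<in> carrier_mat n m \<Longrightarrow> B \<in> carrier_mat n m \<Longrightarrow> mat_adjoint (A + B) = mat_adjoint A + mat_adjoint B"
  for A B :: "complex mat"
  by (rule eq_matI) auto

lemma mat_adjoint_minus:
  "A \<in> carrier_mat n m \<Longrightarrow> B \<in> carrier_mat n m \<Longrightarrow> mat_adjoint (A - B) = mat_adjoint A - mat_adjoint B"
  for A B :: "complex mat"
  by (rule eq_matI) auto

lemma det_mat_adjoint:
  assumes "A \<in> carrier_mat n n"
  shows "Determinant.det (mat_adjoint A) = cnj (Determinant.det A)"
proof -
  interpret cnj: comm_ring_hom cnj by unfold_locales auto
  have "mat_adjoint A = transpose_mat (map_mat cnj A)"
    by (rule eq_matI) auto
  then have "Determinant.det (mat_adjoint A) = Determinant.det (map_mat cnj A)"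
    using det_transpose[of "map_mat cnj A" n] assms by auto
  also have "\<dots> = cnj (Determinant.det A)" by (rule cnj.hom_det)
  finally show ?thesis .
qed

subsection \<open>Inverse matrices and the Cayley transform\<close>

text \<open>Cramer's rule, chosen so that the entries are visibly rational functions of the entries
  of \<open>M\<close>.\<close>

definition inv_mat :: "complex mat \<Rightarrow> complex mat" where
  "inv_mat M = (1 / Determinant.det M) \<cdot>\<^sub>m adj_mat M"

lemma inv_mat:
  assumes M: "M \<in> carrier_mat n n" and d: "Determinant.det M \<noteq> 0"
  shows "inv_mat M \<in> carrier_mat n n" "M * inv_mat M = 1\<^sub>m n" "inv_mat M * M = 1\<^sub>m n"
proof -
  note a = adj_mat[OF M]
  show "inv_mat M \<in> carrier_mat n n" using a by (auto simp: inv_mat_def)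
  have one: "(1 / Determinant.det M) \<cdot>\<^sub>m (Determinant.det M \<cdot>\<^sub>m 1\<^sub>m n) = 1\<^sub>m n"
    by (rule eq_matI) (use d in auto)
  show "M * inv_mat M = 1\<^sub>m n" "inv_mat M * M = 1\<^sub>m n"
    unfolding inv_mat_def using M a one
    by (auto simp: mult_smult_distrib[OF M a(1)] mult_smult_assoc_mat[OF a(1) M])
qed

lemma inv_mat_unique:
  assumes M: "M \<in> carrier_mat n n" and N: "N \<in> carrier_mat n n" and MN: "M * N = 1\<^sub>m n"
  shows "inv_mat M = N" "Determinant.det M \<noteq> 0"
proof -
  show d: "Determinant.det M \<noteq> 0" using det_mult[OF M N] MN by auto
  note i = inv_mat[OF M d]
  have "inv_mat M = inv_mat M * (M * N)" using i MN by simp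
  also have "\<dots> = N" using assoc_mult_mat[OF i(1) M N] i N by simp
  finally show "inv_mat M = N" .
qed

text \<open>An involution that exchanges skew-Hermitian matrices with unitary matrices lacking the
  eigenvalue -1. Being rational, it takes the place of the exponential map, both for charts of the
  special unitary group and for curves in the fiber.\<close>

definition cayley :: "nat \<Rightarrow> complex mat \<Rightarrow> complex mat" where
  "cayley n X = (1\<^sub>m n - X) * inv_mat (1\<^sub>m n + X)"

context
  fixes n :: nat and X :: "complex mat"
  assumes X: "X \<in> carrier_mat n n" and d: "Determinant.det (1\<^sub>m n + X) \<noteq> 0"
begin

private definition "P = 1\<^sub>m n + X"
private definition "Q = inv_mat P"

private lemma PQ: "P \<in> carrier_mat n n" "Q \<in> carrier_mat n n" "P * Q = 1\<^sub>m n" "Q * P = 1\<^sub>m n"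
  using inv_mat[of P n] X d by (auto simp: Q_def P_def)

private lemma M: "1\<^sub>m n - X \<in> carrier_mat n n" "1\<^sub>m n - X = 2 \<cdot>\<^sub>m 1\<^sub>m n - P"
  using X by (auto simp: P_def intro!: eq_matI)

lemma cayley_carrier: "cayley n X \<in> carrier_mat n n"
  using PQ M by (auto simp: cayley_def P_def Q_def)

text \<open>Since \<open>1 - X = 2 - P\<close>, the transform is an affine function of the inverse
  \<open>Q\<close> of \<open>P\<close> alone; the order of its factors is therefore immaterial, and
  the involution property becomes a short calculation.\<close>

private lemma cayley_eq: "cayley n X = 2 \<cdot>\<^sub>m Q - 1\<^sub>m n" "cayley n X = Q * (1\<^sub>m n - X)"
proof -
  have 2: "(2 \<cdot>\<^sub>m 1\<^sub>m n) * Q = 2 \<cdot>\<^sub>m Q" "Q * (2 \<cdot>\<^sub>m 1\<^sub>m n) = 2 \<cdot>\<^sub>m Q"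
    using PQ mult_smult_assoc_mat[of "1\<^sub>m n" n n Q n 2] mult_smult_distrib[of Q n n "1\<^sub>m n" n 2] by auto
  show 1: "cayley n X = 2 \<cdot>\<^sub>m Q - 1\<^sub>m n"
    unfolding cayley_def M(2) P_def[symmetric] Q_def[symmetric]
    using PQ 2 by (subst minus_mult_distrib_mat[of _ n n _ _ n]) auto
  have "Q * (1\<^sub>m n - X) = 2 \<cdot>\<^sub>m Q - 1\<^sub>m n"
    unfolding M(2) using PQ 2 by (subst mult_minus_distrib_mat[of _ n n _ n]) auto
  then show "cayley n X = Q * (1\<^sub>m n - X)" using 1 by simp
qed

lemma cayley_commute: "inv_mat (1\<^sub>m n + X) * (1\<^sub>m n - X) = cayley n X"
  using cayley_eq(2) by (simp add: Q_def P_def)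

private lemma one_plus: "(1\<^sub>m n + cayley n X) * ((1 / 2) \<cdot>\<^sub>m P) = 1\<^sub>m n"
proof -
  have "1\<^sub>m n + cayley n X = 2 \<cdot>\<^sub>m Q"
    unfolding cayley_eq(1) using PQ by (auto intro!: eq_matI)
  then have "(1\<^sub>m n + cayley n X) * ((1 / 2) \<cdot>\<^sub>m P) = 2 \<cdot>\<^sub>m (Q * ((1 / 2) \<cdot>\<^sub>m P))"
    using mult_smult_assoc_mat[of Q n n "(1 / 2) \<cdot>\<^sub>m P" n 2] PQ by simp
  also have "\<dots> = 2 \<cdot>\<^sub>m ((1 / 2) \<cdot>\<^sub>m (Q * P))"
    using PQ by (simp add: mult_smult_distrib[of Q n n])
  also have "\<dots> = 1\<^sub>m n" using PQ by (auto intro!: eq_matI)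
  finally show ?thesis .
qed

lemma det_one_plus_cayley: "Determinant.det (1\<^sub>m n + cayley n X) \<noteq> 0"
  and cayley_cayley: "cayley n (cayley n X) = X"
proof -
  note c = cayley_carrier
  have i: "inv_mat (1\<^sub>m n + cayley n X) = (1 / 2) \<cdot>\<^sub>m P"
    and "Determinant.det (1\<^sub>m n + cayley n X) \<noteq> 0"
    using inv_mat_unique[OF _ _ one_plus] c PQ by auto
  then show "Determinant.det (1\<^sub>m n + cayley n X) \<noteq> 0" by simp
  have "1\<^sub>m n - cayley n X = 2 \<cdot>\<^sub>m (1\<^sub>m n - Q)"
    unfolding cayley_eq(1) using PQ by (auto intro!: eq_matI simp: algebra_simps)
  then have "cayley n (cayley n X) = 2 \<cdot>\<^sub>m ((1\<^sub>m n - Q) * ((1 / 2) \<cdot>\<^sub>m P))"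
    unfolding cayley_def[of n "cayley n X"] i
    using mult_smult_assoc_mat[of "1\<^sub>m n - Q" n n "(1 / 2) \<cdot>\<^sub>m P" n 2] PQ by (simp add: minus_carrier_mat)
  also have "\<dots> = 2 \<cdot>\<^sub>m ((1 / 2) \<cdot>\<^sub>m ((1\<^sub>m n - Q) * P))"
    using PQ by (simp add: mult_smult_distrib[of "1\<^sub>m n - Q" n n] minus_carrier_mat)
  also have "(1\<^sub>m n - Q) * P = X"
    using PQ X by (subst minus_mult_distrib_mat[of _ n n _ _ n]) (auto simp: P_def intro!: eq_matI)
  also have "2 \<cdot>\<^sub>m ((1 / 2) \<cdot>\<^sub>m X) = X" by (auto intro!: eq_matI)
  finally show "cayley n (cayley n X) = X" .
qed

text \<open>For skew-Hermitian \<open>X\<close> the right-hand side is the conjugate of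
  \<open>det (1 + X)\<close>. So the transform has determinant 1 exactly when
  \<open>det (1 + X)\<close> is real.\<close>

lemma det_cayley: "Determinant.det (cayley n X) * Determinant.det (1\<^sub>m n + X) = Determinant.det (1\<^sub>m n - X)"
proof -
  have "cayley n X * P = (1\<^sub>m n - X) * (Q * P)"
    unfolding cayley_def Q_def[symmetric] P_def[symmetric] by (rule assoc_mult_mat) (use PQ M in auto)
  then have "cayley n X * P = 1\<^sub>m n - X" using PQ right_mult_one_mat[OF M(1)] by simp
  then show ?thesis using det_mult[OF cayley_carrier PQ(1)] by (simp add: P_def)
qed

lemma cayley_skew:
  assumes skew: "mat_adjoint X = - X"
  shows "cayley n X * mat_adjoint (cayley n X) = 1\<^sub>m n"
proof -
  define N where "N = 1\<^sub>m n - X"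
  have N: "N \<in> carrier_mat n n" using M by (simp add: N_def)
  have aP: "mat_adjoint P = N" "mat_adjoint N = P"
    using X skew by (auto simp: N_def P_def mat_adjoint_add[of _ n n] mat_adjoint_minus[of _ n n] intro!: eq_matI)
  have aQ: "mat_adjoint Q \<in> carrier_mat n n" using PQ by auto
  have "mat_adjoint (Q * P) = N * mat_adjoint Q" using mat_adjoint_mult[OF PQ(2,1)] aP by simp
  then have NQ: "N * mat_adjoint Q = 1\<^sub>m n" using PQ by simp
  have "mat_adjoint (cayley n X) = mat_adjoint Q * P"
    unfolding cayley_def P_def[symmetric] Q_def[symmetric] N_def[symmetric]
    using mat_adjoint_mult[OF N PQ(2)] aP by simp
  then have "cayley n X * mat_adjoint (cayley n X) = Q * N * (mat_adjoint Q * P)"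
    using cayley_eq(2) by (simp add: N_def)
  also have "\<dots> = Q * (N * (mat_adjoint Q * P))"
    by (rule assoc_mult_mat) (use N PQ aQ in auto)
  also have "N * (mat_adjoint Q * P) = N * mat_adjoint Q * P"
    by (rule assoc_mult_mat[symmetric]) (use N PQ aQ in auto)
  also have "Q * (N * mat_adjoint Q * P) = 1\<^sub>m n" using NQ PQ by simp
  finally show ?thesis .
qed

lemma cayley_unitary:
  assumes unit: "X * mat_adjoint X = 1\<^sub>m n"
  shows "mat_adjoint (cayley n X) = - cayley n X"
proof -
  define N where "N = 1\<^sub>m n - X"
  have N: "N \<in> carrier_mat n n" using M by (simp add: N_def)
  have aX: "mat_adjoint X \<in> carrier_mat n n" using X by auto
  have unit': "mat_adjoint X * X = 1\<^sub>m n"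
    by (rule mat_mult_left_right_inverse[OF X aX unit])
  note ac = mat_adjoint_carrier[OF PQ(1)] mat_adjoint_carrier[OF PQ(2)] mat_adjoint_carrier[OF N]
  have aP: "mat_adjoint P = 1\<^sub>m n + mat_adjoint X" "mat_adjoint N = 1\<^sub>m n - mat_adjoint X"
    using X by (auto simp: N_def P_def mat_adjoint_add[of _ n n] mat_adjoint_minus[of _ n n])
  \<comment> \<open>Unitarity makes this product and the next one opposite to each other;
    multiplying by the inverses of \<open>P\<close> and of its adjoint turns that into
    skewness.\<close>
  have 1: "mat_adjoint N * P = X - mat_adjoint X"
    unfolding aP(2) P_def using X aX unit'
    by (subst minus_mult_distrib_mat[of _ n n _ _ n]; simp?; subst mult_add_distrib_mat[of _ n n _ n]; simp?)
       (auto intro!: eq_matI)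
  have 2: "mat_adjoint P * N = - (X - mat_adjoint X)"
    unfolding aP(1) N_def using X aX unit'
    by (subst add_mult_distrib_mat[of _ n n _ _ n]; (simp add: minus_carrier_mat)?; subst mult_minus_distrib_mat[of _ n n _ n]; simp?)
       (auto intro!: eq_matI)
  have QP: "mat_adjoint Q * mat_adjoint P = 1\<^sub>m n"
    using mat_adjoint_mult[OF PQ(1,2)] PQ by simp
  have "mat_adjoint (cayley n X) = mat_adjoint Q * mat_adjoint N"
    unfolding cayley_def P_def[symmetric] Q_def[symmetric] N_def[symmetric]
    by (rule mat_adjoint_mult) (use N PQ in auto)
  also have "\<dots> = mat_adjoint Q * mat_adjoint N * (P * Q)"
    using right_mult_one_mat[OF mult_carrier_mat[OF ac(2,3)]] PQ(3) by simp
  also have "\<dots> = mat_adjoint Q * (mat_adjoint N * P) * Q"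
    using PQ ac by (simp add: assoc_mult_mat[of _ n n _ n _ n] mult_carrier_mat[of _ n n _ n])
  also have "mat_adjoint N * P = - (mat_adjoint P * N)"
    unfolding 1 2 using X aX by (auto intro!: eq_matI)
  also have "mat_adjoint Q * - (mat_adjoint P * N) * Q = - (mat_adjoint Q * (mat_adjoint P * N) * Q)"
    using PQ ac N by simp
  also have "mat_adjoint Q * (mat_adjoint P * N) * Q = mat_adjoint Q * mat_adjoint P * (N * Q)"
    using PQ ac N by (simp add: assoc_mult_mat[of _ n n _ n _ n] mult_carrier_mat[of _ n n _ n])
  also have "\<dots> = cayley n X"
    unfolding QP using left_mult_one_mat[OF mult_carrier_mat[OF N PQ(2)]] by (simp add: cayley_def N_def P_def Q_def)
  finally show ?thesis .
qed

end

subsection \<open>Matrices as families of entries\<close>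

lemma lookup_entries [simp]:
  "Poly_Mapping.lookup (entries A) (i, j) = (if i < dim_row A \<and> j < dim_col A then A $$ (i, j) else 0)"
proof -
  have "finite {x. (case x of (i, j) \<Rightarrow> if i < dim_row A \<and> j < dim_col A then A $$ (i, j) else 0) \<noteq> 0}"
    by (rule finite_subset[of _ "{..<dim_row A} \<times> {..<dim_col A}"]) (auto split: if_splits)
  then show ?thesis unfolding entries_def by (subst lookup_Abs_poly_mapping) auto
qed

definition dec :: "nat \<Rightarrow> (nat \<times> nat \<Rightarrow>\<^sub>0 complex) \<Rightarrow> complex mat" where
  "dec n x = Matrix.mat n n (\<lambda>(i, j). Poly_Mapping.lookup x (i, j))"

lemma dec_carrier [simp, intro]: "dec n x \<in> carrier_mat n n"
  and dec_dim [simp]: "dim_row (dec n x) = n" "dim_col (dec n x) = n"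
  and dec_index [simp]: "i < n \<Longrightarrow> j < n \<Longrightarrow> dec n x $$ (i, j) = Poly_Mapping.lookup x (i, j)"
  by (auto simp: dec_def)

lemma dec_entries [simp]: "A \<in> carrier_mat n n \<Longrightarrow> dec n (entries A) = A"
  by (rule eq_matI) auto

lemma entries_eq_sum:
  assumes "A \<in> carrier_mat n n"
  shows "entries A = (\<Sum>p\<in>{..<n} \<times> {..<n}. Poly_Mapping.single p (A $$ p))"
proof (rule poly_mapping_eqI)
  fix p :: "nat \<times> nat"
  obtain i j where p: "p = (i, j)" by (cases p)
  show "Poly_Mapping.lookup (entries A) p =
      Poly_Mapping.lookup (\<Sum>p\<in>{..<n} \<times> {..<n}. Poly_Mapping.single p (A $$ p)) p"
    using lookup_sum_single[of "{..<n} \<times> {..<n}" "\<lambda>p. p" p "\<lambda>p. A $$ p"]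
      lookup_sum_single_notin[of p "\<lambda>p. p" "{..<n} \<times> {..<n}" "\<lambda>p. A $$ p"] assms
    by (auto simp: p)
qed

lemma smooth_on_entries:
  assumes "open S" "\<And>x. x \<in> S \<Longrightarrow> M x \<in> carrier_mat n n"
    "\<And>i j. i < n \<Longrightarrow> j < n \<Longrightarrow> smooth_on S (\<lambda>x. M x $$ (i, j))"
  shows "smooth_on S (\<lambda>x. entries (M x))"
proof (rule smooth_on_cong[OF assms(1)])
  show "smooth_on S (\<lambda>x. \<Sum>p\<in>{..<n} \<times> {..<n}. Poly_Mapping.single p (M x $$ p))"
    by (intro smooth_on_sum smooth_on_single assms(1)) (use assms(3) in auto)
qed (use entries_eq_sum[OF assms(2)] in simp)

lemma finite_rank_entries: "X \<subseteq> carrier_mat n n \<Longrightarrow> finite_rank (entries ` X)"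
  by (rule finite_rank_poly_mapping[of "{..<n} \<times> {..<n}"])
     (auto simp: in_keys_iff intro: finite_rank_complex split: if_splits)

text \<open>The hypothesis on \<open>M\<close> is stated through entries, since matrices carry no topology.\<close>

definition smooth_mat_on :: "nat \<Rightarrow> 'a::real_normed_vector set \<Rightarrow> ('a \<Rightarrow> complex mat) \<Rightarrow> bool" where
  "smooth_mat_on n S M \<longleftrightarrow> (\<forall>x. M x \<in> carrier_mat n n) \<and>
     (\<forall>i<n. \<forall>j<n. smooth_on S (\<lambda>x. M x $$ (i, j)))"

lemma smooth_mat_onI:
  "(\<And>x. M x \<in> carrier_mat n n) \<Longrightarrow> (\<And>i j. i < n \<Longrightarrow> j < n \<Longrightarrow> smooth_on S (\<lambda>x. M x $$ (i, j))) \<Longrightarrow>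
   smooth_mat_on n S M"
  by (auto simp: smooth_mat_on_def)

lemma smooth_mat_on_carrier: "smooth_mat_on n S M \<Longrightarrow> M x \<in> carrier_mat n n"
  and smooth_mat_on_index: "smooth_mat_on n S M \<Longrightarrow> i < n \<Longrightarrow> j < n \<Longrightarrow> smooth_on S (\<lambda>x. M x $$ (i, j))"
  by (auto simp: smooth_mat_on_def)

lemma smooth_mat_on_entries: "open S \<Longrightarrow> smooth_mat_on n S M \<Longrightarrow> smooth_on S (\<lambda>x. entries (M x))"
  by (rule smooth_on_entries[of S M n]) (auto simp: smooth_mat_on_def)

lemma smooth_mat_on_dec: "open S \<Longrightarrow> smooth_mat_on n S (dec n)"
  by (auto simp: smooth_mat_on_def intro: smooth_on_bounded_linear[OF _ bounded_linear_lookup])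

lemma smooth_mat_on_const: "open S \<Longrightarrow> A \<in> carrier_mat n n \<Longrightarrow> smooth_mat_on n S (\<lambda>_. A)"
  by (auto simp: smooth_mat_on_def intro: smooth_on_const)

lemma smooth_mat_on_subset:
  assumes "smooth_mat_on n S M" "T \<subseteq> S"
  shows "smooth_mat_on n T M"
  by (rule smooth_mat_onI[OF smooth_mat_on_carrier[OF assms(1)]])
     (rule smooth_on_subset[OF smooth_mat_on_index[OF assms(1)] assms(2)])

lemma smooth_mat_on_add:
  assumes "open S" "smooth_mat_on n S M" "smooth_mat_on n S N"
  shows "smooth_mat_on n S (\<lambda>x. M x + N x)"
proof (rule smooth_mat_onI)
  note c = smooth_mat_on_carrier[OF assms(2)] smooth_mat_on_carrier[OF assms(3)]
  show "M x + N x \<in> carrier_mat n n" for x using c by auto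
  fix i j assume ij: "i < n" "j < n"
  have "(M x + N x) $$ (i, j) = M x $$ (i, j) + N x $$ (i, j)" for x using ij c(1,2)[of x] by auto
  then show "smooth_on S (\<lambda>x. (M x + N x) $$ (i, j))"
    using ij by (auto intro!: smooth_on_add smooth_mat_on_index[OF assms(2)] smooth_mat_on_index[OF assms(3)] assms(1))
qed

lemma smooth_mat_on_minus:
  assumes "open S" "smooth_mat_on n S M" "smooth_mat_on n S N"
  shows "smooth_mat_on n S (\<lambda>x. M x - N x)"
proof (rule smooth_mat_onI)
  note c = smooth_mat_on_carrier[OF assms(2)] smooth_mat_on_carrier[OF assms(3)]
  show "M x - N x \<in> carrier_mat n n" for x using c by (auto simp: minus_carrier_mat)
  fix i j assume ij: "i < n" "j < n"
  have "(M x - N x) $$ (i, j) = M x $$ (i, j) - N x $$ (i, j)" for x using ij c(1,2)[of x] by auto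
  then show "smooth_on S (\<lambda>x. (M x - N x) $$ (i, j))"
    using ij by (auto intro!: smooth_on_diff smooth_mat_on_index[OF assms(2)] smooth_mat_on_index[OF assms(3)] assms(1))
qed

lemma smooth_mat_on_mult:
  assumes "open S" "smooth_mat_on n S M" "smooth_mat_on n S N"
  shows "smooth_mat_on n S (\<lambda>x. M x * N x)"
proof (rule smooth_mat_onI)
  note c = smooth_mat_on_carrier[OF assms(2)] smooth_mat_on_carrier[OF assms(3)]
  show "M x * N x \<in> carrier_mat n n" for x using c by (rule mult_carrier_mat)
  fix i j assume ij: "i < n" "j < n"
  have "(M x * N x) $$ (i, j) = (\<Sum>a<n. M x $$ (i, a) * N x $$ (a, j))" for x
    by (rule index_mult_mat_sum[OF c ij])
  then show "smooth_on S (\<lambda>x. (M x * N x) $$ (i, j))"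
    using ij by (auto intro!: smooth_on_sum smooth_on_mult smooth_mat_on_index[OF assms(2)]
        smooth_mat_on_index[OF assms(3)] assms(1))
qed

lemma smooth_on_det:
  assumes "open S" "smooth_mat_on n S M"
  shows "smooth_on S (\<lambda>x. Determinant.det (M x))"
  unfolding det_def'[OF smooth_mat_on_carrier[OF assms(2)]]
proof (intro smooth_on_sum smooth_on_mult smooth_on_prod smooth_on_const assms(1))
  fix p i assume "p \<in> {p. p permutes {0..<n}}" "i \<in> {0..<n}"
  then show "smooth_on S (\<lambda>x. M x $$ (i, p i))"
    using permutes_in_image[of p "{0..<n}" i] by (auto intro!: smooth_mat_on_index[OF assms(2)])
qed

lemma smooth_on_cofactor:
  assumes S: "open S" and M: "smooth_mat_on n S M" and i: "i < n" and j: "j < n"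
  shows "smooth_on S (\<lambda>x. cofactor (M x) i j)"
proof -
  have "smooth_mat_on (n - 1) S (\<lambda>x. mat_delete (M x) i j)"
  proof (rule smooth_mat_onI)
    show "mat_delete (M x) i j \<in> carrier_mat (n - 1) (n - 1)" for x
      using smooth_mat_on_carrier[OF M] by (rule mat_delete_carrier)
    fix a b assume ab: "a < n - 1" "b < n - 1"
    have "mat_delete (M x) i j $$ (a, b) = M x $$ (if a < i then a else Suc a, if b < j then b else Suc b)" for x
      using ab smooth_mat_on_carrier[OF M, of x] by (auto simp: mat_delete_def)
    then show "smooth_on S (\<lambda>x. mat_delete (M x) i j $$ (a, b))"
      using ab by (auto intro!: smooth_mat_on_index[OF M])
  qed
  then show ?thesis
    unfolding cofactor_def by (intro smooth_on_mult smooth_on_const S smooth_on_det)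
qed

lemma smooth_mat_on_inv_mat:
  assumes S: "open S" and M: "smooth_mat_on n S M" and d: "\<And>x. x \<in> S \<Longrightarrow> Determinant.det (M x) \<noteq> 0"
  shows "smooth_mat_on n S (\<lambda>x. inv_mat (M x))"
proof (rule smooth_mat_onI)
  note c = smooth_mat_on_carrier[OF M]
  show "inv_mat (M x) \<in> carrier_mat n n" for x using adj_mat(1)[OF c] by (simp add: inv_mat_def)
  fix i j assume ij: "i < n" "j < n"
  have "inv_mat (M x) $$ (i, j) = 1 / Determinant.det (M x) * cofactor (M x) j i" for x
    using c[of x] ij by (auto simp: inv_mat_def adj_mat_def)
  then show "smooth_on S (\<lambda>x. inv_mat (M x) $$ (i, j))"
    using ij by (auto intro!: smooth_on_mult smooth_on_divide smooth_on_const S smooth_on_det[OF S M] d smooth_on_cofactor[OF S M])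
qed

lemma smooth_mat_on_cayley:
  assumes S: "open S" and M: "smooth_mat_on n S M" and d: "\<And>x. x \<in> S \<Longrightarrow> Determinant.det (1\<^sub>m n + M x) \<noteq> 0"
  shows "smooth_mat_on n S (\<lambda>x. cayley n (M x))"
  unfolding cayley_def
  by (intro smooth_mat_on_mult smooth_mat_on_inv_mat smooth_mat_on_minus smooth_mat_on_add smooth_mat_on_const S M d) auto

section \<open>The special unitary group and the circle as manifolds\<close>

lemma SU_D:
  assumes "U \<in> SU l"
  shows "U \<in> carrier_mat l l" "U * mat_adjoint U = 1\<^sub>m l" "mat_adjoint U * U = 1\<^sub>m l" "Determinant.det U = 1"
  using assms mat_mult_left_right_inverse[of U l "mat_adjoint U"] by (auto simp: SU_def)

lemma SU_mult:
  assumes "U \<in> SU l" "V \<in> SU l"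
  shows "U * V \<in> SU l"
proof -
  note U = SU_D[OF assms(1)] and V = SU_D[OF assms(2)]
  have aU: "mat_adjoint U \<in> carrier_mat l l" "mat_adjoint V \<in> carrier_mat l l" using U V by auto
  have "U * V * mat_adjoint (U * V) = U * (V * mat_adjoint V) * mat_adjoint U"
    unfolding mat_adjoint_mult[OF U(1) V(1)] using U(1) V(1) aU
    by (simp add: assoc_mult_mat[of _ l l _ l _ l] mult_carrier_mat[of _ l l _ l])
  also have "\<dots> = 1\<^sub>m l" using U V by simp
  finally show ?thesis using U V det_mult[OF U(1) V(1)] by (auto simp: SU_def)
qed

lemma SU_adjoint:
  assumes "U \<in> SU l" shows "mat_adjoint U \<in> SU l"
  using SU_D[OF assms] det_mat_adjoint[of U l] by (auto simp: SU_def)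

text \<open>The determinant is an affine function of the corner entry, with the corner cofactor as
  slope; this lets the chart below solve for the corner.\<close>

lemma det_change_corner:
  assumes A: "A \<in> carrier_mat l l" "B \<in> carrier_mat l l" and l: "l > 0"
    and eq: "\<And>i j. i < l \<Longrightarrow> j < l \<Longrightarrow> (i, j) \<noteq> (0, 0) \<Longrightarrow> A $$ (i, j) = B $$ (i, j)"
  shows "cofactor A 0 0 = cofactor B 0 0"
    "Determinant.det A = Determinant.det B + (A $$ (0, 0) - B $$ (0, 0)) * cofactor B 0 0"
proof -
  have c: "cofactor A i 0 = cofactor B i 0" if "i < l" for i
    unfolding cofactor_def
    by (intro arg_cong2[where f="(*)"] refl arg_cong[where f=Determinant.det] eq_matI)
       (use A that eq in \<open>auto simp: mat_delete_def\<close>)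
  then show "cofactor A 0 0 = cofactor B 0 0" using l by simp
  obtain l' where l': "l = Suc l'" using l by (cases l) auto
  show "Determinant.det A = Determinant.det B + (A $$ (0, 0) - B $$ (0, 0)) * cofactor B 0 0"
    unfolding laplace_expansion_column[OF A(1) l] laplace_expansion_column[OF A(2) l]
    using c eq by (simp add: l' sum.lessThan_Suc_shift algebra_simps del: sum.lessThan_Suc)
qed

text \<open>The coordinates of a skew-Hermitian matrix other than the imaginary part of its entry \<open>(0, 0)\<close>;
  that one is recovered from \<open>det (1 + X) \<in> \<real>\<close>, which expresses \<open>det (cayley X) = 1\<close>.\<close>

definition skew_coords :: "nat \<Rightarrow> complex mat \<Rightarrow> nat \<Rightarrow>\<^sub>0 real" where
  "skew_coords l X = (\<Sum>k\<in>{1..<l\<^sup>2}. Poly_Mapping.single (k - 1)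
     (let i = k div l; j = k mod l in
      if i < j then Re (X $$ (i, j)) else if j < i then Im (X $$ (j, i)) else Im (X $$ (i, i))))"

text \<open>Position \<open>(i, j)\<close> has coordinate number \<open>i * l + j - 1\<close>: the
  corner, which comes first in the enumeration, is left out, and its place is filled with 0 until
  \<open>set_corner\<close> supplies the right value.\<close>

definition skew_of_coords :: "nat \<Rightarrow> (nat \<Rightarrow>\<^sub>0 real) \<Rightarrow> complex mat" where
  "skew_of_coords l \<xi> = (let c = (\<lambda>i j. if i * l + j = 0 then 0 else Poly_Mapping.lookup \<xi> (i * l + j - 1)) in
     Matrix.mat l l (\<lambda>(i, j). if i < j then Complex (c i j) (c j i)
       else if j < i then Complex (- c j i) (c i j) else Complex 0 (c i i)))"

definition set_corner :: "nat \<Rightarrow> complex \<Rightarrow> complex mat \<Rightarrow> complex mat" where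
  "set_corner l z X = Matrix.mat l l (\<lambda>p. if p = (0, 0) then z else X $$ p)"

lemma set_corner_index [simp]:
  "i < l \<Longrightarrow> j < l \<Longrightarrow> set_corner l z X $$ (i, j) = (if i = 0 \<and> j = 0 then z else X $$ (i, j))"
  "set_corner l z X \<in> carrier_mat l l" "dim_row (set_corner l z X) = l" "dim_col (set_corner l z X) = l"
  by (auto simp: set_corner_def)

lemma skew_of_coords_carrier [simp]: "skew_of_coords l \<xi> \<in> carrier_mat l l"
  "dim_row (skew_of_coords l \<xi>) = l" "dim_col (skew_of_coords l \<xi>) = l"
  by (auto simp: skew_of_coords_def)

lemma skew_of_coords_skew: "mat_adjoint (skew_of_coords l \<xi>) = - skew_of_coords l \<xi>"
  by (rule eq_matI) (auto simp: skew_of_coords_def Let_def complex_eq_iff)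

lemma index_less_square:
  fixes i j l :: nat
  assumes "i < l" "j < l"
  shows "i * l + j < l\<^sup>2"
proof -
  have "i * l + j < Suc i * l" using assms by simp
  also have "\<dots> \<le> l * l" using assms by (intro mult_right_mono) auto
  finally show ?thesis by (simp add: power2_eq_square)
qed

lemma lookup_skew_coords:
  assumes "i < l" "j < l" "(i, j) \<noteq> (0, 0)"
  shows "Poly_Mapping.lookup (skew_coords l X) (i * l + j - 1) =
     (if i < j then Re (X $$ (i, j)) else if j < i then Im (X $$ (j, i)) else Im (X $$ (i, i)))"
proof -
  have k: "i * l + j \<in> {1..<l\<^sup>2}" using index_less_square[OF assms(1,2)] assms by (auto simp: Suc_le_eq)
  have "(i * l + j) div l = i" "(i * l + j) mod l = j" using assms by auto
  then show ?thesis
    unfolding skew_coords_def by (subst lookup_sum_single[OF _ _ k]) (auto simp: inj_on_def Let_def)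
qed

lemma skew_of_coords_skew_coords:
  assumes X: "X \<in> carrier_mat l l" and skew: "mat_adjoint X = - X"
  shows "skew_of_coords l (skew_coords l X) = set_corner l 0 X"
proof (rule eq_matI)
  fix i j assume "i < dim_row (set_corner l 0 X)" "j < dim_col (set_corner l 0 X)"
  then have ij: "i < l" "j < l" by auto
  have "mat_adjoint X $$ (i, j) = (- X) $$ (i, j)" using skew by simp
  then have "cnj (X $$ (j, i)) = - X $$ (i, j)" using ij X by simp
  then have "Re (X $$ (i, j)) = - Re (X $$ (j, i))" "Im (X $$ (i, j)) = Im (X $$ (j, i))"
    by (auto simp: complex_eq_iff)
  then show "skew_of_coords l (skew_coords l X) $$ (i, j) = set_corner l 0 X $$ (i, j)"
    using ij by (auto simp: skew_of_coords_def Let_def complex_eq_iff lookup_skew_coords[unfolded One_nat_def])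
qed auto

lemma skew_coords_skew_of_coords:
  assumes "\<xi> \<in> Rn (l\<^sup>2 - 1)" "l > 0"
  shows "skew_coords l (set_corner l z (skew_of_coords l \<xi>)) = \<xi>"
proof (rule poly_mapping_eqI)
  fix k
  show "Poly_Mapping.lookup (skew_coords l (set_corner l z (skew_of_coords l \<xi>))) k = Poly_Mapping.lookup \<xi> k"
  proof (cases "k < l\<^sup>2 - 1")
    case True
    define i j where "i = Suc k div l" and "j = Suc k mod l"
    have ij: "i < l" "j < l" "Suc k = i * l + j"
      using True assms(2) by (auto simp: i_def j_def power2_eq_square less_mult_imp_div_less)
    then have "(i, j) \<noteq> (0, 0)" by (cases "i = 0") auto
    note lookup_skew_coords[OF ij(1,2) this, of "set_corner l z (skew_of_coords l \<xi>)"]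
    moreover have "i * l + j - 1 = k" using ij(3) by auto
    ultimately show ?thesis
      using ij by (auto simp: skew_of_coords_def Let_def split: if_splits)
  next
    case False
    then have "Poly_Mapping.lookup (skew_coords l X) k = 0" for X
      unfolding skew_coords_def by (intro lookup_sum_single_notin) auto
    then show ?thesis using False assms(1) by (auto simp: Rn_iff)
  qed
qed

lemma skew_coords_Rn: "skew_coords l X \<in> Rn (l\<^sup>2 - 1)"
  unfolding Rn_iff skew_coords_def by (intro allI impI lookup_sum_single_notin) auto

lemma smooth_mat_on_skew_of_coords: "open S \<Longrightarrow> smooth_mat_on l S (skew_of_coords l)"
proof (rule smooth_mat_onI)
  fix i j assume S: "open S" and ij: "i < l" "j < l"
  have c: "smooth_on S (\<lambda>x. if P then 0 else Poly_Mapping.lookup x k :: real)" for P k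
    by (cases P) (auto intro: S smooth_on_const smooth_on_bounded_linear[OF S bounded_linear_lookup])
  have eq: "Complex u v = complex_of_real u + \<i> * complex_of_real v" for u v
    by (simp add: complex_eq_iff)
  show "smooth_on S (\<lambda>x. skew_of_coords l x $$ (i, j))"
    using ij unfolding skew_of_coords_def Let_def eq
    by (cases i j rule: linorder_cases)
       (auto intro!: smooth_on_add smooth_on_mult smooth_on_const smooth_on_minus smooth_on_diff
         smooth_on_complex_of_real c smooth_on_bounded_linear[OF S bounded_linear_lookup] S)
qed auto

lemma smooth_mat_on_set_corner:
  assumes "open S" "smooth_on S z" "smooth_mat_on n S M"
  shows "smooth_mat_on n S (\<lambda>x. set_corner n (z x) (M x))"
proof (rule smooth_mat_onI)
  fix i j assume "i < n" "j < n"
  then show "smooth_on S (\<lambda>x. set_corner n (z x) (M x) $$ (i, j))"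
    using assms by (cases "i = 0 \<and> j = 0") (auto intro: smooth_mat_on_index)
qed auto

lemma smooth_on_skew_coords:
  assumes "open S" "smooth_mat_on l S M"
  shows "smooth_on S (\<lambda>x. skew_coords l (M x))"
  unfolding skew_coords_def
proof (intro smooth_on_sum smooth_on_single assms(1))
  fix k assume "k \<in> {1..<l\<^sup>2}"
  then have "l > 0" and k: "k div l < l" "k mod l < l"
    by (cases "l = 0"; auto simp: power2_eq_square less_mult_imp_div_less)+
  then show "smooth_on S (\<lambda>x. let i = k div l; j = k mod l in
      if i < j then Re (M x $$ (i, j)) else if j < i then Im (M x $$ (j, i)) else Im (M x $$ (i, i)))"
    unfolding Let_def
    by (cases "k div l" "k mod l" rule: linorder_cases)
       (auto intro!: smooth_on_Re smooth_on_Im smooth_mat_on_index[OF assms(2)] assms(1))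
qed

lemma cayley_zero: "cayley l (1\<^sub>m l) = 0\<^sub>m l l"
proof -
  have "Determinant.det (1\<^sub>m l + 1\<^sub>m l :: complex mat) \<noteq> 0"
    by (rule inv_mat_unique(2)[where N="(1 / 2) \<cdot>\<^sub>m 1\<^sub>m l"])
       (auto simp: mult_smult_distrib[of _ l l _ l] intro!: eq_matI)
  then have "inv_mat (1\<^sub>m l + 1\<^sub>m l) \<in> carrier_mat l l" by (intro inv_mat) auto
  then show ?thesis unfolding cayley_def by (subst minus_r_inv_mat[of _ l l]) auto
qed

lemma open_preimage_smooth:
  assumes "open S" "smooth_on S f" "open T"
  shows "open {x \<in> S. f x \<in> T}"
proof -
  have "open (S \<inter> f -` T)"
    by (rule continuous_open_preimage[OF smooth_on_imp_continuous_on[OF assms(2)] assms(1,3)])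
  then show ?thesis by (simp add: Int_def vimage_def)
qed

text \<open>Near the identity a special unitary matrix is the Cayley transform of a skew-Hermitian
  \<open>X\<close> with real \<open>det (1 + X)\<close>. This is an affine equation for the
  imaginary part of the corner of \<open>X\<close>, solvable as long as the real part
  \<open>Re (\<beta> X)\<close> of its slope is nonzero; the other coordinates are free.\<close>

lemma SU_chart_at_one:
  assumes l: "l > 0"
  shows "chart_at (l\<^sup>2 - 1) (entries ` SU l) (entries (1\<^sub>m l))"
proof -
  define \<beta> where "\<beta> = (\<lambda>X :: complex mat. cofactor (1\<^sub>m l + X) 0 0)"
  \<comment> \<open>A corner \<open>t\<close> times the imaginary unit adds
    \<open>t * Re \<beta>\<close> to the imaginary part of the determinant. This \<open>t\<close>
    cancels what the matrix with corner 0 contributes.\<close>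
  define t where "t = (\<lambda>\<xi>. - Im (Determinant.det (1\<^sub>m l + skew_of_coords l \<xi>)) / Re (\<beta> (skew_of_coords l \<xi>)))"
  define XX where "XX = (\<lambda>\<xi>. set_corner l (\<i> * complex_of_real (t \<xi>)) (skew_of_coords l \<xi>))"
  define O1 where "O1 = {\<xi> \<in> UNIV. Re (\<beta> (skew_of_coords l \<xi>)) \<in> - {0}}"
  define O2 where "O2 = {\<xi> \<in> O1. Determinant.det (1\<^sub>m l + XX \<xi>) \<in> - {0}}"
  \<comment> \<open>\<open>W1\<close> is where the Cayley transform is defined, and \<open>W\<close>
    moreover keeps the slope of the corner equation away from 0. The identity lies in
    \<open>W\<close>: its transform is the zero matrix, for which the slope is 1.\<close>
  define W1 where "W1 = {x \<in> UNIV. Determinant.det (1\<^sub>m l + dec l x) \<in> - {0}}"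
  define W where "W = {x \<in> W1. Re (\<beta> (cayley l (dec l x))) \<in> - {0}}"
  define V where "V = Rn (l\<^sup>2 - 1) \<inter> O2"
  have op: "open (- {0 :: complex})" "open (- {0 :: real})" by auto
  have sm\<beta>: "smooth_on S (\<lambda>x. \<beta> (M x))" if "open S" "smooth_mat_on l S M" for S :: "'z::real_normed_vector set" and M
    unfolding \<beta>_def using that l by (intro smooth_on_cofactor smooth_mat_on_add smooth_mat_on_const) auto
  have smd: "smooth_on S (\<lambda>x. Determinant.det (1\<^sub>m l + M x))" if "open S" "smooth_mat_on l S M" for S :: "'z::real_normed_vector set" and M
    using that by (intro smooth_on_det smooth_mat_on_add smooth_mat_on_const) auto
  have O1: "open O1"
    unfolding O1_def by (rule open_preimage_smooth[OF _ _ op(2)])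
      (auto intro!: smooth_on_Re sm\<beta> smooth_mat_on_skew_of_coords)
  have smX: "smooth_mat_on l O1 XX"
    unfolding XX_def t_def
    by (intro smooth_mat_on_set_corner smooth_on_mult smooth_on_const smooth_on_complex_of_real smooth_on_divide
        smooth_on_minus smooth_on_Im smooth_on_Re smd sm\<beta> smooth_mat_on_skew_of_coords O1) (auto simp: O1_def)
  have O2: "open O2"
    unfolding O2_def by (rule open_preimage_smooth[OF O1 smd[OF O1 smX] op(1)])
  have W1: "open W1"
    unfolding W1_def by (rule open_preimage_smooth[OF _ _ op(1)]) (auto intro!: smd smooth_mat_on_dec)
  have smc: "smooth_mat_on l W1 (\<lambda>x. cayley l (dec l x))"
    by (rule smooth_mat_on_cayley[OF W1 smooth_mat_on_dec[OF W1]]) (simp add: W1_def)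
  have W: "open W"
    unfolding W_def by (rule open_preimage_smooth[OF W1 smooth_on_Re[OF W1 sm\<beta>[OF W1 smc]] op(2)])
  have corner: "\<beta> (set_corner l z X) = \<beta> X"
    "Determinant.det (1\<^sub>m l + set_corner l z X) = Determinant.det (1\<^sub>m l + X) + (z - X $$ (0, 0)) * \<beta> X"
    if X: "X \<in> carrier_mat l l" for X z
  proof -
    have e: "(1\<^sub>m l + set_corner l z X) $$ (i, j) = (1\<^sub>m l + X) $$ (i, j)"
      if "i < l" "j < l" "(i, j) \<noteq> (0, 0)" for i j using that X by auto
    show "\<beta> (set_corner l z X) = \<beta> X"
      unfolding \<beta>_def by (rule det_change_corner(1)[OF _ _ l e]) (use X in auto)
    show "Determinant.det (1\<^sub>m l + set_corner l z X) = Determinant.det (1\<^sub>m l + X) + (z - X $$ (0, 0)) * \<beta> X"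
      unfolding \<beta>_def by (subst det_change_corner(2)[OF _ _ l e]) (use X l in auto)
  qed
  have skew_det: "Determinant.det (1\<^sub>m l - X) = cnj (Determinant.det (1\<^sub>m l + X))"
    if X: "X \<in> carrier_mat l l" "mat_adjoint X = - X" for X
  proof -
    have "mat_adjoint (1\<^sub>m l + X) = 1\<^sub>m l - X"
      using X by (auto simp: mat_adjoint_add[of _ l l] intro!: eq_matI)
    then show ?thesis using det_mat_adjoint[of "1\<^sub>m l + X" l] X by simp
  qed
  have corner0: "skew_of_coords l \<xi> $$ (0, 0) = 0" for \<xi>
    using l by (simp add: skew_of_coords_def Let_def complex_eq_iff)
  have fwd: "XX (skew_coords l X) = X" "skew_coords l X \<in> V"
    if X: "X \<in> carrier_mat l l" "mat_adjoint X = - X" "Determinant.det (1\<^sub>m l + X) \<noteq> 0"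
      "Im (Determinant.det (1\<^sub>m l + X)) = 0" "Re (\<beta> X) \<noteq> 0" for X
  proof -
    define X0 where "X0 = set_corner l 0 X"
    have X0: "skew_of_coords l (skew_coords l X) = X0" "X0 \<in> carrier_mat l l"
      using skew_of_coords_skew_coords[OF X(1,2)] by (auto simp: X0_def)
    have XX0: "X = set_corner l (X $$ (0, 0)) X0"
      using X(1) by (intro eq_matI) (auto simp: X0_def)
    have "mat_adjoint X $$ (0, 0) = (- X) $$ (0, 0)" using X(2) by simp
    then have re: "Re (X $$ (0, 0)) = 0" using X(1) l by (auto simp: complex_eq_iff)
    have \<beta>: "\<beta> X0 = \<beta> X" unfolding X0_def by (rule corner(1)[OF X(1)])
    have "Determinant.det (1\<^sub>m l + X) = Determinant.det (1\<^sub>m l + X0) + X $$ (0, 0) * \<beta> X"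
      using corner(2)[OF X0(2), of "X $$ (0, 0)"] XX0 \<beta> l by (simp add: X0_def)
    then have "Im (Determinant.det (1\<^sub>m l + X0)) + Im (X $$ (0, 0)) * Re (\<beta> X) = 0"
      using X(4) re by simp
    then have "Im (X $$ (0, 0)) = t (skew_coords l X)"
      unfolding t_def X0(1) \<beta> using X(5) by (simp add: field_simps)
    then have "\<i> * complex_of_real (t (skew_coords l X)) = X $$ (0, 0)"
      using re by (simp add: complex_eq_iff)
    then show XX: "XX (skew_coords l X) = X"
      using XX0 by (simp add: XX_def X0(1))
    show "skew_coords l X \<in> V"
      unfolding V_def O2_def O1_def using XX X(3,5) skew_coords_Rn by (auto simp: X0(1) \<beta>)
  qed
  have bwd: "XX \<xi> \<in> carrier_mat l l" "mat_adjoint (XX \<xi>) = - XX \<xi>" "Determinant.det (1\<^sub>m l + XX \<xi>) \<noteq> 0"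
    "Im (Determinant.det (1\<^sub>m l + XX \<xi>)) = 0" "Re (\<beta> (XX \<xi>)) \<noteq> 0" "skew_coords l (XX \<xi>) = \<xi>"
    if \<xi>: "\<xi> \<in> V" for \<xi>
  proof -
    define X0 where "X0 = skew_of_coords l \<xi>"
    have X0: "X0 \<in> carrier_mat l l" "mat_adjoint X0 = - X0" "X0 $$ (0, 0) = 0"
      by (auto simp: X0_def skew_of_coords_skew corner0)
    show c: "XX \<xi> \<in> carrier_mat l l" by (simp add: XX_def)
    have X0ij: "cnj (X0 $$ (j, i)) = - X0 $$ (i, j)" if "i < l" "j < l" for i j
    proof -
      have "mat_adjoint X0 $$ (i, j) = (- X0) $$ (i, j)" using X0(2) by simp
      then show ?thesis using that X0(1) by simp
    qed
    show "mat_adjoint (XX \<xi>) = - XX \<xi>"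
      using c X0ij by (intro eq_matI) (auto simp: XX_def X0_def[symmetric])
    have nz: "Re (\<beta> X0) \<noteq> 0" using \<xi> by (auto simp: V_def O2_def O1_def X0_def)
    then show "Re (\<beta> (XX \<xi>)) \<noteq> 0"
      unfolding XX_def X0_def[symmetric] by (simp add: corner(1)[OF X0(1)])
    show "Determinant.det (1\<^sub>m l + XX \<xi>) \<noteq> 0" using \<xi> by (auto simp: V_def O2_def)
    show "Im (Determinant.det (1\<^sub>m l + XX \<xi>)) = 0"
      unfolding XX_def X0_def[symmetric] corner(2)[OF X0(1)] using nz
      by (simp add: X0(3) t_def X0_def[symmetric])
    show "skew_coords l (XX \<xi>) = \<xi>"
      unfolding XX_def by (rule skew_coords_skew_of_coords) (use \<xi> l in \<open>auto simp: V_def\<close>)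
  qed
  have "diffeomorphic (entries ` SU l \<inter> W) V"
  proof (rule diffeomorphicI[where f="\<lambda>x. skew_coords l (cayley l (dec l x))" and g="\<lambda>\<xi>. entries (cayley l (XX \<xi>))"])
    show "smooth_map_on (entries ` SU l \<inter> W) (\<lambda>x. skew_coords l (cayley l (dec l x)))"
      by (rule smooth_map_onI[OF W1 smooth_on_skew_coords[OF W1 smc]]) (auto simp: W_def)
    show "smooth_map_on V (\<lambda>\<xi>. entries (cayley l (XX \<xi>)))"
    proof (rule smooth_map_onI[OF O2])
      show "smooth_on O2 (\<lambda>\<xi>. entries (cayley l (XX \<xi>)))"
        by (rule smooth_mat_on_entries[OF O2 smooth_mat_on_cayley[OF O2 smooth_mat_on_subset[OF smX]]])
           (auto simp: O2_def)
    qed (auto simp: V_def)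
  next
    fix x assume "x \<in> entries ` SU l \<inter> W"
    then obtain U where U: "U \<in> SU l" "x = entries U" and xW: "x \<in> W" by auto
    note UD = SU_D[OF U(1)]
    have dx: "dec l x = U" using U UD by simp
    have d: "Determinant.det (1\<^sub>m l + U) \<noteq> 0" and b: "Re (\<beta> (cayley l U)) \<noteq> 0"
      using xW by (auto simp: W_def W1_def dx)
    define X where "X = cayley l U"
    have X: "X \<in> carrier_mat l l" "mat_adjoint X = - X" "Determinant.det (1\<^sub>m l + X) \<noteq> 0" "cayley l X = U"
      unfolding X_def using cayley_carrier[OF UD(1) d] cayley_unitary[OF UD(1) d UD(2)]
        det_one_plus_cayley[OF UD(1) d] cayley_cayley[OF UD(1) d] by auto
    have "Determinant.det (1\<^sub>m l + X) = cnj (Determinant.det (1\<^sub>m l + X))"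
      using det_cayley[OF X(1,3)] skew_det[OF X(1,2)] UD(4) X(4) by simp
    then have im: "Im (Determinant.det (1\<^sub>m l + X)) = 0" by (metis Im_complex_of_real Reals_cnj_iff complex_is_Real_iff)
    note f = fwd[OF X(1-3) im]
    show "skew_coords l (cayley l (dec l x)) \<in> V"
      using f b by (simp add: dx X_def)
    show "entries (cayley l (XX (skew_coords l (cayley l (dec l x))))) = x"
      unfolding dx using f(1) b X(4) U(2) by (simp add: X_def)
  next
    fix \<xi> assume \<xi>: "\<xi> \<in> V"
    note X = bwd[OF \<xi>]
    define U where "U = cayley l (XX \<xi>)"
    have U: "U \<in> carrier_mat l l" "U * mat_adjoint U = 1\<^sub>m l" "Determinant.det (1\<^sub>m l + U) \<noteq> 0" "cayley l U = XX \<xi>"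
      unfolding U_def using cayley_carrier[OF X(1,3)] cayley_skew[OF X(1,3,2)]
        det_one_plus_cayley[OF X(1,3)] cayley_cayley[OF X(1,3)] by auto
    have "Determinant.det U * Determinant.det (1\<^sub>m l + XX \<xi>) = cnj (Determinant.det (1\<^sub>m l + XX \<xi>))"
      using det_cayley[OF X(1,3)] skew_det[OF X(1,2)] by (simp add: U_def)
    also have "\<dots> = Determinant.det (1\<^sub>m l + XX \<xi>)" using X(4) by (simp add: complex_eq_iff)
    finally have "Determinant.det U = 1" using X(3) by simp
    then have "U \<in> SU l" using U by (auto simp: SU_def)
    moreover have "entries U \<in> W" using U X(5) by (simp add: W_def W1_def)
    ultimately show "entries (cayley l (XX \<xi>)) \<in> entries ` SU l \<inter> W" by (auto simp: U_def)
    show "skew_coords l (cayley l (dec l (entries (cayley l (XX \<xi>))))) = \<xi>"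
      using U X(6) by (simp add: U_def)
  qed
  moreover have "entries (1\<^sub>m l) \<in> W"
  proof -
    have d1: "Determinant.det (1\<^sub>m l + 1\<^sub>m l :: complex mat) \<noteq> 0"
      by (rule inv_mat_unique(2)[where N="(1 / 2) \<cdot>\<^sub>m 1\<^sub>m l"])
         (auto simp: mult_smult_distrib[of _ l l _ l] intro!: eq_matI)
    have "1\<^sub>m l + 0\<^sub>m l l = (1\<^sub>m l :: complex mat)" by auto
    moreover have "mat_delete (1\<^sub>m l) 0 0 = (1\<^sub>m (l - 1) :: complex mat)"
      by (rule eq_matI) (auto simp: mat_delete_def)
    ultimately have "\<beta> (0\<^sub>m l l) = 1" by (simp add: \<beta>_def cofactor_def)
    then show ?thesis using d1 by (simp add: W_def W1_def cayley_zero)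
  qed
  ultimately show ?thesis
    unfolding chart_at_def using W O2 by (intro exI[of _ W] exI[of _ V]) (auto simp: V_def openin_open)
qed

text \<open>Multiplication by the adjoint of a point is a diffeomorphism of the group taking that
  point to the identity, where a chart is available.\<close>

lemma submanifold_SU:
  assumes l: "l > 0"
  shows "submanifold (l\<^sup>2 - 1) (entries ` SU l)"
  unfolding submanifold_iff_chart_at
proof
  fix p assume "p \<in> entries ` SU l"
  then obtain U0 where U0: "U0 \<in> SU l" "p = entries U0" by auto
  note D = SU_D[OF U0(1)]
  have aU: "mat_adjoint U0 \<in> carrier_mat l l" using D by auto
  have sm: "smooth_map_on (entries ` SU l) (\<lambda>x. entries (M * dec l x))" if "M \<in> carrier_mat l l" for M
    by (rule smooth_map_onI[of UNIV "\<lambda>x. entries (M * dec l x)"])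
       (auto intro!: smooth_mat_on_entries smooth_mat_on_mult[where M="\<lambda>_. M"] smooth_mat_on_const smooth_mat_on_dec that)
  have inv: "A * (B * U) = U" if "A * B = 1\<^sub>m l" "A \<in> carrier_mat l l" "B \<in> carrier_mat l l" "U \<in> SU l" for A B U
    using assoc_mult_mat[OF that(2,3) SU_D(1)[OF that(4)]] that SU_D(1)[OF that(4)] by simp
  have cD: "mat_adjoint U0 * U \<in> carrier_mat l l" "U0 * U \<in> carrier_mat l l" if "U \<in> SU l" for U
    using SU_D(1)[OF that] D aU by auto
  show "chart_at (l\<^sup>2 - 1) (entries ` SU l) p"
  proof (rule chart_at_diffeomorphic[where X="entries ` SU l" and Y="entries ` SU l"
        and f="\<lambda>x. entries (mat_adjoint U0 * dec l x)" and g="\<lambda>x. entries (U0 * dec l x)"])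
    show "finite_rank (entries ` SU l)" by (rule finite_rank_entries[where n=l]) (auto simp: SU_def)
    show "p \<in> entries ` SU l" using U0 by auto
    show "chart_at (l\<^sup>2 - 1) (entries ` SU l) (entries (mat_adjoint U0 * dec l p))"
      using SU_chart_at_one[OF l] D by (simp add: U0)
  qed (use sm[OF aU] sm[OF D(1)] SU_mult[OF SU_adjoint[OF U0(1)]] SU_mult[OF U0(1)]
        inv[OF D(2,1) aU] inv[OF D(3) aU D(1)] SU_D(1) cD in auto)
qed

text \<open>Stereographic projection from the antipode of \<open>p\<close>: for
  \<open>w = cnj p * z\<close> the coordinate is the tangent of half the angle of \<open>w\<close>,
  and the inverse is the rational half-angle parametrisation.\<close>

lemma submanifold_circle: "submanifold 1 (sphere (0 :: complex) 1)"
  unfolding submanifold_iff_chart_at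
proof
  fix p :: complex assume p: "p \<in> sphere 0 1"
  then have pp: "p * cnj p = 1" by (simp add: complex_norm_square[symmetric])
  define W where "W = {z :: complex. Re (cnj p * z) \<noteq> -1}"
  define f where "f = (\<lambda>z. Poly_Mapping.single (0 :: nat) (Im (cnj p * z) / (1 + Re (cnj p * z))))"
  define g where "g = (\<lambda>\<xi> :: nat \<Rightarrow>\<^sub>0 real. let x = Poly_Mapping.lookup \<xi> 0 in
      p * (complex_of_real ((1 - x\<^sup>2) / (1 + x\<^sup>2)) + \<i> * complex_of_real (2 * x / (1 + x\<^sup>2))))"
  have W: "open W" unfolding W_def by (intro open_Collect_neq continuous_intros)
  have pos: "1 + x\<^sup>2 > 0" for x :: real by (simp add: add_pos_nonneg)
  have nz: "1 + Poly_Mapping.lookup \<xi> 0 * Poly_Mapping.lookup \<xi> 0 \<noteq> 0" for \<xi> :: "nat \<Rightarrow>\<^sub>0 real"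
    using pos[of "Poly_Mapping.lookup \<xi> 0"] by (simp add: power2_eq_square)
  have "diffeomorphic (sphere 0 1 \<inter> W) (Rn 1)"
  proof (rule diffeomorphicI[where f=f and g=g])
    show "smooth_map_on (sphere 0 1 \<inter> W) f"
    proof (rule smooth_map_onI[OF W])
      show "smooth_on W f" unfolding f_def
        by (intro smooth_on_single smooth_on_divide smooth_on_Im smooth_on_Re smooth_on_mult smooth_on_add smooth_on_const smooth_on_ident W)
           (auto simp: W_def)
    qed auto
    show "smooth_map_on (Rn 1) g"
    proof (rule smooth_map_onI[OF open_UNIV])
      show "smooth_on UNIV g" unfolding g_def Let_def power2_eq_square
        by (intro smooth_on_divide smooth_on_mult smooth_on_add smooth_on_diff smooth_on_const smooth_on_complex_of_real
            smooth_on_lookup smooth_on_ident open_UNIV nz)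
    qed auto
    show "f z \<in> Rn 1" for z by (auto simp: Rn_iff f_def lookup_single when_def)
  next
    fix z assume z: "z \<in> sphere 0 1 \<inter> W"
    define w where "w = cnj p * z"
    have pw: "p * w = z" using pp by (simp add: w_def mult.assoc[symmetric])
    have "norm w = 1" using z p by (simp add: w_def norm_mult)
    then have w1: "(Re w)\<^sup>2 + (Im w)\<^sup>2 = 1" by (simp add: cmod_def)
    have nz: "1 + Re w \<noteq> 0" using z by (auto simp: W_def w_def)
    define x where "x = Im w / (1 + Re w)"
    have x2: "1 + x\<^sup>2 = 2 / (1 + Re w)"
    proof -
      have "(1 + Re w)\<^sup>2 + (Im w)\<^sup>2 = 2 * (1 + Re w)" using w1 by (simp add: power2_eq_square algebra_simps)
      then have "(1 + x\<^sup>2) * (1 + Re w)\<^sup>2 = 2 * (1 + Re w)"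
        using nz by (simp add: x_def power_divide field_simps)
      then have "(1 + x\<^sup>2) * (1 + Re w) = 2"
        using nz mult_right_cancel[of "1 + Re w" "(1 + x\<^sup>2) * (1 + Re w)" 2]
        by (simp add: power2_eq_square mult.assoc)
      then show ?thesis using nz by (simp add: eq_divide_eq)
    qed
    have "(1 - x\<^sup>2) / (1 + x\<^sup>2) = 2 / (1 + x\<^sup>2) - 1"
      using pos[of x] by (simp add: field_simps)
    also have "2 / (1 + x\<^sup>2) = 1 + Re w" unfolding x2 using nz by simp
    finally have 1: "(1 - x\<^sup>2) / (1 + x\<^sup>2) = Re w" by simp
    have 2: "2 * x / (1 + x\<^sup>2) = Im w" unfolding x2 using nz by (simp add: x_def)
    have "Poly_Mapping.lookup (f z) 0 = x" by (simp add: f_def x_def w_def)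
    then have "g (f z) = p * (complex_of_real (Re w) + \<i> * complex_of_real (Im w))"
      unfolding g_def Let_def by (simp only: 1 2)
    then show "g (f z) = z" using pw complex_eq[of w] by simp
  next
    fix \<xi> :: "nat \<Rightarrow>\<^sub>0 real" assume \<xi>: "\<xi> \<in> Rn 1"
    define x where "x = Poly_Mapping.lookup \<xi> 0"
    define w where "w = complex_of_real ((1 - x\<^sup>2) / (1 + x\<^sup>2)) + \<i> * complex_of_real (2 * x / (1 + x\<^sup>2))"
    have g: "g \<xi> = p * w" by (simp add: g_def Let_def w_def x_def)
    have cw: "cnj p * g \<xi> = w" using pp by (simp add: g mult.assoc[symmetric] mult.commute)
    have Rw: "Re w = (1 - x\<^sup>2) / (1 + x\<^sup>2)" "Im w = 2 * x / (1 + x\<^sup>2)" by (auto simp: w_def)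
    have "(Re w)\<^sup>2 + (Im w)\<^sup>2 = ((1 - x\<^sup>2)\<^sup>2 + (2 * x)\<^sup>2) / (1 + x\<^sup>2)\<^sup>2"
      unfolding Rw by (simp add: power_divide add_divide_distrib)
    also have "(1 - x\<^sup>2)\<^sup>2 + (2 * x)\<^sup>2 = (1 + x\<^sup>2)\<^sup>2" by (simp add: power2_eq_square algebra_simps)
    finally have "(Re w)\<^sup>2 + (Im w)\<^sup>2 = 1" using pos[of x] by simp
    then have "norm w = 1" by (simp add: cmod_def)
    moreover have R1: "1 + Re w = 2 / (1 + x\<^sup>2)" unfolding Rw using pos[of x] by (simp add: field_simps)
    then have "1 + Re w > 0" using pos[of x] by simp
    then have "g \<xi> \<in> W" unfolding W_def mem_Collect_eq cw by linarith
    ultimately show "g \<xi> \<in> sphere 0 1 \<inter> W" using p by (simp add: g norm_mult)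
    have "Im w / (1 + Re w) = x" unfolding R1 Rw(2) using pos[of x] by simp
    then show "f (g \<xi>) = \<xi>"
      unfolding f_def cw using \<xi> by (intro poly_mapping_eqI) (auto simp: lookup_single when_def x_def Rn_iff)
  qed
  moreover have "p \<in> W"
  proof -
    have "cnj p * p = 1" using pp by (simp only: mult.commute)
    then show ?thesis unfolding W_def mem_Collect_eq by simp
  qed
  ultimately show "chart_at 1 (sphere 0 1) p"
    unfolding chart_at_def using W by (intro exI[of _ W] exI[of _ "Rn 1"]) auto
qed

lemma finite_rank_SU: "finite_rank (entries ` SU l)"
  by (rule finite_rank_entries[where n=l]) (auto simp: SU_def)

section \<open>Combinatorics of the triangle\<close>

text \<open>The triangle is partitioned into diamonds, those of size 1 being the positions at which no
  equality occurs.\<close>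

locale gc_pattern =
  fixes n s :: nat and T :: "nat \<times> nat \<Rightarrow> real" and L I K :: "nat \<Rightarrow> nat"
  assumes L_pos: "r < s \<Longrightarrow> 1 \<le> L r"
    and I_pos: "r < s \<Longrightarrow> 1 \<le> I r"
    and I_L: "r < s \<Longrightarrow> I r + L r \<le> K r + 1"
    and K_L: "r < s \<Longrightarrow> K r + L r \<le> n + 1"
    and disj: "disjoint_family_on (\<lambda>r. diamond_at (L r) (I r) (K r)) {..<s}"
    and cover: "(\<Union>r<s. diamond_at (L r) (I r) (K r)) = {(i, j). 1 \<le> i \<and> i \<le> j \<and> j \<le> n}"
    and eq_iff: "triangle_neighbours n p q \<Longrightarrow>
      T p = T q \<longleftrightarrow> (\<exists>r<s. p \<in> diamond_at (L r) (I r) (K r) \<and> q \<in> diamond_at (L r) (I r) (K r))"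
    and sorted: "1 \<le> i \<Longrightarrow> i < j \<Longrightarrow> j \<le> n \<Longrightarrow> T (Suc i, j) \<le> T (i, j)"
begin

text \<open>The diamond \<open>r\<close> meets the rows \<open>bot r, \<dots>, top r\<close>, and row \<open>j\<close> in the \<open>mult r j\<close> positions from
  \<open>lo r j\<close> on; \<open>val r\<close> is the common value of its entries.\<close>

definition D where "D r = diamond_at (L r) (I r) (K r)"
definition bot where "bot r = K r + 1 - L r"
definition top where "top r = K r + L r - 1"
text \<open>The size minus the distance to the widest row, cut off at 0; one of the two truncated
  differences always vanishes.\<close>

definition mult where "mult r j = L r - (j - K r) - (K r - j)"
definition lo where "lo r j = I r + (j - K r)"
definition act where "act j = {r. r < s \<and> bot r \<le> j \<and> j \<le> top r}"
definition val where "val r = T (I r, K r)"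

lemma finite_act [simp]: "finite (act j)" by (auto simp: act_def)

lemma act_less: "r \<in> act j \<Longrightarrow> r < s" by (simp add: act_def)

lemma bot_pos: "r < s \<Longrightarrow> 1 \<le> bot r" using I_pos[of r] I_L[of r] by (auto simp: bot_def)

lemma bot_le_K: "r < s \<Longrightarrow> bot r \<le> K r" using L_pos[of r] by (auto simp: bot_def)

lemma K_le_top: "r < s \<Longrightarrow> K r \<le> top r" using L_pos[of r] by (auto simp: top_def)

lemma top_le: "r < s \<Longrightarrow> top r \<le> n" using K_L[of r] by (auto simp: top_def)

lemma mem_D:
  assumes r: "r < s"
  shows "(a, j) \<in> D r \<longleftrightarrow> r \<in> act j \<and> lo r j \<le> a \<and> a < lo r j + mult r j"
proof (cases "j \<le> K r")
  case True
  then obtain d where d: "K r = j + d" by (auto simp: le_iff_add)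
  have "(a, j) \<in> D r \<longleftrightarrow> d + 1 \<le> L r \<and> I r \<le> a \<and> a + 1 + d \<le> I r + L r"
    unfolding D_def diamond_at_def d by auto
  moreover have "r \<in> act j \<longleftrightarrow> d + 1 \<le> L r"
    unfolding act_def bot_def top_def mem_Collect_eq d using r L_pos[OF r] by auto
  moreover have "lo r j = I r" "mult r j = L r - d" unfolding lo_def mult_def d by auto
  ultimately show ?thesis by auto
next
  case False
  then obtain d where d: "j = Suc (K r + d)" using less_iff_Suc_add[of "K r" j] by auto
  have "(a, j) \<in> D r \<longleftrightarrow> d + 2 \<le> L r \<and> I r + d + 1 \<le> a \<and> a + 1 \<le> I r + L r"
    unfolding D_def diamond_at_def d by auto
  moreover have "r \<in> act j \<longleftrightarrow> d + 2 \<le> L r"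
    unfolding act_def bot_def top_def mem_Collect_eq d using r L_pos[OF r] by auto
  moreover have "lo r j = I r + d + 1" "mult r j = L r - d - 1" unfolding lo_def mult_def d by auto
  ultimately show ?thesis by auto
qed

lemma act_iff_mult:
  assumes r: "r < s"
  shows "r \<in> act j \<longleftrightarrow> mult r j > 0"
proof (cases "j \<le> K r")
  case True
  then obtain d where d: "K r = j + d" by (auto simp: le_iff_add)
  show ?thesis unfolding act_def bot_def top_def mult_def mem_Collect_eq d using r L_pos[OF r] by auto
next
  case False
  then obtain d where d: "j = Suc (K r + d)" using less_iff_Suc_add[of "K r" j] by auto
  show ?thesis unfolding act_def bot_def top_def mult_def mem_Collect_eq d using r L_pos[OF r] by auto
qed

lemma mult_pos: "r \<in> act j \<Longrightarrow> mult r j > 0"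
  using act_iff_mult act_less by blast

lemma mult_zero: "r < s \<Longrightarrow> r \<notin> act j \<Longrightarrow> mult r j = 0"
  using act_iff_mult by blast

lemma mem_D_triangle: "r < s \<Longrightarrow> (a, j) \<in> D r \<Longrightarrow> 1 \<le> a \<and> a \<le> j \<and> j \<le> n"
proof -
  assume "r < s" "(a, j) \<in> D r"
  then have "(a, j) \<in> (\<Union>r<s. diamond_at (L r) (I r) (K r))" unfolding D_def by blast
  then show ?thesis unfolding cover by simp
qed

lemma D_unique:
  assumes "r < s" "q < s" "p \<in> D r" "p \<in> D q"
  shows "r = q"
proof (rule ccontr)
  assume "r \<noteq> q"
  then have "D r \<inter> D q = {}"
    unfolding D_def using disjoint_family_onD[OF disj, of r q] assms(1,2) by simp
  then show False using assms(3,4) by blast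
qed

lemma D_exists: "1 \<le> i \<Longrightarrow> i \<le> j \<Longrightarrow> j \<le> n \<Longrightarrow> \<exists>r<s. (i, j) \<in> D r"
proof -
  assume "1 \<le> i" "i \<le> j" "j \<le> n"
  then have "(i, j) \<in> (\<Union>r<s. diamond_at (L r) (I r) (K r))" unfolding cover by simp
  then show ?thesis unfolding D_def by blast
qed

lemma neighbour_iff:
  assumes "triangle_neighbours n p q"
  shows "T p = T q \<longleftrightarrow> (\<exists>r<s. p \<in> D r \<and> q \<in> D r)"
  using eq_iff[OF assms] by (simp only: D_def)

lemma neighbour_eq:
  assumes "r < s" "p \<in> D r" "q \<in> D r" "triangle_neighbours n p q"
  shows "T p = T q"
  unfolding neighbour_iff[OF assms(4)] using assms(1-3) by blast

lemma neighbour_neq: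
  assumes "r < s" "q < s" "r \<noteq> q" "x \<in> D r" "y \<in> D q" "triangle_neighbours n x y"
  shows "T x \<noteq> T y"
proof
  assume "T x = T y"
  then obtain t where t: "t < s" "x \<in> D t" "y \<in> D t" using neighbour_iff[OF assms(6)] by blast
  have "r = t" by (rule D_unique[OF assms(1) t(1) assms(4) t(2)])
  moreover have "q = t" by (rule D_unique[OF assms(2) t(1) assms(5) t(3)])
  ultimately show False using assms(3) by simp
qed

text \<open>Neighbouring positions of one diamond have equal entries. A path runs along the row to
  its leftmost position in the diamond and then along the left boundary to the widest row.\<close>

lemma T_val:
  assumes r: "r < s" and p: "(a, j) \<in> D r"
  shows "T (a, j) = val r"
proof -
  have row: "T (lo r j + d, j) = T (lo r j, j)" if "d < mult r j" "r \<in> act j" for d j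
    using that(1)
  proof (induction d)
    case (Suc d)
    have m: "(lo r j + d, j) \<in> D r" "(lo r j + Suc d, j) \<in> D r" using Suc.prems that(2) r by (auto simp: mem_D)
    have "triangle_neighbours n (lo r j + d, j) (lo r j + Suc d, j)"
      using mem_D_triangle[OF r m(1)] mem_D_triangle[OF r m(2)] by (auto simp: triangle_neighbours_def)
    then show ?case using neighbour_eq[OF r m] Suc by simp
  qed simp
  have mlo: "(lo r j, j) \<in> D r" if "r \<in> act j" for j using that r mult_pos by (auto simp: mem_D)
  have up: "K r + d \<le> top r \<Longrightarrow> T (lo r (K r + d), K r + d) = val r" for d
  proof (induction d)
    case 0 then show ?case by (simp add: lo_def val_def)
  next
    case (Suc d)
    have a: "r \<in> act (K r + d)" "r \<in> act (K r + Suc d)" using Suc.prems r bot_le_K[OF r] by (auto simp: act_def)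
    have e: "lo r (K r + Suc d) = Suc (lo r (K r + d))" by (simp add: lo_def)
    have "triangle_neighbours n (lo r (K r + d), K r + d) (lo r (K r + Suc d), K r + Suc d)"
      using mem_D_triangle[OF r mlo[OF a(1)]] mem_D_triangle[OF r mlo[OF a(2)]] by (auto simp: triangle_neighbours_def e[simplified])
    then show ?case using neighbour_eq[OF r mlo[OF a(1)] mlo[OF a(2)]] Suc by simp
  qed
  have down: "bot r \<le> K r - d \<Longrightarrow> T (lo r (K r - d), K r - d) = val r" for d
  proof (induction d)
    case 0 then show ?case by (simp add: lo_def val_def)
  next
    case (Suc d)
    show ?case
    proof (cases "K r - d = 0")
      case True
      then show ?thesis using Suc by simp
    next
      case False
      then have S: "K r - d = Suc (K r - Suc d)" by simp
      have a: "r \<in> act (K r - Suc d)" "r \<in> act (K r - d)" using Suc.prems r K_le_top[OF r] by (auto simp: act_def)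
      have e: "lo r (K r - d) = lo r (K r - Suc d)" by (simp add: lo_def)
      have "triangle_neighbours n (lo r (K r - Suc d), K r - Suc d) (lo r (K r - d), K r - d)"
        using mem_D_triangle[OF r mlo[OF a(1)]] mem_D_triangle[OF r mlo[OF a(2)]] by (auto simp: triangle_neighbours_def S e[unfolded S])
      then show ?thesis using neighbour_eq[OF r mlo[OF a(1)] mlo[OF a(2)]] Suc by simp
    qed
  qed
  have a: "r \<in> act j" "lo r j \<le> a" "a < lo r j + mult r j" using p r by (auto simp: mem_D)
  have "T (lo r j, j) = val r"
  proof (cases "K r \<le> j")
    case True
    then show ?thesis using up[of "j - K r"] a by (auto simp: act_def)
  next
    case False
    then show ?thesis using down[of "K r - j"] a by (auto simp: act_def)
  qed
  then show ?thesis using row[of "a - lo r j" j] a by simp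
qed

lemma T_antimono:
  assumes "1 \<le> i" "i \<le> i'" "i' \<le> j" "j \<le> n"
  shows "T (i', j) \<le> T (i, j)"
  using assms(2,3)
proof (induction i' rule: dec_induct)
  case (step k)
  then show ?case using sorted[of k j] assms(1,4) by auto
qed simp

text \<open>The diamonds cut a row into consecutive intervals. At the right end of an interval the
  next position belongs to another diamond, so the weak inequality between these two entries is
  strict.\<close>

lemma val_less:
  assumes r: "r \<in> act j" and q: "q \<in> act j" and lt: "lo r j < lo q j" and j: "j \<le> n"
  shows "lo r j + mult r j \<le> lo q j" "val q < val r"
proof -
  have rs: "r < s" "q < s" using r q act_less by auto
  have mq: "(lo q j, j) \<in> D q" using q rs mult_pos[OF q] by (simp add: mem_D)
  have ne: "r \<noteq> q" using lt by auto
  show le: "lo r j + mult r j \<le> lo q j"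
  proof (rule ccontr)
    assume "\<not> lo r j + mult r j \<le> lo q j"
    then have "(lo q j, j) \<in> D r" using r rs lt by (simp add: mem_D)
    then show False using mq rs ne D_unique by blast
  qed
  define e where "e = lo r j + mult r j - 1"
  have e: "Suc e = lo r j + mult r j" using mult_pos[OF r] by (simp add: e_def)
  have me: "(e, j) \<in> D r" using r rs mult_pos[OF r] by (auto simp: mem_D e_def)
  note te = mem_D_triangle[OF rs(1) me] and tq = mem_D_triangle[OF rs(2) mq]
  have Se: "Suc e \<le> j" using le e tq by linarith
  obtain r' where r': "r' < s" "(Suc e, j) \<in> D r'" using D_exists[of "Suc e" j] Se j by auto
  have "(Suc e, j) \<notin> D r" using rs e by (simp add: mem_D)
  then have "r' \<noteq> r" using r' by auto
  moreover have "triangle_neighbours n (e, j) (Suc e, j)" using te Se by (auto simp: triangle_neighbours_def)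
  ultimately have "T (e, j) \<noteq> T (Suc e, j)" using neighbour_neq[OF rs(1) r'(1) _ me r'(2)] by auto
  moreover have "T (Suc e, j) \<le> T (e, j)" using sorted[of e j] te Se by auto
  moreover have "T (lo q j, j) \<le> T (Suc e, j)" using T_antimono[of "Suc e" "lo q j" j] le e tq by auto
  ultimately show "val q < val r" using T_val[OF rs(1) me] T_val[OF rs(2) mq] by simp
qed

lemma lo_inj: "r \<in> act j \<Longrightarrow> q \<in> act j \<Longrightarrow> lo r j = lo q j \<Longrightarrow> r = q"
  using D_unique[of r q "(lo r j, j)"] act_less mult_pos by (simp add: mem_D)

lemma val_inj: "j \<le> n \<Longrightarrow> inj_on val (act j)"
proof (rule inj_onI)
  fix r q assume "j \<le> n" "r \<in> act j" "q \<in> act j" "val r = val q"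
  then show "r = q"
    using val_less[of r j q] val_less[of q j r] lo_inj[of r j q] by (cases "lo r j" "lo q j" rule: linorder_cases) auto
qed

lemma val_eq_iff: "j \<le> n \<Longrightarrow> r \<in> act j \<Longrightarrow> q \<in> act j \<Longrightarrow> val r = val q \<longleftrightarrow> r = q"
  using val_inj[of j] by (auto simp: inj_on_def)

lemma row_eq:
  assumes r: "r \<in> act j" and j: "j \<le> n"
  shows "{i \<in> {1..j}. T (i, j) = val r} = {lo r j..<lo r j + mult r j}"
    and "{i \<in> {1..j}. val r < T (i, j)} = {1..<lo r j}"
proof -
  have rs: "r < s" using r act_less by auto
  have cl: "T (i, j) = val r \<longleftrightarrow> lo r j \<le> i \<and> i < lo r j + mult r j"
    "val r < T (i, j) \<longleftrightarrow> i < lo r j" if i: "1 \<le> i" "i \<le> j" for i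
  proof -
    obtain q where q: "q < s" "(i, j) \<in> D q" using D_exists i j by blast
    then have qa: "q \<in> act j" "lo q j \<le> i" "i < lo q j + mult q j" by (auto simp: mem_D)
    have Tq: "T (i, j) = val q" using T_val q by auto
    consider "q = r" | "q \<noteq> r" "lo q j < lo r j" | "q \<noteq> r" "lo r j < lo q j"
      using lo_inj[OF qa(1) r] by (cases "lo r j" "lo q j" rule: linorder_cases) auto
    then have "(T (i, j) = val r \<longleftrightarrow> lo r j \<le> i \<and> i < lo r j + mult r j) \<and> (val r < T (i, j) \<longleftrightarrow> i < lo r j)"
    proof cases
      case 1 then show ?thesis using Tq qa by auto
    next
      case 2 then show ?thesis using val_less[OF qa(1) r 2(2) j] Tq qa by auto
    next
      case 3 then show ?thesis using val_less[OF r qa(1) 3(2) j] Tq qa by auto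
    qed
    then show "T (i, j) = val r \<longleftrightarrow> lo r j \<le> i \<and> i < lo r j + mult r j"
      "val r < T (i, j) \<longleftrightarrow> i < lo r j" by auto
  qed
  have mem: "1 \<le> i \<and> i \<le> j" if "lo r j \<le> i" "i < lo r j + mult r j" for i
    using mem_D_triangle[OF rs, of i j] that r rs by (auto simp: mem_D)
  have "1 \<le> lo r j" "lo r j \<le> j" using mem[of "lo r j"] mult_pos[OF r] by auto
  then show "{i \<in> {1..j}. T (i, j) = val r} = {lo r j..<lo r j + mult r j}"
    "{i \<in> {1..j}. val r < T (i, j)} = {1..<lo r j}"
    using cl mem by auto
qed

lemma row_cover:
  assumes "i \<in> {1..j}" "j \<le> n"
  shows "\<exists>r\<in>act j. T (i, j) = val r"
proof -
  obtain r where "r < s" "(i, j) \<in> D r" using D_exists[of i j] assms by auto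
  then show ?thesis using T_val by (auto simp: mem_D)
qed

definition pol :: "nat \<Rightarrow> complex poly" where
  "pol j = (\<Prod>i\<in>{1..j}. [:- complex_of_real (T (i, j)), 1:])"

lemma sum_mult:
  assumes "j \<le> n" shows "(\<Sum>r\<in>act j. mult r j) = j"
proof -
  have "(\<Sum>r\<in>act j. mult r j) = (\<Sum>r\<in>act j. card {i \<in> {1..j}. T (i, j) = val r})"
    by (rule sum.cong[OF refl]) (subst row_eq(1)[OF _ assms], assumption, simp)
  also have "\<dots> = card (\<Union>r\<in>act j. {i \<in> {1..j}. T (i, j) = val r})"
    by (rule card_UN_disjoint[symmetric]) (use val_eq_iff[OF assms] in auto)
  also have "(\<Union>r\<in>act j. {i \<in> {1..j}. T (i, j) = val r}) = {1..j}"
    using row_cover assms by fastforce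
  finally show ?thesis by simp
qed

lemma sum_mult': "j \<le> n \<Longrightarrow> (\<Sum>r<s. mult r j) = j"
  by (subst sum_mult[symmetric], assumption, rule sum.mono_neutral_right)
     (auto simp: act_less mult_zero)

text \<open>\<open>grow j\<close> collects the diamonds whose width increased on reaching row
  \<open>j\<close>, and \<open>shrink j\<close> those whose width decreases on leaving it. The
  widest row of a diamond counts for both.\<close>

definition grow where "grow j = {r. r < s \<and> bot r \<le> j \<and> j \<le> K r}"
definition shrink where "shrink j = {r. r < s \<and> K r \<le> j \<and> j \<le> top r}"

lemma finite_grow [simp]: "finite (grow j)" "finite (shrink j)"
  by (auto simp: grow_def shrink_def)

lemma grow_act: "grow j \<subseteq> act j" "shrink j \<subseteq> act j"
  using K_le_top bot_le_K by (auto simp: grow_def shrink_def act_def intro: le_trans)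

lemma mult_Suc:
  assumes r: "r < s"
  shows "mult r (Suc j) + (if r \<in> shrink j then 1 else 0) = mult r j + (if r \<in> grow (Suc j) then 1 else 0)"
proof (cases "Suc j \<le> K r")
  case True
  then obtain d where d: "K r = Suc j + d" by (auto simp: le_iff_add)
  show ?thesis
    unfolding mult_def grow_def shrink_def bot_def top_def mem_Collect_eq d using r L_pos[OF r] by auto
next
  case False
  then obtain d where d: "j = K r + d" using le_iff_add[of "K r" j] by auto
  show ?thesis
    unfolding mult_def grow_def shrink_def bot_def top_def mem_Collect_eq d using r L_pos[OF r] by auto
qed

text \<open>The widths in a row add up to its length, which increases by 1. This surplus is what
  makes the linear system in \<open>cauchy_system\<close> square: the new corner is the additional
  unknown.\<close>

lemma card_grow:
  assumes "Suc j \<le> n"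
  shows "card (grow (Suc j)) = card (shrink j) + 1"
proof -
  have "(\<Sum>r<s. mult r (Suc j) + (if r \<in> shrink j then 1 else 0)) =
      (\<Sum>r<s. mult r j + (if r \<in> grow (Suc j) then 1 else 0))"
    by (rule sum.cong) (auto simp only: mult_Suc lessThan_iff)
  moreover have "(\<Sum>r<s. if r \<in> X then 1 else 0) = card X" if "X \<subseteq> {..<s}" for X :: "nat set"
    using that by (simp add: sum.If_cases Int_absorb1)
  moreover have "shrink j \<subseteq> {..<s}" "grow (Suc j) \<subseteq> {..<s}" by (auto simp: shrink_def grow_def)
  ultimately show ?thesis using sum_mult'[of j] sum_mult'[OF assms] assms by (simp add: sum.distrib)
qed

text \<open>A diamond fits into the triangle, so it can meet row \<open>n\<close> only in its
  topmost position.\<close>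

lemma card_act_n: "card (act n) = n"
proof -
  have "mult r n = 1" if "r \<in> act n" for r
    using that K_L[of r] L_pos[of r] by (auto simp: act_def top_def mult_def)
  then have "(\<Sum>r\<in>act n. mult r n) = (\<Sum>r\<in>act n. 1)" by (intro sum.cong) auto
  then show ?thesis using sum_mult[of n] by simp
qed

lemma sum_mult_rows:
  assumes "r < s" shows "(\<Sum>j\<in>{1..n}. mult r j) = (L r)\<^sup>2"
proof -
  define k where "k = K r"
  have "l \<le> k \<Longrightarrow> k + l \<le> n + 1 \<Longrightarrow> (\<Sum>j\<in>{1..n}. l - (j - k) - (k - j)) = l\<^sup>2" for l
  proof (induction l)
    case (Suc l)
    \<comment> \<open>Enlarging the diamond by one adds one position in each of the
      \<open>2 * l + 1\<close> rows that the larger one meets.\<close>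
    have "(\<Sum>j\<in>{1..n}. Suc l - (j - k) - (k - j)) =
        (\<Sum>j\<in>{1..n}. (l - (j - k) - (k - j)) + (if j \<in> {k - l..k + l} then 1 else 0))"
      by (rule sum.cong) auto
    also have "\<dots> = l\<^sup>2 + (\<Sum>j\<in>{1..n}. if j \<in> {k - l..k + l} then 1 else 0)"
      unfolding sum.distrib using Suc by (simp del: One_nat_def)
    also have "(\<Sum>j\<in>{1..n}. if j \<in> {k - l..k + l} then 1 else 0) = card ({1..n} \<inter> {k - l..k + l})"
      by (subst sum.If_cases) (auto simp: Int_def)
    also have "{1..n} \<inter> {k - l..k + l} = {k - l..k + l}" using Suc.prems by auto
    also have "card {k - l..k + l} = 2 * l + 1" using Suc.prems by simp
    finally show ?case by (simp add: power2_eq_square)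
  qed simp
  then show ?thesis using I_pos[OF assms] I_L[OF assms] K_L[OF assms] by (simp add: mult_def k_def)
qed

text \<open>Counts the positions of the triangle in two ways, by diamonds and by rows.\<close>

lemma sum_squares: "2 * (\<Sum>r<s. (L r)\<^sup>2) = n * (n + 1)"
proof -
  have "(\<Sum>r<s. (L r)\<^sup>2) = (\<Sum>r<s. \<Sum>j\<in>{1..n}. mult r j)" by (rule sum.cong[OF refl]) (simp only: sum_mult_rows lessThan_iff)
  also have "\<dots> = (\<Sum>j\<in>{1..n}. \<Sum>r<s. mult r j)" by (rule sum.swap)
  also have "\<dots> = (\<Sum>j\<in>{1..n}. j)"
    by (rule sum.cong[OF refl]) (simp only: sum_mult' atLeastAtMost_iff)
  finally have "(\<Sum>r<s. (L r)\<^sup>2) = (\<Sum>j\<in>{1..n}. j)" .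
  moreover have "2 * (\<Sum>j\<in>{1..m}. j) = m * (m + 1)" for m :: nat by (induction m) auto
  ultimately show ?thesis by simp
qed

lemma card_top_less: "card {r. r < s \<and> top r < n} + n = s"
proof -
  have "act n = {r. r < s \<and> top r = n}" using top_le bot_le_K K_le_top by (fastforce simp: act_def)
  then have "{..<s} = {r. r < s \<and> top r < n} \<union> act n" using top_le by fastforce
  moreover have "{r. r < s \<and> top r < n} \<inter> act n = {}" by (auto simp: act_def)
  ultimately have "card {..<s} = card {r. r < s \<and> top r < n} + card (act n)"
    by (metis card_Un_disjoint finite_Un finite_lessThan)
  then show ?thesis using card_act_n by simp
qed

end

section \<open>Partial fractions and interlacing\<close>

text \<open>Used to cancel powers of \<open>z - v\<close> and then to evaluate at \<open>v\<close>
  itself.\<close>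

lemma isCont_eq_at:
  fixes f g :: "real \<Rightarrow> real"
  assumes "isCont f x" "isCont g x" "finite F" "\<And>z. z \<notin> F \<Longrightarrow> z \<noteq> x \<Longrightarrow> f z = g z"
  shows "f x = g x"
proof -
  have "open (- (F - {x}))" using assms(3) by (intro open_Compl finite_imp_closed) auto
  moreover have "x \<in> - (F - {x})" by simp
  ultimately have "\<forall>\<^sub>F z in at x. z \<in> - (F - {x})" by (rule eventually_at_in_open')
  moreover have "\<forall>\<^sub>F z in at x. z \<noteq> x" by (simp add: eventually_at_filter)
  ultimately have ev: "\<forall>\<^sub>F z in at x. f z = g z"
    by eventually_elim (use assms(4) in auto)
  have "(f \<longlongrightarrow> g x) (at x)"
    using tendsto_cong[OF ev] assms(2) by (simp add: isCont_def)
  moreover have "(f \<longlongrightarrow> f x) (at x)" using assms(1) by (simp add: isCont_def)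
  ultimately show ?thesis by (intro tendsto_unique[of "at x"]) auto
qed

text \<open>The function \<open>z - c - (\<Sum>v. a v / (z - v))\<close> with \<open>a \<ge> 0\<close> is increasing between its poles. Its zeros
  and poles are governed by the multiplicities of the \<open>y i\<close> and \<open>x i\<close>, and its sign by their number
  to the right.\<close>

context
  fixes X Y :: "nat set" and x y :: "nat \<Rightarrow> real" and c :: real and a :: "real \<Rightarrow> real"
  assumes fin: "finite X" "finite Y"
    and nonneg: "\<And>v. v \<in> x ` X \<Longrightarrow> a v \<ge> 0"
    and ident: "\<And>z. z \<notin> x ` X \<Longrightarrow>
      (\<Prod>i\<in>Y. z - y i) = (\<Prod>i\<in>X. z - x i) * (z - c - (\<Sum>v\<in>x ` X. a v / (z - v)))"
begin

text \<open>\<open>m\<close> and \<open>m'\<close> are the multiplicities at \<open>v\<close>,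
  \<open>N\<close> and \<open>N'\<close> the numbers of roots beyond \<open>v\<close>, and
  \<open>h\<close> and \<open>h'\<close> the products of the factors that do not vanish at
  \<open>v\<close>. \<open>S\<close> is the rational factor without its pole at \<open>v\<close>,
  \<open>b\<close> the weight of that pole, and \<open>R\<close> the difference quotient of
  \<open>S\<close> between \<open>z\<close> and \<open>v\<close>.\<close>

private definition "m v = card {i \<in> X. x i = v}"
private definition "m' v = card {i \<in> Y. y i = v}"
private definition "N v = card {i \<in> X. v < x i}"
private definition "N' v = card {i \<in> Y. v < y i}"
private definition "h v z = (\<Prod>i\<in>{i \<in> X. x i \<noteq> v}. z - x i)"
private definition "h' v z = (\<Prod>i\<in>{i \<in> Y. y i \<noteq> v}. z - y i)"
private definition "S v z = z - c - (\<Sum>w\<in>x ` X - {v}. a w / (z - w))"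
private definition "R v z = 1 + (\<Sum>w\<in>x ` X - {v}. a w / ((z - w) * (v - w)))"
private definition "b v = (if v \<in> x ` X then a v else 0)"

private lemma split_prod:
  fixes u :: "nat \<Rightarrow> real"
  assumes "finite Z"
  shows "(\<Prod>i\<in>Z. z - u i) = (z - v) ^ card {i \<in> Z. u i = v} * (\<Prod>i\<in>{i \<in> Z. u i \<noteq> v}. z - u i)"
proof -
  have "Z = {i \<in> Z. u i = v} \<union> {i \<in> Z. u i \<noteq> v}" by auto
  then have "(\<Prod>i\<in>Z. z - u i) = (\<Prod>i\<in>{i \<in> Z. u i = v}. z - u i) * (\<Prod>i\<in>{i \<in> Z. u i \<noteq> v}. z - u i)"
    using assms by (subst prod.union_disjoint[symmetric]) auto
  also have "(\<Prod>i\<in>{i \<in> Z. u i = v}. z - u i) = (\<Prod>i\<in>{i \<in> Z. u i = v}. z - v)"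
    by (rule prod.cong) auto
  finally show ?thesis by simp
qed

private lemma sign_prod:
  fixes u :: "nat \<Rightarrow> real"
  assumes "finite Z"
  shows "(\<Prod>i\<in>{i \<in> Z. u i \<noteq> v}. v - u i) * (-1) ^ card {i \<in> Z. v < u i} > 0"
proof -
  have "{i \<in> Z. u i \<noteq> v} = {i \<in> Z. v < u i} \<union> {i \<in> Z. u i < v}" by auto
  then have "(\<Prod>i\<in>{i \<in> Z. u i \<noteq> v}. v - u i) = (\<Prod>i\<in>{i \<in> Z. v < u i}. v - u i) * (\<Prod>i\<in>{i \<in> Z. u i < v}. v - u i)"
    using assms by (subst prod.union_disjoint[symmetric]) auto
  also have "(\<Prod>i\<in>{i \<in> Z. v < u i}. v - u i) = (\<Prod>i\<in>{i \<in> Z. v < u i}. (-1) * (u i - v))"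
    by (rule prod.cong) auto
  also have "\<dots> = (-1) ^ card {i \<in> Z. v < u i} * (\<Prod>i\<in>{i \<in> Z. v < u i}. u i - v)"
    by (simp only: prod.distrib prod_constant)
  finally have "(\<Prod>i\<in>{i \<in> Z. u i \<noteq> v}. v - u i) * (-1) ^ card {i \<in> Z. v < u i} =
      ((-1) ^ card {i \<in> Z. v < u i} * (-1) ^ card {i \<in> Z. v < u i}) *
      ((\<Prod>i\<in>{i \<in> Z. v < u i}. u i - v) * (\<Prod>i\<in>{i \<in> Z. u i < v}. v - u i))" by (simp only: mult_ac)
  also have "\<dots> = (\<Prod>i\<in>{i \<in> Z. v < u i}. u i - v) * (\<Prod>i\<in>{i \<in> Z. u i < v}. v - u i)"
    by (simp add: power_mult_distrib[symmetric])
  also have "\<dots> > 0" by (intro mult_pos_pos prod_pos) auto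
  finally show ?thesis .
qed

private lemma cont: "isCont (h v) v" "isCont (h' v) v" "isCont (S v) v" "isCont (R v) v"
  unfolding h_def h'_def S_def R_def by (auto intro!: continuous_intros)

private lemma h_sign: "h v v * (-1) ^ N v > 0" "h' v v * (-1) ^ N' v > 0"
  unfolding h_def h'_def N_def N'_def using sign_prod fin by auto

private lemma h_nz: "h v v \<noteq> 0" "h' v v \<noteq> 0"
  using h_sign[of v] by auto

text \<open>The given identity with the powers of \<open>z - v\<close> split off; the additional
  factor \<open>z - v\<close> clears the possible pole.\<close>

private lemma id1:
  assumes "z \<notin> x ` X" "z \<noteq> v"
  shows "(z - v) ^ Suc (m' v) * h' v z = (z - v) ^ m v * h v z * ((z - v) * S v z - b v)"
proof -
  have "z - c - (\<Sum>w\<in>x ` X. a w / (z - w)) = S v z - b v / (z - v)"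
    using fin by (auto simp: S_def b_def sum.remove[of "x ` X" v])
  then have "(z - v) ^ m' v * h' v z = (z - v) ^ m v * h v z * (S v z - b v / (z - v))"
    using ident[OF assms(1)] fin
    unfolding split_prod[OF fin(1), of z x v] split_prod[OF fin(2), of z y v] by (simp add: m_def m'_def h_def h'_def)
  then have "(z - v) * ((z - v) ^ m' v * h' v z) = (z - v) ^ m v * h v z * ((z - v) * (S v z - b v / (z - v)))"
    by simp
  also have "(z - v) * (S v z - b v / (z - v)) = (z - v) * S v z - b v"
    using assms(2) by (simp add: right_diff_distrib)
  finally show ?thesis by simp
qed

private lemma b_nonneg: "b v \<ge> 0" using nonneg by (auto simp: b_def)

text \<open>The left side of \<open>id1\<close> vanishes at \<open>v\<close> to order exactly
  \<open>m' v + 1\<close>, the right side to order at least \<open>m v\<close>. If these numbers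
  agree, cancelling the powers leaves the residue.\<close>

private lemma pole:
  "m v \<le> m' v + 1" "m v = m' v + 1 \<Longrightarrow> h' v v = - h v v * b v"
proof -
  show le: "m v \<le> m' v + 1"
  proof (rule ccontr)
    assume n: "\<not> m v \<le> m' v + 1"
    define k where "k = m v - m' v - 1"
    have k: "m v = Suc (m' v) + k" "k > 0" using n by (auto simp: k_def)
    have "h' v v = (\<lambda>z. (z - v) ^ k * h v z * ((z - v) * S v z - b v)) v"
    proof (rule isCont_eq_at[where x=v and F="x ` X" and f="h' v" and g="\<lambda>z. (z - v) ^ k * h v z * ((z - v) * S v z - b v)"])
      fix z assume z: "z \<notin> x ` X" "z \<noteq> v"
      have "(z - v) ^ Suc (m' v) * h' v z = (z - v) ^ Suc (m' v) * ((z - v) ^ k * h v z * ((z - v) * S v z - b v))"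
        unfolding id1[OF z] k(1) power_add by (simp only: mult_ac)
      then show "h' v z = (z - v) ^ k * h v z * ((z - v) * S v z - b v)" using z by simp
    qed (use fin in \<open>auto intro!: cont continuous_intros\<close>)
    then show False using h_nz(2)[of v] k by simp
  qed
  assume e: "m v = m' v + 1"
  have "h' v v = (\<lambda>z. h v z * ((z - v) * S v z - b v)) v"
  proof (rule isCont_eq_at[where x=v and F="x ` X" and f="h' v" and g="\<lambda>z. h v z * ((z - v) * S v z - b v)"])
    fix z assume z: "z \<notin> x ` X" "z \<noteq> v"
    have "(z - v) ^ Suc (m' v) * h' v z = (z - v) ^ Suc (m' v) * (h v z * ((z - v) * S v z - b v))"
      unfolding id1[OF z] e by simp
    then show "h' v z = h v z * ((z - v) * S v z - b v)" using z by simp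
  qed (use fin in \<open>auto intro!: cont continuous_intros\<close>)
  then show "h' v v = - h v v * b v" by simp
qed

private lemma no_pole:
  assumes "m v \<le> m' v"
  shows "b v = 0"
proof -
  define k where "k = m' v - m v"
  have k: "m' v = m v + k" using assms by (auto simp: k_def)
  have "(\<lambda>z. (z - v) ^ Suc k * h' v z) v = (\<lambda>z. h v z * ((z - v) * S v z - b v)) v"
  proof (rule isCont_eq_at[where x=v and F="x ` X" and f="(\<lambda>z. (z - v) ^ Suc k * h' v z)" and g="(\<lambda>z. h v z * ((z - v) * S v z - b v))"])
    fix z assume z: "z \<notin> x ` X" "z \<noteq> v"
    have "(z - v) ^ m v * ((z - v) ^ Suc k * h' v z) = (z - v) ^ m v * (h v z * ((z - v) * S v z - b v))"
      using id1[OF z] unfolding k by (simp add: power_add mult_ac)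
    then show "(z - v) ^ Suc k * h' v z = h v z * ((z - v) * S v z - b v)" using z by simp
  qed (use fin in \<open>auto intro!: cont continuous_intros\<close>)
  then show ?thesis using h_nz by simp
qed

text \<open>If the multiplicity rises at \<open>v\<close>, there is no pole there and
  \<open>S\<close> must vanish. As \<open>R v v\<close>, the derivative of \<open>S\<close> at
  \<open>v\<close>, is at least 1, this zero is simple, so the multiplicity rises by exactly
  1.\<close>

private lemma zero:
  assumes "m v < m' v"
  shows "S v v = 0" "m' v = m v + 1" "h' v v = h v v * R v v"
proof -
  define k where "k = m' v - m v - 1"
  have k: "m' v = m v + Suc k" using assms by (auto simp: k_def)
  have b0: "b v = 0" using no_pole assms by simp
  have id2: "(z - v) * ((z - v) ^ k * h' v z) = h v z * S v z" if z: "z \<notin> x ` X" "z \<noteq> v" for z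
  proof -
    have "(z - v) ^ Suc (m v) * ((z - v) * ((z - v) ^ k * h' v z)) = (z - v) ^ Suc (m v) * (h v z * S v z)"
      using id1[OF z] unfolding k b0 by (simp add: power_add mult_ac)
    then show ?thesis using z by simp
  qed
  have "(\<lambda>z. (z - v) * ((z - v) ^ k * h' v z)) v = (\<lambda>z. h v z * S v z) v"
    by (rule isCont_eq_at[where x=v and F="x ` X" and f="(\<lambda>z. (z - v) * ((z - v) ^ k * h' v z))" and g="(\<lambda>z. h v z * S v z)"]) (use fin id2 in \<open>auto intro!: cont continuous_intros\<close>)
  then show S0: "S v v = 0" using h_nz by simp
  have SR: "S v z = (z - v) * R v z" if z: "z \<notin> x ` X" for z
  proof -
    have "S v z = S v z - S v v" using S0 by simp
    also have "\<dots> = (z - v) - (\<Sum>w\<in>x ` X - {v}. a w / (z - w) - a w / (v - w))"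
      unfolding S_def by (simp add: sum_subtractf)
    also have "(\<Sum>w\<in>x ` X - {v}. a w / (z - w) - a w / (v - w)) = (\<Sum>w\<in>x ` X - {v}. (v - z) * (a w / ((z - w) * (v - w))))"
    proof (rule sum.cong[OF refl])
      fix w assume "w \<in> x ` X - {v}"
      then have "z \<noteq> w" "v \<noteq> w" using z by auto
      then show "a w / (z - w) - a w / (v - w) = (v - z) * (a w / ((z - w) * (v - w)))"
        by (simp add: divide_simps) (simp add: algebra_simps)
    qed
    also have "(z - v) - \<dots> = (z - v) * R v z"
      unfolding R_def sum_distrib_left[symmetric] by (simp add: algebra_simps)
    finally show ?thesis .
  qed
  have "(\<lambda>z. (z - v) ^ k * h' v z) v = (\<lambda>z. h v z * R v z) v"
  proof (rule isCont_eq_at[where x=v and F="x ` X" and f="(\<lambda>z. (z - v) ^ k * h' v z)" and g="(\<lambda>z. h v z * R v z)"])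
    fix z assume z: "z \<notin> x ` X" "z \<noteq> v"
    have "(z - v) * ((z - v) ^ k * h' v z) = (z - v) * (h v z * R v z)"
      using id2[OF z] SR[OF z(1)] by simp
    then show "(z - v) ^ k * h' v z = h v z * R v z" using z by simp
  qed (use fin in \<open>auto intro!: cont continuous_intros\<close>)
  moreover have "R v v > 0"
  proof -
    have "(\<Sum>w\<in>x ` X - {v}. a w / ((v - w) * (v - w))) \<ge> 0"
      using nonneg by (intro sum_nonneg divide_nonneg_nonneg) auto
    then show ?thesis unfolding R_def by simp
  qed
  ultimately have hR: "0 ^ k * h' v v = h v v * R v v" "h v v * R v v \<noteq> 0" using h_nz by auto
  then have "k = 0" by (cases k) auto
  then show "m' v = m v + 1" "h' v v = h v v * R v v" using k hR by auto
qed

text \<open>The signs of \<open>h v v\<close> and \<open>h' v v\<close> are given by the parities of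
  \<open>N v\<close> and \<open>N' v\<close>. By the previous two lemmas these signs are opposite at
  a pole, because the weight is nonnegative, and equal at a zero.\<close>

private lemma parity:
  "m v = m' v + 1 \<Longrightarrow> odd (N v + N' v)" "m v < m' v \<Longrightarrow> even (N v + N' v)"
proof -
  have pos: "(h v v * h' v v) * (-1) ^ (N v + N' v) > 0"
    using mult_pos_pos[OF h_sign[of v]] by (simp add: power_add mult_ac)
  {
    assume "m v = m' v + 1"
    then have "h v v * h' v v = - (h v v)\<^sup>2 * b v" using pole(2) by (simp add: power2_eq_square)
    also have "\<dots> \<le> 0" using b_nonneg by simp
    finally show "odd (N v + N' v)" using pos by (cases "even (N v + N' v)") auto
  next
    assume lt: "m v < m' v"
    have "R v v > 0"
    proof -
      have "(\<Sum>w\<in>x ` X - {v}. a w / ((v - w) * (v - w))) \<ge> 0"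
        using nonneg by (intro sum_nonneg divide_nonneg_nonneg) auto
      then show ?thesis unfolding R_def by simp
    qed
    then have "h v v * h' v v \<ge> 0" using zero(3)[OF lt] by (simp add: mult.assoc[symmetric])
    then show "even (N v + N' v)" using pos by (cases "even (N v + N' v)") auto
  }
qed

text \<open>Let \<open>v\<close> move from right to left. The difference of the two counts starts at
  0; by parity it is 1 just before a pole, which lowers it to 0, and 0 just before a zero, which
  raises it to 1.\<close>

lemma interlacing:
  "card {i \<in> X. v < x i} \<le> card {i \<in> Y. v < y i}"
  "card {i \<in> Y. v < y i} \<le> card {i \<in> X. v < x i} + 1"
proof -
  have "N v \<le> N' v \<and> N' v \<le> N v + 1"
  proof (induction "card {w \<in> x ` X \<union> y ` Y. v < w}" arbitrary: v rule: less_induct)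
    case less
    let ?W = "{w \<in> x ` X \<union> y ` Y. v < w}"
    have finW: "finite ?W" using fin by simp
    show ?case
    proof (cases "?W = {}")
      case True
      then have e: "{i \<in> X. v < x i} = {}" "{i \<in> Y. v < y i} = {}" by blast+
      show ?thesis unfolding N_def N'_def e by simp
    next
      case False
      \<comment> \<open>The first root to the right of \<open>v\<close>: the counts at
        \<open>v\<close> are those at \<open>w\<close> plus the multiplicities of
        \<open>w\<close>.\<close>
      define w where "w = Min ?W"
      have w: "w \<in> ?W" "\<And>u. u \<in> ?W \<Longrightarrow> w \<le> u" using Min_in[OF finW False] Min_le[OF finW] unfolding w_def by blast+
      have "{w' \<in> x ` X \<union> y ` Y. w < w'} \<subset> ?W" using w by auto
      then have IH: "N w \<le> N' w \<and> N' w \<le> N w + 1"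
        by (intro less psubset_card_mono finW)
      have le: "w \<le> x i" if "i \<in> X" "v < x i" for i by (rule w(2)) (use that in auto)
      have vw: "v < w" using w(1) by simp
      have "{i \<in> X. v < x i} = {i \<in> X. w < x i} \<union> {i \<in> X. x i = w}"
        using le vw by force
      moreover have "{i \<in> X. w < x i} \<inter> {i \<in> X. x i = w} = {}" by auto
      ultimately have Nv: "N v = N w + m w" using fin by (simp add: N_def m_def card_Un_disjoint)
      have le: "w \<le> y i" if "i \<in> Y" "v < y i" for i by (rule w(2)) (use that in auto)
      have vw: "v < w" using w(1) by simp
      have "{i \<in> Y. v < y i} = {i \<in> Y. w < y i} \<union> {i \<in> Y. y i = w}"
        using le vw by force
      moreover have "{i \<in> Y. w < y i} \<inter> {i \<in> Y. y i = w} = {}" by auto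
      ultimately have Nv': "N' v = N' w + m' w" using fin by (simp add: N'_def m'_def card_Un_disjoint)
      consider "m w = m' w" | "m w = m' w + 1" | "m w < m' w" using pole(1)[of w] by linarith
      then show ?thesis
      proof cases
        case 1 then show ?thesis using IH Nv Nv' by simp
      next
        case 2
        then have "odd (N w + N' w)" by (rule parity)
        then have "N' w = N w + 1" using IH by (metis add.commute antisym_conv2 even_add le_Suc_eq Suc_eq_plus1 le_antisym)
        then show ?thesis using 2 Nv Nv' by simp
      next
        case 3
        then have "even (N w + N' w)" by (rule parity)
        moreover have "N' w = N w \<or> N' w = N w + 1" using IH by linarith
        ultimately have "N' w = N w" by auto
        then show ?thesis using zero(2)[OF 3] Nv Nv' by simp
      qed
    qed
  qed
  then show "card {i \<in> X. v < x i} \<le> card {i \<in> Y. v < y i}"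
    "card {i \<in> Y. v < y i} \<le> card {i \<in> X. v < x i} + 1" by (auto simp: N_def N'_def)
qed

lemma pole_weight_zero:
  "v \<in> x ` X \<Longrightarrow> card {i \<in> X. x i = v} \<le> card {i \<in> Y. y i = v} \<Longrightarrow> a v = 0"
  using no_pole[of v] by (simp add: m_def m'_def b_def)

lemma pole_weight_pos:
  "card {i \<in> X. x i = v} = card {i \<in> Y. y i = v} + 1 \<Longrightarrow> a v > 0"
proof -
  assume e: "card {i \<in> X. x i = v} = card {i \<in> Y. y i = v} + 1"
  then have "h' v v = - h v v * b v" using pole(2)[of v] by (simp add: m_def m'_def)
  then have "b v \<noteq> 0" using h_nz by auto
  then show "a v > 0" using b_nonneg[of v] by (auto simp: b_def split: if_splits)
qed

lemma zero_of_partial_fraction: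
  "card {i \<in> X. x i = v} < card {i \<in> Y. y i = v} \<Longrightarrow> v - c - (\<Sum>w\<in>x ` X - {v}. a w / (v - w)) = 0"
  using zero(1)[of v] by (simp add: m_def m'_def S_def)

end

text \<open>Multiplying by \<open>z - v\<close> and letting \<open>z\<close> tend to
  \<open>v\<close> isolates the weight at \<open>v\<close>; the constants are then compared at any
  point that is not a pole.\<close>

lemma partial_fraction_unique:
  fixes c c' :: real and V :: "real set"
  assumes "finite V"
    "\<And>z. z \<notin> V \<Longrightarrow> c + (\<Sum>v\<in>V. a v / (z - v)) = c' + (\<Sum>v\<in>V. a' v / (z - v))"
  shows "c = c' \<and> (\<forall>v\<in>V. a v = a' v)"
proof -
  have a: "a v = a' v" if v: "v \<in> V" for v
  proof -
    define S where "S = (\<lambda>z. (c - c') + (\<Sum>w\<in>V - {v}. (a w - a' w) / (z - w)))"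
    have S: "isCont S v" unfolding S_def by (auto intro!: continuous_intros)
    have "(\<lambda>z. (z - v) * S z) v = (\<lambda>z. a' v - a v) v"
    proof (rule isCont_eq_at[where x=v and F="V" and f="(\<lambda>z. (z - v) * S z)" and g="(\<lambda>z. a' v - a v)"])
      fix z assume z: "z \<notin> V" "z \<noteq> v"
      have "c + (a v / (z - v) + (\<Sum>w\<in>V - {v}. a w / (z - w))) = c' + (a' v / (z - v) + (\<Sum>w\<in>V - {v}. a' w / (z - w)))"
        using assms(2)[OF z(1)] sum.remove[OF assms(1) v, of "\<lambda>v. a v / (z - v)"]
          sum.remove[OF assms(1) v, of "\<lambda>v. a' v / (z - v)"] by simp
      then have "S z = (a' v - a v) / (z - v)"
        unfolding S_def diff_divide_distrib sum_subtractf by simp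
      then show "(z - v) * S z = a' v - a v" using z by simp
    qed (use S assms(1) in \<open>auto intro!: continuous_intros\<close>)
    then show ?thesis by simp
  qed
  obtain z where "z \<notin> V" using ex_new_if_finite[OF infinite_UNIV_char_0 assms(1)] by blast
  moreover have "(\<Sum>v\<in>V. a v / (z - v)) = (\<Sum>v\<in>V. a' v / (z - v))" using a by (intro sum.cong) auto
  ultimately show ?thesis using assms(2)[of z] a by simp
qed

section \<open>Interlacing applied to consecutive rows of the triangle\<close>

context gc_pattern
begin

text \<open>The characteristic polynomials of \<open>A\<^sub>j\<close> and \<open>A\<^sub>j\<^sub>+\<^sub>1\<close> determine the corner entry \<open>c\<close> and the norms
  \<open>a r\<close> of the components of the new column; these satisfy the following.\<close>

definition weights :: "nat \<Rightarrow> real \<Rightarrow> (nat \<Rightarrow> real) \<Rightarrow> bool" where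
  "weights j c a \<longleftrightarrow> (\<forall>r\<in>act j. a r \<ge> 0) \<and>
     (\<forall>z. z \<notin> val ` act j \<longrightarrow> (\<Prod>i\<in>{1..Suc j}. z - T (i, Suc j)) =
       (\<Prod>i\<in>{1..j}. z - T (i, j)) * (z - c - (\<Sum>r\<in>act j. a r / (z - val r))))"

lemma val_act: "j \<le> n \<Longrightarrow> (\<lambda>i. T (i, j)) ` {1..j} = val ` act j"
proof (intro subset_antisym image_subsetI)
  fix i assume "j \<le> n" "i \<in> {1..j}"
  then show "T (i, j) \<in> val ` act j" using row_cover[of i j] by blast
next
  fix r assume "j \<le> n" "r \<in> act j"
  then have "lo r j \<in> {i \<in> {1..j}. T (i, j) = val r}" using row_eq(1)[of r j] mult_pos[of r j] by auto
  then show "val r \<in> (\<lambda>i. T (i, j)) ` {1..j}" by force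
qed

lemma card_val_eq: "j \<le> n \<Longrightarrow> r \<in> act j \<Longrightarrow> card {i \<in> {1..j}. T (i, j) = val r} = mult r j"
  by (subst row_eq(1)) auto

lemma card_val_less: "j \<le> n \<Longrightarrow> r \<in> act j \<Longrightarrow> card {i \<in> {1..j}. val r < T (i, j)} = lo r j - 1"
  by (subst row_eq(2)) auto

lemma lo_pos: "r \<in> act j \<Longrightarrow> 1 \<le> lo r j"
  using I_pos act_less by (auto simp: lo_def trans_le_add1)

context
  fixes j c a
  assumes w: "weights j c a" and j: "Suc j \<le> n"
begin

text \<open>The facts on partial fractions attach weights to poles. Diamonds meeting the same row
  have different values, so weights of diamonds can be read as weights of values.\<close>

private definition "aa v = a (the_inv_into (act j) val v)"

private lemma aa: "r \<in> act j \<Longrightarrow> aa (val r) = a r"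
  using the_inv_into_f_f[OF val_inj[of j]] j by (simp add: aa_def)

private lemma sum_aa: "(\<Sum>v\<in>(\<lambda>i. T (i, j)) ` {1..j}. aa v / (z - v)) = (\<Sum>r\<in>act j. a r / (z - val r))"
  using j by (subst val_act, simp, subst sum.reindex[OF val_inj]) (auto simp: aa intro!: sum.cong)

private lemma nonneg: "v \<in> (\<lambda>i. T (i, j)) ` {1..j} \<Longrightarrow> aa v \<ge> 0"
  using w j by (subst (asm) val_act) (auto simp: weights_def aa)

private lemma ident:
  "z \<notin> (\<lambda>i. T (i, j)) ` {1..j} \<Longrightarrow> (\<Prod>i\<in>{1..Suc j}. z - T (i, Suc j)) =
    (\<Prod>i\<in>{1..j}. z - T (i, j)) * (z - c - (\<Sum>v\<in>(\<lambda>i. T (i, j)) ` {1..j}. aa v / (z - v)))"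
  unfolding sum_aa using w j by (subst (asm) val_act) (simp_all add: weights_def)

lemmas facts = interlacing[OF _ _ nonneg ident, OF finite_atLeastAtMost finite_atLeastAtMost]
  pole_weight_zero[OF _ _ nonneg ident, OF finite_atLeastAtMost finite_atLeastAtMost]
  pole_weight_pos[OF _ _ nonneg ident, OF finite_atLeastAtMost finite_atLeastAtMost]
  zero_of_partial_fraction[OF _ _ nonneg ident, OF finite_atLeastAtMost finite_atLeastAtMost]

text \<open>Values may coincide for diamonds far apart, but not in consecutive rows: by interlacing,
  equal values would begin at positions that are neighbours in the triangle, and neighbours in
  different diamonds have different entries.\<close>

lemma val_neq_next:
  assumes q: "q \<in> act j" and r: "r \<in> act (Suc j)" and eq: "val q = val r"
  shows "q = r"
proof -
  have qs: "q < s" and rs: "r < s" using q r act_less by auto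
  have "lo q j - 1 \<le> lo r (Suc j) - 1" "lo r (Suc j) - 1 \<le> lo q j - 1 + 1"
    using facts(1,2)[of "val r"] card_val_less[OF _ q] card_val_less[OF j r] j eq by auto
  then have lo: "lo r (Suc j) = lo q j \<or> lo r (Suc j) = Suc (lo q j)"
    using lo_pos[OF q] lo_pos[OF r] by linarith
  have mq: "(lo q j, j) \<in> D q" using q qs mult_pos[OF q] by (simp add: mem_D)
  have mr: "(lo r (Suc j), Suc j) \<in> D r" using r rs mult_pos[OF r] by (simp add: mem_D)
  have "triangle_neighbours n (lo q j, j) (lo r (Suc j), Suc j)"
    using lo mem_D_triangle[OF qs mq] mem_D_triangle[OF rs mr] by (auto simp: triangle_neighbours_def)
  moreover have "T (lo q j, j) = T (lo r (Suc j), Suc j)" using T_val[OF qs mq] T_val[OF rs mr] eq by simp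
  ultimately show ?thesis using neighbour_neq[OF qs rs _ mq mr] by blast
qed

text \<open>If the diamond misses one of the two rows, then its value does not occur there, since
  \<open>val_neq_next\<close> rules out any other diamond with that value.\<close>

lemma card_next:
  assumes "r < s" "r \<in> act j \<or> r \<in> act (Suc j)"
  shows "card {i \<in> {1..j}. T (i, j) = val r} = mult r j"
    "card {i \<in> {1..Suc j}. T (i, Suc j) = val r} = mult r (Suc j)"
proof -
  show "card {i \<in> {1..j}. T (i, j) = val r} = mult r j"
  proof (cases "r \<in> act j")
    case False
    have "val r \<notin> val ` act j"
    proof
      assume "val r \<in> val ` act j"
      then obtain q where "q \<in> act j" "val q = val r" by (metis imageE)
      then show False using val_neq_next[of q r] assms False by auto
    qed
    then have "val r \<notin> (\<lambda>i. T (i, j)) ` {1..j}" using val_act j by auto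
    then have e: "{i \<in> {1..j}. T (i, j) = val r} = {}" by force
    show ?thesis unfolding e using mult_zero[OF assms(1) False] by simp
  qed (use card_val_eq j in auto)
  show "card {i \<in> {1..Suc j}. T (i, Suc j) = val r} = mult r (Suc j)"
  proof (cases "r \<in> act (Suc j)")
    case False
    have "val r \<notin> val ` act (Suc j)"
    proof
      assume "val r \<in> val ` act (Suc j)"
      then obtain q where "q \<in> act (Suc j)" "val r = val q" by (metis imageE)
      then show False using val_neq_next[of r q] assms False by auto
    qed
    then have "val r \<notin> (\<lambda>i. T (i, Suc j)) ` {1..Suc j}" using val_act j by auto
    then have e: "{i \<in> {1..Suc j}. T (i, Suc j) = val r} = {}" by force
    show ?thesis unfolding e using mult_zero[OF assms(1) False] by simp
  qed (use card_val_eq j in auto)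
qed

text \<open>Below its widest row the multiplicity of the value of a diamond does not drop, so there
  is no pole: the new column has no component in that eigenspace.\<close>

lemma weight_zero:
  assumes r: "r \<in> act j" "j < K r"
  shows "a r = 0"
proof -
  have "mult r j \<le> mult r (Suc j)" using r by (simp add: mult_def)
  moreover have "val r \<in> (\<lambda>i. T (i, j)) ` {1..j}" using val_act[of j] j r by auto
  ultimately show ?thesis using facts(3)[of "val r"] card_next[of r] r act_less aa by simp
qed

lemma weight_pos:
  assumes r: "r \<in> act j" "K r \<le> j"
  shows "a r > 0"
proof -
  have "mult r j = mult r (Suc j) + 1" using r mult_pos[OF r(1)] by (simp add: mult_def)
  then show ?thesis using facts(4)[of "val r"] card_next[of r] r act_less aa by simp
qed

text \<open>The secular equation for an eigenvalue whose multiplicity rises. It reappears as the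
  last row of the eigenvector equation for \<open>fvec\<close>.\<close>

lemma weight_eq:
  assumes r: "r \<in> grow (Suc j)"
  shows "val r - c - (\<Sum>q\<in>act j - {r}. a q / (val r - val q)) = 0"
proof -
  have rs: "r < s" and ra: "r \<in> act (Suc j)" using r grow_act by (auto simp: grow_def)
  have "mult r j < mult r (Suc j)" using mult_Suc[OF rs, of j] r by (auto simp: shrink_def grow_def)
  then have z: "val r - c - (\<Sum>w\<in>(\<lambda>i. T (i, j)) ` {1..j} - {val r}. aa w / (val r - w)) = 0"
    using facts(5)[of "val r"] card_next[of r] rs ra by simp
  have "(\<lambda>i. T (i, j)) ` {1..j} - {val r} = val ` (act j - {r})"
    using val_act[of j] j val_neq_next[OF _ ra] by auto
  then have "(\<Sum>w\<in>(\<lambda>i. T (i, j)) ` {1..j} - {val r}. aa w / (val r - w)) = (\<Sum>q\<in>act j - {r}. a q / (val r - val q))"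
    using j by (simp only:, subst sum.reindex[OF inj_on_subset[OF val_inj[of j]]]) (auto simp: aa intro!: sum.cong)
  then show ?thesis using z by simp
qed

end

end

section \<open>Eigenprojections of the leading submatrices\<close>

lemma sum_if_eq: "finite S \<Longrightarrow> (\<Sum>q\<in>S. if r = q then f q else 0) = (if r \<in> S then f r else (0::'a::comm_monoid_add))"
  by (simp add: sum.delta)

lemma sum_norm_zeroD:
  fixes v :: "nat \<Rightarrow> complex"
  assumes "(\<Sum>x<j. v x * cnj (v x)) = 0" "x < j"
  shows "v x = 0"
proof -
  have "(\<Sum>x<j. v x * cnj (v x)) = complex_of_real (\<Sum>x<j. (cmod (v x))\<^sup>2)"
    by (simp only: of_real_sum complex_norm_square)
  then have "(\<Sum>x<j. (cmod (v x))\<^sup>2) = 0" using assms(1) by (metis of_real_eq_0_iff)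
  then have "(cmod (v x))\<^sup>2 = 0" using assms(2) by (subst (asm) sum_nonneg_eq_0_iff) auto
  then show ?thesis by simp
qed

text \<open>Vectors and matrices are functions on all indices, of which only an initial part matters; so
  a vector of length \<open>j\<close> is also one of length \<open>j + 1\<close>.\<close>

definition hermf :: "(nat \<Rightarrow> nat \<Rightarrow> complex) \<Rightarrow> bool" where
  "hermf A \<longleftrightarrow> (\<forall>x y. cnj (A x y) = A y x)"

definition submat :: "nat \<Rightarrow> (nat \<Rightarrow> nat \<Rightarrow> complex) \<Rightarrow> complex mat" where
  "submat j A = Matrix.mat j j (\<lambda>(x, y). A x y)"

lemma submat_simps [simp]: "submat j A \<in> carrier_mat j j" "dim_row (submat j A) = j" "dim_col (submat j A) = j"
  "x < j \<Longrightarrow> y < j \<Longrightarrow> submat j A $$ (x, y) = A x y"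
  by (auto simp: submat_def)

lemma poly_char_poly_submat:
  "poly (char_poly (submat j A)) z = Determinant.det (Matrix.mat j j (\<lambda>(x, y). (if x = y then z else 0) - A x y))"
proof -
  have "- char_matrix (submat j A) z = Matrix.mat j j (\<lambda>(x, y). (if x = y then z else 0) - A x y)"
    by (rule eq_matI) (auto simp: char_matrix_def)
  then show ?thesis using char_poly_matrix[of "submat j A" j z] by simp
qed

text \<open>The Schur complement of \<open>z - A\<^sub>j\<close> in \<open>z - A\<^sub>j\<^sub>+\<^sub>1\<close>.\<close>

lemma char_poly_border:
  assumes u: "\<And>x. x < j \<Longrightarrow> z * u x - (\<Sum>k<j. A x k * u k) = A x j"
  shows "poly (char_poly (submat (Suc j) A)) z =
    poly (char_poly (submat j A)) z * (z - A j j - (\<Sum>k<j. A j k * u k))"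
proof -
  define Z where "Z = (\<lambda>x y. (if x = y then z else 0) - A x y)"
  define MZ where "MZ = Matrix.mat (Suc j) (Suc j) (\<lambda>(x, y). Z x y)"
  \<comment> \<open>A column operation of determinant 1: the assumption on \<open>u\<close> says
    that it clears the last column above the corner.\<close>
  define N where "N = Matrix.mat (Suc j) (Suc j) (\<lambda>(x, y). if x = y then 1 else if y = j then u x else 0)"
  have c: "MZ \<in> carrier_mat (Suc j) (Suc j)" "N \<in> carrier_mat (Suc j) (Suc j)" by (auto simp: MZ_def N_def)
  have "upper_triangular N" by (auto simp: N_def)
  moreover have "diag_mat N = replicate (Suc j) 1" by (rule nth_equalityI) (auto simp: diag_mat_def N_def simp del: upt_Suc replicate_Suc)
  ultimately have dN: "Determinant.det N = 1" using det_upper_triangular[OF _ c(2)] by simp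
  have ind: "(MZ * N) $$ (x, y) = (\<Sum>k<Suc j. Z x k * (if k = y then 1 else if y = j then u k else 0))"
    if "x < Suc j" "y < Suc j" for x y
    unfolding index_mult_mat_sum[OF c that] by (rule sum.cong) (use that in \<open>auto simp: MZ_def N_def\<close>)
  have col: "(MZ * N) $$ (x, y) = Z x y" if "x < Suc j" "y < j" for x y
  proof -
    have "(MZ * N) $$ (x, y) = (\<Sum>k<Suc j. if k = y then Z x y else 0)"
      unfolding ind[OF that(1) less_SucI[OF that(2)]] by (rule sum.cong) (use that in auto)
    also have "\<dots> = Z x y" using that(2) by (subst sum.delta) auto
    finally show ?thesis .
  qed
  have last: "(MZ * N) $$ (x, j) = (if x = j then z - A j j - (\<Sum>k<j. A j k * u k) else 0)" if "x < Suc j" for x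
  proof -
    have "(MZ * N) $$ (x, j) = (\<Sum>k<j. Z x k * u k) + Z x j"
      unfolding ind[OF that lessI] sum.lessThan_Suc
      by (rule arg_cong2[where f="(+)"], rule sum.cong) auto
    also have "(\<Sum>k<j. Z x k * u k) = (if x < j then z * u x else 0) - (\<Sum>k<j. A x k * u k)"
    proof -
      have "(\<Sum>k<j. Z x k * u k) = (\<Sum>k<j. (if x = k then z * u k else 0) - A x k * u k)"
        by (rule sum.cong) (auto simp: Z_def left_diff_distrib)
      then show ?thesis by (simp add: sum_subtractf sum_if_eq)
    qed
    finally show ?thesis using u[of x] that by (auto simp: Z_def less_Suc_eq)
  qed
  have "Determinant.det MZ = Determinant.det (MZ * N)" using det_mult[OF c] dN by simp
  also have "\<dots> = (\<Sum>i<Suc j. (MZ * N) $$ (i, j) * cofactor (MZ * N) i j)"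
    by (rule laplace_expansion_column) (use c in auto)
  also have "\<dots> = (\<Sum>i<Suc j. if i = j then (z - A j j - (\<Sum>k<j. A j k * u k)) * cofactor (MZ * N) j j else 0)"
    by (rule sum.cong) (auto simp: last)
  also have "\<dots> = (z - A j j - (\<Sum>k<j. A j k * u k)) * cofactor (MZ * N) j j" by simp
  also have "cofactor (MZ * N) j j = Determinant.det (mat_delete (MZ * N) j j)" by (simp add: cofactor_def)
  also have "mat_delete (MZ * N) j j = Matrix.mat j j (\<lambda>(x, y). Z x y)"
    by (rule eq_matI) (use c col in \<open>auto simp: mat_delete_def\<close>)
  finally show ?thesis
    unfolding poly_char_poly_submat MZ_def Z_def by (simp only: mult.commute)
qed

context gc_pattern
begin

definition comp :: "(nat \<Rightarrow> nat \<Rightarrow> nat \<Rightarrow> complex) \<Rightarrow> (nat \<Rightarrow> nat \<Rightarrow> complex) \<Rightarrow> nat \<Rightarrow> nat \<Rightarrow> nat \<Rightarrow> complex" where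
  "comp M A j r x = (\<Sum>y<j. M r x y * A y j)"

definition fvec :: "(nat \<Rightarrow> nat \<Rightarrow> nat \<Rightarrow> complex) \<Rightarrow> (nat \<Rightarrow> nat \<Rightarrow> complex) \<Rightarrow> nat \<Rightarrow> nat \<Rightarrow> nat \<Rightarrow> complex" where
  "fvec M A j r x = (if x < j then \<Sum>q\<in>act j - {r}. comp M A j q x / complex_of_real (val r - val q)
     else if x = j then 1 else 0)"

definition phi :: "(nat \<Rightarrow> real) \<Rightarrow> nat \<Rightarrow> nat \<Rightarrow> real" where
  "phi w j r = 1 + (\<Sum>q\<in>act j - {r}. w q / (val r - val q)\<^sup>2)"

text \<open>If \<open>M r\<close> projects onto the eigenspace of \<open>A\<^sub>j\<close> for \<open>val r\<close>, then \<open>comp M A j r\<close> is the component of the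
  new column in this space, and \<open>step w A j M r\<close> projects onto the eigenspace of \<open>A\<^sub>j\<^sub>+\<^sub>1\<close>: as long as the
  diamond \<open>r\<close> grows, this space gains the eigenvector \<open>fvec M A j r\<close>, whose squared norm is \<open>phi w j r\<close>;
  afterwards it loses \<open>comp M A j r\<close>.\<close>

definition step where
  "step w A j M = (\<lambda>r x y.
     if r \<in> grow (Suc j) then M r x y + fvec M A j r x * cnj (fvec M A j r y) / complex_of_real (phi w j r)
     else if r \<in> shrink j then M r x y - comp M A j r x * cnj (comp M A j r y) / complex_of_real (w r)
     else M r x y)"

primrec proj :: "(nat \<Rightarrow> nat \<Rightarrow> real) \<Rightarrow> (nat \<Rightarrow> nat \<Rightarrow> complex) \<Rightarrow> nat \<Rightarrow> nat \<Rightarrow> nat \<Rightarrow> nat \<Rightarrow> complex" where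
  "proj w A 0 = (\<lambda>r x y. 0)"
| "proj w A (Suc j) = step (w j) A j (proj w A j)"

text \<open>The properties of a spectral resolution that can be propagated one diamond at a time;
  completeness comes out of the traces in \<open>pre_res_res\<close>. Diamonds not yet reached have
  projection 0, so that growth starts from the zero space.\<close>

definition pre_res where
  "pre_res A j M \<longleftrightarrow>
     (\<forall>r x y. j < bot r \<longrightarrow> M r x y = 0) \<and>
     (\<forall>r\<in>act j. \<forall>x y. (M r x y \<noteq> 0 \<longrightarrow> x < j \<and> y < j) \<and> cnj (M r x y) = M r y x \<and>
        (x < j \<longrightarrow> (\<Sum>z<j. A x z * M r z y) = complex_of_real (val r) * M r x y) \<and>
        (\<Sum>z<j. M r x z * M r z y) = M r x y) \<and>
     (\<forall>r\<in>act j. (\<Sum>x<j. M r x x) = of_nat (mult r j))"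

definition res where
  "res A j M \<longleftrightarrow> pre_res A j M \<and>
     (\<forall>x<j. \<forall>y<j. (\<Sum>r\<in>act j. M r x y) = (if x = y then 1 else 0))"

context
  fixes A :: "nat \<Rightarrow> nat \<Rightarrow> complex" and j :: nat and M :: "nat \<Rightarrow> nat \<Rightarrow> nat \<Rightarrow> complex"
  assumes herm: "hermf A" and pre: "pre_res A j M" and j: "j \<le> n"
begin

lemma pre_resD:
  "j < bot r \<Longrightarrow> M r x y = 0"
  "r \<in> act j \<Longrightarrow> \<not> (x < j \<and> y < j) \<Longrightarrow> M r x y = 0"
  "r \<in> act j \<Longrightarrow> cnj (M r x y) = M r y x"
  "r \<in> act j \<Longrightarrow> x < j \<Longrightarrow> (\<Sum>z<j. A x z * M r z y) = complex_of_real (val r) * M r x y"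
  "r \<in> act j \<Longrightarrow> (\<Sum>z<j. M r x z * M r z y) = M r x y"
  "r \<in> act j \<Longrightarrow> (\<Sum>x<j. M r x x) = of_nat (mult r j)"
  using pre unfolding pre_res_def by blast+

lemma proj_left_eig:
  assumes r: "r \<in> act j" and y: "y < j"
  shows "(\<Sum>z<j. M r x z * A z y) = complex_of_real (val r) * M r x y"
proof -
  have "cnj (\<Sum>z<j. A y z * M r z x) = cnj (complex_of_real (val r) * M r y x)"
    using pre_resD(4)[OF r y] by simp
  then show ?thesis using herm by (simp add: pre_resD(3)[OF r] hermf_def mult.commute)
qed

text \<open>Eigenspaces for different eigenvalues of a Hermitian matrix are orthogonal:
  \<open>A\<close> between the two projections acts by \<open>val r\<close> from the left and by
  \<open>val q\<close> from the right.\<close>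

lemma proj_orth:
  assumes r: "r \<in> act j" and q: "q \<in> act j"
  shows "(\<Sum>z<j. M r x z * M q z y) = (if r = q then M r x y else 0)"
proof (cases "r = q")
  case False
  have "(\<Sum>w<j. \<Sum>z<j. M r x z * A z w * M q w y) = complex_of_real (val r) * (\<Sum>w<j. M r x w * M q w y)"
    unfolding sum_distrib_left
    by (rule sum.cong[OF refl]) (simp add: sum_distrib_right[symmetric] proj_left_eig[OF r])
  moreover have "(\<Sum>z<j. \<Sum>w<j. M r x z * A z w * M q w y) = complex_of_real (val q) * (\<Sum>z<j. M r x z * M q z y)"
    by (simp add: mult.assoc sum_distrib_left[symmetric] pre_resD(4)[OF q])
       (simp add: sum_distrib_left mult.left_commute)
  moreover have "(\<Sum>w<j. \<Sum>z<j. M r x z * A z w * M q w y) = (\<Sum>z<j. \<Sum>w<j. M r x z * A z w * M q w y)"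
    by (rule sum.swap)
  ultimately have "complex_of_real (val r) * (\<Sum>w<j. M r x w * M q w y) = complex_of_real (val q) * (\<Sum>z<j. M r x z * M q z y)"
    by (simp only:)
  moreover have "complex_of_real (val r) \<noteq> complex_of_real (val q)" using False val_eq_iff[OF j r q] by simp
  ultimately have "(\<Sum>z<j. M r x z * M q z y) = 0" unfolding mult_cancel_right by blast
  then show ?thesis using False by simp
qed (use pre_resD(5)[OF r] in simp)

text \<open>The defect \<open>E\<close> of the resolution is Hermitian and idempotent, and its trace
  is \<open>j\<close> minus the sum of the multiplicities, that is 0. The trace of such a matrix is
  the sum of the squared moduli of its entries.\<close>

lemma pre_res_res: "res A j M"
proof -
  define E where "E x y = (if x = y then 1 else 0) - (\<Sum>r\<in>act j. M r x y)" for x y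
  have adj: "cnj (E x y) = E y x" for x y
    using pre_resD(3) by (auto simp: E_def intro!: sum.cong)
  have sq: "(\<Sum>z<j. E x z * E z y) = E x y" if "x < j" "y < j" for x y
  proof -
    have "(\<Sum>z<j. (\<Sum>r\<in>act j. M r x z) * (\<Sum>q\<in>act j. M q z y)) = (\<Sum>z<j. \<Sum>r\<in>act j. \<Sum>q\<in>act j. M r x z * M q z y)"
      by (simp add: sum_product)
    also have "\<dots> = (\<Sum>r\<in>act j. \<Sum>z<j. \<Sum>q\<in>act j. M r x z * M q z y)" by (rule sum.swap)
    also have "\<dots> = (\<Sum>r\<in>act j. \<Sum>q\<in>act j. \<Sum>z<j. M r x z * M q z y)"
      by (rule sum.cong[OF refl], rule sum.swap)
    also have "\<dots> = (\<Sum>r\<in>act j. M r x y)"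
      by (rule sum.cong[OF refl]) (simp add: proj_orth sum_if_eq cong: sum.cong)
    finally have P: "(\<Sum>z<j. (\<Sum>r\<in>act j. M r x z) * (\<Sum>q\<in>act j. M q z y)) = (\<Sum>r\<in>act j. M r x y)" .
    have "(\<Sum>z<j. E x z * E z y) = (\<Sum>z<j. (if x = z then E z y else 0)) -
        (\<Sum>z<j. if y = z then (\<Sum>r\<in>act j. M r x z) else 0) + (\<Sum>z<j. (\<Sum>r\<in>act j. M r x z) * (\<Sum>q\<in>act j. M q z y))"
      unfolding sum_subtractf[symmetric] sum.distrib[symmetric]
      by (rule sum.cong) (auto simp: E_def algebra_simps)
    also have "\<dots> = E x y" unfolding P using that by (simp add: sum_if_eq)
    finally show ?thesis .
  qed
  have "(\<Sum>x<j. \<Sum>r\<in>act j. M r x x) = (\<Sum>r\<in>act j. \<Sum>x<j. M r x x)" by (rule sum.swap)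
  also have "\<dots> = of_nat (\<Sum>r\<in>act j. mult r j)" by (simp add: pre_resD(6))
  finally have tr: "(\<Sum>x<j. E x x) = 0" using sum_mult[OF j] by (simp add: E_def sum_subtractf)
  have row: "(\<Sum>y<j. E x y * cnj (E x y)) = E x x" if "x < j" for x
    using sq[OF that that] by (simp add: adj)
  have "E x y = 0" if xy: "x < j" "y < j" for x y
  proof -
    have Re: "E x x = complex_of_real (\<Sum>y<j. (cmod (E x y))\<^sup>2)" if "x < j" for x
      using row[OF that] by (simp only: of_real_sum complex_norm_square)
    have "complex_of_real (\<Sum>x<j. \<Sum>y<j. (cmod (E x y))\<^sup>2) = (\<Sum>x<j. E x x)"
      unfolding of_real_sum by (rule sum.cong[OF refl]) (use Re in auto)
    then have "(\<Sum>x<j. \<Sum>y<j. (cmod (E x y))\<^sup>2) = 0" unfolding tr by (metis of_real_eq_0_iff)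
    then have "(\<Sum>y<j. (cmod (E x y))\<^sup>2) = 0" using xy(1)
      by (subst (asm) sum_nonneg_eq_0_iff) (auto intro: sum_nonneg)
    then have "E x x = 0" using Re[OF xy(1)] by simp
    then show ?thesis using sum_norm_zeroD[of "E x" j y] row[OF xy(1)] xy(2) by simp
  qed
  then have "(\<Sum>r\<in>act j. M r x y) = (if x = y then 1 else 0)" if "x < j" "y < j" for x y
    using that unfolding E_def right_minus_eq by simp
  then show ?thesis unfolding res_def using pre by blast
qed

lemma proj_sum: "x < j \<Longrightarrow> y < j \<Longrightarrow> (\<Sum>r\<in>act j. M r x y) = (if x = y then 1 else 0)"
  using pre_res_res by (auto simp: res_def)

lemma proj_decomp:
  assumes "x < j"
  shows "(\<Sum>r\<in>act j. \<Sum>y<j. M r x y * v y) = v x"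
proof -
  have "(\<Sum>r\<in>act j. \<Sum>y<j. M r x y * v y) = (\<Sum>y<j. \<Sum>r\<in>act j. M r x y * v y)" by (rule sum.swap)
  also have "\<dots> = (\<Sum>y<j. if x = y then v y else 0)"
    by (rule sum.cong[OF refl]) (use assms in \<open>simp add: sum_distrib_right[symmetric] proj_sum\<close>)
  finally show ?thesis using assms by (simp add: sum_if_eq)
qed

lemma comp_zero: "r \<in> act j \<Longrightarrow> j \<le> x \<Longrightarrow> comp M A j r x = 0"
  by (auto simp: comp_def pre_resD(2) intro!: sum.neutral)

lemma comp_sum: "x < j \<Longrightarrow> (\<Sum>r\<in>act j. comp M A j r x) = A x j"
  unfolding comp_def by (rule proj_decomp)

lemma proj_comp:
  assumes r: "r \<in> act j" and q: "q \<in> act j"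
  shows "(\<Sum>z<j. M r x z * comp M A j q z) = (if r = q then comp M A j r x else 0)"
proof -
  have "(\<Sum>z<j. M r x z * comp M A j q z) = (\<Sum>z<j. \<Sum>y<j. M r x z * M q z y * A y j)"
    by (simp add: comp_def sum_distrib_left mult.assoc)
  also have "\<dots> = (\<Sum>y<j. \<Sum>z<j. M r x z * M q z y * A y j)" by (rule sum.swap)
  also have "\<dots> = (\<Sum>y<j. (if r = q then M r x y else 0) * A y j)"
    by (simp add: sum_distrib_right[symmetric] proj_orth[OF r q])
  finally show ?thesis by (simp add: comp_def)
qed

lemma A_comp:
  assumes r: "r \<in> act j" and x: "x < j"
  shows "(\<Sum>z<j. A x z * comp M A j r z) = complex_of_real (val r) * comp M A j r x"
proof -
  have "(\<Sum>z<j. A x z * comp M A j r z) = (\<Sum>z<j. \<Sum>y<j. A x z * M r z y * A y j)"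
    by (simp add: comp_def sum_distrib_left mult.assoc)
  also have "\<dots> = (\<Sum>y<j. \<Sum>z<j. A x z * M r z y * A y j)" by (rule sum.swap)
  also have "\<dots> = (\<Sum>y<j. complex_of_real (val r) * M r x y * A y j)"
    by (simp add: sum_distrib_right[symmetric] pre_resD(4)[OF r x])
  finally show ?thesis by (simp add: comp_def sum_distrib_left mult.assoc)
qed

lemma comp_orth:
  assumes r: "r \<in> act j" and q: "q \<in> act j"
  shows "(\<Sum>x<j. cnj (comp M A j q x) * comp M A j r x) =
    (if r = q then \<Sum>x<j. cnj (A x j) * comp M A j r x else 0)"
proof -
  have "(\<Sum>x<j. cnj (comp M A j q x) * comp M A j r x) = (\<Sum>x<j. \<Sum>y<j. cnj (A y j) * M q y x * comp M A j r x)"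
    by (simp add: comp_def[of M A j q] sum_distrib_right sum_distrib_left pre_resD(3)[OF q] mult_ac)
  also have "\<dots> = (\<Sum>y<j. \<Sum>x<j. cnj (A y j) * M q y x * comp M A j r x)" by (rule sum.swap)
  also have "\<dots> = (\<Sum>y<j. cnj (A y j) * (if q = r then comp M A j q y else 0))"
    by (simp add: mult.assoc sum_distrib_left[symmetric] proj_comp[OF q r])
  finally show ?thesis by auto
qed

lemma char_poly_Suc:
  assumes w: "\<And>r. r \<in> act j \<Longrightarrow> (\<Sum>x<j. comp M A j r x * cnj (comp M A j r x)) = complex_of_real (w r)"
    and z: "z \<notin> (\<lambda>r. complex_of_real (val r)) ` act j"
  shows "poly (char_poly (submat (Suc j) A)) z = poly (char_poly (submat j A)) z *
    (z - A j j - (\<Sum>r\<in>act j. complex_of_real (w r) / (z - complex_of_real (val r))))"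
proof -
  \<comment> \<open>The solution of the linear system required by \<open>char_poly_border\<close>,
    found on each eigenspace separately.\<close>
  define u where "u x = (\<Sum>r\<in>act j. comp M A j r x / (z - complex_of_real (val r)))" for x
  have nz: "z - complex_of_real (val r) \<noteq> 0" if "r \<in> act j" for r using z that by auto
  have wr: "(\<Sum>x<j. A j x * comp M A j r x) = complex_of_real (w r)" if r: "r \<in> act j" for r
    using comp_orth[OF r r] w[OF r] herm by (simp add: hermf_def mult.commute)
  have "(\<Sum>k<j. A j k * u k) = (\<Sum>k<j. \<Sum>r\<in>act j. A j k * comp M A j r k / (z - complex_of_real (val r)))"
    by (simp add: u_def sum_distrib_left)
  also have "\<dots> = (\<Sum>r\<in>act j. \<Sum>k<j. A j k * comp M A j r k / (z - complex_of_real (val r)))" by (rule sum.swap)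
  also have "\<dots> = (\<Sum>r\<in>act j. complex_of_real (w r) / (z - complex_of_real (val r)))"
    by (simp add: sum_divide_distrib[symmetric] wr)
  finally have 1: "(\<Sum>k<j. A j k * u k) = (\<Sum>r\<in>act j. complex_of_real (w r) / (z - complex_of_real (val r)))" .
  have "z * u x - (\<Sum>k<j. A x k * u k) = A x j" if x: "x < j" for x
  proof -
    have "(\<Sum>k<j. A x k * u k) = (\<Sum>k<j. \<Sum>r\<in>act j. A x k * comp M A j r k / (z - complex_of_real (val r)))"
      by (simp add: u_def sum_distrib_left)
    also have "\<dots> = (\<Sum>r\<in>act j. \<Sum>k<j. A x k * comp M A j r k / (z - complex_of_real (val r)))" by (rule sum.swap)
    also have "\<dots> = (\<Sum>r\<in>act j. complex_of_real (val r) * comp M A j r x / (z - complex_of_real (val r)))"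
      by (simp add: sum_divide_distrib[symmetric] A_comp x)
    finally have "z * u x - (\<Sum>k<j. A x k * u k) = (\<Sum>r\<in>act j. z * (comp M A j r x / (z - complex_of_real (val r)))
        - complex_of_real (val r) * comp M A j r x / (z - complex_of_real (val r)))"
      by (simp add: u_def sum_distrib_left sum_subtractf)
    also have "\<dots> = (\<Sum>r\<in>act j. comp M A j r x)"
    proof (rule sum.cong[OF refl])
      fix r assume "r \<in> act j"
      then show "z * (comp M A j r x / (z - complex_of_real (val r)))
        - complex_of_real (val r) * comp M A j r x / (z - complex_of_real (val r)) = comp M A j r x"
        using nz[of r] by (simp add: diff_divide_distrib[symmetric] left_diff_distrib[symmetric])
    qed
    finally show ?thesis using comp_sum[OF x] by simp
  qed
  then show ?thesis using char_poly_border[of j z u A] 1 by simp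
qed

end

end

section \<open>Passing from the eigenprojections of one leading block to those of the next\<close>

context gc_pattern
begin

context
  fixes A :: "nat \<Rightarrow> nat \<Rightarrow> complex" and j :: nat and M :: "nat \<Rightarrow> nat \<Rightarrow> nat \<Rightarrow> complex" and c :: real and w :: "nat \<Rightarrow> real"
  assumes herm: "hermf A" and pre: "pre_res A j M" and j: "Suc j \<le> n"
    and c: "A j j = complex_of_real c"
    and w: "\<And>r. r \<in> act j \<Longrightarrow> (\<Sum>x<j. comp M A j r x * cnj (comp M A j r x)) = complex_of_real (w r)"
    and weights: "weights j c w"
begin

private lemma j': "j \<le> n" using j by simp

lemmas pD = pre_resD[OF herm pre j']

private abbreviation "G \<equiv> comp M A j"
private abbreviation "f \<equiv> fvec M A j"

private lemma A_sym: "A j x = cnj (A x j)" using herm by (simp add: hermf_def)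

lemma comp_inner: "r \<in> act j \<Longrightarrow> (\<Sum>x<j. cnj (A x j) * G r x) = complex_of_real (w r)"
  using comp_orth[OF herm pre j', of r r] w[of r] by (simp add: mult.commute)

lemma comp_inner2: "r \<in> act j \<Longrightarrow> q \<in> act j \<Longrightarrow>
    (\<Sum>x<j. cnj (G q x) * G r x) = (if r = q then complex_of_real (w r) else 0)"
  using comp_orth[OF herm pre j', of r q] comp_inner by simp

lemma comp_vanish: "r \<in> act j \<Longrightarrow> j < K r \<Longrightarrow> G r x = 0"
proof (cases "x < j")
  case True
  assume r: "r \<in> act j" "j < K r"
  then show ?thesis using w[OF r(1)] weight_zero[OF weights j r] sum_norm_zeroD[OF _ True] by simp
next
  case False
  assume "r \<in> act j"
  then show ?thesis using comp_zero[OF herm pre j'] False by simp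
qed

private lemma grow_act': "r \<in> grow (Suc j) \<Longrightarrow> r \<in> act (Suc j)" using grow_act by blast

private lemma val_ne: "r \<in> grow (Suc j) \<Longrightarrow> q \<in> act j - {r} \<Longrightarrow> val r - val q \<noteq> 0"
  using val_neq_next[OF weights j, of q r] grow_act'[of r] by auto

private lemma grow_comp: "r \<in> grow (Suc j) \<Longrightarrow> r \<in> act j \<Longrightarrow> G r x = 0"
  by (rule comp_vanish) (auto simp: grow_def)

private lemma sum_minus: "r \<in> grow (Suc j) \<Longrightarrow> (\<Sum>q\<in>act j - {r}. G q x) = (\<Sum>q\<in>act j. G q x)"
  using grow_comp[of r] by (cases "r \<in> act j") (simp_all add: sum.remove[of "act j" r])

lemma phi_pos: "phi w j r \<ge> 1"
  using weights by (auto simp: phi_def weights_def intro!: sum_nonneg)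

text \<open>Each component of the new column is an eigenvector of the old block, and its coefficient
  \<open>1 / (val r - val q)\<close> is such that adding the column itself replaces
  \<open>val q\<close> by \<open>val r\<close>. The last row is the secular equation
  \<open>weight_eq\<close>.\<close>

lemma fvec_eig:
  assumes r: "r \<in> grow (Suc j)" and x: "x < Suc j"
  shows "(\<Sum>z<Suc j. A x z * f r z) = complex_of_real (val r) * f r x"
proof (cases "x < j")
  case True
  have "(\<Sum>z<j. A x z * f r z) = (\<Sum>z<j. \<Sum>q\<in>act j - {r}. A x z * G q z / complex_of_real (val r - val q))"
    by (rule sum.cong[OF refl]) (simp add: fvec_def sum_distrib_left)
  also have "\<dots> = (\<Sum>q\<in>act j - {r}. \<Sum>z<j. A x z * G q z / complex_of_real (val r - val q))" by (rule sum.swap)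
  also have "\<dots> = (\<Sum>q\<in>act j - {r}. complex_of_real (val q) * G q x / complex_of_real (val r - val q))"
    by (rule sum.cong[OF refl]) (simp add: sum_divide_distrib[symmetric] A_comp[OF herm pre j' _ True])
  finally have "(\<Sum>z<Suc j. A x z * f r z) = (\<Sum>q\<in>act j - {r}. complex_of_real (val q) * G q x / complex_of_real (val r - val q)) + A x j"
    by (simp add: fvec_def)
  also have "A x j = (\<Sum>q\<in>act j - {r}. G q x)"
    using comp_sum[OF herm pre j' True] sum_minus[OF r] by simp
  also have "(\<Sum>q\<in>act j - {r}. complex_of_real (val q) * G q x / complex_of_real (val r - val q)) + \<dots> =
      (\<Sum>q\<in>act j - {r}. complex_of_real (val r) * (G q x / complex_of_real (val r - val q)))"
    unfolding sum.distrib[symmetric]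
  proof (rule sum.cong[OF refl])
    fix q assume "q \<in> act j - {r}"
    then have "complex_of_real (val r - val q) \<noteq> 0" using val_ne[OF r] by (metis of_real_eq_0_iff)
    then show "complex_of_real (val q) * G q x / complex_of_real (val r - val q) + G q x =
        complex_of_real (val r) * (G q x / complex_of_real (val r - val q))"
      by (simp add: field_simps)
  qed
  finally show ?thesis using True by (simp add: fvec_def sum_distrib_left)
next
  case False
  then have x: "x = j" using x by simp
  have "(\<Sum>z<j. A j z * f r z) = (\<Sum>z<j. \<Sum>q\<in>act j - {r}. cnj (A z j) * G q z / complex_of_real (val r - val q))"
    by (rule sum.cong[OF refl]) (simp add: fvec_def sum_distrib_left A_sym)
  also have "\<dots> = (\<Sum>q\<in>act j - {r}. \<Sum>z<j. cnj (A z j) * G q z / complex_of_real (val r - val q))" by (rule sum.swap)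
  also have "\<dots> = (\<Sum>q\<in>act j - {r}. complex_of_real (w q) / complex_of_real (val r - val q))"
    by (rule sum.cong[OF refl]) (simp add: sum_divide_distrib[symmetric] comp_inner)
  also have "\<dots> = complex_of_real (\<Sum>q\<in>act j - {r}. w q / (val r - val q))" by simp
  also have "(\<Sum>q\<in>act j - {r}. w q / (val r - val q)) = val r - c"
    using weight_eq[OF weights j r] by simp
  finally show ?thesis using c by (simp add: x fvec_def)
qed

lemma fvec_norm:
  assumes r: "r \<in> grow (Suc j)"
  shows "(\<Sum>x<Suc j. cnj (f r x) * f r x) = complex_of_real (phi w j r)"
proof -
  have "(\<Sum>x<j. cnj (f r x) * f r x) =
     (\<Sum>x<j. \<Sum>p\<in>act j - {r}. \<Sum>q\<in>act j - {r}. cnj (G p x) * G q x / complex_of_real ((val r - val p) * (val r - val q)))"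
    by (rule sum.cong[OF refl]) (simp add: fvec_def sum_product)
  also have "\<dots> = (\<Sum>p\<in>act j - {r}. \<Sum>x<j. \<Sum>q\<in>act j - {r}. cnj (G p x) * G q x / complex_of_real ((val r - val p) * (val r - val q)))"
    by (rule sum.swap)
  also have "\<dots> = (\<Sum>p\<in>act j - {r}. \<Sum>q\<in>act j - {r}. \<Sum>x<j. cnj (G p x) * G q x / complex_of_real ((val r - val p) * (val r - val q)))"
    by (rule sum.cong[OF refl], rule sum.swap)
  also have "\<dots> = (\<Sum>p\<in>act j - {r}. \<Sum>q\<in>act j - {r}. if p = q then complex_of_real (w p / (val r - val p)\<^sup>2) else 0)"
    by (intro sum.cong refl) (auto simp: sum_divide_distrib[symmetric] comp_inner2 power2_eq_square)
  also have "\<dots> = (\<Sum>p\<in>act j - {r}. complex_of_real (w p / (val r - val p)\<^sup>2))"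
    by (rule sum.cong[OF refl]) (auto simp: sum_if_eq)
  finally show ?thesis by (simp add: phi_def fvec_def)
qed

text \<open>The sum defining \<open>fvec\<close> leaves out the component for \<open>r\<close>, and
  all others are orthogonal to that eigenspace.\<close>

lemma proj_fvec:
  assumes r: "r \<in> grow (Suc j)"
  shows "(\<Sum>z<Suc j. M r x z * f r z) = 0"
proof (cases "r \<in> act j")
  case False
  then have "j < bot r" using r by (auto simp: grow_def act_def K_le_top intro: le_trans[OF Suc_leD] dest!: K_le_top)
  then show ?thesis by (simp add: pD(1))
next
  case True
  have "(\<Sum>z<j. M r x z * f r z) = (\<Sum>z<j. \<Sum>q\<in>act j - {r}. M r x z * G q z / complex_of_real (val r - val q))"
    by (rule sum.cong[OF refl]) (simp add: fvec_def sum_distrib_left)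
  also have "\<dots> = (\<Sum>q\<in>act j - {r}. \<Sum>z<j. M r x z * G q z / complex_of_real (val r - val q))" by (rule sum.swap)
  also have "\<dots> = 0"
    by (rule sum.neutral) (auto simp: sum_divide_distrib[symmetric] proj_comp[OF herm pre j' True])
  finally show ?thesis using True by (simp add: pD(2))
qed

private lemma grow_not_act: "r \<in> grow (Suc j) \<Longrightarrow> r \<notin> act j \<Longrightarrow> j < bot r"
  using K_le_top[of r] by (auto simp: grow_def act_def)

private lemma grow_M:
  assumes "r \<in> grow (Suc j)"
  shows "\<not> (x < j \<and> y < j) \<Longrightarrow> M r x y = 0" "cnj (M r x y) = M r y x"
    "(\<Sum>z<j. M r x z * M r z y) = M r x y"
  using pD(1)[OF grow_not_act[OF assms]] pD(2,3,5)[of r] by (cases "r \<in> act j"; simp)+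

private lemma M_eig:
  assumes "r \<in> grow (Suc j)" "x < Suc j"
  shows "(\<Sum>z<Suc j. A x z * M r z y) = complex_of_real (val r) * M r x y"
proof (cases "r \<in> act j")
  case True
  have "(\<Sum>z<j. A j z * M r z y) = cnj (G r y)"
    by (simp add: comp_def A_sym pD(3)[OF True] mult.commute)
  then have "(\<Sum>z<j. A j z * M r z y) = 0" using grow_comp[OF assms(1) True] by simp
  then show ?thesis using assms(2) True pD(2)[OF True] pD(4)[OF True] by (auto simp: less_Suc_eq)
qed (use pD(1)[OF grow_not_act[OF assms(1)]] in simp)

text \<open>A growing eigenspace has no component of the new column, so its vectors, extended by 0,
  remain eigenvectors and \<open>fvec\<close> joins them as an orthogonal one. In a shrinking
  eigenspace only the vectors orthogonal to the new column remain eigenvectors.\<close>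

lemma step_pre_res: "pre_res A (Suc j) (step w A j M)"
proof -
  let ?M' = "step w A j M"
  have Z: "?M' r x y = 0" if "Suc j < bot r" for r x y
    using that pD(1)[of r] bot_le_K[of r] by (auto simp: step_def grow_def shrink_def)
  have G: "?M' r x y = M r x y + f r x * cnj (f r y) / complex_of_real (phi w j r)" if "r \<in> grow (Suc j)" for r x y
    using that by (simp add: step_def)
  have S: "?M' r x y = M r x y - G r x * cnj (G r y) / complex_of_real (w r)"
    and Sa: "r \<in> act j" "K r \<le> j" "w r > 0"
    if "r \<in> act (Suc j)" "r \<notin> grow (Suc j)" for r x y
  proof -
    have "r \<in> shrink j" "r \<in> act j" "K r \<le> j"
      using that bot_le_K[of r] by (auto simp: act_def grow_def shrink_def)
    then show "r \<in> act j" "K r \<le> j" "w r > 0" "?M' r x y = M r x y - G r x * cnj (G r y) / complex_of_real (w r)"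
      using that weight_pos[OF weights j] by (auto simp: step_def)
  qed
  have phi0: "complex_of_real (phi w j r) \<noteq> 0" for r using phi_pos[of r] by simp
  have fz: "f r x = 0" if "\<not> x < Suc j" for r x using that by (simp add: fvec_def)
  have supp: "?M' r x y = 0" if "r \<in> act (Suc j)" "\<not> (x < Suc j \<and> y < Suc j)" for r x y
  proof (cases "r \<in> grow (Suc j)")
    case True
    then show ?thesis using that(2) grow_M(1)[OF True, of x y] fz by (auto simp: G)
  next
    case False
    then show ?thesis using that(2) pD(2)[OF Sa(1)[OF that(1) False], of x y]
      comp_zero[OF herm pre j' Sa(1)[OF that(1) False]] by (auto simp: S[OF that(1) False])
  qed
  have adj: "cnj (?M' r x y) = ?M' r y x" if "r \<in> act (Suc j)" for r x y
  proof (cases "r \<in> grow (Suc j)")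
    case True
    then show ?thesis using grow_M(2)[OF True] by (simp add: G mult.commute)
  next
    case False
    then show ?thesis using pD(3)[OF Sa(1)[OF that False]] by (simp add: S[OF that False] mult.commute)
  qed
  have eig: "(\<Sum>z<Suc j. A x z * ?M' r z y) = complex_of_real (val r) * ?M' r x y"
    if r: "r \<in> act (Suc j)" and x: "x < Suc j" for r x y
  proof (cases "r \<in> grow (Suc j)")
    case True
    have "(\<Sum>z<Suc j. A x z * ?M' r z y) = (\<Sum>z<Suc j. A x z * M r z y) +
        (\<Sum>z<Suc j. A x z * f r z) * cnj (f r y) / complex_of_real (phi w j r)"
      by (simp only: G[OF True] distrib_left sum.distrib sum_distrib_right sum_divide_distrib times_divide_eq_right mult.assoc)
    then show ?thesis unfolding M_eig[OF True x] fvec_eig[OF True x] by (simp add: G[OF True] distrib_left)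
  next
    case False
    note a = Sa[OF r False]
    have "(\<Sum>z<Suc j. A x z * ?M' r z y) = (\<Sum>z<j. A x z * ?M' r z y)"
      using pD(2)[OF a(1)] comp_zero[OF herm pre j' a(1)] by (simp add: S[OF r False])
    also have "\<dots> = (\<Sum>z<j. A x z * M r z y) - (\<Sum>z<j. A x z * G r z) * cnj (G r y) / complex_of_real (w r)"
      by (simp only: S[OF r False] right_diff_distrib sum_subtractf sum_distrib_right sum_divide_distrib times_divide_eq_right mult.assoc)
    also have "\<dots> = complex_of_real (val r) * ?M' r x y"
    proof (cases "x < j")
      case True
      then show ?thesis
        using pD(4)[OF a(1) True] A_comp[OF herm pre j' a(1) True] by (simp add: S[OF r False] right_diff_distrib)
    next
      case F: False
      then have x: "x = j" using x by simp
      \<comment> \<open>In the last row the old projection contributes the conjugate component, and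
        the subtracted term cancels it because \<open>w r\<close> is the squared norm of that
        component.\<close>
      have 1: "(\<Sum>z<j. A j z * M r z y) = cnj (G r y)"
        by (simp add: comp_def A_sym pD(3)[OF a(1)] mult.commute)
      have 2: "(\<Sum>z<j. A j z * G r z) = complex_of_real (w r)" using comp_inner[OF a(1)] by (simp add: A_sym)
      have "?M' r j y = 0" using pD(2)[OF a(1)] comp_zero[OF herm pre j' a(1)] by (simp add: S[OF r False])
      then show ?thesis using a(3) by (simp add: x 1 2)
    qed
    finally show ?thesis .
  qed
  have idem: "(\<Sum>z<Suc j. ?M' r x z * ?M' r z y) = ?M' r x y" if r: "r \<in> act (Suc j)" for r x y
  proof (cases "r \<in> grow (Suc j)")
    case True
    have Mf: "(\<Sum>z<Suc j. M r x z * f r z) = 0" for x by (rule proj_fvec[OF True])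
    have fM: "(\<Sum>z<Suc j. cnj (f r z) * M r z y) = 0"
      using arg_cong[OF Mf[of y], of cnj] grow_M(2)[OF True] by (simp add: mult.commute del: sum.lessThan_Suc)
    have MM: "(\<Sum>z<Suc j. M r x z * M r z y) = M r x y" using grow_M(1,3)[OF True] by simp
    have "(\<Sum>z<Suc j. ?M' r x z * ?M' r z y) = (\<Sum>z<Suc j. M r x z * M r z y) +
        (\<Sum>z<Suc j. M r x z * f r z) * (cnj (f r y) / complex_of_real (phi w j r)) +
        (f r x / complex_of_real (phi w j r)) * (\<Sum>z<Suc j. cnj (f r z) * M r z y) +
        (f r x / complex_of_real (phi w j r)) * (\<Sum>z<Suc j. cnj (f r z) * f r z) * (cnj (f r y) / complex_of_real (phi w j r))"
      unfolding G[OF True] sum_distrib_left sum_distrib_right sum.distrib[symmetric]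
      by (rule sum.cong[OF refl]) (simp add: algebra_simps)
    then show ?thesis unfolding MM Mf fM fvec_norm[OF True] using phi0 by (simp add: G[OF True])
  next
    case False
    note a = Sa[OF r False]
    have MG: "(\<Sum>z<j. M r x z * G r z) = G r x" for x using proj_comp[OF herm pre j' a(1) a(1)] by simp
    have GM: "(\<Sum>z<j. cnj (G r z) * M r z y) = cnj (G r y)"
      using arg_cong[OF MG[of y], of cnj] pD(3)[OF a(1)] by (simp add: mult.commute)
    have GG: "(\<Sum>z<j. cnj (G r z) * G r z) = complex_of_real (w r)" using comp_inner2[OF a(1) a(1)] by simp
    have "(\<Sum>z<Suc j. ?M' r x z * ?M' r z y) = (\<Sum>z<j. ?M' r x z * ?M' r z y)"
      using pD(2)[OF a(1)] comp_zero[OF herm pre j' a(1)] by (simp add: S[OF r False])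
    also have "\<dots> = (\<Sum>z<j. M r x z * M r z y) -
        (\<Sum>z<j. M r x z * G r z) * (cnj (G r y) / complex_of_real (w r)) -
        (G r x / complex_of_real (w r)) * (\<Sum>z<j. cnj (G r z) * M r z y) +
        (G r x / complex_of_real (w r)) * (\<Sum>z<j. cnj (G r z) * G r z) * (cnj (G r y) / complex_of_real (w r))"
      unfolding S[OF r False] sum_distrib_left sum_distrib_right sum.distrib[symmetric] sum_subtractf[symmetric]
      by (rule sum.cong[OF refl]) (simp add: algebra_simps)
    also have "\<dots> = ?M' r x y"
      unfolding MG GM GG pD(5)[OF a(1)] using a(3) by (simp add: S[OF r False])
    finally show ?thesis .
  qed
  have tr: "(\<Sum>x<Suc j. ?M' r x x) = of_nat (mult r (Suc j))" if r: "r \<in> act (Suc j)" for r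
  proof (cases "r \<in> grow (Suc j)")
    case True
    have rs: "r < s" using r act_less by simp
    have t0: "(\<Sum>x<j. M r x x) = of_nat (mult r j)"
    proof (cases "r \<in> act j")
      case False
      then show ?thesis using pD(1)[OF grow_not_act[OF True False]] mult_zero[OF rs False] by simp
    qed (rule pD(6))
    have "(\<Sum>x<Suc j. ?M' r x x) = (\<Sum>x<Suc j. M r x x) + (\<Sum>x<Suc j. cnj (f r x) * f r x) / complex_of_real (phi w j r)"
      by (simp only: G[OF True] sum.distrib sum_divide_distrib mult.commute)
    also have "\<dots> = of_nat (mult r j) + 1"
      unfolding fvec_norm[OF True] using phi0 t0 grow_M(1)[OF True] by simp
    also have "\<dots> = of_nat (mult r (Suc j))"
      using mult_Suc[OF rs, of j] True by (auto simp: grow_def shrink_def)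
    finally show ?thesis .
  next
    case False
    note a = Sa[OF r False]
    have "(\<Sum>x<Suc j. ?M' r x x) = (\<Sum>x<j. ?M' r x x)"
      using pD(2)[OF a(1)] comp_zero[OF herm pre j' a(1)] by (simp add: S[OF r False])
    also have "\<dots> = (\<Sum>x<j. M r x x) - (\<Sum>x<j. G r x * cnj (G r x)) / complex_of_real (w r)"
      by (simp only: S[OF r False] sum_subtractf sum_divide_distrib)
    also have "\<dots> = of_nat (mult r j) - 1" unfolding w[OF a(1)] pD(6)[OF a(1)] using a(3) by simp
    also have "\<dots> = of_nat (mult r (Suc j))"
      using a(2) mult_pos[OF a(1)] by (simp add: mult_def of_nat_diff)
    finally show ?thesis .
  qed
  show ?thesis
    unfolding pre_res_def using Z supp adj eig idem tr by blast
qed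

end

lemma pre_res_0: "pre_res A 0 (\<lambda>r x y. 0)"
proof -
  have "act 0 = {}" using bot_pos by (fastforce simp: act_def)
  then show ?thesis by (simp add: pre_res_def)
qed

lemma poly_pol: "poly (pol j) (complex_of_real z) = complex_of_real (\<Prod>i\<in>{1..j}. z - T (i, j))"
  unfolding pol_def poly_prod of_real_prod by (rule prod.cong) auto

lemma poly_eq_cofinite:
  fixes p q :: "complex poly"
  assumes "finite F" "\<And>z. z \<notin> F \<Longrightarrow> poly p z = poly q z"
  shows "p = q"
proof (rule ccontr)
  assume "p \<noteq> q"
  then have "finite {z. poly (p - q) z = 0}" by (intro poly_roots_finite) simp
  moreover have "- F \<subseteq> {z. poly (p - q) z = 0}" using assms(2) by auto
  ultimately have "finite (- F)" by (rule rev_finite_subset)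
  then have "finite (UNIV :: complex set)" using assms(1) finite_Un[of F "- F"] by (simp add: Compl_partition)
  then show False using infinite_UNIV_char_0 by blast
qed

lemma poly_eq_real:
  fixes p q :: "complex poly" and F :: "real set"
  assumes "\<And>x. x \<notin> F \<Longrightarrow> poly p (complex_of_real x) = poly q (complex_of_real x)" "finite F"
  shows "p = q"
proof (rule ccontr)
  assume "p \<noteq> q"
  then have "finite {z. poly (p - q) z = 0}" by (intro poly_roots_finite) simp
  moreover have "complex_of_real ` (- F) \<subseteq> {z. poly (p - q) z = 0}" using assms(1) by auto
  ultimately have "finite (complex_of_real ` (- F))" by (rule rev_finite_subset)
  then have "finite (- F)" by (rule finite_imageD) (auto simp: inj_on_def)
  then have "finite (UNIV :: real set)" using assms(2) finite_Un[of F "- F"] by (simp add: Compl_partition)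
  then show False using infinite_UNIV_char_0 by blast
qed

lemma weights_of_char_poly:
  assumes herm: "hermf A" and pre: "pre_res A j M" and j: "Suc j \<le> n"
    and c: "A j j = complex_of_real c"
    and w: "\<And>r. r \<in> act j \<Longrightarrow> (\<Sum>x<j. comp M A j r x * cnj (comp M A j r x)) = complex_of_real (w r)"
    and p: "char_poly (submat j A) = pol j" "char_poly (submat (Suc j) A) = pol (Suc j)"
  shows "weights j c w"
  unfolding weights_def
proof (intro conjI ballI allI impI)
  fix r assume "r \<in> act j"
  then have "complex_of_real (w r) = complex_of_real (\<Sum>x<j. (cmod (comp M A j r x))\<^sup>2)"
    using w[of r] by (simp only: of_real_sum complex_norm_square)
  then have "w r = (\<Sum>x<j. (cmod (comp M A j r x))\<^sup>2)" by (simp only: of_real_eq_iff)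
  then show "w r \<ge> 0" by (simp add: sum_nonneg)
next
  fix z assume z: "z \<notin> val ` act j"
  then have "complex_of_real z \<notin> (\<lambda>r. complex_of_real (val r)) ` act j" by auto
  from char_poly_Suc[OF herm pre _ w this] j
  have "poly (pol (Suc j)) (complex_of_real z) = poly (pol j) (complex_of_real z) *
     (complex_of_real z - complex_of_real c - (\<Sum>r\<in>act j. complex_of_real (w r) / (complex_of_real z - complex_of_real (val r))))"
    by (simp add: p c)
  also have "\<dots> = complex_of_real ((\<Prod>i\<in>{1..j}. z - T (i, j)) * (z - c - (\<Sum>r\<in>act j. w r / (z - val r))))"
    unfolding poly_pol by simp
  finally show "(\<Prod>i\<in>{1..Suc j}. z - T (i, Suc j)) = (\<Prod>i\<in>{1..j}. z - T (i, j)) * (z - c - (\<Sum>r\<in>act j. w r / (z - val r)))"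
    unfolding poly_pol by (simp only: of_real_eq_iff)
qed

text \<open>\<open>weights\<close> is an identity of real rational functions. Multiplied by the
  common denominator it becomes an identity of polynomials, which then holds at complex points as
  well.\<close>

lemma char_poly_of_weights:
  assumes herm: "hermf A" and pre: "pre_res A j M" and j: "Suc j \<le> n"
    and c: "A j j = complex_of_real c"
    and w: "\<And>r. r \<in> act j \<Longrightarrow> (\<Sum>x<j. comp M A j r x * cnj (comp M A j r x)) = complex_of_real (w r)"
    and p: "char_poly (submat j A) = pol j" and weights: "weights j c w"
  shows "char_poly (submat (Suc j) A) = pol (Suc j)"
proof (rule poly_eq_cofinite)
  show "finite ((\<lambda>r. complex_of_real (val r)) ` act j)" by simp
  fix z assume z: "z \<notin> (\<lambda>r. complex_of_real (val r)) ` act j"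
  let ?R = "\<lambda>z. z - complex_of_real c - (\<Sum>r\<in>act j. complex_of_real (w r) / (z - complex_of_real (val r)))"
  have lhs: "poly (char_poly (submat (Suc j) A)) z = poly (pol j) z * ?R z"
    using char_poly_Suc[OF herm pre _ w z] j by (simp add: p c)
  \<comment> \<open>The common denominator of the partial fractions; \<open>?N\<close> is the
    numerator belonging to it.\<close>
  let ?D = "\<Prod>r\<in>act j. [:- complex_of_real (val r), 1:]"
  let ?N = "[:- complex_of_real c, 1:] * ?D - (\<Sum>r\<in>act j. [:complex_of_real (w r):] * (\<Prod>q\<in>act j - {r}. [:- complex_of_real (val q), 1:]))"
  have N: "poly ?N z = poly ?D z * ?R z" and D: "poly ?D z \<noteq> 0" if z: "z \<notin> (\<lambda>r. complex_of_real (val r)) ` act j" for z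
  proof -
    have nz: "z - complex_of_real (val r) \<noteq> 0" if "r \<in> act j" for r using z that by auto
    then show "poly ?D z \<noteq> 0" by (auto simp: poly_prod)
    have "(\<Prod>q\<in>act j. z - complex_of_real (val q)) * (complex_of_real (w r) / (z - complex_of_real (val r))) =
        complex_of_real (w r) * (\<Prod>q\<in>act j - {r}. z - complex_of_real (val q))" if "r \<in> act j" for r
      using nz[OF that] that by (simp add: prod.remove[of "act j" r])
    then show "poly ?N z = poly ?D z * ?R z"
      by (simp add: poly_prod poly_sum right_diff_distrib sum_distrib_left algebra_simps)
  qed
  have "pol (Suc j) * ?D = pol j * ?N"
  proof (rule poly_eq_real)
    fix x :: real assume x: "x \<notin> val ` act j"
    then have x': "complex_of_real x \<notin> (\<lambda>r. complex_of_real (val r)) ` act j" by auto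
    have "poly (pol (Suc j)) (complex_of_real x) = poly (pol j) (complex_of_real x) * ?R (complex_of_real x)"
      unfolding poly_pol using weights x by (simp add: weights_def)
    then show "poly (pol (Suc j) * ?D) (complex_of_real x) = poly (pol j * ?N) (complex_of_real x)"
      unfolding poly_mult N[OF x'] by (simp only: mult_ac)
  qed simp
  then have "poly (pol (Suc j)) z * poly ?D z = poly (pol j) z * poly ?N z"
    by (simp only: poly_mult[of "pol (Suc j)" ?D, symmetric] poly_mult[of "pol j" ?N, symmetric])
  then have "poly (pol (Suc j)) z = poly (pol j) z * ?R z" unfolding N[OF z] using D[OF z] by simp
  then show "poly (char_poly (submat (Suc j) A)) z = poly (pol (Suc j)) z" using lhs by simp
qed

end

text \<open>From here on a point \<open>A0\<close> of the fiber is fixed; it provides the weights.\<close>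

locale gc_ref = gc_pattern +
  fixes A0 :: "nat \<Rightarrow> nat \<Rightarrow> complex"
  assumes herm0: "hermf A0" and char0: "\<And>j. j \<le> n \<Longrightarrow> char_poly (submat j A0) = pol j"
begin

text \<open>The recursion takes its weights from \<open>A0\<close> as it proceeds. This avoids a
  circularity: \<open>proj\<close> needs \<open>w\<close>, and \<open>w\<close> needs the
  projections of \<open>A0\<close>.\<close>

primrec proj0 :: "nat \<Rightarrow> nat \<Rightarrow> nat \<Rightarrow> nat \<Rightarrow> complex" where
  "proj0 0 = (\<lambda>r x y. 0)"
| "proj0 (Suc j) = step (\<lambda>r. \<Sum>x<j. (cmod (comp (proj0 j) A0 j r x))\<^sup>2) A0 j (proj0 j)"

definition w where "w j r = (\<Sum>x<j. (cmod (comp (proj0 j) A0 j r x))\<^sup>2)"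
definition c where "c j = Re (A0 j j)"

abbreviation "P \<equiv> proj w"
abbreviation "gv A j \<equiv> comp (P A j) A j"
abbreviation "fv A j \<equiv> fvec (P A j) A j"

lemma proj0: "P A0 j = proj0 j"
  by (induction j) (simp_all add: w_def)

lemma diag_real: "hermf A \<Longrightarrow> A j j = complex_of_real (Re (A j j))"
proof -
  assume "hermf A"
  then have "cnj (A j j) = A j j" by (simp add: hermf_def)
  then show ?thesis by (simp add: complex_eq_iff)
qed

lemma cmod_sum: "(\<Sum>x<j. v x * cnj (v x)) = complex_of_real (\<Sum>x<j. (cmod (v x))\<^sup>2)"
  by (simp only: of_real_sum complex_norm_square)

lemma w0: "(\<Sum>x<j. gv A0 j r x * cnj (gv A0 j r x)) = complex_of_real (w j r)"
  unfolding proj0 cmod_sum w_def ..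

lemma c0: "A0 j j = complex_of_real (c j)"
  unfolding c_def by (rule diag_real[OF herm0])

text \<open>A simultaneous induction: the weights of a row come from its projections, and these in
  turn from the weights of the earlier rows.\<close>

lemma pre_res0: "j \<le> n \<Longrightarrow> pre_res A0 j (P A0 j)"
  and weights0: "Suc j \<le> n \<Longrightarrow> weights j (c j) (w j)"
proof (induction j)
  case 0
  {
    case 1 show ?case using pre_res_0 by simp
  next
    case 2 show ?case
      by (rule weights_of_char_poly[OF herm0 pre_res_0[of A0] 2 c0])
         (use 2 char0 in \<open>auto simp: act_def dest: bot_pos\<close>)
  }
next
  case (Suc j)
  {
    case 1
    then have j: "Suc j \<le> n" by simp
    then show ?case
      unfolding proj.simps
      by (intro step_pre_res[OF herm0 Suc.IH(1) j c0 w0 Suc.IH(2)[OF j]]) (use j in simp)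
  next
    case 2
    then have "pre_res A0 (Suc j) (P A0 (Suc j))"
      unfolding proj.simps
      by (intro step_pre_res[OF herm0 Suc.IH(1) _ c0 w0 Suc.IH(2)]) simp_all
    then show ?case
      by (rule weights_of_char_poly[OF herm0 _ 2 c0 w0]) (use 2 char0 in simp_all)
  }
qed

text \<open>The fiber described by equations that are polynomial in the entries and their
  conjugates, with constants taken from \<open>A0\<close>, instead of by characteristic
  polynomials.\<close>

definition fib :: "(nat \<Rightarrow> nat \<Rightarrow> complex) \<Rightarrow> bool" where
  "fib A \<longleftrightarrow> hermf A \<and> (\<forall>j<n. A j j = complex_of_real (c j) \<and>
     (\<forall>r\<in>act j. (\<Sum>x<j. gv A j r x * cnj (gv A j r x)) = complex_of_real (w j r)))"

lemma fibD:
  assumes "fib A"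
  shows "hermf A" "j < n \<Longrightarrow> A j j = complex_of_real (c j)"
    "j < n \<Longrightarrow> r \<in> act j \<Longrightarrow> (\<Sum>x<j. gv A j r x * cnj (gv A j r x)) = complex_of_real (w j r)"
  using assms unfolding fib_def by blast+

lemma pre_res_of_weights:
  assumes "hermf A" "J \<le> n" "\<And>j. j < J \<Longrightarrow> A j j = complex_of_real (c j)"
    "\<And>j r. j < J \<Longrightarrow> r \<in> act j \<Longrightarrow> (\<Sum>x<j. gv A j r x * cnj (gv A j r x)) = complex_of_real (w j r)"
  shows "pre_res A J (P A J)"
  using assms(2-)
proof (induction J)
  case 0
  show ?case using pre_res_0 by simp
next
  case (Suc J)
  show ?case unfolding proj.simps
    by (rule step_pre_res[OF assms(1) Suc.IH _ _ _ weights0]) (use Suc.prems in auto)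
qed

lemma fib_pre_res: "fib A \<Longrightarrow> j \<le> n \<Longrightarrow> pre_res A j (P A j)"
  by (rule pre_res_of_weights) (use fibD in auto)

lemma fib_char_poly:
  assumes A: "fib A"
  shows "j \<le> n \<Longrightarrow> char_poly (submat j A) = pol j"
proof (induction j)
  case 0
  have "submat 0 A = submat 0 A0" by (rule eq_matI) auto
  then show ?case using char0[of 0] by simp
next
  case (Suc j)
  show ?case
    by (rule char_poly_of_weights[OF fibD(1)[OF A] fib_pre_res[OF A] Suc.prems _ _ Suc.IH weights0[OF Suc.prems]])
       (use Suc.prems fibD[OF A] in auto)
qed

text \<open>Once the constants of the earlier rows agree with those of \<open>A0\<close>, the
  recursion gives true eigenprojections in row \<open>j\<close>. The next two characteristic
  polynomials then determine the corner and the weights by uniqueness of partial fractions.\<close>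

lemma fib_of_char_poly:
  assumes herm: "hermf A" and char: "\<And>j. j \<le> n \<Longrightarrow> char_poly (submat j A) = pol j"
  shows "fib A"
proof -
  have "j < n \<longrightarrow> A j j = complex_of_real (c j) \<and>
     (\<forall>r\<in>act j. (\<Sum>x<j. gv A j r x * cnj (gv A j r x)) = complex_of_real (w j r))" for j
  proof (induction j rule: less_induct)
    case (less j)
    show ?case
    proof
      assume j: "j < n"
      have pre: "pre_res A j (P A j)"
        by (rule pre_res_of_weights[OF herm]) (use less j in auto)
      define w' where "w' r = (\<Sum>x<j. (cmod (gv A j r x))\<^sup>2)" for r
      have wt: "weights j (Re (A j j)) w'"
        by (rule weights_of_char_poly[OF herm pre])
           (use j char diag_real[OF herm] in \<open>auto simp: w'_def cmod_sum\<close>)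
      have wt0: "weights j (c j) (w j)" using weights0 j by simp
      \<comment> \<open>Transfers weights from diamonds to their values, which are the
        poles.\<close>
      let ?a = "\<lambda>u v. u (the_inv_into (act j) val v) :: real"
      have inv: "the_inv_into (act j) val (val r) = r" if "r \<in> act j" for r
        using the_inv_into_f_f[OF val_inj[of j] that] j by simp
      have s: "(\<Sum>v\<in>val ` act j. ?a u v / (z - v)) = (\<Sum>r\<in>act j. u r / (z - val r))" for u z
        using j by (subst sum.reindex[OF val_inj]) (auto simp: inv intro!: sum.cong)
      have "Re (A j j) = c j \<and> (\<forall>v\<in>val ` act j. ?a w' v = ?a (w j) v)"
      proof (rule partial_fraction_unique)
        fix z assume z: "z \<notin> val ` act j"
        have "(\<Prod>i\<in>{1..j}. z - T (i, j)) \<noteq> 0" using z val_act[of j] j by fastforce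
        moreover have "(\<Prod>i\<in>{1..j}. z - T (i, j)) * (z - Re (A j j) - (\<Sum>r\<in>act j. w' r / (z - val r))) =
            (\<Prod>i\<in>{1..j}. z - T (i, j)) * (z - c j - (\<Sum>r\<in>act j. w j r / (z - val r)))"
          using wt wt0 z unfolding weights_def by (metis (no_types, lifting))
        ultimately have "z - Re (A j j) - (\<Sum>r\<in>act j. w' r / (z - val r)) = z - c j - (\<Sum>r\<in>act j. w j r / (z - val r))"
          using mult_left_cancel by blast
        then show "Re (A j j) + (\<Sum>v\<in>val ` act j. ?a w' v / (z - v)) = c j + (\<Sum>v\<in>val ` act j. ?a (w j) v / (z - v))"
          unfolding s by linarith
      qed simp
      then have "Re (A j j) = c j" "\<And>r. r \<in> act j \<Longrightarrow> w' r = w j r" using inv by auto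
      then show "A j j = complex_of_real (c j) \<and> (\<forall>r\<in>act j. (\<Sum>x<j. gv A j r x * cnj (gv A j r x)) = complex_of_real (w j r))"
        using diag_real[OF herm, of j] by (auto simp: cmod_sum w'_def[symmetric])
    qed
  qed
  then show ?thesis unfolding fib_def using herm by blast
qed

end

section \<open>Parametrisation of the fiber by unitary matrices\<close>

context gc_ref
begin

definition ip :: "(nat \<Rightarrow> complex) \<Rightarrow> (nat \<Rightarrow> complex) \<Rightarrow> complex" where
  "ip u v = (\<Sum>x<n. cnj (u x) * v x)"

definition app :: "(nat \<Rightarrow> nat \<Rightarrow> complex) \<Rightarrow> (nat \<Rightarrow> complex) \<Rightarrow> nat \<Rightarrow> complex" where
  "app M v x = (\<Sum>z<n. M x z * v z)"

lemma ip_cnj: "cnj (ip u v) = ip v u"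
  by (simp add: ip_def mult.commute)

lemma ip_sum_right: "ip v (\<lambda>x. \<Sum>t\<in>S. a t * u t x) = (\<Sum>t\<in>S. a t * ip v (u t))"
proof -
  have "ip v (\<lambda>x. \<Sum>t\<in>S. a t * u t x) = (\<Sum>x<n. \<Sum>t\<in>S. a t * (cnj (v x) * u t x))"
    by (simp add: ip_def sum_distrib_left mult.left_commute)
  also have "\<dots> = (\<Sum>t\<in>S. \<Sum>x<n. a t * (cnj (v x) * u t x))" by (rule sum.swap)
  finally show ?thesis by (simp add: ip_def sum_distrib_left)
qed

lemma ip_sum_left: "ip (\<lambda>x. \<Sum>t\<in>S. a t * u t x) v = (\<Sum>t\<in>S. cnj (a t) * ip (u t) v)"
proof -
  have "ip (\<lambda>x. \<Sum>t\<in>S. a t * u t x) v = cnj (ip v (\<lambda>x. \<Sum>t\<in>S. a t * u t x))" by (simp only: ip_cnj)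
  then show ?thesis unfolding ip_sum_right by (simp add: ip_cnj)
qed

lemma app_sum: "app M (\<lambda>x. \<Sum>t\<in>S. a t * u t x) x = (\<Sum>t\<in>S. a t * app M (u t) x)"
proof -
  have "app M (\<lambda>x. \<Sum>t\<in>S. a t * u t x) x = (\<Sum>z<n. \<Sum>t\<in>S. a t * (M x z * u t z))"
    by (simp add: app_def sum_distrib_left mult.left_commute)
  also have "\<dots> = (\<Sum>t\<in>S. \<Sum>z<n. a t * (M x z * u t z))" by (rule sum.swap)
  finally show ?thesis by (simp add: app_def sum_distrib_left)
qed

lemma app_rank_one: "app (\<lambda>x y. M x y + u x * cnj (v y)) z x = app M z x + u x * ip v z"
  "app (\<lambda>x y. M x y - u x * cnj (v y)) z x = app M z x - u x * ip v z"
  by (simp_all add: app_def ip_def distrib_right left_diff_distrib sum.distrib sum_subtractf sum_distrib_left mult.assoc)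

lemma ip_app:
  assumes "\<And>x y. cnj (M x y) = M y x"
  shows "ip u (app M v) = ip (app M u) v"
proof -
  have "ip u (app M v) = (\<Sum>x<n. \<Sum>z<n. cnj (u x) * M x z * v z)"
    by (simp add: ip_def app_def sum_distrib_left mult.assoc)
  also have "\<dots> = (\<Sum>z<n. \<Sum>x<n. cnj (u x) * M x z * v z)" by (rule sum.swap)
  also have "\<dots> = ip (app M u) v"
    by (simp add: ip_def app_def sum_distrib_right sum_distrib_left assms mult_ac)
  finally show ?thesis .
qed

lemma ip_zero: "ip u (\<lambda>x. 0) = 0" "ip (\<lambda>x. 0) u = 0"
  by (simp_all add: ip_def)

text \<open>The eigenspace for \<open>val r\<close> in row \<open>K r\<close> has the orthonormal basis of the vectors \<open>fh A r t\<close>, which enter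
  one by one in the rows \<open>t \<le> K r\<close>, and the orthonormal family of the vectors \<open>gh A r j\<close>, which leave it after
  the rows \<open>j \<ge> K r\<close>, for \<open>j < n\<close>.\<close>

definition fh :: "(nat \<Rightarrow> nat \<Rightarrow> complex) \<Rightarrow> nat \<Rightarrow> nat \<Rightarrow> nat \<Rightarrow> complex" where
  "fh A r t x = fv A (t - 1) r x / complex_of_real (sqrt (phi (w (t - 1)) (t - 1) r))"

definition gh :: "(nat \<Rightarrow> nat \<Rightarrow> complex) \<Rightarrow> nat \<Rightarrow> nat \<Rightarrow> nat \<Rightarrow> complex" where
  "gh A r j x = gv A j r x / complex_of_real (sqrt (w j r))"

text \<open>The equations of the fiber for the first \<open>J\<close> columns only; a matrix that is
  rebuilt column by column satisfies no more than these at the intermediate stages.\<close>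

definition fibJ :: "nat \<Rightarrow> (nat \<Rightarrow> nat \<Rightarrow> complex) \<Rightarrow> bool" where
  "fibJ J A \<longleftrightarrow> hermf A \<and> J \<le> n \<and> (\<forall>j<J. A j j = complex_of_real (c j) \<and>
     (\<forall>r\<in>act j. (\<Sum>x<j. gv A j r x * cnj (gv A j r x)) = complex_of_real (w j r)))"

lemma fib_fibJ: "fib A \<longleftrightarrow> fibJ n A" by (simp add: fib_def fibJ_def)

context
  fixes A :: "nat \<Rightarrow> nat \<Rightarrow> complex" and J :: nat
  assumes A: "fibJ J A"
begin

lemma fibJ_D: "hermf A" "J \<le> n" "j < J \<Longrightarrow> A j j = complex_of_real (c j)"
    "j < J \<Longrightarrow> r \<in> act j \<Longrightarrow> (\<Sum>x<j. gv A j r x * cnj (gv A j r x)) = complex_of_real (w j r)"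
  using A unfolding fibJ_def by blast+

lemma fibJ_pre: "j \<le> J \<Longrightarrow> pre_res A j (P A j)"
  using fibJ_D by (intro pre_res_of_weights) auto

lemma fibJ_le: "j \<le> J \<Longrightarrow> j \<le> n"
  using fibJ_D(2) by simp

private lemma pD:
  assumes "j \<le> J"
  shows "j < bot r \<Longrightarrow> P A j r x y = 0"
    "r \<in> act j \<Longrightarrow> \<not> (x < j \<and> y < j) \<Longrightarrow> P A j r x y = 0"
    "r \<in> act j \<Longrightarrow> cnj (P A j r x y) = P A j r y x"
  using pre_resD(1-3)[OF fibJ_D(1) fibJ_pre[OF assms] fibJ_le[OF assms]] by blast+

lemma P_herm: "j \<le> J \<Longrightarrow> r \<in> act j \<or> j < bot r \<Longrightarrow> cnj (P A j r x y) = P A j r y x"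
  using pD(1,3) by auto

lemma ip_P: "j \<le> J \<Longrightarrow> r \<in> act j \<or> j < bot r \<Longrightarrow> ip u (app (P A j r) v) = ip (app (P A j r) u) v"
  by (rule ip_app) (rule P_herm)

lemma app_P: "j \<le> J \<Longrightarrow> r \<in> act j \<Longrightarrow> app (P A j r) v x = (\<Sum>z<j. P A j r x z * v z)"
  unfolding app_def by (rule sum.mono_neutral_right) (use fibJ_le pD(2) in auto)

lemma P_idem: "j \<le> J \<Longrightarrow> r \<in> act j \<Longrightarrow> q \<in> act j \<Longrightarrow>
    app (P A j r) (app (P A j q) v) x = (if r = q then app (P A j r) v x else 0)"
proof -
  assume a: "j \<le> J" "r \<in> act j" "q \<in> act j"
  have "app (P A j r) (app (P A j q) v) x = (\<Sum>z<j. \<Sum>y<j. P A j r x z * P A j q z y * v y)"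
    by (simp add: app_P a sum_distrib_left mult.assoc)
  also have "\<dots> = (\<Sum>y<j. \<Sum>z<j. P A j r x z * P A j q z y * v y)" by (rule sum.swap)
  also have "\<dots> = (\<Sum>y<j. (if r = q then P A j r x y else 0) * v y)"
    by (simp add: sum_distrib_right[symmetric] proj_orth[OF fibJ_D(1) fibJ_pre[OF a(1)] fibJ_le[OF a(1)] a(2,3)])
  finally show ?thesis by (simp add: app_P a)
qed

lemma grow_or: "r \<in> grow (Suc j) \<Longrightarrow> r \<in> act j \<or> j < bot r"
  using K_le_top[of r] by (auto simp: grow_def act_def)

lemma fvec_support: "x \<ge> Suc j \<Longrightarrow> fvec M B j r x = 0"
  by (simp add: fvec_def)

context
  fixes j r
  assumes j: "Suc j \<le> J" and r: "r \<in> grow (Suc j)"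
begin

private lemma jn: "Suc j \<le> n" using fibJ_le j by simp

private lemma hyps: "hermf A" "pre_res A j (P A j)" "Suc j \<le> n" "A j j = complex_of_real (c j)"
  "\<And>r. r \<in> act j \<Longrightarrow> (\<Sum>x<j. gv A j r x * cnj (gv A j r x)) = complex_of_real (w j r)"
  "weights j (c j) (w j)"
  using fibJ_D fibJ_pre[of j] j jn weights0 by auto

private lemma phi0: "phi (w j) j r > 0"
  using phi_pos[OF hyps, of r] by simp

private lemma sq: "complex_of_real (sqrt (phi (w j) j r)) * complex_of_real (sqrt (phi (w j) j r)) = complex_of_real (phi (w j) j r)"
  using phi0 by (simp add: of_real_mult[symmetric] del: of_real_mult)

lemma P_grow: "P A (Suc j) r = (\<lambda>x y. P A j r x y + fh A r (Suc j) x * cnj (fh A r (Suc j) y))"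
  using r sq by (intro ext) (simp add: step_def fh_def)

lemma fh_norm: "ip (fh A r (Suc j)) (fh A r (Suc j)) = 1"
proof -
  have "ip (fh A r (Suc j)) (fh A r (Suc j)) = (\<Sum>x<n. cnj (fv A j r x) * fv A j r x) / complex_of_real (phi (w j) j r)"
    unfolding sq[symmetric] by (simp add: ip_def fh_def sum_divide_distrib)
  also have "(\<Sum>x<n. cnj (fv A j r x) * fv A j r x) = (\<Sum>x<Suc j. cnj (fv A j r x) * fv A j r x)"
    by (rule sum.mono_neutral_right) (use jn in \<open>auto simp: fvec_support\<close>)
  also have "(\<Sum>x<Suc j. cnj (fv A j r x) * fv A j r x) = complex_of_real (phi (w j) j r)"
    by (rule fvec_norm[OF hyps r])
  finally show ?thesis using phi0 by simp
qed

lemma P_fh: "app (P A j r) (fh A r (Suc j)) x = 0"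
proof -
  have "app (P A j r) (fh A r (Suc j)) x = (\<Sum>z<n. P A j r x z * fv A j r z) / complex_of_real (sqrt (phi (w j) j r))"
    by (simp add: app_def fh_def sum_divide_distrib)
  also have "(\<Sum>z<n. P A j r x z * fv A j r z) = (\<Sum>z<Suc j. P A j r x z * fv A j r z)"
    by (rule sum.mono_neutral_right) (use jn in \<open>auto simp: fvec_support\<close>)
  also have "(\<Sum>z<Suc j. P A j r x z * fv A j r z) = 0" by (rule proj_fvec[OF hyps r])
  finally show ?thesis by simp
qed

end

context
  fixes j r
  assumes j: "Suc j \<le> J" and r: "r \<in> shrink j"
begin

private lemma jn': "Suc j \<le> n" using fibJ_le j by simp

private lemma hyps': "hermf A" "pre_res A j (P A j)" "Suc j \<le> n" "A j j = complex_of_real (c j)"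
  "\<And>r. r \<in> act j \<Longrightarrow> (\<Sum>x<j. gv A j r x * cnj (gv A j r x)) = complex_of_real (w j r)"
  "weights j (c j) (w j)"
  using fibJ_D fibJ_pre[of j] j jn' weights0 by auto

private lemma ra: "r \<in> act j" "K r \<le> j" "r \<notin> grow (Suc j)" using r grow_act(2) by (auto simp: shrink_def grow_def)

lemma w_pos: "w j r > 0" by (rule weight_pos[OF hyps'(6) jn' ra(1,2)])

private lemma sq': "complex_of_real (sqrt (w j r)) * complex_of_real (sqrt (w j r)) = complex_of_real (w j r)"
  using w_pos by (simp add: of_real_mult[symmetric] del: of_real_mult)

lemma gv_gh: "gv A j r x = complex_of_real (sqrt (w j r)) * gh A r j x"
  using w_pos by (simp add: gh_def)

lemma P_shrink: "P A (Suc j) r = (\<lambda>x y. P A j r x y - gh A r j x * cnj (gh A r j y))"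
  using r ra(3) sq' by (intro ext) (simp add: step_def gh_def)

lemma P_gh: "app (P A j r) (gh A r j) x = gh A r j x"
proof -
  have "app (P A j r) (gh A r j) x = (\<Sum>z<j. P A j r x z * gv A j r z) / complex_of_real (sqrt (w j r))"
    using j ra(1) by (simp add: app_P gh_def sum_divide_distrib)
  then show ?thesis using proj_comp[OF hyps'(1,2) _ ra(1) ra(1)] jn' by (simp add: gh_def)
qed

lemma gh_norm: "ip (gh A r j) (gh A r j) = 1"
proof -
  have z: "gv A j r x = 0" if "j \<le> x" for x
    using comp_zero[OF hyps'(1,2) _ ra(1) that] jn' by simp
  have "ip (gh A r j) (gh A r j) = (\<Sum>x<n. gv A j r x * cnj (gv A j r x)) / complex_of_real (w j r)"
    unfolding sq'[symmetric] by (simp add: ip_def gh_def sum_divide_distrib mult.commute)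
  also have "(\<Sum>x<n. gv A j r x * cnj (gv A j r x)) = (\<Sum>x<j. gv A j r x * cnj (gv A j r x))"
    by (rule sum.mono_neutral_right) (use jn' z in auto)
  finally show ?thesis using hyps'(5)[OF ra(1)] w_pos by simp
qed

end

lemma shrink_act: "r \<in> shrink j \<Longrightarrow> r \<in> act j" using grow_act by blast

lemma fh_frame:
  assumes r: "r < s" and j: "bot r \<le> j" "j \<le> K r" "j \<le> J"
  shows "P A j r x y = (\<Sum>t\<in>{bot r..j}. fh A r t x * cnj (fh A r t y))"
  using j
proof (induction j rule: dec_induct)
  case base
  obtain m where m: "bot r = Suc m" using bot_pos[OF r] by (cases "bot r") auto
  have "r \<in> grow (Suc m)" using r bot_le_K[OF r] m by (auto simp: grow_def)
  then show ?case using P_grow[of m r] base m pD(1)[of m r] by simp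
next
  case (step j)
  have "r \<in> grow (Suc j)" using step r by (auto simp: grow_def)
  then show ?case using P_grow[of j r] step by (simp del: proj.simps)
qed

lemma P_fh_fix:
  assumes r: "r < s" and j: "bot r \<le> t" "t \<le> j" "j \<le> K r" "j \<le> J"
  shows "app (P A j r) (fh A r t) x = fh A r t x"
  using j(2-)
proof (induction j arbitrary: x rule: dec_induct)
  case base
  obtain m where m: "t = Suc m" using bot_pos[OF r] j(1) by (cases t) auto
  have g: "r \<in> grow (Suc m)" using r j(1) base m by (auto simp: grow_def)
  have J: "Suc m \<le> J" using base m by simp
  show ?case unfolding m P_grow[OF J g] app_rank_one P_fh[OF J g] fh_norm[OF J g] by simp
next
  case (step j)
  have g: "r \<in> grow (Suc j)" using step r j(1) by (auto simp: grow_def)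
  have J: "Suc j \<le> J" using step by simp
  have IH: "app (P A j r) (fh A r t) = fh A r t" using step by (intro ext) simp
  have "ip (fh A r (Suc j)) (fh A r t) = ip (fh A r (Suc j)) (app (P A j r) (fh A r t))" by (simp only: IH)
  also have "\<dots> = ip (app (P A j r) (fh A r (Suc j))) (fh A r t)"
    by (rule ip_P) (use J grow_or[OF g] in auto)
  also have "\<dots> = 0" using P_fh[OF J g] by (simp add: ip_def)
  finally have z: "ip (fh A r (Suc j)) (fh A r t) = 0" .
  show ?case unfolding P_grow[OF J g] app_rank_one z IH by simp
qed

text \<open>A vector entering in a later row is orthogonal to the eigenspace reached so far, and
  that space contains all earlier ones.\<close>

lemma fh_orth:
  assumes r: "r < s" and t: "bot r \<le> t" "t \<le> K r" "t \<le> J" "bot r \<le> t'" "t' \<le> K r" "t' \<le> J"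
  shows "ip (fh A r t) (fh A r t') = (if t = t' then 1 else 0)"
proof -
  have eq: "ip (fh A r t) (fh A r t) = 1" if a: "bot r \<le> t" "t \<le> K r" "t \<le> J" for t
  proof -
    obtain m where m: "t = Suc m" using bot_pos[OF r] a(1) by (cases t) auto
    show ?thesis unfolding m by (rule fh_norm) (use m a r in \<open>auto simp: grow_def\<close>)
  qed
  have lt: "ip (fh A r t) (fh A r t') = 0" if a: "bot r \<le> t'" "t' < t" "t \<le> K r" "t \<le> J" for t t'
  proof -
    obtain m where m: "t = Suc m" using a by (cases t) auto
    have g: "r \<in> grow (Suc m)" and J: "Suc m \<le> J" using a m r by (auto simp: grow_def)
    have fx: "app (P A m r) (fh A r t') = fh A r t'" using a m r by (intro ext P_fh_fix) auto
    have "ip (fh A r t) (fh A r t') = ip (fh A r t) (app (P A m r) (fh A r t'))" by (simp only: fx)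
    also have "\<dots> = ip (app (P A m r) (fh A r t)) (fh A r t')"
      by (rule ip_P) (use J grow_or[OF g] in auto)
    also have "\<dots> = 0" using P_fh[OF J g] by (simp add: ip_def m)
    finally show ?thesis .
  qed
  show ?thesis
  proof (cases t t' rule: linorder_cases)
    case less
    then have "ip (fh A r t') (fh A r t) = 0" using lt t by auto
    then show ?thesis using less ip_cnj[of "fh A r t'" "fh A r t"] by simp
  qed (use eq lt t in auto)
qed

lemma gh_frame:
  assumes r: "r < s" and j: "K r \<le> j" "j \<le> top r + 1" "j \<le> J"
  shows "P A j r = (\<lambda>x y. P A (K r) r x y - (\<Sum>i\<in>{K r..<j}. gh A r i x * cnj (gh A r i y)))"
  using j
proof (induction j rule: dec_induct)
  case (step j)
  have g: "r \<in> shrink j" using step r by (auto simp: shrink_def)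
  have J: "Suc j \<le> J" using step by simp
  show ?case unfolding P_shrink[OF J g] using step by (simp add: diff_diff_eq)
qed simp

lemma P_gh_kill:
  assumes r: "r < s" and j: "K r \<le> i" "Suc i \<le> j" "j \<le> top r" "j \<le> J"
  shows "app (P A j r) (gh A r i) x = 0"
  using j(2-)
proof (induction j arbitrary: x rule: dec_induct)
  case base
  have g: "r \<in> shrink i" using base j(1) r by (auto simp: shrink_def)
  show ?case unfolding P_shrink[OF base(2) g] app_rank_one P_gh[OF base(2) g] gh_norm[OF base(2) g] by simp
next
  case (step j)
  have g: "r \<in> shrink j" using step j(1) r by (auto simp: shrink_def)
  have J: "Suc j \<le> J" using step by simp
  have IH: "app (P A j r) (gh A r i) = (\<lambda>x. 0)" using step by (intro ext) simp
  have gj: "app (P A j r) (gh A r j) = gh A r j" by (intro ext P_gh[OF J g])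
  have "ip (gh A r j) (gh A r i) = ip (app (P A j r) (gh A r j)) (gh A r i)" by (simp only: gj)
  also have "\<dots> = ip (gh A r j) (app (P A j r) (gh A r i))"
    by (rule ip_P[symmetric]) (use J shrink_act[OF g] in auto)
  also have "\<dots> = 0" by (simp add: IH ip_zero)
  finally show ?case unfolding P_shrink[OF J g] app_rank_one IH by simp
qed

text \<open>The projection of row \<open>j\<close> kills the vectors that have already left and
  fixes the one about to leave.\<close>

lemma gh_orth:
  assumes r: "r < s" and i: "K r \<le> i" "i \<le> top r" "i < J" and j: "K r \<le> j" "j \<le> top r" "j < J"
  shows "ip (gh A r i) (gh A r j) = (if i = j then 1 else 0)"
proof -
  have lt: "ip (gh A r i) (gh A r j) = 0" if a: "K r \<le> i" "i < j" "j \<le> top r" "j < J" for i j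
  proof -
    have g: "r \<in> shrink j" using a r by (auto simp: shrink_def)
    have J: "Suc j \<le> J" using a by simp
    have gj: "app (P A j r) (gh A r j) = gh A r j" by (intro ext P_gh[OF J g])
    have "ip (gh A r i) (gh A r j) = ip (gh A r i) (app (P A j r) (gh A r j))" by (simp only: gj)
    also have "\<dots> = ip (app (P A j r) (gh A r i)) (gh A r j)"
      by (rule ip_P) (use J shrink_act[OF g] in auto)
    also have "\<dots> = 0" unfolding ip_def using P_gh_kill[OF r a(1), of j] a by simp
    finally show ?thesis .
  qed
  have eq: "ip (gh A r i) (gh A r i) = 1"
    by (rule gh_norm) (use i r in \<open>auto simp: shrink_def\<close>)
  show ?thesis
  proof (cases i j rule: linorder_cases)
    case greater
    then have "ip (gh A r j) (gh A r i) = 0" using lt i j by auto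
    then show ?thesis using greater ip_cnj[of "gh A r j" "gh A r i"] by simp
  qed (use eq lt i j in auto)
qed

text \<open>From the widest row on the eigenspace only loses vectors, so whatever leaves later was
  already contained in the widest one.\<close>

lemma P_K_gh:
  assumes r: "r < s" and j: "K r \<le> j" "j \<le> top r" "j < J"
  shows "app (P A (K r) r) (gh A r j) x = gh A r j x"
proof -
  have g: "r \<in> shrink j" using j r by (auto simp: shrink_def)
  have "app (P A j r) (gh A r j) x = app (P A (K r) r) (gh A r j) x - (\<Sum>i\<in>{K r..<j}. gh A r i x * ip (gh A r i) (gh A r j))"
  proof -
    have "app (P A j r) v x = app (P A (K r) r) v x - (\<Sum>i\<in>{K r..<j}. gh A r i x * ip (gh A r i) v)" for v
    proof -
      have "(\<Sum>z<n. \<Sum>i\<in>{K r..<j}. gh A r i x * cnj (gh A r i z) * v z) = (\<Sum>i\<in>{K r..<j}. \<Sum>z<n. gh A r i x * cnj (gh A r i z) * v z)"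
        by (rule sum.swap)
      then show ?thesis
        using j by (subst gh_frame[OF r j(1)])
          (simp_all add: app_def ip_def left_diff_distrib sum_subtractf sum_distrib_right sum_distrib_left mult.assoc)
    qed
    then show ?thesis .
  qed
  also have "(\<Sum>i\<in>{K r..<j}. gh A r i x * ip (gh A r i) (gh A r j)) = 0"
    by (rule sum.neutral) (use gh_orth[OF r _ _ _ j] j in auto)
  finally show ?thesis using P_gh[of j r x] j g by simp
qed

lemma fh_expand:
  assumes r: "r < s" "K r \<le> J"
  shows "app (P A (K r) r) v x = (\<Sum>t\<in>{bot r..K r}. ip (fh A r t) v * fh A r t x)"
proof -
  have "app (P A (K r) r) v x = (\<Sum>z<n. \<Sum>t\<in>{bot r..K r}. fh A r t x * cnj (fh A r t z) * v z)"
    using fh_frame[OF r(1) bot_le_K[OF r(1)] order_refl r(2)] by (simp add: app_def sum_distrib_right)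
  also have "\<dots> = (\<Sum>t\<in>{bot r..K r}. \<Sum>z<n. fh A r t x * cnj (fh A r t z) * v z)" by (rule sum.swap)
  finally show ?thesis by (simp add: ip_def sum_distrib_left mult_ac)
qed

text \<open>Growing diamonds contribute nothing to the new column, so it is determined by the unit
  vectors that leave, with prescribed lengths.\<close>

lemma col_gh:
  assumes j: "j < J" and x: "x < j"
  shows "A x j = (\<Sum>r\<in>shrink j. complex_of_real (sqrt (w j r)) * gh A r j x)"
proof -
  have J: "Suc j \<le> J" and jn: "Suc j \<le> n" using j fibJ_le[of "Suc j"] by auto
  have h: "hermf A" "pre_res A j (P A j)" "Suc j \<le> n" "A j j = complex_of_real (c j)"
    "\<And>r. r \<in> act j \<Longrightarrow> (\<Sum>x<j. gv A j r x * cnj (gv A j r x)) = complex_of_real (w j r)"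
    "weights j (c j) (w j)"
    using fibJ_D fibJ_pre[of j] j jn weights0 by auto
  have "A x j = (\<Sum>r\<in>act j. gv A j r x)" using comp_sum[OF h(1,2) _ x] jn by simp
  also have "\<dots> = (\<Sum>r\<in>shrink j. gv A j r x)"
  proof (rule sum.mono_neutral_right)
    show "\<forall>r\<in>act j - shrink j. gv A j r x = 0"
    proof
      fix r assume r: "r \<in> act j - shrink j"
      then have "j < K r" by (auto simp: shrink_def act_def)
      then show "gv A j r x = 0" using comp_vanish[OF h, of r x] r by simp
    qed
  qed (use grow_act in auto)
  also have "\<dots> = (\<Sum>r\<in>shrink j. complex_of_real (sqrt (w j r)) * gh A r j x)"
    by (rule sum.cong[OF refl]) (use gv_gh[OF J] in auto)
  finally show ?thesis .
qed

end

end

section \<open>Rebuilding a matrix of the fiber from its unitary coefficients\<close>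

context gc_ref
begin

text \<open>Projections and entering vectors of a row depend on the leading block of that size only;
  the column-by-column construction relies on this.\<close>

definition agree :: "nat \<Rightarrow> (nat \<Rightarrow> nat \<Rightarrow> complex) \<Rightarrow> (nat \<Rightarrow> nat \<Rightarrow> complex) \<Rightarrow> bool" where
  "agree j A B \<longleftrightarrow> (\<forall>x<j. \<forall>y<j. A x y = B x y)"

lemma agree_mono: "agree j A B \<Longrightarrow> i \<le> j \<Longrightarrow> agree i A B"
  by (auto simp: agree_def)

lemma gv_cong0: "agree (Suc j) A B \<Longrightarrow> comp M A j = comp M B j"
  by (auto simp: agree_def comp_def fun_eq_iff intro!: sum.cong)

lemma fvec_cong0: "agree (Suc j) A B \<Longrightarrow> fvec M A j = fvec M B j"
  using gv_cong0[of j A B M] by (simp add: fvec_def fun_eq_iff)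

lemma P_cong: "agree j A B \<Longrightarrow> P A j = P B j"
proof (induction j)
  case (Suc j)
  have e: "P A j = P B j" using Suc agree_mono by simp
  show ?case
    unfolding proj.simps step_def e gv_cong0[OF Suc.prems] fvec_cong0[OF Suc.prems] ..
qed simp

lemma fh_cong: "agree t A B \<Longrightarrow> t > 0 \<Longrightarrow> fh A r t = fh B r t"
proof -
  assume t: "agree t A B" "t > 0"
  then obtain m where m: "t = Suc m" by (cases t) auto
  have e: "P A m = P B m" using P_cong agree_mono[OF t(1)] m by simp
  show ?thesis
    by (rule ext) (simp only: fh_def m diff_Suc_1 e fvec_cong0[OF t(1)[unfolded m], of "P B m"])
qed

text \<open>The fiber is parametrised by the matrices \<open>coef A r\<close> of the families \<open>gh A r\<close> in the bases \<open>fh A r\<close>; the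
  matrix with given coefficients \<open>U\<close> is \<open>bld U n\<close>.\<close>

definition ghat :: "(nat \<Rightarrow> nat \<Rightarrow> nat \<Rightarrow> complex) \<Rightarrow> (nat \<Rightarrow> nat \<Rightarrow> complex) \<Rightarrow> nat \<Rightarrow> nat \<Rightarrow> nat \<Rightarrow> complex" where
  "ghat U A r j x = (\<Sum>t<L r. U r t (j - K r) * fh A r (bot r + t) x)"

definition newcol :: "(nat \<Rightarrow> nat \<Rightarrow> nat \<Rightarrow> complex) \<Rightarrow> (nat \<Rightarrow> nat \<Rightarrow> complex) \<Rightarrow> nat \<Rightarrow> nat \<Rightarrow> complex" where
  "newcol U A j x = (\<Sum>r\<in>shrink j. complex_of_real (sqrt (w j r)) * ghat U A r j x)"

primrec bld :: "(nat \<Rightarrow> nat \<Rightarrow> nat \<Rightarrow> complex) \<Rightarrow> nat \<Rightarrow> nat \<Rightarrow> nat \<Rightarrow> complex" where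
  "bld U 0 = (\<lambda>x y. 0)"
| "bld U (Suc j) = (\<lambda>x y. if x < j \<and> y < j then bld U j x y
     else if x < j \<and> y = j then newcol U (bld U j) j x
     else if x = j \<and> y < j then cnj (newcol U (bld U j) j y)
     else if x = j \<and> y = j then complex_of_real (c j) else 0)"

definition coef :: "(nat \<Rightarrow> nat \<Rightarrow> complex) \<Rightarrow> nat \<Rightarrow> nat \<Rightarrow> nat \<Rightarrow> complex" where
  "coef A r t d = ip (fh A r (bot r + t)) (gh A r (K r + d))"

text \<open>The condition \<open>K r + b < n\<close> omits the vector that would leave after row
  \<open>n\<close>, which no column of the matrix records.\<close>

definition ortho :: "(nat \<Rightarrow> nat \<Rightarrow> nat \<Rightarrow> complex) \<Rightarrow> bool" where
  "ortho U \<longleftrightarrow> (\<forall>r<s. \<forall>b<L r. \<forall>c<L r. K r + b < n \<longrightarrow> K r + c < n \<longrightarrow>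
     (\<Sum>t<L r. cnj (U r t b) * U r t c) = (if b = c then 1 else 0))"

text \<open>A shrinking diamond is past its widest row, so all of its entering vectors are already
  determined by the leading block of size \<open>j\<close>.\<close>

lemma newcol_cong:
  assumes "agree j A B"
  shows "ghat U A r j x = ghat U B r j x \<or> r \<notin> shrink j" "newcol U A j x = newcol U B j x"
proof -
  have g: "ghat U A r j x = ghat U B r j x" if r: "r \<in> shrink j" for r
    unfolding ghat_def
  proof (rule sum.cong[OF refl])
    fix t assume t: "t \<in> {..<L r}"
    have rs: "r < s" using r by (auto simp: shrink_def)
    have "bot r + t \<le> K r" "bot r + t > 0" using t L_pos[OF rs] I_L[OF rs] I_pos[OF rs] by (auto simp: bot_def)
    then have "fh A r (bot r + t) = fh B r (bot r + t)"
      using r agree_mono[OF assms] by (intro fh_cong) (auto simp: shrink_def)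
    then show "U r t (j - K r) * fh A r (bot r + t) x = U r t (j - K r) * fh B r (bot r + t) x" by simp
  qed
  then show "ghat U A r j x = ghat U B r j x \<or> r \<notin> shrink j" by blast
  show "newcol U A j x = newcol U B j x"
    unfolding newcol_def by (rule sum.cong[OF refl]) (use g in simp)
qed

lemma bld_hermf: "hermf (bld U j)"
proof (induction j)
  case (Suc j)
  then have h: "cnj (bld U j x y) = bld U j y x" for x y by (simp add: hermf_def)
  show ?case unfolding hermf_def bld.simps by (intro allI) (rename_tac x y, case_tac "x < j"; case_tac "y < j"; case_tac "x = j"; case_tac "y = j"; simp add: h)
qed (simp add: hermf_def)

lemma bld_agree: "i \<le> j \<Longrightarrow> agree i (bld U j) (bld U i)"
proof (induction j)
  case (Suc j)
  show ?case
  proof (cases "i = Suc j")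
    case False
    then have "agree i (bld U j) (bld U i)" using Suc by simp
    then show ?thesis using False Suc.prems by (auto simp: agree_def)
  qed (simp add: agree_def)
qed (simp add: agree_def)

lemma bld_diag: "j < n \<Longrightarrow> bld U n j j = complex_of_real (c j)"
  using bld_agree[of "Suc j" n U] by (simp add: agree_def)

lemma bld_col: "j < n \<Longrightarrow> x < j \<Longrightarrow> bld U n x j = newcol U (bld U n) j x"
  using bld_agree[of "Suc j" n U] newcol_cong(2)[of j "bld U j" "bld U n" U x] bld_agree[of j n U]
  by (simp add: agree_def)

lemma bot_L: "r < s \<Longrightarrow> bot r + L r = K r + 1" "r < s \<Longrightarrow> top r + 1 = K r + L r"
  using L_pos[of r] I_L[of r] I_pos[of r] by (auto simp: bot_def top_def)

lemma sum_bot_K: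
  assumes "r < s"
  shows "(\<Sum>t\<in>{bot r..K r}. h t) = (\<Sum>t<L r. h (bot r + t))"
proof -
  have "{bot r..K r} = {0 + bot r..<L r + bot r}" using bot_L(1)[OF assms] by auto
  then show ?thesis
    by (simp only: sum.shift_bounds_nat_ivl atLeast0LessThan add.commute)
qed

text \<open>Induction on the columns. As long as the vectors that left were the prescribed ones, the
  next prescribed vector still lies in the remaining eigenspace. The component of the new column is
  then that unit vector times \<open>sqrt (w j r)\<close>, which has the prescribed norm.\<close>

lemma bld_fib:
  assumes U: "ortho U"
  shows "fib (bld U n)" "r < s \<Longrightarrow> K r \<le> j \<Longrightarrow> j \<le> top r \<Longrightarrow> j < n \<Longrightarrow> gh (bld U n) r j x = ghat U (bld U n) r j x"
proof -
  define A where "A = bld U n"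
  have herm: "hermf A" by (simp add: A_def bld_hermf)
  have main: "fibJ J A \<and> (\<forall>j<J. \<forall>r\<in>shrink j. \<forall>x. gh A r j x = ghat U A r j x)" if "J \<le> n" for J
    using that
  proof (induction J)
    case 0
    then show ?case using herm by (simp add: fibJ_def)
  next
    case (Suc j)
    then have fJ: "fibJ j A" and gJ: "\<And>i r x. i < j \<Longrightarrow> r \<in> shrink i \<Longrightarrow> gh A r i x = ghat U A r i x" and jn: "j < n" by auto
    have jn': "j \<le> n" using jn by simp
    note pre = fibJ_pre[OF fJ order_refl]
    define \<beta> where "\<beta> q = ghat U A q j" for q
    have fix\<beta>: "app (P A j q) (\<beta> q) x = \<beta> q x" and norm\<beta>: "ip (\<beta> q) (\<beta> q) = 1" if q: "q \<in> shrink j" for q x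
    proof -
      have qs: "q < s" "K q \<le> j" "j \<le> top q" using q by (auto simp: shrink_def)
      have tr: "bot q + t \<le> K q" if "t < L q" for t using bot_L(1)[OF qs(1)] that by simp
      have fo: "ip (fh A q (bot q + t)) (fh A q (bot q + t')) = (if t = t' then 1 else 0)" if "t < L q" "t' < L q" for t t'
        using fh_orth[OF fJ qs(1), of "bot q + t" "bot q + t'"] tr[OF that(1)] tr[OF that(2)] qs(2) by simp
      have inner: "ip (ghat U A q i) (ghat U A q k) = (\<Sum>t<L q. cnj (U q t (i - K q)) * U q t (k - K q))" for i k
      proof -
        have "ip (ghat U A q i) (ghat U A q k) = (\<Sum>t<L q. \<Sum>t'<L q. cnj (U q t (i - K q)) * (U q t' (k - K q) * (if t = t' then 1 else 0)))"
          unfolding ghat_def ip_sum_left ip_sum_right sum_distrib_left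
          by (intro sum.cong refl) (simp add: fo)
        also have "\<dots> = (\<Sum>t<L q. \<Sum>t'<L q. if t = t' then cnj (U q t (i - K q)) * U q t' (k - K q) else 0)"
          by (intro sum.cong refl) simp
        finally show ?thesis by (simp add: sum_if_eq)
      qed
      have orth: "ip (ghat U A q i) (ghat U A q j) = (if i = j then 1 else 0)" if "K q \<le> i" "i \<le> j" for i
      proof -
        have "i - K q < L q" "j - K q < L q" "K q + (i - K q) < n" "K q + (j - K q) < n"
          using that qs jn bot_L(2)[OF qs(1)] by auto
        then have "(\<Sum>t<L q. cnj (U q t (i - K q)) * U q t (j - K q)) = (if i - K q = j - K q then 1 else 0)"
          using U qs(1) unfolding ortho_def by blast
        then show ?thesis using that inner by auto
      qed
      show "ip (\<beta> q) (\<beta> q) = 1" using orth[of j] qs by (simp add: \<beta>_def)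
      have PK: "app (P A (K q) q) (\<beta> q) x = \<beta> q x"
      proof -
        have "app (P A (K q) q) (\<beta> q) x = (\<Sum>t<L q. U q t (j - K q) * app (P A (K q) q) (fh A q (bot q + t)) x)"
          unfolding \<beta>_def ghat_def by (rule app_sum)
        also have "\<dots> = (\<Sum>t<L q. U q t (j - K q) * fh A q (bot q + t) x)"
          by (rule sum.cong[OF refl]) (use P_fh_fix[OF fJ qs(1)] tr qs in simp)
        finally show ?thesis by (simp add: \<beta>_def ghat_def)
      qed
      \<comment> \<open>What row \<open>j\<close> lacks compared with the widest row are the vectors
        that have left; the prescribed vector is orthogonal to all of them.\<close>
      have "app (P A j q) (\<beta> q) x = app (P A (K q) q) (\<beta> q) x - (\<Sum>i\<in>{K q..<j}. gh A q i x * ip (gh A q i) (\<beta> q))"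
      proof -
        have "(\<Sum>z<n. \<Sum>i\<in>{K q..<j}. gh A q i x * cnj (gh A q i z) * v z) = (\<Sum>i\<in>{K q..<j}. \<Sum>z<n. gh A q i x * cnj (gh A q i z) * v z)" for v
          by (rule sum.swap)
        then show ?thesis
          using qs by (subst gh_frame[OF fJ qs(1,2)])
            (simp_all add: app_def ip_def left_diff_distrib sum_subtractf sum_distrib_right sum_distrib_left mult.assoc)
      qed
      also have "(\<Sum>i\<in>{K q..<j}. gh A q i x * ip (gh A q i) (\<beta> q)) = 0"
      proof (rule sum.neutral, rule ballI)
        fix i assume i: "i \<in> {K q..<j}"
        then have "q \<in> shrink i" using qs by (auto simp: shrink_def)
        then have "gh A q i = ghat U A q i" using gJ i by (intro ext) auto
        then show "gh A q i x * ip (gh A q i) (\<beta> q) = 0" using orth[of i] i by (simp add: \<beta>_def)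
      qed
      finally show "app (P A j q) (\<beta> q) x = \<beta> q x" using PK by simp
    qed
    have gvr: "gv A j r x = (if r \<in> shrink j then complex_of_real (sqrt (w j r)) * \<beta> r x else 0)" if r: "r \<in> act j" for r x
    proof -
      have "gv A j r x = (\<Sum>y<j. P A j r x y * newcol U A j y)"
        unfolding comp_def by (rule sum.cong[OF refl]) (use bld_col[OF jn] in \<open>simp add: A_def\<close>)
      also have "\<dots> = app (P A j r) (newcol U A j) x" by (rule app_P[OF fJ order_refl r, symmetric])
      also have "\<dots> = (\<Sum>q\<in>shrink j. complex_of_real (sqrt (w j q)) * app (P A j r) (\<beta> q) x)"
        unfolding newcol_def \<beta>_def by (rule app_sum)
      also have "\<dots> = (\<Sum>q\<in>shrink j. if r = q then complex_of_real (sqrt (w j q)) * \<beta> q x else 0)"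
      proof (rule sum.cong[OF refl])
        fix q assume q: "q \<in> shrink j"
        then have qa: "q \<in> act j" using grow_act by blast
        have "app (P A j q) (\<beta> q) = \<beta> q" using fix\<beta>[OF q] by (intro ext) simp
        then have "app (P A j r) (\<beta> q) x = app (P A j r) (app (P A j q) (\<beta> q)) x" by simp
        then show "complex_of_real (sqrt (w j q)) * app (P A j r) (\<beta> q) x = (if r = q then complex_of_real (sqrt (w j q)) * \<beta> q x else 0)"
          using P_idem[OF fJ order_refl r qa, of "\<beta> q" x] fix\<beta>[OF q] by auto
      qed
      finally show ?thesis by (simp add: sum_if_eq)
    qed
    have \<beta>0: "\<beta> r x = 0" if "r \<in> shrink j" "x \<ge> j" for r x
    proof -
      have ra: "r \<in> act j" using that grow_act by blast
      have "\<beta> r x = (\<Sum>z<j. P A j r x z * \<beta> r z)" using fix\<beta>[OF that(1)] app_P[OF fJ order_refl ra] by simp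
      also have "\<dots> = 0" using pre_resD(2)[OF herm pre jn' ra] that(2) by simp
      finally show ?thesis .
    qed
    have norm: "(\<Sum>x<j. gv A j r x * cnj (gv A j r x)) = complex_of_real (w j r)" if r: "r \<in> act j" for r
    proof (cases "r \<in> shrink j")
      case True
      have w0: "w j r \<ge> 0" using weights0[of j] jn r by (auto simp: weights_def)
      have "(\<Sum>x<j. gv A j r x * cnj (gv A j r x)) = complex_of_real (sqrt (w j r)) * complex_of_real (sqrt (w j r)) * (\<Sum>x<j. cnj (\<beta> r x) * \<beta> r x)"
        by (simp add: gvr[OF r] True sum_distrib_left mult_ac)
      also have "(\<Sum>x<j. cnj (\<beta> r x) * \<beta> r x) = ip (\<beta> r) (\<beta> r)"
        unfolding ip_def by (rule sum.mono_neutral_left) (use jn \<beta>0[OF True] in auto)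
      also have "\<dots> = 1" by (rule norm\<beta>[OF True])
      finally show ?thesis using w0 by (simp add: of_real_mult[symmetric] del: of_real_mult)
    next
      case False
      then have "j < K r" using r by (auto simp: shrink_def act_def)
      then have "w j r = 0" using weight_zero[OF weights0 _ r] jn by simp
      then show ?thesis using False by (simp add: gvr[OF r])
    qed
    have "fibJ (Suc j) A"
      using fJ norm jn bld_diag[of j U] by (auto simp: fibJ_def less_Suc_eq A_def[symmetric])
    moreover have "gh A r j x = ghat U A r j x" if r: "r \<in> shrink j" for r x
    proof -
      have "w j r > 0" using w_pos[OF calculation order_refl r] .
      then show ?thesis using gvr[OF subsetD[OF grow_act(2) r], of x] r by (simp add: gh_def \<beta>_def)
    qed
    ultimately show ?case using gJ by (auto simp: less_Suc_eq)
  qed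
  show "fib (bld U n)" using main[of n] by (simp add: fib_fibJ A_def)
  show "gh (bld U n) r j x = ghat U (bld U n) r j x" if "r < s" "K r \<le> j" "j \<le> top r" "j < n"
    using main[of n] that by (auto simp: A_def shrink_def)
qed

lemma coef_bld:
  assumes U: "ortho U" and r: "r < s" and t: "t < L r" and c: "d < L r" "K r + d < n"
  shows "coef (bld U n) r t d = U r t d"
proof -
  let ?A = "bld U n"
  note f = bld_fib(1)[OF U, unfolded fib_fibJ]
  have "gh ?A r (K r + d) = ghat U ?A r (K r + d)"
    using bot_L(2)[OF r] c by (intro ext bld_fib(2)[OF U r]) auto
  then have "coef ?A r t d = (\<Sum>t'<L r. U r t' d * ip (fh ?A r (bot r + t)) (fh ?A r (bot r + t')))"
    unfolding coef_def by (simp add: ip_sum_right ghat_def[abs_def])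
  also have "\<dots> = (\<Sum>t'<L r. if t = t' then U r t' d else 0)"
  proof (rule sum.cong[OF refl])
    fix t' assume "t' \<in> {..<L r}"
    then have "ip (fh ?A r (bot r + t)) (fh ?A r (bot r + t')) = (if t = t' then 1 else 0)"
      using fh_orth[OF f r, of "bot r + t" "bot r + t'"] bot_L(1)[OF r] t K_le_top[OF r] top_le[OF r] by simp
    then show "U r t' d * ip (fh ?A r (bot r + t)) (fh ?A r (bot r + t')) = (if t = t' then U r t' d else 0)" by simp
  qed
  finally show ?thesis using t by (simp add: sum_if_eq)
qed

lemma gh_coef:
  assumes A: "fib A" and r: "r < s" and j: "K r \<le> j" "j \<le> top r" "j < n"
  shows "gh A r j x = ghat (coef A) A r j x"
proof -
  note f = A[unfolded fib_fibJ]
  have "gh A r j x = (\<Sum>t\<in>{bot r..K r}. ip (fh A r t) (gh A r j) * fh A r t x)"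
    using P_K_gh[OF f r j] fh_expand[OF f r, of "gh A r j" x] j by simp
  then show ?thesis using j by (simp add: sum_bot_K[OF r] ghat_def coef_def)
qed

lemma coef_ortho:
  assumes A: "fib A"
  shows "ortho (coef A)"
  unfolding ortho_def
proof (intro allI impI)
  fix r b c' assume r: "r < s" and b: "b < L r" "K r + b < n" and c': "c' < L r" "K r + c' < n"
  note f = A[unfolded fib_fibJ]
  have top: "K r + b \<le> top r" "K r + c' \<le> top r" using bot_L(2)[OF r] b c' by auto
  have "(if b = c' then 1 else 0) = ip (gh A r (K r + b)) (gh A r (K r + c'))"
    using gh_orth[OF f r, of "K r + b" "K r + c'"] b c' top by simp
  also have "\<dots> = ip (gh A r (K r + b)) (\<lambda>x. \<Sum>t\<in>{bot r..K r}. ip (fh A r t) (gh A r (K r + c')) * fh A r t x)"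
  proof (rule arg_cong[where f="ip _"], rule ext)
    show "gh A r (K r + c') x = (\<Sum>t\<in>{bot r..K r}. ip (fh A r t) (gh A r (K r + c')) * fh A r t x)" for x
      using P_K_gh[OF f r _ top(2) c'(2)] fh_expand[OF f r, of "gh A r (K r + c')" x] c' by simp
  qed
  also have "\<dots> = (\<Sum>t<L r. cnj (coef A r t b) * coef A r t c')"
    unfolding ip_sum_right sum_bot_K[OF r] by (simp add: coef_def ip_cnj mult.commute)
  finally show "(\<Sum>t<L r. cnj (coef A r t b) * coef A r t c') = (if b = c' then 1 else 0)" by simp
qed

lemma bld_cong:
  assumes "\<And>r t d. r < s \<Longrightarrow> t < L r \<Longrightarrow> d < L r \<Longrightarrow> K r + d < n \<Longrightarrow> U r t d = V r t d"
  shows "j \<le> n \<Longrightarrow> bld U j = bld V j"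
proof (induction j)
  case (Suc j)
  have "ghat U B r j x = ghat V B r j x" if "r \<in> shrink j" for B r x
  proof -
    have a: "r < s" "j - K r < L r" "K r + (j - K r) < n"
      using that Suc.prems bot_L(2)[of r] by (auto simp: shrink_def)
    have "U r t (j - K r) = V r t (j - K r)" if t: "t < L r" for t by (rule assms[OF a(1) t a(2,3)])
    then show ?thesis unfolding ghat_def by (intro sum.cong refl) simp
  qed
  then have nc: "newcol U B j x = newcol V B j x" for B x by (simp add: newcol_def cong: sum.cong)
  have e: "bld U j = bld V j" using Suc by simp
  show ?case unfolding bld.simps e nc ..
qed simp

lemma bld_coef:
  assumes A: "fib A"
  shows "j \<le> n \<Longrightarrow> agree j (bld (coef A) j) A"
proof (induction j)
  case (Suc j)
  then have IH: "agree j (bld (coef A) j) A" and jn: "j < n" by auto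
  note f = A[unfolded fib_fibJ]
  have col: "newcol (coef A) (bld (coef A) j) j x = A x j" if x: "x < j" for x
  proof -
    have "newcol (coef A) (bld (coef A) j) j x = newcol (coef A) A j x" by (rule newcol_cong(2)[OF IH])
    also have "\<dots> = (\<Sum>r\<in>shrink j. complex_of_real (sqrt (w j r)) * gh A r j x)"
      unfolding newcol_def by (rule sum.cong[OF refl]) (use gh_coef[OF A] jn in \<open>auto simp: shrink_def\<close>)
    also have "\<dots> = A x j" using col_gh[OF f jn x] by simp
    finally show ?thesis .
  qed
  have "cnj (A x j) = A j x" for x using fibD(1)[OF A] by (simp add: hermf_def)
  then show ?case using IH col fibD(2)[OF A jn] by (auto simp: agree_def less_Suc_eq)
qed (simp add: agree_def)

end

subsection \<open>Completing orthonormal columns to a special unitary matrix\<close>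

definition set_last :: "nat \<Rightarrow> (nat \<Rightarrow> nat \<Rightarrow> complex) \<Rightarrow> (nat \<Rightarrow> complex) \<Rightarrow> complex mat" where
  "set_last l M v = Matrix.mat l l (\<lambda>(t, d). if d < l - 1 then M t d else v t)"

lemma set_last_simps [simp]: "set_last l M v \<in> carrier_mat l l" "dim_row (set_last l M v) = l" "dim_col (set_last l M v) = l"
  "t < l \<Longrightarrow> d < l \<Longrightarrow> set_last l M v $$ (t, d) = (if d < l - 1 then M t d else v t)"
  by (auto simp: set_last_def)

lemma cofactor_set_last: "cofactor (set_last l M u) t (l - 1) = cofactor (set_last l M v) t (l - 1)"
  unfolding cofactor_def
  by (intro arg_cong2[where f="(*)"] refl arg_cong[where f=Determinant.det] eq_matI)
     (auto simp: mat_delete_def)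

lemma det_set_last:
  assumes "l > 0"
  shows "Determinant.det (set_last l M v) = (\<Sum>t<l. v t * cofactor (set_last l M u) t (l - 1))"
  by (subst laplace_expansion_column[of _ l "l - 1"])
     (use assms cofactor_set_last[of l M v _ u] in \<open>auto intro!: sum.cong\<close>)

text \<open>The Gram matrix of the columns is diagonal, with entries 1 except for the squared norm
  of \<open>v\<close> in last place, and its determinant is the squared modulus of the
  determinant.\<close>

lemma norm_det_set_last:
  assumes l: "l > 0"
    and M: "\<And>b d. b < l - 1 \<Longrightarrow> d < l - 1 \<Longrightarrow> (\<Sum>t<l. cnj (M t b) * M t d) = (if b = d then 1 else 0)"
    and v: "\<And>b. b < l - 1 \<Longrightarrow> (\<Sum>t<l. cnj (v t) * M t b) = 0"
  shows "cnj (Determinant.det (set_last l M v)) * Determinant.det (set_last l M v) = (\<Sum>t<l. cnj (v t) * v t)"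
    "i < l \<Longrightarrow> k < l \<Longrightarrow> (mat_adjoint (set_last l M v) * set_last l M v) $$ (i, k) =
      (if i = k then if i < l - 1 then 1 else (\<Sum>t<l. cnj (v t) * v t) else 0)"
proof -
  let ?W = "set_last l M v"
  let ?N = "mat_adjoint ?W * ?W"
  have c: "mat_adjoint ?W \<in> carrier_mat l l" "?N \<in> carrier_mat l l" by auto
  have v': "(\<Sum>t<l. cnj (M t b) * v t) = 0" if "b < l - 1" for b
    using arg_cong[OF v[OF that], of cnj] by (simp add: mult.commute)
  show ent: "?N $$ (i, k) = (if i = k then if i < l - 1 then 1 else (\<Sum>t<l. cnj (v t) * v t) else 0)"
    if ik: "i < l" "k < l" for i k
  proof -
    have "?N $$ (i, k) = (\<Sum>t<l. cnj (?W $$ (t, i)) * ?W $$ (t, k))"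
      unfolding index_mult_mat_sum[OF c(1) set_last_simps(1) ik] by (rule sum.cong) (use ik in auto)
    also have "\<dots> = (\<Sum>t<l. cnj (if i < l - 1 then M t i else v t) * (if k < l - 1 then M t k else v t))"
      by (rule sum.cong) (use ik in auto)
    also have "\<dots> = (if i = k then if i < l - 1 then 1 else (\<Sum>t<l. cnj (v t) * v t) else 0)"
      by (cases "i < l - 1"; cases "k < l - 1") (use M v v' ik in auto)
    finally show ?thesis .
  qed
  have "upper_triangular ?N" using ent by (auto simp: upper_triangular_def)
  then have "Determinant.det ?N = prod_list (diag_mat ?N)" by (rule det_upper_triangular[OF _ c(2)])
  also have "\<dots> = (\<Prod>i<l. ?N $$ (i, i))"
    by (simp add: diag_mat_def prod.list_conv_set_nth atLeast0LessThan)
  also have "\<dots> = (\<Prod>i<l. if i < l - 1 then 1 else (\<Sum>t<l. cnj (v t) * v t))"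
    by (rule prod.cong) (use ent in auto)
  also have "\<dots> = (\<Sum>t<l. cnj (v t) * v t)" using l by (cases l) auto
  finally show "cnj (Determinant.det ?W) * Determinant.det ?W = (\<Sum>t<l. cnj (v t) * v t)"
    using det_mult[OF c(1) set_last_simps(1)] det_mat_adjoint[of ?W l] by simp
qed

text \<open>The conjugated cofactors form a generalised cross product of the given columns. It is
  orthogonal to them, since a determinant with a repeated column vanishes, and makes the determinant
  equal to its own squared norm \<open>\<delta>\<close>. The Gram determinant gives
  \<open>\<delta>\<^sup>2 = \<delta>\<close>, so it remains to exclude 0.\<close>

lemma set_last_cofactor_SU:
  assumes l: "l > 0"
    and M: "\<And>b d. b < l - 1 \<Longrightarrow> d < l - 1 \<Longrightarrow> (\<Sum>t<l. cnj (M t b) * M t d) = (if b = d then 1 else 0)"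
  shows "set_last l M (\<lambda>t. cnj (cofactor (set_last l M (\<lambda>_. 0)) t (l - 1))) \<in> SU l"
proof -
  define C where "C t = cofactor (set_last l M (\<lambda>_. 0)) t (l - 1)" for t
  let ?W = "set_last l M (\<lambda>t. cnj (C t))"
  have det: "Determinant.det (set_last l M v) = (\<Sum>t<l. v t * C t)" for v
    unfolding C_def by (rule det_set_last[OF l])
  have orth: "(\<Sum>t<l. M t b * C t) = 0" if b: "b < l - 1" for b
  proof -
    have "col (set_last l M (\<lambda>t. M t b)) b = col (set_last l M (\<lambda>t. M t b)) (l - 1)"
      by (rule eq_vecI) (use b in auto)
    then have "Determinant.det (set_last l M (\<lambda>t. M t b)) = 0"
      by (intro det_identical_columns[of _ l b "l - 1"]) (use b in auto)
    then show ?thesis using det by simp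
  qed
  define \<delta> where "\<delta> = (\<Sum>t<l. cnj (C t) * C t)"
  have o: "(\<Sum>t<l. cnj (cnj (C t)) * M t b) = 0" if "b < l - 1" for b
    using orth[OF that] by (simp add: mult.commute)
  have \<delta>r: "\<delta> = complex_of_real (\<Sum>t<l. (cmod (C t))\<^sup>2)"
    unfolding \<delta>_def of_real_sum complex_norm_square by (simp add: mult.commute)
  have dW: "Determinant.det ?W = \<delta>" using det[of "\<lambda>t. cnj (C t)"] by (simp add: \<delta>_def)
  have "cnj (Determinant.det ?W) * Determinant.det ?W = (\<Sum>t<l. cnj (cnj (C t)) * cnj (C t))"
    by (rule norm_det_set_last(1)[OF l M o])
  also have "\<dots> = \<delta>" by (simp add: \<delta>_def mult.commute)
  finally have "cnj \<delta> * \<delta> = \<delta>" by (simp only: dW)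
  moreover have "cnj \<delta> = \<delta>" unfolding \<delta>r by simp
  moreover have "\<delta> \<noteq> 0"
  proof
    assume "\<delta> = 0"
    then have "(\<Sum>t<l. C t * cnj (C t)) = 0" by (simp add: \<delta>_def mult.commute)
    then have C0: "C t = 0" if "t < l" for t using sum_norm_zeroD[of C l t] that by simp
    \<comment> \<open>With last column 0 the matrix is singular, so some \<open>v \<noteq> 0\<close>
      annihilates the given columns. Its conjugate as last column has Gram determinant equal to the
      squared norm of \<open>v\<close>, but determinant 0 if all cofactors vanish.\<close>
    let ?N = "transpose_mat (set_last l M (\<lambda>_. 0))"
    have "Determinant.det ?N = 0" using det_transpose[of "set_last l M (\<lambda>_. 0)" l] det[of "\<lambda>_. 0"] by simp
    then obtain v where v: "v \<in> carrier_vec l" "v \<noteq> 0\<^sub>v l" "?N *\<^sub>v v = 0\<^sub>v l"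
      using det_0_iff_vec_prod_zero[of ?N l] by auto
    have vb: "(\<Sum>t<l. M t b * v $ t) = 0" if b: "b < l - 1" for b
    proof -
      have "(?N *\<^sub>v v) $ b = (\<Sum>t<l. M t b * v $ t)"
        using b v(1) by (auto simp: scalar_prod_def atLeast0LessThan intro!: sum.cong)
      then show ?thesis using v(3) b by simp
    qed
    have "cnj (Determinant.det (set_last l M (\<lambda>t. cnj (v $ t)))) * Determinant.det (set_last l M (\<lambda>t. cnj (v $ t))) =
        (\<Sum>t<l. cnj (cnj (v $ t)) * cnj (v $ t))"
      by (rule norm_det_set_last(1)[OF l M]) (use vb in \<open>auto simp: mult.commute\<close>)
    moreover have "Determinant.det (set_last l M (\<lambda>t. cnj (v $ t))) = 0" unfolding det using C0 by simp
    ultimately have "(\<Sum>t<l. v $ t * cnj (v $ t)) = 0" by simp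
    then have "v $ t = 0" if "t < l" for t using sum_norm_zeroD[of "\<lambda>t. v $ t" l t] that by simp
    then have "v = 0\<^sub>v l" using v(1) by (intro eq_vecI) auto
    then show False using v(2) by simp
  qed
  ultimately have \<delta>1: "\<delta> = 1" by simp
  have "mat_adjoint ?W * ?W = 1\<^sub>m l"
  proof (rule eq_matI)
    fix i k assume "i < dim_row (1\<^sub>m l :: complex mat)" "k < dim_col (1\<^sub>m l :: complex mat)"
    then have ik: "i < l" "k < l" by auto
    have "(mat_adjoint ?W * ?W) $$ (i, k) = (if i = k then if i < l - 1 then 1 else (\<Sum>t<l. cnj (cnj (C t)) * cnj (C t)) else 0)"
      by (rule norm_det_set_last(2)[OF l M o ik])
    also have "(\<Sum>t<l. cnj (cnj (C t)) * cnj (C t)) = 1" using \<delta>1 by (simp add: \<delta>_def mult.commute)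
    finally show "(mat_adjoint ?W * ?W) $$ (i, k) = 1\<^sub>m l $$ (i, k)" using ik by simp
  qed auto
  then have "?W * mat_adjoint ?W = 1\<^sub>m l"
    by (intro mat_mult_left_right_inverse[of "mat_adjoint ?W" l]) auto
  then show ?thesis using dW \<delta>1 by (simp add: SU_def C_def)
qed

text \<open>Adjoint, inverse and adjugate coincide for a special unitary matrix. So its last column
  is the one that the cofactor construction restores from the others.\<close>

lemma SU_cofactor:
  assumes U: "U \<in> SU l" and ij: "i < l" "j < l"
  shows "cnj (cofactor U i j) = U $$ (i, j)"
proof -
  note D = SU_D[OF U] and a = adj_mat[OF SU_D(1)[OF U]]
  have aU: "mat_adjoint U \<in> carrier_mat l l" using D by auto
  have "1 \<cdot>\<^sub>m 1\<^sub>m l = (1\<^sub>m l :: complex mat)" by (rule eq_matI) auto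
  then have "mat_adjoint U = mat_adjoint U * (U * adj_mat U)" using a D aU by simp
  also have "\<dots> = adj_mat U" using assoc_mult_mat[OF aU D(1) a(1)] D a by simp
  finally have "mat_adjoint U $$ (j, i) = adj_mat U $$ (j, i)" by simp
  then have "cnj (U $$ (i, j)) = cofactor U i j" using D(1) ij by (simp add: adj_mat_def)
  then show ?thesis by (metis complex_cnj_cnj)
qed

lemma SU_columns:
  assumes U: "U \<in> SU l" and "b < l" "d < l"
  shows "(\<Sum>t<l. cnj (U $$ (t, b)) * U $$ (t, d)) = (if b = d then 1 else 0)"
proof -
  note D = SU_D[OF U]
  have "(mat_adjoint U * U) $$ (b, d) = (\<Sum>t<l. mat_adjoint U $$ (b, t) * U $$ (t, d))"
    by (rule index_mult_mat_sum) (use D assms in auto)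
  also have "\<dots> = (\<Sum>t<l. cnj (U $$ (t, b)) * U $$ (t, d))" by (rule sum.cong) (use D assms in auto)
  finally show ?thesis using D assms by simp
qed

lemma SU_rows:
  assumes U: "U \<in> SU l" and "b < l" "d < l"
  shows "(\<Sum>t<l. U $$ (b, t) * cnj (U $$ (d, t))) = (if b = d then 1 else 0)"
proof -
  note D = SU_D[OF U]
  have "(U * mat_adjoint U) $$ (b, d) = (\<Sum>t<l. U $$ (b, t) * mat_adjoint U $$ (t, d))"
    by (rule index_mult_mat_sum) (use D assms in auto)
  also have "\<dots> = (\<Sum>t<l. U $$ (b, t) * cnj (U $$ (d, t)))" by (rule sum.cong) (use D assms in auto)
  finally show ?thesis using D assms by simp
qed

definition mf :: "(nat \<times> nat \<Rightarrow>\<^sub>0 complex) \<Rightarrow> nat \<Rightarrow> nat \<Rightarrow> complex" where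
  "mf z x y = Poly_Mapping.lookup z (x, y)"

lemma mf_entries: "mf (entries X) x y = (if x < dim_row X \<and> y < dim_col X then X $$ (x, y) else 0)"
  by (simp add: mf_def)

lemma smooth_on_divide_const [smooth]:
  fixes f :: "'a::real_normed_vector \<Rightarrow> complex"
  shows "open S \<Longrightarrow> smooth_on S f \<Longrightarrow> smooth_on S (\<lambda>x. f x / c)"
  unfolding divide_inverse by (intro smooth_on_mult smooth_on_const)

text \<open>The first \<open>s0\<close> diamonds will be the given ones, all others being single
  positions. \<open>e\<close> numbers the diamonds that end before row \<open>n\<close>; each of
  them keeps a phase, so \<open>m\<close> is the dimension of the torus.\<close>

locale gc_param = gc_ref +
  fixes s0 m :: nat and e :: "nat \<Rightarrow> nat"
  assumes s0: "s0 \<le> s" and L1: "s0 \<le> r \<Longrightarrow> r < s \<Longrightarrow> L r = 1"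
    and e: "bij_betw e {..<m} {r. r < s \<and> top r < n}"
begin

text \<open>A unitary matrix splits into one of determinant 1 and a phase of its last column; if \<open>top r = n\<close>, the
  last column of \<open>coef A r\<close> carries no information and is replaced by the one making the determinant 1.\<close>

definition suV where
  "suV A r = set_last (L r) (coef A r) (\<lambda>t. cnj (cofactor (set_last (L r) (coef A r) (\<lambda>_. 0)) t (L r - 1)))"

definition zz where
  "zz A r = (\<Sum>t<L r. cnj (suV A r $$ (t, L r - 1)) * coef A r t (L r - 1))"

definition Phi where
  "Phi x = (\<Sum>r<s0. Poly_Mapping.single r (entries (suV (mf x) r)), \<Sum>i<m. Poly_Mapping.single i (zz (mf x) (e i)))"

text \<open>Recombines the two parts: the phase multiplies the last column only. For a single
  position the determinant 1 part is trivial and at most a phase is left.\<close>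

definition Uof ::
    "(nat, (nat \<times> nat, complex) poly_mapping) poly_mapping \<Rightarrow> (nat, complex) poly_mapping \<Rightarrow>
     nat \<Rightarrow> nat \<Rightarrow> nat \<Rightarrow> complex" where
  "Uof y u r t d = (if r < s0 then Poly_Mapping.lookup (Poly_Mapping.lookup y r) (t, d) else 1) *
     (if d = L r - 1 \<and> top r < n then Poly_Mapping.lookup u (the_inv_into {..<m} e r) else 1)"

definition Psi where
  "Psi p = entries (submat n (bld (Uof (fst p) (snd p)) n))"

definition Fib where "Fib = {X \<in> carrier_mat n n. fib (mf (entries X))}"

definition Target where
  "Target = finprod_set s0 (\<lambda>r. entries ` SU (L r)) \<times> finprod_set m (\<lambda>_. sphere (0 :: complex) 1)"

lemma suV_SU:
  assumes A: "ortho (coef A)" and r: "r < s"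
  shows "suV A r \<in> SU (L r)"
  unfolding suV_def
proof (rule set_last_cofactor_SU)
  show "L r > 0" using L_pos[OF r] by simp
  fix b d assume "b < L r - 1" "d < L r - 1"
  then show "(\<Sum>t<L r. cnj (coef A r t b) * coef A r t d) = (if b = d then 1 else 0)"
    using A r bot_L(2)[OF r] top_le[OF r] unfolding ortho_def by auto
qed

text \<open>If all columns of \<open>coef A r\<close> are constrained, the last columns of
  \<open>coef A r\<close> and of \<open>suV A r\<close> are unit vectors orthogonal to the same
  \<open>L r - 1\<close> columns. Hence they differ by a scalar of modulus 1, namely their inner
  product.\<close>

lemma zz:
  assumes A: "ortho (coef A)" and r: "r < s" "top r < n"
  shows "t < L r \<Longrightarrow> suV A r $$ (t, L r - 1) * zz A r = coef A r t (L r - 1)" "norm (zz A r) = 1"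
proof -
  let ?l = "L r"
  have l: "?l > 0" using L_pos[OF r(1)] by simp
  have V: "suV A r \<in> SU ?l" by (rule suV_SU[OF A r(1)])
  have last: "K r + (?l - 1) < n" using r bot_L(2)[OF r(1)] l by simp
  have ort: "(\<Sum>t<?l. cnj (coef A r t b) * coef A r t d) = (if b = d then 1 else 0)" if "b < ?l" "d < ?l" for b d
    using A r(1) that last unfolding ortho_def by auto
  have inner: "(\<Sum>t<?l. cnj (suV A r $$ (t, d)) * coef A r t (?l - 1)) = (if d = ?l - 1 then zz A r else 0)" if d: "d < ?l" for d
  proof (cases "d = ?l - 1")
    case False
    then have "(\<Sum>t<?l. cnj (suV A r $$ (t, d)) * coef A r t (?l - 1)) = (\<Sum>t<?l. cnj (coef A r t d) * coef A r t (?l - 1))"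
      using d by (intro sum.cong) (auto simp: suV_def)
    then show ?thesis using ort[of d "?l - 1"] d l False by simp
  qed (simp add: zz_def)
  show 1: "suV A r $$ (t, ?l - 1) * zz A r = coef A r t (?l - 1)" if t: "t < ?l" for t
  proof -
    have "suV A r $$ (t, ?l - 1) * zz A r = (\<Sum>d<?l. if ?l - 1 = d then suV A r $$ (t, d) * zz A r else 0)"
      using l by (simp add: sum_if_eq)
    also have "\<dots> = (\<Sum>d<?l. suV A r $$ (t, d) * (\<Sum>t'<?l. cnj (suV A r $$ (t', d)) * coef A r t' (?l - 1)))"
      by (rule sum.cong[OF refl]) (use inner in auto)
    also have "\<dots> = (\<Sum>d<?l. \<Sum>t'<?l. suV A r $$ (t, d) * cnj (suV A r $$ (t', d)) * coef A r t' (?l - 1))"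
      by (simp add: sum_distrib_left mult.assoc)
    also have "\<dots> = (\<Sum>t'<?l. \<Sum>d<?l. suV A r $$ (t, d) * cnj (suV A r $$ (t', d)) * coef A r t' (?l - 1))" by (rule sum.swap)
    also have "\<dots> = (\<Sum>t'<?l. if t = t' then coef A r t' (?l - 1) else 0)"
      by (rule sum.cong[OF refl]) (simp add: sum_distrib_right[symmetric] SU_rows[OF V t])
    finally show ?thesis using t by (simp add: sum_if_eq)
  qed
  have "1 = (\<Sum>t<?l. cnj (coef A r t (?l - 1)) * coef A r t (?l - 1))" using ort[of "?l - 1" "?l - 1"] l by simp
  also have "\<dots> = (\<Sum>t<?l. cnj (suV A r $$ (t, ?l - 1) * zz A r) * (suV A r $$ (t, ?l - 1) * zz A r))"
    by (rule sum.cong[OF refl]) (simp only: 1 lessThan_iff)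
  also have "\<dots> = (\<Sum>t<?l. cnj (suV A r $$ (t, ?l - 1)) * suV A r $$ (t, ?l - 1)) * (zz A r * cnj (zz A r))"
    unfolding sum_distrib_right by (rule sum.cong[OF refl]) (simp add: mult_ac)
  also have "\<dots> = complex_of_real ((norm (zz A r))\<^sup>2)"
    using SU_columns[OF V, of "?l - 1" "?l - 1"] l by (simp only: complex_norm_square) simp
  finally have "(norm (zz A r))\<^sup>2 = 1" by (metis of_real_eq_1_iff)
  then show "norm (zz A r) = 1" using norm_ge_zero[of "zz A r"] by (simp add: power2_eq_1_iff)
qed

lemma inv_e: "r < s \<Longrightarrow> top r < n \<Longrightarrow> the_inv_into {..<m} e r < m \<and> e (the_inv_into {..<m} e r) = r"
  using e f_the_inv_into_f_bij_betw[OF e, of r] the_inv_into_into[of e "{..<m}" r "{..<m}"]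
  by (auto simp: bij_betw_def)

lemma e_D: "i < m \<Longrightarrow> e i < s" "i < m \<Longrightarrow> top (e i) < n" "i < m \<Longrightarrow> the_inv_into {..<m} e (e i) = i"
  using e the_inv_into_f_f[of e "{..<m}" i] by (auto simp: bij_betw_def)

lemma lookup_Phi:
  "Poly_Mapping.lookup (fst (Phi x)) r = (if r < s0 then entries (suV (mf x) r) else 0)"
  "Poly_Mapping.lookup (snd (Phi x)) i = (if i < m then zz (mf x) (e i) else 0)"
proof -
  show "Poly_Mapping.lookup (fst (Phi x)) r = (if r < s0 then entries (suV (mf x) r) else 0)"
    using lookup_sum_single[of "{..<s0}" "\<lambda>i. i" r "\<lambda>r. entries (suV (mf x) r)"]
      lookup_sum_single_notin[of r "\<lambda>i. i" "{..<s0}" "\<lambda>r. entries (suV (mf x) r)"] by (auto simp: Phi_def)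
  show "Poly_Mapping.lookup (snd (Phi x)) i = (if i < m then zz (mf x) (e i) else 0)"
    using lookup_sum_single[of "{..<m}" "\<lambda>i. i" i "\<lambda>i. zz (mf x) (e i)"]
      lookup_sum_single_notin[of i "\<lambda>i. i" "{..<m}" "\<lambda>i. zz (mf x) (e i)"] by (auto simp: Phi_def)
qed

lemma finprod_set_iff: "x \<in> finprod_set k X \<longleftrightarrow>
    (\<forall>i. if i < k then Poly_Mapping.lookup x i \<in> X i else Poly_Mapping.lookup x i = 0)"
  by (auto simp: finprod_set_def in_keys_iff subset_iff)

lemma Phi_Target:
  assumes "fib (mf x)"
  shows "Phi x \<in> Target"
proof -
  note o = coef_ortho[OF assms]
  have "fst (Phi x) \<in> finprod_set s0 (\<lambda>r. entries ` SU (L r))"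
    unfolding finprod_set_iff lookup_Phi using suV_SU[OF o] s0 by auto
  moreover have "snd (Phi x) \<in> finprod_set m (\<lambda>_. sphere 0 1)"
    unfolding finprod_set_iff lookup_Phi using zz(2)[OF o] e_D by auto
  ultimately show ?thesis by (simp add: Target_def mem_Times_iff)
qed

context
  fixes y u
  assumes p: "(y, u) \<in> Target"
begin

private definition "V r = (if r < s0 then dec (L r) (Poly_Mapping.lookup y r) else 1\<^sub>m 1)"

private lemma V_SU: "r < s \<Longrightarrow> V r \<in> SU (L r)"
proof -
  assume r: "r < s"
  show ?thesis
  proof (cases "r < s0")
    case True
    then have "Poly_Mapping.lookup y r \<in> entries ` SU (L r)"
      using p by (auto simp: Target_def finprod_set_iff)
    then obtain U where "U \<in> SU (L r)" "Poly_Mapping.lookup y r = entries U" by blast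
    then show ?thesis using True SU_D(1) by (simp add: V_def)
  next
    case False
    then show ?thesis using L1[of r] r by (simp add: V_def SU_def)
  qed
qed

private definition "ph r d = (if d = L r - 1 \<and> top r < n then Poly_Mapping.lookup u (the_inv_into {..<m} e r) else 1)"

private lemma ph: "r < s \<Longrightarrow> cnj (ph r d) * ph r d = 1"
proof -
  assume r: "r < s"
  have "norm (Poly_Mapping.lookup u i) = 1" if "i < m" for i
    using p that by (auto simp: Target_def finprod_set_def)
  then have "norm (ph r d) = 1" using inv_e[OF r] by (simp add: ph_def)
  then have "ph r d * cnj (ph r d) = 1" by (simp add: complex_norm_square[symmetric])
  then show ?thesis by (simp add: mult.commute)
qed

private lemma Uof_eq: "r < s \<Longrightarrow> t < L r \<Longrightarrow> d < L r \<Longrightarrow> Uof y u r t d = V r $$ (t, d) * ph r d"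
  using L1[of r] by (cases "r < s0") (auto simp: Uof_def V_def ph_def)

lemma Uof_ortho: "ortho (Uof y u)"
  unfolding ortho_def
proof (intro allI impI)
  fix r b d assume r: "r < s" and b: "b < L r" and d: "d < L r" and "K r + b < n" "K r + d < n"
  have "(\<Sum>t<L r. cnj (Uof y u r t b) * Uof y u r t d) = (\<Sum>t<L r. cnj (V r $$ (t, b)) * V r $$ (t, d)) * (cnj (ph r b) * ph r d)"
    unfolding sum_distrib_right by (rule sum.cong[OF refl]) (use r b d in \<open>simp add: Uof_eq\<close>)
  then show "(\<Sum>t<L r. cnj (Uof y u r t b) * Uof y u r t d) = (if b = d then 1 else 0)"
    using SU_columns[OF V_SU[OF r] b d] ph[OF r] by simp
qed

text \<open>The phase does not touch the first \<open>L r - 1\<close> columns, and these determine a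
  special unitary matrix.\<close>

private lemma coef_V:
  assumes r: "r < s"
  shows "suV (bld (Uof y u) n) r = V r"
proof -
  let ?A = "bld (Uof y u) n"
  have first: "coef ?A r t d = V r $$ (t, d)" if "t < L r" "d < L r - 1" for t d
  proof -
    have "coef ?A r t d = Uof y u r t d"
      by (rule coef_bld[OF Uof_ortho r]) (use that bot_L(2)[OF r] top_le[OF r] in auto)
    also have "\<dots> = V r $$ (t, d)" using Uof_eq[OF r] that by (simp add: ph_def)
    finally show ?thesis .
  qed
  have carr: "V r \<in> carrier_mat (L r) (L r)" using SU_D(1)[OF V_SU[OF r]] .
  have eq: "set_last (L r) (coef ?A r) (\<lambda>t. V r $$ (t, L r - 1)) = V r"
  proof (rule eq_matI)
    fix t d assume "t < dim_row (V r)" "d < dim_col (V r)"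
    then have td: "t < L r" "d < L r" using carr by auto
    then show "set_last (L r) (coef ?A r) (\<lambda>t. V r $$ (t, L r - 1)) $$ (t, d) = V r $$ (t, d)"
      using first[of t d] by (cases "d < L r - 1") (auto intro: arg_cong[where f="\<lambda>d. V r $$ (t, d)"])
  qed (use carr in auto)
  have "cnj (cofactor (set_last (L r) (coef ?A r) (\<lambda>_. 0)) t (L r - 1)) = V r $$ (t, L r - 1)" if t: "t < L r" for t
  proof -
    have "cofactor (set_last (L r) (coef ?A r) (\<lambda>_. 0)) t (L r - 1) = cofactor (V r) t (L r - 1)"
      by (subst eq[symmetric]) (rule cofactor_set_last)
    then show ?thesis using SU_cofactor[OF V_SU[OF r] t, of "L r - 1"] t by simp
  qed
  then have "suV ?A r = set_last (L r) (coef ?A r) (\<lambda>t. V r $$ (t, L r - 1))"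
    unfolding suV_def by (intro eq_matI) auto
  then show ?thesis using eq by simp
qed

private lemma zz_u:
  assumes i: "i < m"
  shows "zz (bld (Uof y u) n) (e i) = Poly_Mapping.lookup u i"
proof -
  let ?A = "bld (Uof y u) n" let ?r = "e i" let ?d = "L ?r - 1"
  have r: "?r < s" "top ?r < n" using e_D i by auto
  have l: "?d < L ?r" using L_pos[OF r(1)] by simp
  have "zz ?A ?r = (\<Sum>t<L ?r. cnj (V ?r $$ (t, ?d)) * (V ?r $$ (t, ?d) * ph ?r ?d))"
    unfolding zz_def coef_V[OF r(1)]
  proof (rule sum.cong[OF refl])
    fix t assume t: "t \<in> {..<L ?r}"
    have "coef ?A ?r t ?d = Uof y u ?r t ?d"
      by (rule coef_bld[OF Uof_ortho r(1)]) (use t l bot_L(2)[OF r(1)] r in auto)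
    then show "cnj (V ?r $$ (t, ?d)) * coef ?A ?r t ?d = cnj (V ?r $$ (t, ?d)) * (V ?r $$ (t, ?d) * ph ?r ?d)"
      using Uof_eq[OF r(1) _ l, of t] t by simp
  qed
  also have "\<dots> = (\<Sum>t<L ?r. cnj (V ?r $$ (t, ?d)) * V ?r $$ (t, ?d)) * ph ?r ?d"
    by (simp add: sum_distrib_right mult.assoc)
  also have "\<dots> = ph ?r ?d" using SU_columns[OF V_SU[OF r(1)] l l] by simp
  finally show ?thesis using r e_D(3)[OF i] by (simp add: ph_def)
qed

lemma bld_outside: "\<not> (x < j \<and> y' < j) \<Longrightarrow> bld U j x y' = 0"
  by (cases j) auto

lemma mf_Psi: "mf (Psi (y, u)) = bld (Uof y u) n"
  using bld_outside by (intro ext) (simp add: Psi_def mf_entries)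

lemma Psi_Fib: "Psi (y, u) \<in> entries ` Fib"
proof -
  have "submat n (bld (Uof y u) n) \<in> Fib"
    using mf_Psi bld_fib(1)[OF Uof_ortho] by (simp add: Fib_def Psi_def)
  then show ?thesis by (simp add: Psi_def)
qed

lemma Phi_Psi: "Phi (Psi (y, u)) = (y, u)"
proof -
  have 1: "Poly_Mapping.lookup (fst (Phi (Psi (y, u)))) r = Poly_Mapping.lookup y r" for r
  proof (cases "r < s0")
    case True
    then have "Poly_Mapping.lookup y r \<in> entries ` SU (L r)"
      using p by (auto simp: Target_def finprod_set_iff)
    then obtain U where "U \<in> SU (L r)" "Poly_Mapping.lookup y r = entries U" by blast
    then have "entries (V r) = Poly_Mapping.lookup y r" using True SU_D(1) by (simp add: V_def)
    then show ?thesis unfolding lookup_Phi mf_Psi using True coef_V s0 by simp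
  next
    case False
    then show ?thesis using p by (auto simp: lookup_Phi Target_def finprod_set_iff)
  qed
  have 2: "Poly_Mapping.lookup (snd (Phi (Psi (y, u)))) i = Poly_Mapping.lookup u i" for i
    using zz_u[of i] p unfolding lookup_Phi mf_Psi by (auto simp: Target_def finprod_set_iff)
  have "fst (Phi (Psi (y, u))) = y" by (rule poly_mapping_eqI) (rule 1)
  moreover have "snd (Phi (Psi (y, u))) = u" by (rule poly_mapping_eqI) (rule 2)
  ultimately show ?thesis by (simp add: prod_eq_iff)
qed

end

lemma Psi_Phi:
  assumes X: "X \<in> Fib"
  shows "Psi (Phi (entries X)) = entries X"
proof -
  let ?A = "mf (entries X)"
  have A: "fib ?A" and carr: "X \<in> carrier_mat n n" using X by (auto simp: Fib_def)
  note o = coef_ortho[OF A]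
  have U: "Uof (fst (Phi (entries X))) (snd (Phi (entries X))) r t d = coef ?A r t d"
    if r: "r < s" and t: "t < L r" and d: "d < L r" "K r + d < n" for r t d
  proof -
    have V: "(if r < s0 then Poly_Mapping.lookup (Poly_Mapping.lookup (fst (Phi (entries X))) r) (t, d) else 1) = suV ?A r $$ (t, d)"
    proof (cases "r < s0")
      case True
      then show ?thesis using t d by (simp add: lookup_Phi suV_def)
    next
      case False
      then have l: "L r = 1" using L1[of r] r by simp
      have "suV ?A r $$ (0, 0) = 1" using l SU_D(4)[OF suV_SU[OF o r]] SU_D(1)[OF suV_SU[OF o r]]
        by (simp add: det_single)
      then show ?thesis using False t d l by simp
    qed
    show ?thesis
    proof (cases "d = L r - 1")
      case True
      then have top: "top r < n" using d bot_L(2)[OF r] by simp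
      have "Poly_Mapping.lookup (snd (Phi (entries X))) (the_inv_into {..<m} e r) = zz ?A r"
        using inv_e[OF r top] by (simp add: lookup_Phi)
      then show ?thesis unfolding Uof_def V using zz(1)[OF o r top t] True top by simp
    next
      case False
      then have "d < L r - 1" using d by simp
      then show ?thesis unfolding Uof_def V using t d False by (simp add: suV_def)
    qed
  qed
  have "bld (Uof (fst (Phi (entries X))) (snd (Phi (entries X)))) n = bld (coef ?A) n"
    by (rule bld_cong[OF U order_refl])
  moreover have "submat n (bld (coef ?A) n) = X"
    using bld_coef[OF A order_refl] carr by (intro eq_matI) (auto simp: agree_def mf_entries)
  ultimately show ?thesis by (simp add: Psi_def)
qed

end

subsection \<open>Smoothness of the parametrisation\<close>

context gc_param
begin

context
  fixes S :: "'z::real_normed_vector set"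
  assumes S: "open S"
begin

lemma smooth_comp:
  assumes "\<And>x y. smooth_on S (\<lambda>z. A z x y)" "\<And>r x y. smooth_on S (\<lambda>z. M z r x y)"
  shows "smooth_on S (\<lambda>z. comp (M z) (A z) j r x)"
  unfolding comp_def by (intro smooth_on_sum smooth_on_mult assms S)

lemma smooth_fvec:
  assumes "\<And>x y. smooth_on S (\<lambda>z. A z x y)" "\<And>r x y. smooth_on S (\<lambda>z. M z r x y)"
  shows "smooth_on S (\<lambda>z. fvec (M z) (A z) j r x)"
  unfolding fvec_def
  by (cases "x < j"; cases "x = j")
     (auto intro!: smooth_on_sum smooth_on_divide_const smooth_comp[OF assms] smooth_on_const S)

text \<open>Only constants taken from the reference point are divided by, so smoothness holds on all
  of \<open>S\<close> without a condition on \<open>A z\<close>.\<close>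

lemma smooth_P:
  assumes A: "\<And>x y. smooth_on S (\<lambda>z. A z x y)"
  shows "smooth_on S (\<lambda>z. P (A z) j r x y)"
proof (induction j arbitrary: r x y)
  case 0
  show ?case by (simp add: smooth_on_const S)
next
  case (Suc j)
  have c: "smooth_on S (\<lambda>z. gv (A z) j r x)" and f: "smooth_on S (\<lambda>z. fv (A z) j r x)" for r x
    by (rule smooth_comp[OF A Suc.IH], rule smooth_fvec[OF A Suc.IH])
  show ?case
  proof (cases "r \<in> grow (Suc j)")
    case True
    then show ?thesis unfolding proj.simps step_def
      by (simp only: if_True) (intro smooth_on_add smooth_on_divide_const smooth_on_mult smooth_on_cnj f Suc.IH S)
  next
    case False
    then show ?thesis unfolding proj.simps step_def
      by (cases "r \<in> shrink j"; simp only: if_True if_False)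
         (intro smooth_on_diff smooth_on_divide_const smooth_on_mult smooth_on_cnj c Suc.IH S)+
  qed
qed

lemma smooth_fh:
  assumes A: "\<And>x y. smooth_on S (\<lambda>z. A z x y)"
  shows "smooth_on S (\<lambda>z. fh (A z) r t x)"
  unfolding fh_def by (intro smooth_on_divide_const smooth_fvec[OF A smooth_P[OF A]] S)

lemma smooth_coef:
  assumes A: "\<And>x y. smooth_on S (\<lambda>z. A z x y)"
  shows "smooth_on S (\<lambda>z. coef (A z) r t d)"
  unfolding coef_def ip_def gh_def
  by (intro smooth_on_sum smooth_on_mult smooth_on_cnj smooth_fh[OF A] smooth_on_divide_const smooth_comp[OF A smooth_P[OF A]] S)

lemma smooth_set_last:
  assumes "\<And>t d. smooth_on S (\<lambda>z. M z t d)" "\<And>t. t < l \<Longrightarrow> smooth_on S (\<lambda>z. v z t)"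
  shows "smooth_mat_on l S (\<lambda>z. set_last l (M z) (v z))"
proof (rule smooth_mat_onI)
  fix t d assume "t < l" "d < l"
  then show "smooth_on S (\<lambda>z. set_last l (M z) (v z) $$ (t, d))"
    using assms by (cases "d < l - 1") simp_all
qed simp

lemma smooth_suV:
  assumes A: "\<And>x y. smooth_on S (\<lambda>z. A z x y)"
  shows "smooth_mat_on (L r) S (\<lambda>z. suV (A z) r)"
  unfolding suV_def
proof (rule smooth_set_last[OF smooth_coef[OF A]])
  fix t assume t: "t < L r"
  show "smooth_on S (\<lambda>z. cnj (cofactor (set_last (L r) (coef (A z) r) (\<lambda>_. 0)) t (L r - 1)))"
    by (rule smooth_on_cnj[OF S], rule smooth_on_cofactor[OF S _ t])
       (use t in \<open>auto intro!: smooth_set_last smooth_coef[OF A] smooth_on_const S\<close>)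
qed

lemma smooth_zz:
  assumes A: "\<And>x y. smooth_on S (\<lambda>z. A z x y)"
  shows "smooth_on S (\<lambda>z. zz (A z) r)"
  unfolding zz_def
proof (intro smooth_on_sum smooth_on_mult smooth_on_cnj smooth_coef[OF A] S)
  fix t assume "t \<in> {..<L r}"
  then show "smooth_on S (\<lambda>z. suV (A z) r $$ (t, L r - 1))"
    by (intro smooth_mat_on_index[OF smooth_suV[OF A]]) auto
qed

lemma smooth_bld:
  assumes U: "\<And>r t d. smooth_on S (\<lambda>z. U z r t d)"
  shows "smooth_on S (\<lambda>z. bld (U z) j x y)"
proof (induction j arbitrary: x y)
  case 0
  show ?case by (simp add: smooth_on_const S)
next
  case (Suc j)
  have n: "smooth_on S (\<lambda>z. newcol (U z) (bld (U z) j) j x)" for x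
    unfolding newcol_def ghat_def by (intro smooth_on_sum smooth_on_mult smooth_on_const U smooth_fh[OF Suc.IH] S)
  consider "x < j \<and> y < j" | "\<not> (x < j \<and> y < j)" "x < j \<and> y = j"
    | "\<not> (x < j \<and> y < j)" "\<not> (x < j \<and> y = j)" "x = j \<and> y < j"
    | "\<not> (x < j \<and> y < j)" "\<not> (x < j \<and> y = j)" "\<not> (x = j \<and> y < j)" by blast
  then show ?case
  proof cases
    case 1
    then show ?thesis unfolding bld.simps by (simp add: Suc.IH)
  next
    case 2
    then show ?thesis unfolding bld.simps by (auto simp: n)
  next
    case 3
    then show ?thesis unfolding bld.simps by (auto intro!: smooth_on_cnj n S)
  next
    case 4
    then show ?thesis unfolding bld.simps by (auto intro!: smooth_on_const S)
  qed
qed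

end

lemma smooth_mf: "smooth_on UNIV (\<lambda>z. mf z x y)"
  unfolding mf_def by (intro smooth_on_lookup smooth_on_ident open_UNIV)

lemma smooth_Phi: "smooth_on UNIV Phi"
  unfolding Phi_def[abs_def]
  by (intro smooth_on_Pair smooth_on_sum smooth_on_single open_UNIV smooth_zz[OF open_UNIV smooth_mf]
      smooth_mat_on_entries[OF open_UNIV smooth_suV[OF open_UNIV smooth_mf]])

lemma smooth_Uof: "smooth_on UNIV (\<lambda>p. Uof (fst p) (snd p) r t d)"
proof -
  have "smooth_on UNIV (\<lambda>p :: (nat, (nat \<times> nat, complex) poly_mapping) poly_mapping \<times> (nat, complex) poly_mapping.
      if r < s0 then Poly_Mapping.lookup (Poly_Mapping.lookup (fst p) r) (t, d) else 1)"
    by (cases "r < s0") (auto intro!: smooth_on_lookup smooth_on_fst smooth_on_ident smooth_on_const)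
  moreover have "smooth_on UNIV (\<lambda>p :: (nat, (nat \<times> nat, complex) poly_mapping) poly_mapping \<times> (nat, complex) poly_mapping.
      if d = L r - 1 \<and> top r < n then Poly_Mapping.lookup (snd p) (the_inv_into {..<m} e r) else 1)"
    by (cases "d = L r - 1 \<and> top r < n") (auto intro!: smooth_on_lookup smooth_on_snd smooth_on_ident smooth_on_const)
  ultimately show ?thesis unfolding Uof_def by (rule smooth_on_mult[OF open_UNIV])
qed

lemma smooth_Psi: "smooth_on UNIV Psi"
  unfolding Psi_def[abs_def]
proof (rule smooth_mat_on_entries[OF open_UNIV smooth_mat_onI])
  fix i k assume "i < n" "k < n"
  then show "smooth_on UNIV (\<lambda>p. submat n (bld (Uof (fst p) (snd p)) n) $$ (i, k))"
    using smooth_bld[OF open_UNIV smooth_Uof] by simp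
qed simp

lemma Fib_mf: "X \<in> Fib \<Longrightarrow> fib (mf (entries X))" "X \<in> Fib \<Longrightarrow> X \<in> carrier_mat n n"
  by (auto simp: Fib_def)

lemma diffeomorphic_Fib: "diffeomorphic (entries ` Fib) Target"
proof (rule diffeomorphicI[where f=Phi and g=Psi])
  show "smooth_map_on (entries ` Fib) Phi" by (rule smooth_map_onI[OF open_UNIV smooth_Phi]) auto
  show "smooth_map_on Target Psi" by (rule smooth_map_onI[OF open_UNIV smooth_Psi]) auto
  show "Phi x \<in> Target" if "x \<in> entries ` Fib" for x using that Phi_Target Fib_mf by auto
  show "Psi q \<in> entries ` Fib" if "q \<in> Target" for q using that Psi_Fib by (cases q) auto
  show "Psi (Phi x) = x" if "x \<in> entries ` Fib" for x using that Psi_Phi by auto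
  show "Phi (Psi q) = q" if "q \<in> Target" for q using that Phi_Psi by (cases q) auto
qed

lemma m_eq: "m + n = s"
  using card_top_less bij_betw_same_card[OF e] by simp

text \<open>The squares of all sizes add up to \<open>n * (n + 1) / 2\<close>. Subtracting 1 for
  each of the \<open>m + n\<close> diamonds and adding \<open>m\<close> for the phases leaves
  \<open>n * (n - 1) / 2\<close>; single positions contribute 0 to the sum.\<close>

lemma sum_L: "(\<Sum>r<s0. ((L r)\<^sup>2 - 1)) + m = n * (n - 1) div 2"
proof -
  have "(\<Sum>r<s. (L r)\<^sup>2) = (\<Sum>r<s. ((L r)\<^sup>2 - 1) + 1)"
    using L_pos by (intro sum.cong) (auto simp: Suc_le_eq power2_eq_square)
  also have "\<dots> = (\<Sum>r<s. ((L r)\<^sup>2 - 1)) + s" unfolding sum.distrib by simp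
  also have "(\<Sum>r<s. ((L r)\<^sup>2 - 1)) = (\<Sum>r<s0. ((L r)\<^sup>2 - 1))"
    by (rule sum.mono_neutral_right) (use s0 L1 in auto)
  finally have "2 * ((\<Sum>r<s0. ((L r)\<^sup>2 - 1)) + m + n) = n * (n + 1)"
    using sum_squares m_eq by simp
  moreover have "n * (n + 1) = n * (n - 1) + 2 * n" by (cases n) auto
  ultimately have "2 * ((\<Sum>r<s0. ((L r)\<^sup>2 - 1)) + m) = n * (n - 1)" by simp
  then show ?thesis by (metis nonzero_mult_div_cancel_left zero_neq_numeral)
qed

lemma finite_rank_Target: "finite_rank Target"
  unfolding Target_def
  by (intro finite_rank_Times finite_rank_finprod_set finite_rank_SU finite_rank_complex)

lemma submanifold_Fib: "submanifold (n * (n - 1) div 2) (entries ` Fib)"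
proof -
  have "submanifold ((\<Sum>r<s0. ((L r)\<^sup>2 - 1)) + (\<Sum>i<m. 1)) Target"
    unfolding Target_def
    using L_pos s0
    by (intro submanifold_Times submanifold_finprod_set submanifold_SU submanifold_circle finite_rank_SU finite_rank_complex)
       (auto simp: Suc_le_eq)
  then show ?thesis
    using submanifold_diffeomorphic[OF diffeomorphic_Fib _ finite_rank_Target] sum_L by simp
qed

end

section \<open>The fiber is Lagrangian\<close>

text \<open>Clearing denominators turns the left-hand side into a polynomial of degree at most
  \<open>card Q\<close> with more roots than that, so it is zero. Its value at \<open>v q\<close>
  isolates \<open>u q\<close>.\<close>

lemma cauchy_system:
  fixes v :: "nat \<Rightarrow> real" and u :: "nat \<Rightarrow> real"
  assumes fin: "finite Q" "finite R" and inj: "inj_on v Q" "inj_on v R"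
    and ne: "\<And>r q. r \<in> R \<Longrightarrow> q \<in> Q \<Longrightarrow> v r \<noteq> v q" and card: "card R = card Q + 1"
    and eq: "\<And>r. r \<in> R \<Longrightarrow> k + (\<Sum>q\<in>Q. u q / (v r - v q)) = 0"
  shows "k = 0" "q \<in> Q \<Longrightarrow> u q = 0"
proof -
  define p where "p = Polynomial.smult k (\<Prod>q\<in>Q. [:- v q, 1:]) + (\<Sum>q\<in>Q. Polynomial.smult (u q) (\<Prod>q'\<in>Q - {q}. [:- v q', 1:]))"
  have poly_p: "poly p x = k * (\<Prod>q\<in>Q. x - v q) + (\<Sum>q\<in>Q. u q * (\<Prod>q'\<in>Q - {q}. x - v q'))" for x
    by (simp add: p_def poly_sum poly_prod)
  have root: "poly p (v r) = 0" if r: "r \<in> R" for r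
  proof -
    have nz: "v r - v q \<noteq> 0" if "q \<in> Q" for q using ne[OF r that] by simp
    have "u q * (\<Prod>q'\<in>Q - {q}. v r - v q') = (\<Prod>q\<in>Q. v r - v q) * (u q / (v r - v q))" if "q \<in> Q" for q
      using nz[OF that] fin that by (simp add: prod.remove[of Q q])
    then have "poly p (v r) = (\<Prod>q\<in>Q. v r - v q) * (k + (\<Sum>q\<in>Q. u q / (v r - v q)))"
      unfolding poly_p by (simp add: distrib_left sum_distrib_left)
    then show ?thesis using eq[OF r] by simp
  qed
  have deg: "degree (\<Prod>q\<in>Z. [:- v q, 1:]) \<le> card Z" for Z
    using degree_prod_sum_le[of Z "\<lambda>q. [:- v q, 1:]"] by (cases "finite Z") auto
  have "degree p \<le> card Q"
    unfolding p_def
  proof (rule degree_add_le)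
    show "degree (Polynomial.smult k (\<Prod>q\<in>Q. [:- v q, 1:])) \<le> card Q" by (rule order_trans[OF degree_smult_le deg])
    show "degree (\<Sum>q\<in>Q. Polynomial.smult (u q) (\<Prod>q'\<in>Q - {q}. [:- v q', 1:])) \<le> card Q"
    proof (rule degree_sum_le[OF fin(1)])
      fix q assume "q \<in> Q"
      have "degree (Polynomial.smult (u q) (\<Prod>q'\<in>Q - {q}. [:- v q', 1:])) \<le> card (Q - {q})"
        by (rule order_trans[OF degree_smult_le deg])
      also have "\<dots> \<le> card Q" using fin by (simp add: card_mono)
      finally show "degree (Polynomial.smult (u q) (\<Prod>q'\<in>Q - {q}. [:- v q', 1:])) \<le> card Q" .
    qed
  qed
  moreover have "card R \<le> card {x. poly p x = 0}" if "p \<noteq> 0"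
  proof -
    have "card (v ` R) \<le> card {x. poly p x = 0}"
      by (rule card_mono[OF poly_roots_finite[OF that]]) (use root in auto)
    then show ?thesis by (simp add: card_image[OF inj(2)])
  qed
  moreover have "card {x. poly p x = 0} \<le> degree p" if "p \<noteq> 0" by (rule poly_roots_degree[OF that])
  ultimately have p0: "p = 0" using card by (cases "p = 0") auto
  show u0: "u q = 0" if q: "q \<in> Q" for q
  proof -
    have "(\<Sum>q'\<in>Q. u q' * (\<Prod>i\<in>Q - {q'}. v q - v i)) = u q * (\<Prod>i\<in>Q - {q}. v q - v i)"
      using fin q by (subst sum.remove[of Q q]) (auto intro!: sum.neutral)
    moreover have "(\<Prod>q\<in>Q. v q' - v q) = 0" if "q' \<in> Q" for q' using that fin by auto
    moreover have "(\<Prod>i\<in>Q - {q}. v q - v i) \<noteq> 0" using inj(1) fin q by (auto simp: inj_on_def)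
    ultimately show ?thesis using poly_p[of "v q"] p0 q by simp
  qed
  have "R \<noteq> {}" using card by auto
  then obtain r where "r \<in> R" by blast
  then show "k = 0" using eq[of r] u0 by simp
qed

section \<open>Compressions to eigenspaces, stabilisers, and the decomposition of tangent
  matrices\<close>

context gc_param
begin

definition mm :: "(nat \<Rightarrow> nat \<Rightarrow> complex) \<Rightarrow> (nat \<Rightarrow> nat \<Rightarrow> complex) \<Rightarrow> nat \<Rightarrow> nat \<Rightarrow> complex" where
  "mm B C x y = (\<Sum>z<n. B x z * C z y)"

definition bracket where "bracket B C x y = mm B C x y - mm C B x y"

lemma mm_assoc: "mm (mm B C) E = mm B (mm C E)"
proof (intro ext)
  fix x y
  have "mm (mm B C) E x y = (\<Sum>z<n. \<Sum>u<n. B x u * C u z * E z y)"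
    by (simp add: mm_def sum_distrib_right)
  also have "\<dots> = (\<Sum>u<n. \<Sum>z<n. B x u * C u z * E z y)" by (rule sum.swap)
  finally show "mm (mm B C) E x y = mm B (mm C E) x y" by (simp add: mm_def sum_distrib_left mult.assoc)
qed

lemma mm_scale:
  "(\<And>z. z < n \<Longrightarrow> B x z = k * B' x z) \<Longrightarrow> mm B C x y = k * mm B' C x y"
  "(\<And>z. z < n \<Longrightarrow> C z y = k * C' z y) \<Longrightarrow> mm B C x y = k * mm B C' x y"
  by (simp_all add: mm_def sum_distrib_left mult_ac)

lemma mm_app: "app (mm B C) v x = app B (app C v) x"
proof -
  have "app (mm B C) v x = (\<Sum>z<n. \<Sum>u<n. B x u * C u z * v z)"
    by (simp add: mm_def app_def sum_distrib_right)
  also have "\<dots> = (\<Sum>u<n. \<Sum>z<n. B x u * C u z * v z)" by (rule sum.swap)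
  finally show ?thesis by (simp add: app_def sum_distrib_left mult.assoc)
qed

lemma mm_cong: "(\<And>z. z < n \<Longrightarrow> B x z = B' x z) \<Longrightarrow> (\<And>z. z < n \<Longrightarrow> C z y = C' z y) \<Longrightarrow> mm B C x y = mm B' C' x y"
  unfolding mm_def by (rule sum.cong) auto

lemma mm_sum_left: "mm (\<lambda>x y. \<Sum>i\<in>F. B i x y) C x y = (\<Sum>i\<in>F. mm (B i) C x y)"
  unfolding mm_def sum_distrib_right by (rule sum.swap)

lemma mm_sum_right: "mm C (\<lambda>x y. \<Sum>i\<in>F. B i x y) x y = (\<Sum>i\<in>F. mm C (B i) x y)"
  unfolding mm_def sum_distrib_left by (rule sum.swap)

lemma mm_diff: "mm (\<lambda>x y. B x y - B' x y) C x y = mm B C x y - mm B' C x y"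
  "mm C (\<lambda>x y. B x y - B' x y) x y = mm C B x y - mm C B' x y"
  by (simp_all add: mm_def left_diff_distrib right_diff_distrib sum_subtractf)

lemma mm_zero: "mm (\<lambda>x y. 0) C x y = 0" "mm C (\<lambda>x y. 0) x y = 0"
  by (simp_all add: mm_def)

lemma bracket_sum: "bracket (\<lambda>x y. \<Sum>i\<in>F. B i x y) C x y = (\<Sum>i\<in>F. bracket (B i) C x y)"
  by (simp add: bracket_def mm_sum_left mm_sum_right sum_subtractf)

definition supp :: "nat \<Rightarrow> (nat \<Rightarrow> nat \<Rightarrow> complex) \<Rightarrow> bool" where
  "supp k B \<longleftrightarrow> (\<forall>x y. \<not> (x < k \<and> y < k) \<longrightarrow> B x y = 0)"

text \<open>\<open>KK A\<close> turns out to be the tangent space of the fiber; \<open>HH A j\<close> consists of the skew-Hermitian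
  \<open>j \<times> j\<close> matrices commuting with \<open>A\<^sub>j\<close>.\<close>

definition tangent_mats where
  "tangent_mats A = {Y. hermf Y \<and> supp n Y \<and> (\<forall>j\<le>n. \<forall>r\<in>act j. \<forall>x y. mm (P A j r) (mm Y (P A j r)) x y = 0)}"

text \<open>Commuting with the leading block means being block diagonal with respect to its
  eigenspaces. Written with the projections, the condition is linear in \<open>B\<close> and also
  forces \<open>B\<close> to vanish outside that block.\<close>

definition stabilizer where
  "stabilizer A j = {B. (\<forall>x y. cnj (B x y) = - B y x) \<and> (\<forall>x y. B x y = (\<Sum>r\<in>act j. mm (P A j r) (mm B (P A j r)) x y))}"

lemma supp_mm: "supp n B \<Longrightarrow> supp n C \<Longrightarrow> supp n (mm B C)"
  by (auto simp: supp_def mm_def)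

lemma supp_mono: "supp j B \<Longrightarrow> j \<le> k \<Longrightarrow> supp k B"
  unfolding supp_def by (metis less_le_trans)

lemma stabilizer_eq:
  assumes "B \<in> stabilizer A j"
  shows "B = (\<lambda>x y. \<Sum>r\<in>act j. mm (P A j r) (mm B (P A j r)) x y)"
proof (intro ext)
  fix x y
  have "\<forall>x y. B x y = (\<Sum>r\<in>act j. mm (P A j r) (mm B (P A j r)) x y)"
    using assms unfolding stabilizer_def by blast
  then show "B x y = (\<Sum>r\<in>act j. mm (P A j r) (mm B (P A j r)) x y)" by blast
qed

lemma stabilizer_skew: "B \<in> stabilizer A j \<Longrightarrow> cnj (B x y) = - B y x"
  unfolding stabilizer_def by blast

lemma tangent_mats_diff:
  assumes "Y \<in> tangent_mats A" "Z \<in> tangent_mats A"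
  shows "(\<lambda>x y. Y x y - Z x y) \<in> tangent_mats A"
proof -
  have "mm M (mm (\<lambda>x y. Y x y - Z x y) M) x y = mm M (mm Y M) x y - mm M (mm Z M) x y" for M x y
    by (simp add: mm_def[of M "mm _ _"] mm_diff right_diff_distrib sum_subtractf)
  then show ?thesis using assms by (simp add: tangent_mats_def hermf_def supp_def)
qed

lemma stabilizer_sum:
  assumes "\<And>i. i \<in> F \<Longrightarrow> B i \<in> stabilizer A j"
  shows "(\<lambda>x y. \<Sum>i\<in>F. B i x y) \<in> stabilizer A j"
proof -
  have "mm M (mm (\<lambda>x y. \<Sum>i\<in>F. B i x y) M) x y = (\<Sum>i\<in>F. mm M (mm (B i) M) x y)" for M x y
    unfolding mm_sum_right[symmetric] by (rule mm_cong[OF refl]) (rule mm_sum_left)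
  then have "(\<Sum>r\<in>act j. mm (P A j r) (mm (\<lambda>x y. \<Sum>i\<in>F. B i x y) (P A j r)) x y) = (\<Sum>i\<in>F. B i x y)" for x y
    using assms by (subst sum.swap[of _ F] | simp add: stabilizer_def)+
  moreover have "cnj (\<Sum>i\<in>F. B i x y) = - (\<Sum>i\<in>F. B i y x)" for x y
    unfolding cnj_sum sum_negf[symmetric] by (rule sum.cong[OF refl]) (rule stabilizer_skew[OF assms])
  ultimately show ?thesis unfolding stabilizer_def by (intro CollectI conjI allI) simp_all
qed

lemma tangent_mats_herm: "Y \<in> tangent_mats A \<Longrightarrow> cnj (Y x y) = Y y x"
  by (simp add: tangent_mats_def hermf_def)

context
  fixes A
  assumes A: "fib A" and sA: "supp n A"
begin

private lemma f: "fibJ n A" using A by (simp add: fib_fibJ)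

private lemma herm: "hermf A" by (rule fibD(1)[OF A])

private lemma pre: "j \<le> n \<Longrightarrow> pre_res A j (P A j)" by (rule fib_pre_res[OF A])

private lemma pD:
  assumes "j \<le> n" "r \<in> act j"
  shows "\<not> (x < j \<and> y < j) \<Longrightarrow> P A j r x y = 0" "cnj (P A j r x y) = P A j r y x"
  using pre_resD(2,3)[OF herm pre[OF assms(1)] assms(1) assms(2)] by blast+

lemma mm_PP:
  assumes j: "j \<le> n" and r: "r \<in> act j" and q: "q \<in> act j"
  shows "mm (P A j r) (P A j q) x y = (if r = q then P A j r x y else 0)"
proof -
  have "mm (P A j r) (P A j q) x y = (\<Sum>z<j. P A j r x z * P A j q z y)"
    unfolding mm_def by (rule sum.mono_neutral_right) (use j pD(1)[OF j r] in auto)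
  then show ?thesis using proj_orth[OF herm pre[OF j] j r q] by simp
qed

lemma mm_AP:
  assumes j: "j \<le> n" and r: "r \<in> act j" and x: "x < j"
  shows "mm A (P A j r) x y = complex_of_real (val r) * P A j r x y"
proof -
  have "mm A (P A j r) x y = (\<Sum>z<j. A x z * P A j r z y)"
    unfolding mm_def by (rule sum.mono_neutral_right) (use j pD(1)[OF j r] in auto)
  then show ?thesis using pre_resD(4)[OF herm pre[OF j] j r x] by simp
qed

lemma mm_PA:
  assumes j: "j \<le> n" and r: "r \<in> act j" and y: "y < j"
  shows "mm (P A j r) A x y = complex_of_real (val r) * P A j r x y"
proof -
  have "mm (P A j r) A x y = (\<Sum>z<j. P A j r x z * A z y)"
    unfolding mm_def by (rule sum.mono_neutral_right) (use j pD(1)[OF j r] in auto)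
  then show ?thesis using proj_left_eig[OF herm pre[OF j] j r y] by simp
qed

lemma app_P_sum:
  assumes j: "j \<le> n" and v: "\<And>x. x \<ge> j \<Longrightarrow> v x = 0"
  shows "(\<Sum>r\<in>act j. app (P A j r) v x) = v x"
proof (cases "x < j")
  case True
  have "(\<Sum>r\<in>act j. app (P A j r) v x) = (\<Sum>r\<in>act j. \<Sum>y<j. P A j r x y * v y)"
    by (rule sum.cong[OF refl]) (use app_P[OF f j] in auto)
  then show ?thesis using proj_decomp[OF herm pre[OF j] j True] by simp
next
  case False
  have "app (P A j r) v x = 0" if "r \<in> act j" for r
    using pD(1)[OF j that] False by (simp add: app_def)
  then show ?thesis using v False by simp
qed

lemma stabilizer_supp:
  assumes j: "j \<le> n" and B: "B \<in> stabilizer A j"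
  shows "supp j B"
  unfolding supp_def
proof (intro allI impI)
  fix x y assume xy: "\<not> (x < j \<and> y < j)"
  have "mm (P A j r) (mm B (P A j r)) x y = 0" if "r \<in> act j" for r
    using pD(1)[OF j that] xy by (cases "x < j") (auto simp: mm_def)
  moreover have "B x y = (\<Sum>r\<in>act j. mm (P A j r) (mm B (P A j r)) x y)" using B by (simp add: stabilizer_def)
  ultimately show "B x y = 0" by simp
qed

lemma stabilizer_commute:
  assumes j: "j \<le> n" and B: "B \<in> stabilizer A j" and xy: "x < j" "y < j"
  shows "mm A B x y = mm B A x y"
proof -
  have eB: "B = (\<lambda>x y. \<Sum>r\<in>act j. mm (P A j r) (mm B (P A j r)) x y)" by (rule stabilizer_eq[OF B])
  have "mm A B x y = (\<Sum>r\<in>act j. mm A (mm (P A j r) (mm B (P A j r))) x y)"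
    by (subst eB) (rule mm_sum_right)
  also have "\<dots> = (\<Sum>r\<in>act j. complex_of_real (val r) * mm (P A j r) (mm B (P A j r)) x y)"
  proof (rule sum.cong[OF refl])
    fix r assume r: "r \<in> act j"
    show "mm A (mm (P A j r) (mm B (P A j r))) x y = complex_of_real (val r) * mm (P A j r) (mm B (P A j r)) x y"
      unfolding mm_assoc[symmetric, of A] by (rule mm_scale(1)) (rule mm_AP[OF j r xy(1)])
  qed
  also have "\<dots> = (\<Sum>r\<in>act j. mm (mm (P A j r) (mm B (P A j r))) A x y)"
  proof (rule sum.cong[OF refl])
    fix r assume r: "r \<in> act j"
    show "complex_of_real (val r) * mm (P A j r) (mm B (P A j r)) x y = mm (mm (P A j r) (mm B (P A j r))) A x y"
      unfolding mm_assoc by (intro mm_scale(2)[symmetric] mm_scale(2)) (rule mm_PA[OF j r xy(2)])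
  qed
  also have "\<dots> = mm B A x y" unfolding mm_sum_left[symmetric] eB[symmetric] by (rule refl)
  finally show ?thesis .
qed

lemma bracket_herm:
  assumes "\<And>x y. cnj (B x y) = - B y x"
  shows "hermf (bracket B A)"
  using herm by (simp add: hermf_def bracket_def mm_def assms sum_negf mult.commute)

text \<open>Between two copies of the projection for \<open>r\<close> the block acts as the scalar
  \<open>val r\<close> from either side, so both halves of the commutator have the same
  compression.\<close>

lemma bracket_proj_zero:
  assumes j: "j \<le> n" and r: "r \<in> act j" and B: "supp j B"
  shows "mm (P A j r) (mm (bracket B A) (P A j r)) x y = 0"
proof -
  have 1: "mm B (mm A (P A j r)) z y = complex_of_real (val r) * mm B (P A j r) z y" for z
  proof -
    have "B z u * mm A (P A j r) u y = complex_of_real (val r) * (B z u * P A j r u y)" for u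
      using mm_AP[OF j r, of u y] B by (cases "u < j") (auto simp: supp_def)
    then show ?thesis unfolding mm_def[of B] sum_distrib_left by (intro sum.cong refl)
  qed
  have 2: "mm (P A j r) (mm A C) x y = complex_of_real (val r) * mm (P A j r) C x y"
    if "\<And>z. z \<ge> j \<Longrightarrow> C z y = 0" for C
  proof -
    have "mm (P A j r) A x u * C u y = complex_of_real (val r) * (P A j r x u * C u y)" for u
      using mm_PA[OF j r, of u x] that[of u] by (cases "u < j") auto
    then have "mm (mm (P A j r) A) C x y = complex_of_real (val r) * mm (P A j r) C x y"
      unfolding mm_def[of _ C] sum_distrib_left by (intro sum.cong refl)
    then show ?thesis by (simp add: mm_assoc)
  qed
  have B0: "mm B (P A j r) z y = 0" if "z \<ge> j" for z using B that by (auto simp: mm_def supp_def)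
  have "mm (bracket B A) (P A j r) z y = mm B (mm A (P A j r)) z y - mm A (mm B (P A j r)) z y" for z
    by (simp add: bracket_def[abs_def] mm_diff mm_assoc)
  then have "mm (P A j r) (mm (bracket B A) (P A j r)) x y =
      mm (P A j r) (mm B (mm A (P A j r))) x y - mm (P A j r) (mm A (mm B (P A j r))) x y"
    by (simp add: mm_def[of "P A j r"] right_diff_distrib sum_subtractf)
  also have "mm (P A j r) (mm B (mm A (P A j r))) x y = complex_of_real (val r) * mm (P A j r) (mm B (P A j r)) x y"
    unfolding mm_def[of "P A j r"] 1 by (simp add: sum_distrib_left mult.left_commute)
  also have "mm (P A j r) (mm A (mm B (P A j r))) x y = complex_of_real (val r) * mm (P A j r) (mm B (P A j r)) x y"
    by (rule 2) (rule B0)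
  finally show ?thesis by simp
qed

text \<open>For rows from \<open>j\<close> on, \<open>B\<close> is supported in the leading block
  and \<open>bracket_proj_zero\<close> applies. For smaller rows the commutator vanishes on the
  whole block, because \<open>B\<close> commutes with the leading block of size
  \<open>j\<close>.\<close>

lemma bracket_tangent_mats:
  assumes j: "j \<le> n" and B: "B \<in> stabilizer A j"
  shows "bracket B A \<in> tangent_mats A"
proof -
  have s: "supp j B" by (rule stabilizer_supp[OF j B])
  have z: "bracket B A x y = 0" if "x < j" "y < j" for x y
    using stabilizer_commute[OF j B that] by (simp add: bracket_def)
  have "mm (P A i r) (mm (bracket B A) (P A i r)) x y = 0" if i: "i \<le> n" and r: "r \<in> act i" for i r x y
  proof (cases "j \<le> i")
    case True
    then show ?thesis using bracket_proj_zero[OF i r supp_mono[OF s]] by simp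
  next
    case False
    have "P A i r x u * mm (bracket B A) (P A i r) u y = 0" for u
    proof (cases "u < i")
      case True
      have "bracket B A u v * P A i r v y = 0" for v
        using z[of u v] pD(1)[OF i r, of v y] True False by (cases "v < i") auto
      then show ?thesis by (simp add: mm_def)
    qed (use pD(1)[OF i r] in simp)
    then show ?thesis by (simp add: mm_def[of "P A i r"])
  qed
  moreover have "supp n (bracket B A)"
    using supp_mm[OF supp_mono[OF s j] sA] supp_mm[OF sA supp_mono[OF s j]] by (simp add: supp_def bracket_def)
  moreover have "hermf (bracket B A)" by (rule bracket_herm) (rule stabilizer_skew[OF B])
  ultimately show ?thesis by (simp add: tangent_mats_def)
qed

text \<open>\<open>B\<close> is a sum of its compressions to eigenspaces; under the trace the outer
  projections can be moved cyclically around \<open>Y\<close>, whose compressions vanish.\<close>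

lemma trace_tangent_mats_stabilizer:
  assumes j: "j \<le> n" and B: "B \<in> stabilizer A j" and Y: "Y \<in> tangent_mats A"
  shows "(\<Sum>x<n. mm Y B x x) = 0"
proof -
  have eB: "B = (\<lambda>x y. \<Sum>r\<in>act j. mm (P A j r) (mm B (P A j r)) x y)" by (rule stabilizer_eq[OF B])
  have cyc: "(\<Sum>x<n. mm C E x x) = (\<Sum>x<n. mm E C x x)" for C E
    unfolding mm_def by (subst sum.swap) (simp add: mult.commute)
  have "(\<Sum>x<n. mm Y B x x) = (\<Sum>x<n. \<Sum>r\<in>act j. mm Y (mm (P A j r) (mm B (P A j r))) x x)"
    by (subst eB) (simp add: mm_sum_right)
  also have "\<dots> = (\<Sum>r\<in>act j. \<Sum>x<n. mm Y (mm (P A j r) (mm B (P A j r))) x x)" by (rule sum.swap)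
  also have "\<dots> = 0"
  proof (rule sum.neutral, rule ballI)
    fix r assume r: "r \<in> act j"
    have Z: "mm (P A j r) (mm Y (P A j r)) = (\<lambda>x y. 0)" using Y j r by (auto simp: tangent_mats_def fun_eq_iff)
    have "mm Y (mm (P A j r) (mm B (P A j r))) x x = mm (mm (mm Y (P A j r)) B) (P A j r) x x" for x
      by (simp add: mm_assoc)
    then have "(\<Sum>x<n. mm Y (mm (P A j r) (mm B (P A j r))) x x) = (\<Sum>x<n. mm (P A j r) (mm (mm Y (P A j r)) B) x x)"
      using cyc by simp
    also have "\<dots> = (\<Sum>x<n. mm (mm (P A j r) (mm Y (P A j r))) B x x)" by (simp add: mm_assoc)
    finally show "(\<Sum>x<n. mm Y (mm (P A j r) (mm B (P A j r))) x x) = 0" unfolding Z mm_zero by simp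
  qed
  finally show ?thesis .
qed

text \<open>The source of explicit stabiliser elements: skew combinations of two vectors from one
  eigenspace. Leaving the scalar \<open>a\<close> complex makes real and imaginary parts of inner
  products accessible.\<close>

lemma stabilizer_rank_one:
  assumes j: "j \<le> n" and r: "r \<in> act j"
    and u: "\<And>x. app (P A j r) u x = u x" and v: "\<And>x. app (P A j r) v x = v x"
    and B: "\<And>x y. B x y = a * u x * cnj (v y) - cnj a * v x * cnj (u y)"
  shows "B \<in> stabilizer A j"
proof -
  have sandwich: "mm (P A j q) (mm (\<lambda>x y. u' x * cnj (v' y)) (P A j q)) x y =
      (if q = r then u' x * cnj (v' y) else 0)"
    if q: "q \<in> act j" and u': "\<And>x. app (P A j r) u' x = u' x" and v': "\<And>x. app (P A j r) v' x = v' x" for q x y u' v'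
  proof -
    have qv: "app (P A j q) w x = (if q = r then w x else 0)" if "\<And>x. app (P A j r) w x = w x" for w x
    proof -
      have "app (P A j q) w x = app (P A j q) (app (P A j r) w) x" using that by (simp add: app_def)
      then show ?thesis using P_idem[OF f j q r, of w x] that by auto
    qed
    have "mm (\<lambda>x y. u' x * cnj (v' y)) (P A j q) z y = u' z * cnj (app (P A j q) v' y)" for z
      by (simp add: mm_def app_def sum_distrib_left pD(2)[OF j q] mult_ac)
    then have "mm (P A j q) (mm (\<lambda>x y. u' x * cnj (v' y)) (P A j q)) x y = app (P A j q) u' x * cnj (app (P A j q) v' y)"
      by (simp add: mm_def[of "P A j q"] app_def[of _ u'] sum_distrib_right mult.assoc)
    then show ?thesis unfolding qv[OF u'] qv[OF v'] by simp
  qed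
  have "mm (P A j q) (mm B (P A j q)) x y = a * mm (P A j q) (mm (\<lambda>x y. u x * cnj (v y)) (P A j q)) x y -
      cnj a * mm (P A j q) (mm (\<lambda>x y. v x * cnj (u y)) (P A j q)) x y" for q x y
    by (simp add: mm_def B left_diff_distrib right_diff_distrib sum_subtractf sum_distrib_left mult_ac)
  then have "mm (P A j q) (mm B (P A j q)) x y = (if r = q then B x y else 0)" if "q \<in> act j" for q x y
    using sandwich[OF that u v, of x y] sandwich[OF that v u, of x y] by (auto simp: B mult.assoc)
  then have "(\<Sum>q\<in>act j. mm (P A j q) (mm B (P A j q)) x y) = B x y" for x y
    using r by (simp add: sum_if_eq)
  then show ?thesis by (simp add: stabilizer_def B mult_ac)
qed

text \<open>Testing \<open>Y\<close> against the eigenvectors \<open>fvec\<close> of row \<open>j + 1\<close> gives a homogeneous linear system for its new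
  corner and column, with a bordered Cauchy matrix.\<close>

lemma tangent_mats_step_system:
  assumes Y: "Y \<in> tangent_mats A" and j: "Suc j \<le> n" and Y0: "\<And>x y. x < j \<Longrightarrow> y < j \<Longrightarrow> Y x y = 0"
  defines "X \<equiv> (\<lambda>x. if x < j then Y x j else 0)"
  shows "Y j j = 0" "q \<in> shrink j \<Longrightarrow> Re (ip X (gv A j q)) = 0"
    "r \<in> act j \<Longrightarrow> r \<notin> shrink j \<Longrightarrow> app (P A j r) X x = 0"
proof -
  have jn: "j < n" using j by simp
  have X0: "X x = 0" if "x \<ge> j" for x using that by (simp add: X_def)
  have hyps: "hermf A" "pre_res A j (P A j)" "Suc j \<le> n" "A j j = complex_of_real (c j)"
    "\<And>r. r \<in> act j \<Longrightarrow> (\<Sum>x<j. gv A j r x * cnj (gv A j r x)) = complex_of_real (w j r)"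
    "weights j (c j) (w j)"
    using fibD[OF A] pre[of j] weights0[OF j] jn by simp_all
  have gv0: "gv A j q x = 0" if "q \<in> act j" "q \<notin> shrink j" for q x
    using comp_vanish[OF hyps that(1)] that by (auto simp: shrink_def act_def)
  have gvs: "gv A j q x = 0" if "q \<in> act j" "j \<le> x" for q x
    using comp_zero[OF hyps(1,2) _ that] j by simp
  have f_eq: "fv A j r x = (if x = j then 1 else \<Sum>q\<in>shrink j. gv A j q x / complex_of_real (val r - val q))"
    if r: "r \<in> grow (Suc j)" for r x
  proof -
    have "(\<Sum>q\<in>act j - {r}. gv A j q x / complex_of_real (val r - val q)) =
        (\<Sum>q\<in>shrink j. gv A j q x / complex_of_real (val r - val q))"
      by (rule sum.mono_neutral_right) (use r gv0 subsetD[OF grow_act(2)] in \<open>auto simp: grow_def shrink_def\<close>)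
    moreover have "(\<Sum>q\<in>shrink j. gv A j q x / complex_of_real (val r - val q)) = 0" if "x > j"
      using gvs that subsetD[OF grow_act(2)] by (intro sum.neutral) auto
    ultimately show ?thesis by (auto simp: fvec_def)
  qed
  have f0: "fv A j r x = 0" if "x \<ge> Suc j" for r x using that by (simp add: fvec_def)
  \<comment> \<open>As \<open>Y\<close> vanishes on the leading block, only the last coordinate of
    \<open>fvec\<close> matters, and that is 1.\<close>
  have Yf: "app Y (fv A j r) x = X x" if r: "r \<in> grow (Suc j)" and x: "x < j" for r x
  proof -
    have "app Y (fv A j r) x = (\<Sum>z\<in>{j}. Y x z * fv A j r z)"
      unfolding app_def
    proof (rule sum.mono_neutral_right)
      show "\<forall>z\<in>{..<n} - {j}. Y x z * fv A j r z = 0"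
      proof
        fix z assume "z \<in> {..<n} - {j}"
        then show "Y x z * fv A j r z = 0" using Y0[OF x, of z] f0[of z r] by (cases "z < j") auto
      qed
    qed (use jn in auto)
    then show ?thesis using x f_eq[OF r, of j] by (simp add: X_def)
  qed
  have Yfj: "app Y (fv A j r) j = ip X (fv A j r) + Y j j" if r: "r \<in> grow (Suc j)" for r
  proof -
    have "app Y (fv A j r) j = (\<Sum>z<n. (cnj (X z) * fv A j r z) + (if z = j then Y j j else 0))"
      unfolding app_def
    proof (rule sum.cong[OF refl])
      fix z
      show "Y j z * fv A j r z = cnj (X z) * fv A j r z + (if z = j then Y j j else 0)"
        using f0[of z r] f_eq[OF r, of j] tangent_mats_herm[OF Y, of z j]
        by (cases "z < j"; cases "z = j") (simp_all add: X_def)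
    qed
    then show ?thesis using jn by (simp add: ip_def sum.distrib)
  qed
  have Pf: "app (P A (Suc j) r) (fv A j r) x = fv A j r x" if r: "r \<in> grow (Suc j)" for r x
  proof -
    have rs: "r < s" "bot r \<le> Suc j" "Suc j \<le> K r" using r by (auto simp: grow_def)
    have fe: "fv A j r x = complex_of_real (sqrt (phi (w j) j r)) * fh A r (Suc j) x" for x
    proof -
      have "phi (w j) j r \<ge> 1" by (rule phi_pos[OF hyps])
      then show ?thesis by (simp add: fh_def)
    qed
    have "app (P A (Suc j) r) (fv A j r) x = complex_of_real (sqrt (phi (w j) j r)) * app (P A (Suc j) r) (fh A r (Suc j)) x"
      unfolding app_def fe[abs_def] by (simp add: sum_distrib_left mult_ac)
    then show ?thesis using P_fh_fix[OF f rs(1,2) le_refl rs(3) j, of x] fe[of x] by simp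
  qed
  have PYf: "app (P A (Suc j) r) (app Y (fv A j r)) x = 0" if r: "r \<in> grow (Suc j)" for r x
  proof -
    have ra: "r \<in> act (Suc j)" using r grow_act by blast
    have "app (P A (Suc j) r) (app Y (fv A j r)) x =
        app (P A (Suc j) r) (app Y (app (P A (Suc j) r) (fv A j r))) x"
      using Pf[OF r] by (simp add: app_def)
    also have "\<dots> = app (mm (P A (Suc j) r) (mm Y (P A (Suc j) r))) (fv A j r) x"
      by (simp add: mm_app[abs_def])
    also have "\<dots> = 0"
    proof -
      have "mm (P A (Suc j) r) (mm Y (P A (Suc j) r)) x y = 0" for y
        using Y j ra unfolding tangent_mats_def by blast
      then show ?thesis unfolding app_def by simp
    qed
    finally show ?thesis .
  qed
  \<comment> \<open>\<open>fvec\<close> lies in an eigenspace of row \<open>j + 1\<close>, where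
    \<open>Y\<close> has compression 0. Pairing it with its image under \<open>Y\<close> leaves only
    the new column and the new corner.\<close>
  have quad: "ip X (fv A j r) + ip (fv A j r) X + Y j j = 0" if r: "r \<in> grow (Suc j)" for r
  proof -
    have ra: "r \<in> act (Suc j)" using r grow_act by blast
    have "ip (fv A j r) (app Y (fv A j r)) = ip (app (P A (Suc j) r) (fv A j r)) (app Y (fv A j r))"
      using Pf[OF r] by (simp add: ip_def)
    also have "\<dots> = ip (fv A j r) (app (P A (Suc j) r) (app Y (fv A j r)))"
      using ip_P[OF f j, of r] ra by simp
    also have "\<dots> = 0" using PYf[OF r] by (simp add: ip_def)
    finally have 0: "ip (fv A j r) (app Y (fv A j r)) = 0" .
    have "ip (fv A j r) (app Y (fv A j r)) =
        (\<Sum>x<n. cnj (fv A j r x) * X x + (if x = j then ip X (fv A j r) + Y j j else 0))"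
      unfolding ip_def[of "fv A j r"]
    proof (rule sum.cong[OF refl])
      fix x
      consider "x < j" | "x = j" | "x \<ge> Suc j" by linarith
      then show "cnj (fv A j r x) * app Y (fv A j r) x =
          cnj (fv A j r x) * X x + (if x = j then ip X (fv A j r) + Y j j else 0)"
        by cases (use Yf[OF r] Yfj[OF r] f0[of x r] X0[of x] f_eq[OF r, of j] in auto)
    qed
    also have "\<dots> = ip (fv A j r) X + ip X (fv A j r) + Y j j"
      using jn by (simp add: ip_def sum.distrib)
    finally show ?thesis using 0 by (simp add: add_ac)
  qed
  have ipf: "ip X (fv A j r) = (\<Sum>q\<in>shrink j. ip X (gv A j q) / complex_of_real (val r - val q))"
    if r: "r \<in> grow (Suc j)" for r
  proof -
    have "ip X (fv A j r) = ip X (\<lambda>x. \<Sum>q\<in>shrink j. (1 / complex_of_real (val r - val q)) * gv A j q x)"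
      unfolding ip_def
    proof (rule sum.cong[OF refl])
      fix x
      show "cnj (X x) * fv A j r x = cnj (X x) * (\<Sum>q\<in>shrink j. (1 / complex_of_real (val r - val q)) * gv A j q x)"
        using X0[of x] f_eq[OF r, of x] by (cases "x < j") auto
    qed
    then show ?thesis by (simp only: ip_sum_right) simp
  qed
  have Yr: "Y j j = complex_of_real (Re (Y j j))"
    using tangent_mats_herm[OF Y, of j j] by (simp add: complex_eq_iff)
  \<comment> \<open>Inserting the expansion of \<open>fvec\<close> gives a real linear system, whose
    unknowns are the corner and twice the real parts of the pairings with the components of the
    column of \<open>A\<close>.\<close>
  have eq: "Re (Y j j) + (\<Sum>q\<in>shrink j. (2 * Re (ip X (gv A j q))) / (val r - val q)) = 0" if r: "r \<in> grow (Suc j)" for r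
  proof -
    have "ip (fv A j r) X = cnj (ip X (fv A j r))" by (simp add: ip_cnj)
    then have "Re (ip X (fv A j r) + ip (fv A j r) X + Y j j) = 2 * Re (ip X (fv A j r)) + Re (Y j j)" by simp
    moreover have "Re (z / complex_of_real a) = Re z / a" for z a by (simp add: Re_divide_of_real)
    then have "Re (ip X (fv A j r)) = (\<Sum>q\<in>shrink j. Re (ip X (gv A j q)) / (val r - val q))"
      unfolding ipf[OF r] by simp
    ultimately show ?thesis using quad[OF r] by (simp add: sum_distrib_left)
  qed
  have inj: "inj_on val (shrink j)" "inj_on val (grow (Suc j))"
    using inj_on_subset[OF val_inj[of j] grow_act(2)] inj_on_subset[OF val_inj[of "Suc j"] grow_act(1)] j by simp_all
  have ne: "val r \<noteq> val q" if "r \<in> grow (Suc j)" "q \<in> shrink j" for r q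
  proof
    assume "val r = val q"
    then have "q = r" using val_neq_next[OF hyps(6) j, of q r] that grow_act by auto
    then show False using that by (auto simp: grow_def shrink_def)
  qed
  note sys = cauchy_system[OF finite_grow(2) finite_grow(1) inj ne card_grow[OF j] eq]
  show "Y j j = 0" using sys(1) Yr by simp
  show "Re (ip X (gv A j q)) = 0" if "q \<in> shrink j" using sys(2)[of q] that by simp
  \<comment> \<open>An active diamond that does not shrink grows in the next row. Its old eigenspace
    is contained in the new one, where the image of \<open>fvec\<close> under \<open>Y\<close> has
    component 0, and that image agrees with \<open>X\<close> in the first \<open>j\<close>
    coordinates.\<close>
  show "app (P A j r) X x = 0" if r: "r \<in> act j" "r \<notin> shrink j"
  proof -
    have g: "r \<in> grow (Suc j)" using r by (auto simp: act_def grow_def shrink_def)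
    have jle: "j \<le> n" using j by simp
    have "app (P A j r) X x = app (P A j r) (app Y (fv A j r)) x"
      unfolding app_P[OF f jle r(1)] by (rule sum.cong) (use Yf[OF g] in auto)
    also have "\<dots> = app (P A j r) (app (P A (Suc j) r) (app Y (fv A j r))) x"
    proof -
      have e: "app (P A (Suc j) r) v z = app (P A j r) v z + fh A r (Suc j) z * ip (fh A r (Suc j)) v" for v z
        unfolding P_grow[OF f j g] by (rule app_rank_one)
      have "app (P A j r) (app (P A (Suc j) r) v) x =
          app (P A j r) (app (P A j r) v) x + app (P A j r) (fh A r (Suc j)) x * ip (fh A r (Suc j)) v" for v
        unfolding app_def[of "P A j r"] e by (simp add: distrib_left sum.distrib sum_distrib_right mult.assoc app_def)
      then show ?thesis using P_idem[OF f jle r(1) r(1)] P_fh[OF f j g] by simp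
    qed
    also have "\<dots> = 0" using PYf[OF g] by (simp add: app_def)
    finally show ?thesis .
  qed
qed

text \<open>A stabiliser element moves the new column within each eigenspace, infinitesimally by a
  skew-Hermitian matrix. Such a matrix can send a vector to another one of the same eigenspace
  exactly when their inner product is purely imaginary, which is what the linear system
  provides.\<close>

lemma tangent_mats_step:
  assumes Y: "Y \<in> tangent_mats A" and j: "Suc j \<le> n" and Y0: "\<And>x y. x < j \<Longrightarrow> y < j \<Longrightarrow> Y x y = 0"
  obtains B where "B \<in> stabilizer A j" "\<And>x y. x < Suc j \<Longrightarrow> y < Suc j \<Longrightarrow> bracket B A x y = Y x y"
proof -
  have jn: "j \<le> n" using j by simp
  define X where "X = (\<lambda>x. if x < j then Y x j else 0)"
  define b where "b = (\<lambda>x. if x < j then A x j else 0)"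
  note sys = tangent_mats_step_system[OF Y j Y0, folded X_def]
  define g where "g q = gh A q j" for q
  define xq where "xq q = app (P A j q) X" for q
  define \<tau> where "\<tau> q = ip (g q) X" for q
  define \<rho> where "\<rho> q = complex_of_real (sqrt (w j q))" for q
  \<comment> \<open>Both terms of \<open>B q\<close> act on \<open>g q\<close>, so the component of
    \<open>xq q\<close> along \<open>g q\<close> would be counted twice; half of it is subtracted in
    advance.\<close>
  define u where "u q x = xq q x - \<tau> q / 2 * g q x" for q x
  define B where "B q x y = (1 / \<rho> q) * u q x * cnj (g q y) - cnj (1 / \<rho> q) * g q x * cnj (u q y)" for q x y
  have act: "q \<in> act j" if "q \<in> shrink j" for q using that grow_act by blast
  have P\<^sub>g: "app (P A j q) (g q) x = g q x" if "q \<in> shrink j" for q x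
    unfolding g_def using P_gh[OF f j that] .
  have Pb: "app (P A j q) b x = \<rho> q * g q x" if "q \<in> shrink j" for q x
  proof -
    have "app (P A j q) b x = gv A j q x"
      unfolding app_P[OF f jn act[OF that]] comp_def b_def by (rule sum.cong) auto
    then show ?thesis using gv_gh[OF f j that] by (simp add: \<rho>_def g_def)
  qed
  have HB: "B q \<in> stabilizer A j" and Bb: "app (B q) b x = xq q x" if q: "q \<in> shrink j" for q x
  proof -
    have \<rho>0: "\<rho> q \<noteq> 0" using w_pos[OF f j q] by (simp add: \<rho>_def)
    have \<rho>r: "cnj (\<rho> q) = \<rho> q" by (simp add: \<rho>_def)
    have Px: "app (P A j q) (xq q) x = xq q x" for x
      unfolding xq_def using P_idem[OF f jn act[OF q] act[OF q]] by simp
    have "app (P A j q) (u q) x = app (P A j q) (xq q) x - \<tau> q / 2 * app (P A j q) (g q) x" for x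
      by (simp add: app_def u_def left_diff_distrib right_diff_distrib sum_subtractf sum_distrib_left mult_ac)
    then have Pu: "app (P A j q) (u q) x = u q x" for x using Px P\<^sub>g[OF q] by (simp add: u_def)
    show "B q \<in> stabilizer A j"
      by (rule stabilizer_rank_one[OF jn act[OF q] Pu P\<^sub>g[OF q], of _ "1 / \<rho> q"]) (simp add: B_def)
    have "ip X (gv A j q) = \<rho> q * ip X (g q)"
      unfolding gv_gh[OF f j q, abs_def] ip_def by (simp add: sum_distrib_left g_def \<rho>_def mult_ac)
    then have "ip X (gv A j q) = \<rho> q * cnj (\<tau> q)" by (simp add: \<tau>_def ip_cnj)
    moreover have "cnj (\<rho> q) = \<rho> q" "Im (\<rho> q) = 0" by (simp_all add: \<rho>_def)
    ultimately have "sqrt (w j q) * Re (\<tau> q) = 0" using sys(2)[of q] q by (simp add: \<rho>_def)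
    then have "Re (\<tau> q) = 0" using w_pos[OF f j q] by simp
    then have \<tau>i: "cnj (\<tau> q) = - \<tau> q" by (simp add: complex_eq_iff)
    have ipP: "ip v b = \<rho> q * ip v (g q)" if "\<And>x. app (P A j q) v x = v x" for v
    proof -
      have "ip v b = ip (app (P A j q) v) b" using that by (simp add: ip_def)
      also have "\<dots> = ip v (app (P A j q) b)" using ip_P[OF f jn, of q v b] act[OF q] by simp
      finally show ?thesis using Pb[OF q] by (simp add: ip_def sum_distrib_left mult_ac)
    qed
    have cayley_fun: "ip (g q) (g q) = 1" unfolding g_def by (rule gh_norm[OF f j q])
    have "ip (xq q) (g q) = ip X (app (P A j q) (g q))"
      unfolding xq_def using ip_P[OF f jn, of q X "g q"] act[OF q] by simp
    also have "\<dots> = cnj (\<tau> q)" using P\<^sub>g[OF q] by (simp add: \<tau>_def ip_cnj) (simp add: ip_def)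
    finally have xg: "ip (xq q) (g q) = - \<tau> q" using \<tau>i by simp
    have "ip (u q) (g q) = ip (xq q) (g q) - cnj (\<tau> q / 2) * ip (g q) (g q)"
      by (simp add: ip_def u_def left_diff_distrib right_diff_distrib sum_subtractf sum_distrib_left mult_ac)
    then have ug: "ip (u q) (g q) = - \<tau> q / 2" using xg cayley_fun \<tau>i by simp
    have "app (B q) b x = (1 / \<rho> q) * u q x * ip (g q) b - cnj (1 / \<rho> q) * g q x * ip (u q) b"
      by (simp add: app_def ip_def B_def left_diff_distrib right_diff_distrib sum_subtractf sum_distrib_left mult_ac)
    also have "\<dots> = u q x * ip (g q) (g q) - g q x * ip (u q) (g q)"
      unfolding ipP[OF P\<^sub>g[OF q]] ipP[OF Pu] using \<rho>0 \<rho>r by simp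
    finally show "app (B q) b x = xq q x" unfolding cayley_fun ug by (simp add: u_def)
  qed
  define Bs where "Bs = (\<lambda>x y. \<Sum>q\<in>shrink j. B q x y)"
  have H: "Bs \<in> stabilizer A j" unfolding Bs_def by (rule stabilizer_sum) (rule HB)
  note supB = stabilizer_supp[OF jn H]
  have "app Bs b x = (\<Sum>q\<in>shrink j. app (B q) b x)" for x
    unfolding app_def Bs_def sum_distrib_right by (rule sum.swap)
  also have "\<dots> x = (\<Sum>q\<in>shrink j. xq q x)" for x using Bb by simp
  also have "\<dots> x = (\<Sum>q\<in>act j. xq q x)" for x
    by (rule sum.mono_neutral_left) (use sys(3) grow_act in \<open>auto simp: xq_def\<close>)
  also have "\<dots> x = X x" for x unfolding xq_def by (rule app_P_sum[OF jn]) (simp add: X_def)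
  finally have BX: "app Bs b x = X x" for x .
  have B0: "Bs x y = 0" if "x \<ge> j \<or> y \<ge> j" for x y using supB that by (auto simp: supp_def)
  have col: "bracket Bs A x j = Y x j" if "x < j" for x
  proof -
    have "mm Bs A x j = app Bs b x"
      unfolding mm_def app_def
    proof (rule sum.cong[OF refl])
      fix z show "Bs x z * A z j = Bs x z * b z" using B0[of x z] by (cases "z < j") (auto simp: b_def)
    qed
    moreover have "mm A Bs x j = 0" using B0 by (simp add: mm_def)
    ultimately show ?thesis using BX that by (simp add: bracket_def X_def)
  qed
  have "bracket Bs A x y = Y x y" if "x < Suc j" "y < Suc j" for x y
  proof -
    consider "x < j" "y < j" | "x < j" "y = j" | "x = j" "y < j" | "x = j" "y = j" using \<open>x < Suc j\<close> \<open>y < Suc j\<close> by linarith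
    then show ?thesis
    proof cases
      case 1
      then show ?thesis using stabilizer_commute[OF jn H] Y0 by (simp add: bracket_def)
    next
      case 2
      then show ?thesis using col by simp
    next
      case 3
      have "hermf (bracket Bs A)" by (rule bracket_herm) (rule stabilizer_skew[OF H])
      then have "bracket Bs A j y = cnj (bracket Bs A y j)" by (simp add: hermf_def)
      then show ?thesis using col[of y] 3 tangent_mats_herm[OF Y, of y j] by simp
    next
      case 4
      then show ?thesis using B0 sys(1) by (simp add: bracket_def mm_def)
    qed
  qed
  then show thesis using H by (rule that[rotated])
qed

text \<open>Row by row, a commutator with a stabiliser element is subtracted. It does not disturb
  the smaller blocks, so after \<open>j\<close> steps the remainder vanishes on the leading block of
  size \<open>j\<close>.\<close>

lemma tangent_mats_decomp:
  assumes Y: "Y \<in> tangent_mats A"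
  obtains B where "\<And>j. j < n \<Longrightarrow> B j \<in> stabilizer A j" "Y = (\<lambda>x y. \<Sum>j<n. bracket (B j) A x y)"
proof -
  have "\<exists>B. (\<forall>i<j. B i \<in> stabilizer A i) \<and> (\<lambda>x y. Y x y - (\<Sum>i<j. bracket (B i) A x y)) \<in> tangent_mats A \<and>
      (\<forall>x<j. \<forall>y<j. Y x y = (\<Sum>i<j. bracket (B i) A x y))" if "j \<le> n" for j
    using that
  proof (induction j)
    case 0
    show ?case using Y by simp
  next
    case (Suc j)
    then obtain B where B: "\<forall>i<j. B i \<in> stabilizer A i" "(\<lambda>x y. Y x y - (\<Sum>i<j. bracket (B i) A x y)) \<in> tangent_mats A"
      "\<forall>x<j. \<forall>y<j. Y x y = (\<Sum>i<j. bracket (B i) A x y)" by auto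
    obtain C where C: "C \<in> stabilizer A j"
      "\<And>x y. x < Suc j \<Longrightarrow> y < Suc j \<Longrightarrow> bracket C A x y = Y x y - (\<Sum>i<j. bracket (B i) A x y)"
      by (rule tangent_mats_step[OF B(2) Suc.prems]) (use B(3) in auto)
    define B' where "B' = B(j := C)"
    have S: "(\<Sum>i<Suc j. bracket (B' i) A x y) = (\<Sum>i<j. bracket (B i) A x y) + bracket C A x y" for x y
      by (simp add: B'_def)
    have "(\<lambda>x y. (Y x y - (\<Sum>i<j. bracket (B i) A x y)) - bracket C A x y) \<in> tangent_mats A"
      by (rule tangent_mats_diff[OF B(2) bracket_tangent_mats[OF _ C(1)]]) (use Suc.prems in simp)
    then have "(\<lambda>x y. Y x y - (\<Sum>i<Suc j. bracket (B' i) A x y)) \<in> tangent_mats A"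
      unfolding S by (simp only: diff_diff_eq)
    moreover have "\<forall>i<Suc j. B' i \<in> stabilizer A i" using B(1) C(1) by (simp add: B'_def less_Suc_eq)
    moreover have "\<forall>x<Suc j. \<forall>y<Suc j. Y x y = (\<Sum>i<Suc j. bracket (B' i) A x y)"
      unfolding S using C(2) by simp
    ultimately show ?case by blast
  qed
  from this[of n] obtain B where B: "\<forall>i<n. B i \<in> stabilizer A i" "(\<lambda>x y. Y x y - (\<Sum>i<n. bracket (B i) A x y)) \<in> tangent_mats A"
      "\<forall>x<n. \<forall>y<n. Y x y = (\<Sum>i<n. bracket (B i) A x y)" by auto
  have "Y x y = (\<Sum>i<n. bracket (B i) A x y)" for x y
  proof (cases "x < n \<and> y < n")
    case False
    then have "Y x y - (\<Sum>i<n. bracket (B i) A x y) = 0" using B(2) by (simp add: tangent_mats_def supp_def)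
    then show ?thesis by simp
  qed (use B(3) in auto)
  then show thesis using that[of B] B(1) by blast
qed

end

end

section \<open>Conjugation by Cayley transforms of stabiliser elements\<close>

context gc_param
begin

text \<open>Matrices being functions on all indices, the unit has to be cut off at \<open>n\<close>
  and is neutral for matrices supported there.\<close>

lemma mm_idn: "supp n M \<Longrightarrow> mm (\<lambda>x y. if x = y \<and> x < n then 1 else 0) M = M"
  "supp n M \<Longrightarrow> mm M (\<lambda>x y. if x = y \<and> x < n then 1 else 0) = M"
proof -
  assume M: "supp n M"
  have e: "(if x = z \<and> x < n then 1 else 0) * a = (if x = z then (if x < n then a else 0) else 0)"
    "a * (if z = x \<and> z < n then 1 else 0) = (if x = z then (if x < n then a else 0) else 0)" for x z :: nat and a :: complex
    by auto
  show "mm (\<lambda>x y. if x = y \<and> x < n then 1 else 0) M = M"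
    unfolding mm_def e using M by (intro ext) (simp add: sum_if_eq supp_def)
  show "mm M (\<lambda>x y. if x = y \<and> x < n then 1 else 0) = M"
    unfolding mm_def e using M by (intro ext) (simp add: sum_if_eq supp_def)
qed

lemma mm_mf: "M \<in> carrier_mat n n \<Longrightarrow> N \<in> carrier_mat n n \<Longrightarrow> mm (mf (entries M)) (mf (entries N)) = mf (entries (M * N))"
  by (intro ext) (auto simp: mm_def mf_entries index_mult_mat_sum[of M n n N n] simp del: index_mult_mat(1))

lemma supp_mf: "M \<in> carrier_mat n n \<Longrightarrow> supp n (mf (entries M))"
  by (auto simp: supp_def mf_entries)

lemma mf_one: "mf (entries (1\<^sub>m n)) = (\<lambda>x y. if x = y \<and> x < n then 1 else 0)"
  by (auto simp: fun_eq_iff mf_entries)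

lemma mf_submat: "supp n C \<Longrightarrow> mf (entries (submat n C)) = C"
  by (auto simp: fun_eq_iff mf_entries supp_def)

definition adj :: "(nat \<Rightarrow> nat \<Rightarrow> complex) \<Rightarrow> nat \<Rightarrow> nat \<Rightarrow> complex" where
  "adj M x y = cnj (M y x)"

lemma supp_adj: "supp n M \<Longrightarrow> supp n (adj M)"
  unfolding supp_def adj_def by (metis complex_cnj_zero)

definition cut :: "nat \<Rightarrow> (nat \<Rightarrow> nat \<Rightarrow> complex) \<Rightarrow> nat \<Rightarrow> nat \<Rightarrow> complex" where
  "cut j A x y = (if x < j \<and> y < j then A x y else 0)"

text \<open>A unitary matrix that acts on the first \<open>j\<close> coordinates only and commutes
  with the leading block of size \<open>j\<close>.\<close>

definition block_unitary where
  "block_unitary j A U \<longleftrightarrow> supp n U \<and> mm U (adj U) = (\<lambda>x y. if x = y \<and> x < n then 1 else 0) \<and>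
     (\<forall>x<n. \<forall>y<n. \<not> (x < j \<and> y < j) \<longrightarrow> U x y = (if x = y then 1 else 0)) \<and>
     mm U (cut j A) = mm (cut j A) U"

text \<open>Leading blocks of size more than \<open>j\<close> are conjugated by the corresponding
  block of \<open>U\<close>, which is unitary too, and keep their characteristic polynomials. The
  block of size \<open>j\<close>, and with it all smaller ones, is not changed at all, because
  \<open>U\<close> commutes with it.\<close>

lemma conj_block:
  assumes U: "block_unitary j A U" and C: "hermf C" "supp n C" and j: "j \<le> n"
    and CA: "\<And>x y. x < j \<Longrightarrow> y < j \<Longrightarrow> C x y = A x y"
  defines "C' \<equiv> mm U (mm C (adj U))"
  shows "hermf C'" "supp n C'" "x < j \<Longrightarrow> y < j \<Longrightarrow> C' x y = A x y"
    "i \<le> n \<Longrightarrow> char_poly (submat i C') = char_poly (submat i C)"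
proof -
  have sU: "supp n U" and UU: "mm U (adj U) = (\<lambda>x y. if x = y \<and> x < n then 1 else 0)"
    and Ub: "\<And>x y. x < n \<Longrightarrow> y < n \<Longrightarrow> \<not> (x < j \<and> y < j) \<Longrightarrow> U x y = (if x = y then 1 else 0)"
    and UA: "mm U (cut j A) = mm (cut j A) U"
    using U unfolding block_unitary_def by blast+
  have expand: "C' x y = (\<Sum>u<i. U x u * (\<Sum>v<i. C u v * cnj (U y v)))"
    if x: "x < i" "y < i" and i: "j \<le> i" "i \<le> n" for x y i
  proof -
    have z: "U x u = 0" if "x < i" "i \<le> u" "u < n" for x u
      using Ub[of x u] that i by simp
    have "mm C (adj U) u y = (\<Sum>v<i. C u v * cnj (U y v))" for u
      unfolding mm_def adj_def by (rule sum.mono_neutral_right) (use z x i in auto)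
    moreover have "mm U D x y = (\<Sum>u<i. U x u * D u y)" for D
      unfolding mm_def by (rule sum.mono_neutral_right) (use z x i in auto)
    ultimately show ?thesis by (simp add: C'_def)
  qed
  have "mm U (mm C (adj U)) x y = cnj (mm U (mm C (adj U)) y x)" for x y
  proof -
    have "mm U (mm C (adj U)) x y = (\<Sum>u<n. \<Sum>v<n. U x u * C u v * cnj (U y v))"
      by (simp add: mm_def adj_def sum_distrib_left mult.assoc)
    also have "\<dots> = (\<Sum>v<n. \<Sum>u<n. U x u * C u v * cnj (U y v))" by (rule sum.swap)
    also have "\<dots> = (\<Sum>v<n. \<Sum>u<n. cnj (U y v * C v u * cnj (U x u)))"
      using C(1) by (simp add: hermf_def mult_ac)
    also have "\<dots> = cnj (mm U (mm C (adj U)) y x)"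
      by (simp add: mm_def adj_def sum_distrib_left mult.assoc)
    finally show ?thesis .
  qed
  then show "hermf C'" unfolding hermf_def C'_def by metis
  show "supp n C'" unfolding C'_def by (intro supp_mm sU C(2) supp_adj)
  show block: "C' x y = A x y" if "x < j" "y < j" for x y
  proof -
    have "C' x y = (\<Sum>u<j. U x u * (\<Sum>v<j. cut j A u v * cnj (U y v)))"
      unfolding expand[OF that le_refl j] using CA by (simp add: cut_def)
    also have "\<dots> = mm U (mm (cut j A) (adj U)) x y"
    proof -
      have "mm (cut j A) (adj U) u y = (\<Sum>v<j. cut j A u v * cnj (U y v))" for u
        unfolding mm_def adj_def by (rule sum.mono_neutral_right) (use j in \<open>auto simp: cut_def\<close>)
      moreover have "mm (cut j A) (adj U) u y = 0" if "u \<ge> j" for u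
        using that by (simp add: mm_def cut_def)
      then have "mm U (mm (cut j A) (adj U)) x y = (\<Sum>u<j. U x u * mm (cut j A) (adj U) u y)"
        unfolding mm_def[of U] by (intro sum.mono_neutral_right) (use j in auto)
      ultimately show ?thesis by simp
    qed
    also have "\<dots> = mm (cut j A) (mm U (adj U)) x y"
      unfolding mm_assoc[symmetric] UA by (rule refl)
    also have "\<dots> = cut j A x y"
      unfolding UU using j by (subst mm_idn) (auto simp: supp_def cut_def)
    finally show ?thesis using that by (simp add: cut_def)
  qed
  show "char_poly (submat i C') = char_poly (submat i C)" if i: "i \<le> n"
  proof (cases "i \<le> j")
    case True
    have "submat i C' = submat i C" by (rule eq_matI) (use block CA True in auto)
    then show ?thesis by simp
  next
    case False
    then have ij: "j \<le> i" by simp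
    define Um where "Um = submat i U"
    define Ua where "Ua = submat i (adj U)"
    have c: "Um \<in> carrier_mat i i" "Ua \<in> carrier_mat i i" "submat i C \<in> carrier_mat i i" by (simp_all add: Um_def Ua_def)
    have z: "U x u = 0" if "x < i" "i \<le> u" "u < n" for x u
      using Ub[of x u] that ij i by simp
    have UUa: "Um * Ua = 1\<^sub>m i"
    proof (rule eq_matI)
      fix x y assume xy: "x < dim_row (1\<^sub>m i :: complex mat)" "y < dim_col (1\<^sub>m i :: complex mat)"
      have "(Um * Ua) $$ (x, y) = (\<Sum>a<i. U x a * adj U a y)"
        using index_mult_mat_sum[OF c(1,2)] xy by (simp add: Um_def Ua_def)
      also have "\<dots> = mm U (adj U) x y"
        unfolding mm_def by (rule sum.mono_neutral_left) (use z xy i in auto)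
      finally show "(Um * Ua) $$ (x, y) = 1\<^sub>m i $$ (x, y)" using UU xy i by simp
    qed (use c in auto)
    have eq: "submat i C' = Um * submat i C * Ua"
    proof (rule eq_matI)
      fix x y assume "x < dim_row (Um * submat i C * Ua)" "y < dim_col (Um * submat i C * Ua)"
      then have xy: "x < i" "y < i" using c by auto
      have "(Um * submat i C * Ua) $$ (x, y) = (Um * (submat i C * Ua)) $$ (x, y)"
        using assoc_mult_mat[OF c(1,3,2)] by simp
      also have "\<dots> = (\<Sum>u<i. U x u * (submat i C * Ua) $$ (u, y))"
        using index_mult_mat_sum[OF c(1) mult_carrier_mat[OF c(3,2)] xy] xy by (simp add: Um_def)
      also have "\<dots> = (\<Sum>u<i. U x u * (\<Sum>v<i. C u v * cnj (U y v)))"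
      proof (rule sum.cong[OF refl])
        fix u assume "u \<in> {..<i}"
        then show "U x u * (submat i C * Ua) $$ (u, y) = U x u * (\<Sum>v<i. C u v * cnj (U y v))"
          using index_mult_mat_sum[OF c(3,2), of u y] xy by (simp add: Ua_def adj_def)
      qed
      finally show "submat i C' $$ (x, y) = (Um * submat i C * Ua) $$ (x, y)" using expand[OF xy ij i] xy by simp
    qed (use c in auto)
    have "similar_mat_wit (submat i C') (submat i C) Um Ua"
      unfolding similar_mat_wit_def Let_def
      using c eq UUa mat_mult_left_right_inverse[OF c(1,2) UUa] submat_simps(1)[of i C']
      by (simp only: submat_simps insert_subset empty_subsetI carrier_matI) simp
    then show ?thesis by (intro char_poly_similar) (auto simp: similar_mat_def)
  qed
qed

text \<open>The Cayley transform of a small \<open>X\<close> is \<open>1 - 2 X\<close> to first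
  order, so the factor -1/2 makes the resulting curve start at the identity with velocity
  \<open>B\<close>.\<close>

definition scaled_mat :: "(nat \<Rightarrow> nat \<Rightarrow> complex) \<Rightarrow> real \<Rightarrow> complex mat" where
  "scaled_mat B t = Matrix.mat n n (\<lambda>(x, y). - complex_of_real (t / 2) * B x y)"

definition cayley_fun where "cayley_fun B t = mf (entries (cayley n (scaled_mat B t)))"

lemma scaled_mat_simps [simp]: "scaled_mat B t \<in> carrier_mat n n" "dim_row (scaled_mat B t) = n" "dim_col (scaled_mat B t) = n"
  by (simp_all add: scaled_mat_def)

lemma scaled_mat_index: "x < n \<Longrightarrow> y < n \<Longrightarrow> scaled_mat B t $$ (x, y) = - complex_of_real (t / 2) * B x y"
  by (simp_all add: scaled_mat_def)

context
  fixes B A :: "nat \<Rightarrow> nat \<Rightarrow> complex" and j :: nat and t :: real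
  assumes skew: "\<And>x y. cnj (B x y) = - B y x" and sB: "supp j B" and j: "j \<le> n"
    and d: "Determinant.det (1\<^sub>m n + scaled_mat B t) \<noteq> 0"
begin

private lemma NG: "(1\<^sub>m n + scaled_mat B t) * cayley n (scaled_mat B t) = 1\<^sub>m n - scaled_mat B t"
  and GN: "cayley n (scaled_mat B t) * (1\<^sub>m n + scaled_mat B t) = 1\<^sub>m n - scaled_mat B t"
  and QN: "inv_mat (1\<^sub>m n + scaled_mat B t) * (1\<^sub>m n + scaled_mat B t) = 1\<^sub>m n" "inv_mat (1\<^sub>m n + scaled_mat B t) \<in> carrier_mat n n"
  and QM: "inv_mat (1\<^sub>m n + scaled_mat B t) * (1\<^sub>m n - scaled_mat B t) = cayley n (scaled_mat B t)"
  and G: "cayley n (scaled_mat B t) \<in> carrier_mat n n"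
proof -
  let ?N = "1\<^sub>m n + scaled_mat B t" and ?M = "1\<^sub>m n - scaled_mat B t" and ?Q = "inv_mat (1\<^sub>m n + scaled_mat B t)"
  have c: "?N \<in> carrier_mat n n" "?M \<in> carrier_mat n n" by (simp_all add: minus_carrier_mat)
  note i = inv_mat[OF c(1) d]
  show QM: "?Q * ?M = cayley n (scaled_mat B t)" by (rule cayley_commute[OF _ d]) simp
  show "cayley n (scaled_mat B t) * ?N = ?M"
    unfolding cayley_def using assoc_mult_mat[OF c(2) i(1) c(1)] i(3) c by simp
  show "?N * cayley n (scaled_mat B t) = ?M"
    unfolding QM[symmetric] using assoc_mult_mat[OF c(1) i(1) c(2), symmetric] i(2) c by simp
  show "?Q * ?N = 1\<^sub>m n" "?Q \<in> carrier_mat n n" using i by auto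
  show "cayley n (scaled_mat B t) \<in> carrier_mat n n" by (rule cayley_carrier[OF _ d]) simp
qed

private lemma cayley_fun_row: "x < n \<Longrightarrow> y < n \<Longrightarrow>
    cayley_fun B t x y + (\<Sum>z<n. scaled_mat B t $$ (x, z) * cayley_fun B t z y) = (if x = y then 1 else 0) - scaled_mat B t $$ (x, y)"
proof -
  assume xy: "x < n" "y < n"
  have "((1\<^sub>m n + scaled_mat B t) * cayley n (scaled_mat B t)) $$ (x, y) =
      (\<Sum>z<n. (if x = z then cayley_fun B t z y else 0) + scaled_mat B t $$ (x, z) * cayley_fun B t z y)"
    unfolding index_mult_mat_sum[OF add_carrier_mat[OF scaled_mat_simps(1)] G xy]
    by (rule sum.cong) (use xy G in \<open>auto simp: cayley_fun_def mf_entries distrib_right\<close>)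
  then show "cayley_fun B t x y + (\<Sum>z<n. scaled_mat B t $$ (x, z) * cayley_fun B t z y) = (if x = y then 1 else 0) - scaled_mat B t $$ (x, y)"
    using NG xy by (simp add: sum.distrib sum_if_eq)
qed

lemma cayley_fun_col: "x < n \<Longrightarrow> y < n \<Longrightarrow>
    cayley_fun B t x y + (\<Sum>z<n. cayley_fun B t x z * scaled_mat B t $$ (z, y)) = (if x = y then 1 else 0) - scaled_mat B t $$ (x, y)"
proof -
  assume xy: "x < n" "y < n"
  have "(cayley n (scaled_mat B t) * (1\<^sub>m n + scaled_mat B t)) $$ (x, y) =
      (\<Sum>z<n. (if y = z then cayley_fun B t x z else 0) + cayley_fun B t x z * scaled_mat B t $$ (z, y))"
    unfolding index_mult_mat_sum[OF G add_carrier_mat[OF scaled_mat_simps(1)] xy]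
    by (rule sum.cong) (use xy G in \<open>auto simp: cayley_fun_def mf_entries distrib_left\<close>)
  then show "cayley_fun B t x y + (\<Sum>z<n. cayley_fun B t x z * scaled_mat B t $$ (z, y)) = (if x = y then 1 else 0) - scaled_mat B t $$ (x, y)"
    using GN xy by (simp add: sum.distrib sum_if_eq)
qed

text \<open>Outside the block either a row or a column of \<open>scaled_mat B t\<close> is zero, and
  the defining equation of the Cayley transform then forces the entry of the identity. Commutation
  with the block passes through the inverse.\<close>

lemma block_unitary_gg:
  assumes comm: "\<And>x y. x < j \<Longrightarrow> y < j \<Longrightarrow> mm A B x y = mm B A x y"
  shows "block_unitary j A (cayley_fun B t)"
  unfolding block_unitary_def
proof (intro conjI allI impI)
  let ?X = "scaled_mat B t"
  show "supp n (cayley_fun B t)" unfolding cayley_fun_def by (rule supp_mf[OF G])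
  have aX: "mat_adjoint ?X = - ?X" by (rule eq_matI) (auto simp: skew scaled_mat_index)
  have "cayley_fun B t x y = (if x = y then 1 else 0)" if xy: "x < n" "y < n" "\<not> (x < j \<and> y < j)" for x y
  proof (cases "x < j")
    case True
    then have "?X $$ (z, y) = 0" if "z < n" for z using sB xy that by (simp add: supp_def scaled_mat_index)
    then show ?thesis using cayley_fun_col[OF xy(1,2)] xy by simp
  next
    case False
    then have "?X $$ (x, z) = 0" if "z < n" for z using sB False that xy by (simp add: supp_def scaled_mat_index)
    then show ?thesis using cayley_fun_row[OF xy(1,2)] xy by simp
  qed
  then show "cayley_fun B t x y = (if x = y then 1 else 0)" if "x < n" "y < n" "\<not> (x < j \<and> y < j)" for x y using that by blast
  have "adj (cayley_fun B t) = mf (entries (mat_adjoint (cayley n ?X)))"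
    using G by (auto simp: fun_eq_iff adj_def cayley_fun_def mf_entries)
  then show "mm (cayley_fun B t) (adj (cayley_fun B t)) = (\<lambda>x y. if x = y \<and> x < n then 1 else 0)"
    unfolding cayley_fun_def using mm_mf[OF G mat_adjoint_carrier[OF G]] cayley_skew[OF scaled_mat_simps(1) d aX] mf_one by simp
  have cb: "mm (cut j A) B x y = mm B (cut j A) x y" for x y
  proof (cases "x < j \<and> y < j")
    case True
    have "mm (cut j A) B x y = mm A B x y" "mm B (cut j A) x y = mm B A x y"
      unfolding mm_def by (rule sum.cong[OF refl]; use True sB in \<open>auto simp: cut_def supp_def\<close>)+
    then show ?thesis using comm True by simp
  next
    case False
    have "cut j A x z * B z y = 0" "B x z * cut j A z y = 0" for z
      using False sB by (auto simp: cut_def supp_def)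
    then show ?thesis by (simp add: mm_def)
  qed
  \<comment> \<open>\<open>N\<close> and \<open>M\<close> are combinations of the unit and of
    \<open>B\<close>, hence commute with the cut-off block. Inserting \<open>mm Q N\<close> carries
    this over to \<open>mm Q M\<close>, which is the Cayley transform.\<close>
  define N where "N = mf (entries (1\<^sub>m n + ?X))"
  define M where "M = mf (entries (1\<^sub>m n - ?X))"
  define Q where "Q = mf (entries (inv_mat (1\<^sub>m n + ?X)))"
  have Ne: "N = (\<lambda>x y. (if x = y \<and> x < n then 1 else 0) - complex_of_real (t / 2) * cut n B x y)"
    and Me: "M = (\<lambda>x y. (if x = y \<and> x < n then 1 else 0) - (- complex_of_real (t / 2)) * cut n B x y)"
    by (auto simp: fun_eq_iff N_def M_def mf_entries cut_def scaled_mat_index)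
  have "cut n B = B" using sB j by (auto simp: fun_eq_iff cut_def supp_def)
  note e = Ne[unfolded this] Me[unfolded this]
  have sc: "supp n (cut j A)" using j by (auto simp: supp_def cut_def)
  have lin: "mm (cut j A) (\<lambda>x y. E x y - a * B x y) = (\<lambda>x y. mm (cut j A) E x y - a * mm (cut j A) B x y)"
    "mm (\<lambda>x y. E x y - a * B x y) (cut j A) = (\<lambda>x y. mm E (cut j A) x y - a * mm B (cut j A) x y)" for E a
    by (simp_all add: fun_eq_iff mm_def left_diff_distrib right_diff_distrib sum_subtractf sum_distrib_left mult_ac)
  have AN: "mm (cut j A) N = mm N (cut j A)" and AM: "mm (cut j A) M = mm M (cut j A)"
    unfolding e lin mm_idn[OF sc] cb by (rule refl)+
  have QNi: "mm Q N = (\<lambda>x y. if x = y \<and> x < n then 1 else 0)"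
    unfolding Q_def N_def using mm_mf[OF QN(2) add_carrier_mat[OF scaled_mat_simps(1)]] QN(1) mf_one by simp
  have GM: "mm N (cayley_fun B t) = M" and QG: "cayley_fun B t = mm Q M"
    unfolding Q_def N_def M_def cayley_fun_def
    using mm_mf[OF add_carrier_mat[OF scaled_mat_simps(1)] G] NG mm_mf[OF QN(2) minus_carrier_mat[OF scaled_mat_simps(1)]] QM by simp_all
  have s: "supp n (mm (cut j A) (cayley_fun B t))" by (rule supp_mm[OF sc]) (simp add: cayley_fun_def supp_mf[OF G])
  have "mm (cut j A) (cayley_fun B t) = mm (mm Q N) (mm (cut j A) (cayley_fun B t))" unfolding QNi mm_idn(1)[OF s] by (rule refl)
  also have "\<dots> = mm Q (mm (mm N (cut j A)) (cayley_fun B t))" by (simp only: mm_assoc)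
  also have "\<dots> = mm Q (mm (cut j A) (mm N (cayley_fun B t)))" unfolding AN[symmetric] by (simp only: mm_assoc)
  also have "\<dots> = mm (mm Q M) (cut j A)" unfolding GM AM by (simp only: mm_assoc)
  also have "\<dots> = mm (cayley_fun B t) (cut j A)" unfolding QG by (rule refl)
  finally show "mm (cayley_fun B t) (cut j A) = mm (cut j A) (cayley_fun B t)" by (rule sym)
qed

end

end

section \<open>Curves in the fiber and its tangent spaces\<close>

context gc_param
begin

text \<open>Conjugation by an element of the stabiliser of \<open>A\<^sub>j\<close> preserves the fiber, as long as the upper left
  \<open>j \<times> j\<close> block is still \<open>A\<^sub>j\<close>; hence the larger blocks are treated first.\<close>

primrec curve :: "(nat \<Rightarrow> nat \<Rightarrow> nat \<Rightarrow> complex) \<Rightarrow> (nat \<Rightarrow> nat \<Rightarrow> complex) \<Rightarrow> nat \<Rightarrow> real \<Rightarrow> nat \<Rightarrow> nat \<Rightarrow> complex" where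
  "curve B A 0 t = A"
| "curve B A (Suc k) t = mm (cayley_fun (B (n - Suc k)) t) (mm (curve B A k t) (adj (cayley_fun (B (n - Suc k)) t)))"

lemma has_vector_derivative_mm:
  assumes "\<And>z. z < n \<Longrightarrow> ((\<lambda>t. M t x z) has_vector_derivative M' x z) (at t0)"
    and "\<And>z. z < n \<Longrightarrow> ((\<lambda>t. N t z y) has_vector_derivative N' z y) (at t0)"
  shows "((\<lambda>t. mm (M t) (N t) x y) has_vector_derivative (mm (M t0) N' x y + mm M' (N t0) x y)) (at t0)"
  unfolding mm_def sum.distrib[symmetric]
  by (rule has_vector_derivative_sum) (rule has_vector_derivative_mult[OF assms], auto)

text \<open>Along a curve in the fiber the projections are differentiable and satisfy
  \<open>A P = val P\<close>. Differentiating and multiplying by \<open>P\<close> from the left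
  cancels the terms with the derivative of \<open>P\<close> and leaves
  \<open>P Y P = 0\<close>.\<close>

lemma tangent_tangent_mats:
  assumes X: "X \<in> Fib" and V: "V \<in> mat_tangent n Fib X"
  shows "mf (entries V) \<in> tangent_mats (mf (entries X))"
proof -
  obtain \<epsilon> and \<gamma> :: "real \<Rightarrow> (nat \<times> nat, complex) poly_mapping" where \<epsilon>: "\<epsilon> > 0"
    and sm: "smooth_on {-\<epsilon><..<\<epsilon>} \<gamma>" and im: "\<gamma> ` {-\<epsilon><..<\<epsilon>} \<subseteq> entries ` Fib"
    and \<gamma>0: "\<gamma> 0 = entries X" and der: "(\<gamma> has_vector_derivative entries V) (at 0)" and Vc: "V \<in> carrier_mat n n"
    using V unfolding mat_tangent_def tangent_space_def by blast
  define I where "I = {-\<epsilon><..<\<epsilon>}"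
  have I: "open I" "0 \<in> I" using \<epsilon> by (auto simp: I_def)
  define A where "A t = mf (\<gamma> t)" for t
  define Y where "Y = mf (entries V)"
  have A0: "mf (entries X) = A 0" by (simp add: A_def \<gamma>0)
  have fib: "fib (A t)" and sA: "supp n (A t)" if "t \<in> I" for t
  proof -
    have "\<gamma> t \<in> entries ` Fib" using im that unfolding I_def by blast
    then obtain Z where Z: "Z \<in> Fib" "\<gamma> t = entries Z" by blast
    show "fib (A t)" using Fib_mf(1)[OF Z(1)] Z(2) by (simp add: A_def)
    show "supp n (A t)" using supp_mf[OF Fib_mf(2)[OF Z(1)]] Z(2) by (simp add: A_def)
  qed
  have smA: "smooth_on I (\<lambda>t. A t x y)" for x y
    unfolding A_def mf_def I_def by (rule smooth_on_lookup[OF _ sm]) simp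
  have dA: "((\<lambda>t. A t x y) has_vector_derivative Y x y) (at 0)" for x y
    unfolding A_def mf_def Y_def by (rule bounded_linear.has_vector_derivative[OF bounded_linear_lookup der])
  have unique: "d1 = d2" if "(f has_vector_derivative d1) (at 0)" "(g has_vector_derivative d2) (at 0)"
    "\<And>t. t \<in> I \<Longrightarrow> f t = g t" for f g :: "real \<Rightarrow> complex" and d1 d2
    using vector_derivative_unique_at[OF has_vector_derivative_transform_within_open[OF that(1) I that(3)] that(2)] .
  have "cnj (Y x y) = Y y x" for x y
  proof (rule unique)
    show "((\<lambda>t. cnj (A t x y)) has_vector_derivative cnj (Y x y)) (at 0)"
      by (rule bounded_linear.has_vector_derivative[OF bounded_linear_cnj dA])
    show "((\<lambda>t. A t y x) has_vector_derivative Y y x) (at 0)" by (rule dA)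
    show "cnj (A t x y) = A t y x" if "t \<in> I" for t using fibD(1)[OF fib[OF that]] by (simp add: hermf_def)
  qed
  then have hY: "hermf Y" by (simp add: hermf_def)
  have sY: "supp n Y" unfolding Y_def by (rule supp_mf[OF Vc])
  have "mm (P (A 0) j r) (mm Y (P (A 0) j r)) x y = 0" if j: "j \<le> n" and r: "r \<in> act j" for j r x y
  proof -
    let ?P = "\<lambda>t. P (A t) j r"
    define p' where "p' x y = vector_derivative (\<lambda>t. ?P t x y) (at 0)" for x y
    have p': "((\<lambda>t. ?P t x y) has_vector_derivative p' x y) (at 0)" for x y
    proof -
      have "smooth_on I (\<lambda>t. ?P t x y)" by (rule smooth_P[OF I(1) smA])
      then show ?thesis
        unfolding p'_def vector_derivative_works[symmetric] using I(2) by (rule smooth_on_imp_differentiable)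
    qed
    have P0: "?P t z y = 0" if "t \<in> I" "z \<ge> j" for t z y
      using pre_resD(2)[OF fibD(1)[OF fib[OF that(1)]] fib_pre_res[OF fib[OF that(1)] j] j r, of z y] that(2) by simp
    have p0: "p' z y = 0" if "z \<ge> j" for z y
      by (rule unique[OF p' has_vector_derivative_const]) (use P0 that in auto)
    have eq: "mm (A 0) p' u y + mm Y (?P 0) u y = complex_of_real (val r) * p' u y" if u: "u < j" for u
    proof (rule unique)
      show "((\<lambda>t. mm (A t) (?P t) u y) has_vector_derivative mm (A 0) p' u y + mm Y (?P 0) u y) (at 0)"
        by (rule has_vector_derivative_mm[where M=A and N="?P" and M'=Y and N'=p', OF dA p'])
      show "((\<lambda>t. complex_of_real (val r) * ?P t u y) has_vector_derivative complex_of_real (val r) * p' u y) (at 0)"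
        by (rule has_vector_derivative_mult_right[OF p'])
      show "mm (A t) (?P t) u y = complex_of_real (val r) * ?P t u y" if "t \<in> I" for t
        by (rule mm_AP[OF fib[OF that] sA[OF that] j r u])
    qed
    note f0 = fib[OF I(2)] and s0 = sA[OF I(2)]
    have Pc: "?P 0 x u = 0" if "u \<ge> j" for x u
      using pre_resD(2)[OF fibD(1)[OF f0] fib_pre_res[OF f0 j] j r, of x u] that by simp
    \<comment> \<open>The left eigenvector equation holds only for columns below \<open>j\<close>;
      beyond them the derivative of the projection is 0.\<close>
    have "mm (?P 0) (mm (A 0) p') x y = complex_of_real (val r) * mm (?P 0) p' x y"
    proof -
      have "mm (?P 0) (A 0) x u * p' u y = complex_of_real (val r) * (?P 0 x u * p' u y)" for u
        using mm_PA[OF f0 s0 j r, of u x] p0[of u y] by (cases "u < j") auto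
      then have "mm (mm (?P 0) (A 0)) p' x y = complex_of_real (val r) * mm (?P 0) p' x y"
        unfolding mm_def[of _ p'] sum_distrib_left by (intro sum.cong refl)
      then show ?thesis by (simp only: mm_assoc)
    qed
    moreover have "mm (?P 0) (mm (A 0) p') x y + mm (?P 0) (mm Y (?P 0)) x y = complex_of_real (val r) * mm (?P 0) p' x y"
      unfolding mm_def[of "?P 0"] sum_distrib_left sum.distrib[symmetric]
    proof (rule sum.cong[OF refl])
      fix u
      show "?P 0 x u * mm (A 0) p' u y + ?P 0 x u * mm Y (?P 0) u y = complex_of_real (val r) * (?P 0 x u * p' u y)"
        using Pc[of u x] eq[of u] by (cases "u < j") (simp_all add: distrib_left[symmetric] mult.left_commute)
    qed
    ultimately show ?thesis by simp
  qed
  then show ?thesis unfolding A0 Y_def[symmetric] tangent_mats_def using hY sY by blast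
qed

lemma cayley_fun_zero: "cayley_fun B 0 = (\<lambda>x y. if x = y \<and> x < n then 1 else 0)"
proof -
  have x: "scaled_mat B 0 = 0\<^sub>m n n" by (rule eq_matI) (auto simp: scaled_mat_index)
  have i: "inv_mat (1\<^sub>m n + scaled_mat B 0) = 1\<^sub>m n"
    by (rule inv_mat_unique[of _ n]) (simp_all add: x)
  have "cayley n (scaled_mat B 0) = 1\<^sub>m n"
    unfolding cayley_def i unfolding x by (rule eq_matI) auto
  then show ?thesis by (simp add: cayley_fun_def mf_one)
qed

context
  fixes B :: "nat \<Rightarrow> nat \<Rightarrow> nat \<Rightarrow> complex" and X :: "complex mat"
  assumes X: "X \<in> Fib" and HB: "\<And>j. j < n \<Longrightarrow> B j \<in> stabilizer (mf (entries X)) j"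
begin

private abbreviation "A \<equiv> mf (entries X)"
private abbreviation "S \<equiv> {t. \<forall>j<n. Determinant.det (1\<^sub>m n + scaled_mat (B j) t) \<noteq> 0}"

private lemma fB: "fib A" and sAB: "supp n A"
  using Fib_mf[OF X] supp_mf by auto

private lemma curve_invariant:
  assumes t: "t \<in> S"
  shows "k \<le> n \<Longrightarrow> hermf (curve B A k t) \<and> supp n (curve B A k t) \<and>
    (\<forall>x<n - k. \<forall>y<n - k. curve B A k t x y = A x y) \<and>
    (\<forall>i\<le>n. char_poly (submat i (curve B A k t)) = char_poly (submat i A))"
proof (induction k)
  case 0
  then show ?case using fibD(1)[OF fB] sAB by simp
next
  case (Suc k)
  define j where "j = n - Suc k"
  have j: "j < n" "j \<le> n" using Suc.prems by (simp_all add: j_def)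
  have IH: "hermf (curve B A k t)" "supp n (curve B A k t)"
    "\<And>x y. x < j \<Longrightarrow> y < j \<Longrightarrow> curve B A k t x y = A x y"
    "\<And>i. i \<le> n \<Longrightarrow> char_poly (submat i (curve B A k t)) = char_poly (submat i A)"
    using Suc by (simp_all add: j_def)
  have "block_unitary j A (cayley_fun (B j) t)"
    by (rule block_unitary_gg[OF _ stabilizer_supp[OF fB sAB j(2) HB[OF j(1)]] j(2) _ stabilizer_commute[OF fB sAB j(2) HB[OF j(1)]]])
      (use stabilizer_skew[OF HB[OF j(1)]] t j in auto)
  note c = conj_block[OF this IH(1,2) j(2) IH(3)]
  show ?case using c IH(4) by (simp add: j_def[symmetric])
qed

private lemma S: "open S" "0 \<in> S"
proof -
  have "open {t \<in> UNIV. Determinant.det (1\<^sub>m n + scaled_mat (B j) t) \<in> - {0}}" for j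
  proof (rule open_preimage_smooth[OF open_UNIV smooth_on_det[OF open_UNIV]])
    show "smooth_mat_on n UNIV (\<lambda>t. 1\<^sub>m n + scaled_mat (B j) t)"
      unfolding scaled_mat_def
      by (intro smooth_mat_on_add smooth_mat_on_const open_UNIV smooth_mat_onI)
        (auto intro!: smooth_on_mult smooth_on_const smooth_on_minus smooth_on_complex_of_real smooth_on_divide smooth_on_ident)
  qed auto
  then have "open (\<Inter>j\<in>{..<n}. {t. Determinant.det (1\<^sub>m n + scaled_mat (B j) t) \<noteq> 0})" by (intro open_INT) auto
  moreover have "(\<Inter>j\<in>{..<n}. {t. Determinant.det (1\<^sub>m n + scaled_mat (B j) t) \<noteq> 0}) = S" by auto
  ultimately show "open S" by simp
  have "1\<^sub>m n + scaled_mat (B j) 0 = 1\<^sub>m n" for j by (rule eq_matI) (auto simp: scaled_mat_index)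
  then show "0 \<in> S" by simp
qed

private lemma smooth_gg: "j < n \<Longrightarrow> smooth_on S (\<lambda>t. cayley_fun (B j) t x y)"
proof -
  assume j: "j < n"
  have 1: "smooth_mat_on n S (\<lambda>t. cayley n (scaled_mat (B j) t))"
  proof (rule smooth_mat_on_cayley[OF S(1)])
    show "smooth_mat_on n S (scaled_mat (B j))"
    proof (rule smooth_mat_onI)
      fix x y assume "x < n" "y < n"
      then have "(\<lambda>t. scaled_mat (B j) t $$ (x, y)) = (\<lambda>t. - complex_of_real (t / 2) * B j x y)" by (simp add: scaled_mat_index)
      moreover have "smooth_on S \<dots>"
        by (intro smooth_on_mult smooth_on_const smooth_on_minus smooth_on_complex_of_real smooth_on_divide smooth_on_ident S(1)) simp
      ultimately show "smooth_on S (\<lambda>t. scaled_mat (B j) t $$ (x, y))" by simp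
    qed simp
  qed (use j in auto)
  have "dim_row (cayley n (scaled_mat (B j) t)) = n" "dim_col (cayley n (scaled_mat (B j) t)) = n" for t
    using smooth_mat_on_carrier[OF 1, of t] by auto
  then have "(\<lambda>t. cayley_fun (B j) t x y) = (if x < n \<and> y < n then (\<lambda>t. cayley n (scaled_mat (B j) t) $$ (x, y)) else (\<lambda>t. 0))"
    by (auto simp: fun_eq_iff cayley_fun_def mf_entries)
  then show ?thesis using smooth_mat_on_index[OF 1] smooth_on_const[OF S(1)] by auto
qed

private lemma smooth_curve: "k \<le> n \<Longrightarrow> smooth_on S (\<lambda>t. curve B A k t x y)"
proof (induction k arbitrary: x y)
  case 0
  show ?case by (simp add: smooth_on_const[OF S(1)])
next
  case (Suc k)
  have j: "n - Suc k < n" using Suc.prems by simp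
  show ?case
    unfolding curve.simps mm_def adj_def
    by (intro smooth_on_sum smooth_on_mult smooth_on_cnj S(1) smooth_gg[OF j] Suc.IH) (use Suc.prems in simp)
qed

private lemma derivative_gg:
  assumes j: "j < n" and x: "x < n" and y: "y < n"
  shows "((\<lambda>t. cayley_fun (B j) t x y) has_vector_derivative B j x y) (at 0)"
proof -
  define g' where "g' x y = vector_derivative (\<lambda>t. cayley_fun (B j) t x y) (at 0)" for x y
  have g': "((\<lambda>t. cayley_fun (B j) t x y) has_vector_derivative g' x y) (at 0)" for x y
    unfolding g'_def vector_derivative_works[symmetric]
    by (rule smooth_on_imp_differentiable[OF smooth_gg[OF j] S(2)])
  have dx: "((\<lambda>t. scaled_mat (B j) t $$ (z, y)) has_vector_derivative - (1 / 2) * B j z y) (at 0)" if "z < n" for z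
  proof -
    have "((\<lambda>t. complex_of_real t * (- (1 / 2) * B j z y)) has_vector_derivative complex_of_real 1 * (- (1 / 2) * B j z y)) (at 0)"
      by (intro has_vector_derivative_mult_left has_vector_derivative_of_real has_vector_derivative_id[unfolded id_def] DERIV_ident)
    moreover have "scaled_mat (B j) t $$ (z, y) = complex_of_real t * (- (1 / 2) * B j z y)" for t
      using that y by (simp add: scaled_mat_index)
    ultimately show ?thesis by simp
  qed
  have 1: "((\<lambda>t. cayley_fun (B j) t x y + (\<Sum>z<n. cayley_fun (B j) t x z * scaled_mat (B j) t $$ (z, y))) has_vector_derivative
      g' x y + (\<Sum>z<n. cayley_fun (B j) 0 x z * (- (1 / 2) * B j z y) + g' x z * scaled_mat (B j) 0 $$ (z, y))) (at 0)"
    by (intro has_vector_derivative_add g' has_vector_derivative_sum has_vector_derivative_mult dx) auto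
  have 2: "((\<lambda>t. (if x = y then 1 else 0) - scaled_mat (B j) t $$ (x, y)) has_vector_derivative 0 - (- (1 / 2) * B j x y)) (at 0)"
    by (intro has_vector_derivative_diff has_vector_derivative_const dx x)
  have eq: "cayley_fun (B j) t x y + (\<Sum>z<n. cayley_fun (B j) t x z * scaled_mat (B j) t $$ (z, y)) = (if x = y then 1 else 0) - scaled_mat (B j) t $$ (x, y)"
    if "t \<in> S" for t
    by (rule cayley_fun_col[OF _ stabilizer_supp[OF fB sAB _ HB[OF j]]]) (use stabilizer_skew[OF HB[OF j]] that j x y in auto)
  have "g' x y + (\<Sum>z<n. cayley_fun (B j) 0 x z * (- (1 / 2) * B j z y) + g' x z * scaled_mat (B j) 0 $$ (z, y)) = 0 - (- (1 / 2) * B j x y)"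
    using vector_derivative_unique_at[OF has_vector_derivative_transform_within_open[OF 1 S eq] 2] .
  moreover have "(\<Sum>z<n. cayley_fun (B j) 0 x z * (- (1 / 2) * B j z y) + g' x z * scaled_mat (B j) 0 $$ (z, y)) = - (1 / 2) * B j x y"
  proof -
    have "(\<Sum>z<n. cayley_fun (B j) 0 x z * (- (1 / 2) * B j z y) + g' x z * scaled_mat (B j) 0 $$ (z, y)) =
        (\<Sum>z<n. if x = z then - (1 / 2) * B j z y else 0)"
      by (rule sum.cong) (use x y in \<open>auto simp: cayley_fun_zero scaled_mat_index\<close>)
    then show ?thesis using x by (simp add: sum_if_eq)
  qed
  ultimately have "g' x y = B j x y" by (simp add: field_simps)
  then show ?thesis using g'[of x y] by simp
qed

private lemma curve_zero: "k \<le> n \<Longrightarrow> curve B A k 0 = A"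
proof (induction k)
  case (Suc k)
  have a: "adj (\<lambda>x y. if x = y \<and> x < n then 1 else 0) = (\<lambda>x y. if x = y \<and> x < n then 1 else 0)"
    by (auto simp: fun_eq_iff adj_def)
  show ?case using Suc by (simp add: cayley_fun_zero a mm_idn[OF sAB])
qed simp

private lemma derivative_curve:
  "k \<le> n \<Longrightarrow> x < n \<Longrightarrow> y < n \<Longrightarrow>
    ((\<lambda>t. curve B A k t x y) has_vector_derivative (\<Sum>i<k. bracket (B (n - Suc i)) A x y)) (at 0)"
proof (induction k arbitrary: x y)
  case 0
  show ?case by simp
next
  case (Suc k)
  define j where "j = n - Suc k"
  define D where "D x y = (\<Sum>i<k. bracket (B (n - Suc i)) A x y)" for x y
  have j: "j < n" using Suc.prems by (simp add: j_def)
  have IH: "((\<lambda>t. curve B A k t x y) has_vector_derivative D x y) (at 0)" if "x < n" "y < n" for x y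
    unfolding D_def by (rule Suc.IH) (use Suc.prems that in auto)
  have da: "((\<lambda>t. adj (cayley_fun (B j) t) x y) has_vector_derivative adj (B j) x y) (at 0)" if "x < n" "y < n" for x y
    unfolding adj_def by (rule bounded_linear.has_vector_derivative[OF bounded_linear_cnj derivative_gg[OF j that(2,1)]])
  define G where "G = (\<lambda>x y. if x = y \<and> x < n then 1 else (0::complex))"
  have a: "adj G = G" by (auto simp: fun_eq_iff adj_def G_def)
  have G0: "cayley_fun (B j) 0 = G" by (simp add: cayley_fun_zero G_def)
  have C0: "curve B A k 0 = A" using curve_zero Suc.prems by simp
  have mG: "mm G M = M" "mm M G = M" if "supp n M" for M using mm_idn[OF that] by (simp_all add: G_def)
  have inner: "((\<lambda>t. mm (curve B A k t) (adj (cayley_fun (B j) t)) x y) has_vector_derivative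
      mm A (adj (B j)) x y + mm D G x y) (at 0)" if "x < n" "y < n" for x y
    using has_vector_derivative_mm[where M="curve B A k" and N="\<lambda>t. adj (cayley_fun (B j) t)" and M'=D and N'="adj (B j)" and x=x and y=y,
        OF IH[OF that(1)] da[OF _ that(2)]] unfolding C0 G0 a by simp
  have "((\<lambda>t. mm (cayley_fun (B j) t) (mm (curve B A k t) (adj (cayley_fun (B j) t))) x y) has_vector_derivative
      mm G (\<lambda>x y. mm A (adj (B j)) x y + mm D G x y) x y + mm (B j) (mm A G) x y) (at 0)"
    using has_vector_derivative_mm[where M="cayley_fun (B j)" and N="\<lambda>t. mm (curve B A k t) (adj (cayley_fun (B j) t))" and M'="B j"
        and N'="\<lambda>x y. mm A (adj (B j)) x y + mm D G x y" and x=x and y=y,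
        OF derivative_gg[OF j Suc.prems(2)] inner[OF _ Suc.prems(3)]]
    unfolding C0 G0 a by simp
  moreover have "mm G (\<lambda>x y. mm A (adj (B j)) x y + mm D G x y) x y + mm (B j) (mm A G) x y = (\<Sum>i<Suc k. bracket (B (n - Suc i)) A x y)"
  proof -
    have l: "mm G M x y = M x y" "mm M G x y = M x y" for M
    proof -
      have "G x z * M z y = (if x = z then M x y else 0)" "M x z * G z y = (if y = z then M x y else 0)" if "z < n" for z
        using that by (auto simp: G_def)
      then show "mm G M x y = M x y" "mm M G x y = M x y"
        using Suc.prems by (simp_all add: mm_def sum_if_eq)
    qed
    have "adj (B j) = (\<lambda>x y. - B j x y)" using stabilizer_skew[OF HB[OF j]] by (auto simp: fun_eq_iff adj_def)
    then have "mm A (adj (B j)) x y = - mm A (B j) x y" by (simp add: mm_def sum_negf)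
    then show ?thesis unfolding l mG(2)[OF sAB] by (simp add: bracket_def D_def j_def)
  qed
  ultimately show ?case by (simp add: j_def)
qed

lemma tangent_mats_tangent:
  assumes V: "V \<in> carrier_mat n n" and eq: "mf (entries V) = (\<lambda>x y. \<Sum>j<n. bracket (B j) A x y)"
  shows "V \<in> mat_tangent n Fib X"
proof -
  obtain \<epsilon> where \<epsilon>: "\<epsilon> > 0" "ball 0 \<epsilon> \<subseteq> S" using S open_contains_ball by blast
  have b: "ball 0 \<epsilon> = {-\<epsilon><..<\<epsilon>}" by (simp add: ball_eq_greaterThanLessThan)
  define \<gamma> where "\<gamma> t = entries (submat n (curve B A n t))" for t
  have "smooth_on S \<gamma>"
    unfolding \<gamma>_def
  proof (rule smooth_on_entries[OF S(1)])
    show "smooth_on S (\<lambda>t. submat n (curve B A n t) $$ (i, j))" if "i < n" "j < n" for i j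
      using smooth_curve[OF le_refl, of i j] that by simp
  qed simp
  then have sm: "smooth_on {-\<epsilon><..<\<epsilon>} \<gamma>" by (rule smooth_on_subset) (use \<epsilon>(2) b in simp)
  have im: "\<gamma> ` {-\<epsilon><..<\<epsilon>} \<subseteq> entries ` Fib"
  proof
    fix p assume "p \<in> \<gamma> ` {-\<epsilon><..<\<epsilon>}"
    then obtain t where t: "t \<in> S" "p = \<gamma> t" using \<epsilon>(2) b by auto
    note c = curve_invariant[OF t(1) le_refl]
    have "fib (curve B A n t)"
      by (rule fib_of_char_poly) (use c fib_char_poly[OF fB] in auto)
    then have "submat n (curve B A n t) \<in> Fib" using c by (simp add: Fib_def mf_submat)
    then show "p \<in> entries ` Fib" using t(2) by (simp add: \<gamma>_def)
  qed
  have "submat n A = X" by (rule eq_matI) (use Fib_mf(2)[OF X] in \<open>auto simp: mf_entries\<close>)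
  then have \<gamma>0: "\<gamma> 0 = entries X" by (simp add: \<gamma>_def curve_zero)
  have "((\<lambda>t. \<Sum>p\<in>{..<n} \<times> {..<n}. Poly_Mapping.single p (submat n (curve B A n t) $$ p)) has_vector_derivative
      (\<Sum>p\<in>{..<n} \<times> {..<n}. Poly_Mapping.single p (V $$ p))) (at 0)"
  proof (rule has_vector_derivative_sum, rule bounded_linear.has_vector_derivative[OF bounded_linear_single])
    fix p assume "p \<in> {..<n} \<times> {..<n}"
    then obtain x y where p: "p = (x, y)" "x < n" "y < n" by auto
    have "(\<Sum>i<n. bracket (B (n - Suc i)) A x y) = (\<Sum>j<n. bracket (B j) A x y)" by (rule sum.nat_diff_reindex)
    also have "\<dots> = V $$ p" using fun_cong[OF fun_cong[OF eq], of x y] p V by (simp add: mf_entries)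
    finally show "((\<lambda>t. submat n (curve B A n t) $$ p) has_vector_derivative V $$ p) (at 0)"
      using derivative_curve[OF le_refl p(2,3)] p by simp
  qed
  then have "(\<gamma> has_vector_derivative entries V) (at 0)"
    unfolding \<gamma>_def entries_eq_sum[OF V] entries_eq_sum[OF submat_simps(1)] .
  then show ?thesis
    unfolding mat_tangent_def tangent_space_def using V \<epsilon>(1) sm im \<gamma>0 by blast
qed

end

text \<open>One inclusion comes from differentiating curves in the fiber, the other from realising
  the decomposition into commutators by an explicit curve.\<close>

lemma mat_tangent_eq:
  assumes X: "X \<in> Fib"
  shows "mat_tangent n Fib X = {V \<in> carrier_mat n n. mf (entries V) \<in> tangent_mats (mf (entries X))}"
proof (intro equalityI subsetI)
  fix V assume "V \<in> mat_tangent n Fib X"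
  then show "V \<in> {V \<in> carrier_mat n n. mf (entries V) \<in> tangent_mats (mf (entries X))}"
    using tangent_tangent_mats[OF X] by (simp add: mat_tangent_def)
next
  fix V assume V: "V \<in> {V \<in> carrier_mat n n. mf (entries V) \<in> tangent_mats (mf (entries X))}"
  then obtain B where "\<And>j. j < n \<Longrightarrow> B j \<in> stabilizer (mf (entries X)) j"
    "mf (entries V) = (\<lambda>x y. \<Sum>j<n. bracket (B j) (mf (entries X)) x y)"
    using tangent_mats_decomp[OF Fib_mf(1)[OF X] supp_mf[OF Fib_mf(2)[OF X]], of "mf (entries V)"] by blast
  then show "V \<in> mat_tangent n Fib X" using tangent_mats_tangent[OF X, of B V] V by simp
qed

end

section \<open>The symplectic form on the tangent spaces of the fiber\<close>

context gc_param
begin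

lemma trace_mm_commute: "(\<Sum>x<n. mm C E x x) = (\<Sum>x<n. mm E C x x)"
  unfolding mm_def by (subst sum.swap) (simp add: mult.commute)

lemma mf_commutator:
  assumes "C \<in> carrier_mat n n" "E \<in> carrier_mat n n"
  shows "mf (entries (commutator C E)) = bracket (mf (entries C)) (mf (entries E))"
proof (intro ext)
  fix x y
  have "mf (entries (commutator C E)) x y = mf (entries (C * E)) x y - mf (entries (E * C)) x y"
    using assms by (simp add: mf_entries commutator_def del: index_mult_mat(1))
  then show "mf (entries (commutator C E)) x y = bracket (mf (entries C)) (mf (entries E)) x y"
    by (simp add: bracket_def mm_mf[OF assms] mm_mf[OF assms(2,1)])
qed

lemma mf_skew:
  assumes "H \<in> skew_hermitian_mats n"
  shows "cnj (mf (entries H) x y) = - mf (entries H) y x"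
proof (cases "x < n \<and> y < n")
  case True
  have H: "H \<in> carrier_mat n n" "mat_adjoint H = - H" using assms by (simp_all add: skew_hermitian_mats_def)
  have "mat_adjoint H $$ (y, x) = (- H) $$ (y, x)" by (simp add: H(2))
  then show ?thesis using H(1) True by (simp add: mf_entries)
next
  case False
  then show ?thesis using assms by (auto simp: mf_entries skew_hermitian_mats_def)
qed

lemma submat_skew:
  assumes "\<And>x y. cnj (H x y) = - H y x"
  shows "submat n H \<in> skew_hermitian_mats n"
  unfolding skew_hermitian_mats_def using assms by (auto intro!: eq_matI)

lemma mf_inject: "C \<in> carrier_mat n n \<Longrightarrow> E \<in> carrier_mat n n \<Longrightarrow> mf (entries C) = mf (entries E) \<Longrightarrow> C = E"
proof (rule eq_matI)
  fix i j assume a: "C \<in> carrier_mat n n" "E \<in> carrier_mat n n" "mf (entries C) = mf (entries E)"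
    and ij: "i < dim_row E" "j < dim_col E"
  show "C $$ (i, j) = E $$ (i, j)" using fun_cong[OF fun_cong[OF a(3)], of i j] a(1,2) ij by (simp add: mf_entries)
qed auto

lemma bracket_sum_stabilizer:
  assumes "\<And>j. j < n \<Longrightarrow> B j \<in> stabilizer A j"
  shows "cnj (\<Sum>j<n. B j x y) = - (\<Sum>j<n. B j y x)"
  unfolding cnj_sum sum_negf[symmetric] by (rule sum.cong[OF refl]) (rule stabilizer_skew[OF assms], simp)

context
  fixes X :: "complex mat"
  assumes X: "X \<in> Fib"
begin

private abbreviation "AX \<equiv> mf (entries X)"

private lemma fX: "fib AX" and sAX: "supp n AX" and Xc: "X \<in> carrier_mat n n"
  using Fib_mf[OF X] supp_mf by auto

text \<open>By cyclicity of the trace, the form pairs the first tangent vector with a generator of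
  the second one. Orthogonality thus becomes a trace condition against stabiliser elements.\<close>

lemma kks_form_trace:
  assumes H: "H1 \<in> skew_hermitian_mats n" "H2 \<in> skew_hermitian_mats n"
  shows "kks_form n X (commutator H1 X) (commutator H2 X) =
    - \<i> * (\<Sum>x<n. mm (mf (entries (commutator H1 X))) (mf (entries H2)) x x)"
proof -
  have c: "H1 \<in> carrier_mat n n" "H2 \<in> carrier_mat n n" "commutator H1 H2 \<in> carrier_mat n n"
    using H by (auto simp: skew_hermitian_mats_def commutator_def)
  define h1 h2 where "h1 = mf (entries H1)" and "h2 = mf (entries H2)"
  have "trace_mat (X * commutator H1 H2) = (\<Sum>x<n. mf (entries (X * commutator H1 H2)) x x)"
    using Xc c(3) by (simp add: trace_mat_def diag_mat_def sum_list_sum_nth atLeast0LessThan mf_entries del: index_mult_mat(1))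
  also have "\<dots> = (\<Sum>x<n. mm AX (bracket h1 h2) x x)"
    unfolding mm_mf[OF Xc c(3), symmetric] mf_commutator[OF c(1,2)] h1_def h2_def by (rule refl)
  also have "\<dots> = (\<Sum>x<n. mm AX (mm h1 h2) x x) - (\<Sum>x<n. mm AX (mm h2 h1) x x)"
    by (simp add: bracket_def[abs_def] mm_diff sum_subtractf)
  also have "(\<Sum>x<n. mm AX (mm h2 h1) x x) = (\<Sum>x<n. mm (mm h1 AX) h2 x x)"
    using trace_mm_commute[of "mm AX h2" h1] by (simp only: mm_assoc)
  also have "(\<Sum>x<n. mm AX (mm h1 h2) x x) - \<dots> = - (\<Sum>x<n. mm (bracket h1 AX) h2 x x)"
    by (simp add: bracket_def[abs_def] mm_diff sum_subtractf mm_assoc)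
  finally show ?thesis
    using kks_form_commutator[OF Xc H] mf_commutator[OF c(1) Xc] by (simp add: h1_def h2_def)
qed

text \<open>The bracket is linear in its first argument, so the generators of all rows add up to a
  single skew-Hermitian generator and the vector is tangent to the orbit.\<close>

lemma tangent_mats_orbit_tangent:
  assumes Z: "Z \<in> carrier_mat n n" "mf (entries Z) \<in> tangent_mats AX"
  obtains B where "\<And>j. j < n \<Longrightarrow> B j \<in> stabilizer AX j" "submat n (\<lambda>x y. \<Sum>j<n. B j x y) \<in> skew_hermitian_mats n"
    "Z = commutator (submat n (\<lambda>x y. \<Sum>j<n. B j x y)) X" "mf (entries (submat n (\<lambda>x y. \<Sum>j<n. B j x y))) = (\<lambda>x y. \<Sum>j<n. B j x y)"
proof -
  obtain B where B: "\<And>j. j < n \<Longrightarrow> B j \<in> stabilizer AX j" "mf (entries Z) = (\<lambda>x y. \<Sum>j<n. bracket (B j) AX x y)"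
    using tangent_mats_decomp[OF fX sAX Z(2)] by blast
  define H where "H = (\<lambda>x y. \<Sum>j<n. B j x y)"
  have "supp n (B j)" if "j < n" for j
    by (rule supp_mono[OF stabilizer_supp[OF fX sAX _ B(1)[OF that]]]) (use that in auto)
  then have sH: "supp n H" by (simp add: supp_def H_def)
  have e: "mf (entries (submat n H)) = H" by (rule mf_submat[OF sH])
  have sk: "submat n H \<in> skew_hermitian_mats n"
    by (rule submat_skew) (unfold H_def, rule bracket_sum_stabilizer[OF B(1)])
  have c: "commutator (submat n H) X \<in> carrier_mat n n" using Xc by (auto simp: commutator_def)
  have "mf (entries (commutator (submat n H) X)) = mf (entries Z)"
    unfolding mf_commutator[OF submat_simps(1) Xc] e B(2) unfolding H_def by (intro ext bracket_sum)
  then have "Z = commutator (submat n H) X" using mf_inject[OF c Z(1)] by simp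
  then show thesis using that[of B] B(1) sk e by (simp add: H_def)
qed

text \<open>The second vector is generated by a sum of stabiliser elements, each of which has trace
  0 against the first vector.\<close>

lemma isotropic:
  assumes Z: "Z \<in> carrier_mat n n" "mf (entries Z) \<in> tangent_mats AX" and Y: "Y \<in> carrier_mat n n" "mf (entries Y) \<in> tangent_mats AX"
  shows "kks_form n X Z Y = 0"
proof -
  obtain B where B: "submat n (\<lambda>x y. \<Sum>j<n. B j x y) \<in> skew_hermitian_mats n"
    "Z = commutator (submat n (\<lambda>x y. \<Sum>j<n. B j x y)) X" by (rule tangent_mats_orbit_tangent[OF Z])
  obtain C where C: "\<And>j. j < n \<Longrightarrow> C j \<in> stabilizer AX j" "submat n (\<lambda>x y. \<Sum>j<n. C j x y) \<in> skew_hermitian_mats n"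
    "Y = commutator (submat n (\<lambda>x y. \<Sum>j<n. C j x y)) X"
    "mf (entries (submat n (\<lambda>x y. \<Sum>j<n. C j x y))) = (\<lambda>x y. \<Sum>j<n. C j x y)" by (rule tangent_mats_orbit_tangent[OF Y]) (rule that, blast+)
  have "(\<Sum>x<n. mm (mf (entries Z)) (\<lambda>x y. \<Sum>j<n. C j x y) x x) = (\<Sum>x<n. \<Sum>j<n. mm (mf (entries Z)) (C j) x x)"
    by (simp only: mm_sum_right)
  also have "\<dots> = (\<Sum>j<n. \<Sum>x<n. mm (mf (entries Z)) (C j) x x)" by (rule sum.swap)
  also have "\<dots> = 0"
  proof (rule sum.neutral, rule ballI)
    fix j assume "j \<in> {..<n}"
    then show "(\<Sum>x<n. mm (mf (entries Z)) (C j) x x) = 0" using trace_tangent_mats_stabilizer[OF fX sAX _ C(1) Z(2)] by simp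
  qed
  finally show ?thesis using kks_form_trace[OF B(1) C(2)] by (simp add: B(2)[symmetric] C(3)[symmetric] C(4))
qed

text \<open>Commutators with stabiliser elements are tangent to the fiber, so \<open>Z\<close> has
  trace 0 against every stabiliser element of a row before \<open>n\<close>. The elements of
  \<open>stabilizer_rank_one\<close> detect each entry of the compressions of
  \<open>Z\<close>.\<close>

lemma coisotropic:
  assumes Z: "Z \<in> orbit_tangent n X"
    and ort: "\<And>Y. Y \<in> carrier_mat n n \<Longrightarrow> mf (entries Y) \<in> tangent_mats AX \<Longrightarrow> kks_form n X Z Y = 0"
  shows "Z \<in> carrier_mat n n" "mf (entries Z) \<in> tangent_mats AX"
proof -
  obtain H where H: "H \<in> skew_hermitian_mats n" "Z = commutator H X" using Z by (auto simp: orbit_tangent_def)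
  have Hc: "H \<in> carrier_mat n n" using H(1) by (simp add: skew_hermitian_mats_def)
  show Zc: "Z \<in> carrier_mat n n" using H(2) Hc Xc by (auto simp: commutator_def)
  define h where "h = mf (entries H)"
  define z where "z = mf (entries Z)"
  have ze: "z = bracket h AX" unfolding z_def h_def H(2) by (rule mf_commutator[OF Hc Xc])
  have sh: "supp n h" unfolding h_def by (rule supp_mf[OF Hc])
  have hz: "hermf z" unfolding ze by (rule bracket_herm[OF fX sAX]) (use mf_skew[OF H(1)] in \<open>simp add: h_def\<close>)
  have sz: "supp n z" unfolding z_def by (rule supp_mf[OF Zc])
  have trace0: "(\<Sum>x<n. mm z B x x) = 0" if j: "j < n" and B: "B \<in> stabilizer AX j" for j B
  proof -
    have jn: "j \<le> n" using j by simp
    have e: "mf (entries (submat n B)) = B"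
      by (rule mf_submat, rule supp_mono[OF stabilizer_supp[OF fX sAX jn B] jn])
    have sk: "submat n B \<in> skew_hermitian_mats n" by (rule submat_skew) (rule stabilizer_skew[OF B])
    define Y where "Y = commutator (submat n B) X"
    have Yc: "Y \<in> carrier_mat n n" using Xc by (auto simp: Y_def commutator_def)
    have "mf (entries Y) = bracket B AX" unfolding Y_def mf_commutator[OF submat_simps(1) Xc] e by (rule refl)
    then have "kks_form n X Z Y = 0" using ort[OF Yc] bracket_tangent_mats[OF fX sAX jn B] by simp
    then show ?thesis using kks_form_trace[OF H(1) sk] by (simp add: Y_def H(2)[symmetric] e z_def)
  qed
  have "mm (P AX j r) (mm z (P AX j r)) x y = 0" if j: "j \<le> n" and r: "r \<in> act j" for j r x y
  proof (cases "j = n")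
    case True
    \<comment> \<open>In row \<open>n\<close> every commutator with \<open>X\<close> has compression
      0.\<close>
    show ?thesis unfolding ze by (rule bracket_proj_zero[OF fX sAX j r]) (use sh True in simp)
  next
    case False
    then have jn: "j < n" using j by simp
    define u where "u = (\<lambda>z. P AX j r z y)"
    define v where "v = (\<lambda>z. P AX j r z x)"
    have Pc: "app (P AX j r) (\<lambda>z. P AX j r z q) x = P AX j r x q" for q x :: nat
      using mm_PP[OF fX sAX j r r, where x=x and y=q] by (simp add: app_def mm_def)
    have tr: "(\<Sum>x<n. mm z (\<lambda>x y. a * u x * cnj (v y) - cnj a * v x * cnj (u y)) x x) =
        a * ip v (app z u) - cnj a * ip u (app z v)" for a
      by (simp add: mm_def ip_def app_def right_diff_distrib left_diff_distrib sum_subtractf sum_distrib_left mult_ac)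
    have 0: "a * ip v (app z u) - cnj a * ip u (app z v) = 0" for a
      unfolding tr[symmetric]
      by (rule trace0[OF jn stabilizer_rank_one[OF fX sAX j r]]) (auto simp: u_def v_def Pc)
    \<comment> \<open>The two scalars show that the difference and the sum of the two inner products
      vanish.\<close>
    have "ip v (app z u) = 0" using 0[of 1] 0[of \<i>] by (simp add: algebra_simps)
    moreover have "ip v (app z u) = mm (P AX j r) (mm z (P AX j r)) x y"
      using pre_resD(3)[OF fibD(1)[OF fX] fib_pre_res[OF fX j] j r]
      by (simp add: ip_def app_def mm_def u_def v_def)
    ultimately show ?thesis by simp
  qed
  then show "mf (entries Z) \<in> tangent_mats AX" unfolding tangent_mats_def z_def[symmetric] using hz sz by blast
qed

end

lemma lagrangian_Fib: "lagrangian n Fib"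
  unfolding lagrangian_def
proof (intro ballI equalityI subsetI)
  fix X Z assume X: "X \<in> Fib"
  assume "Z \<in> {Z \<in> orbit_tangent n X. \<forall>Y\<in>mat_tangent n Fib X. kks_form n X Z Y = 0}"
  then show "Z \<in> mat_tangent n Fib X" using coisotropic[OF X, of Z] by (simp add: mat_tangent_eq[OF X])
next
  fix X Z assume X: "X \<in> Fib" and "Z \<in> mat_tangent n Fib X"
  then have Z: "Z \<in> carrier_mat n n" "mf (entries Z) \<in> tangent_mats (mf (entries X))" by (simp_all add: mat_tangent_eq[OF X])
  have "Z \<in> orbit_tangent n X"
    by (rule tangent_mats_orbit_tangent[OF X Z]) (auto simp: orbit_tangent_def)
  then show "Z \<in> {Z \<in> orbit_tangent n X. \<forall>Y\<in>mat_tangent n Fib X. kks_form n X Z Y = 0}"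
    using isotropic[OF X Z] by (simp add: mat_tangent_eq[OF X])
qed

end

subsection \<open>Gelfand--Cetlin fibers\<close>

lemma mat_adjoint_index_cnj: "mat_adjoint A = A \<Longrightarrow> i < dim_row A \<Longrightarrow> j < dim_col A \<Longrightarrow> A $$ (j, i) = cnj (A $$ (i, j))"
  for A :: "complex mat"
  by (metis complex_cnj_cnj mat_adjoint_dim mat_adjoint_index)

lemma upper_left_hermitian: "A \<in> hermitian_mats n \<Longrightarrow> k \<le> n \<Longrightarrow> upper_left k A \<in> hermitian_mats k"
  unfolding hermitian_mats_def upper_left_def by (auto intro!: eq_matI mat_adjoint_index_cnj[symmetric])

lemma hermitian_root_real:
  assumes A: "A \<in> hermitian_mats k" and x: "poly (char_poly A) x = 0"
  shows "complex_of_real (Re x) = x"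
proof -
  have Ac: "A \<in> carrier_mat k k" and Aa: "mat_adjoint A = A" using A by (auto simp: hermitian_mats_def)
  have "eigenvalue A x" using eigenvalue_root_char_poly[OF Ac] x by simp
  then obtain v where v: "v \<in> carrier_vec k" "v \<noteq> 0\<^sub>v k" "A *\<^sub>v v = x \<cdot>\<^sub>v v"
    using Ac unfolding eigenvalue_def eigenvector_def by auto
  define N where "N = (\<Sum>i<k. cnj (v $ i) * v $ i)"
  define F where "F = (\<Sum>i<k. \<Sum>j<k. cnj (v $ i) * A $$ (i, j) * v $ j)"
  have row: "(\<Sum>j<k. A $$ (i, j) * v $ j) = x * v $ i" if i: "i < k" for i
  proof -
    have "(A *\<^sub>v v) $ i = (\<Sum>j<k. A $$ (i, j) * v $ j)"
      using Ac v(1) i by (simp add: scalar_prod_def atLeast0LessThan)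
    then show ?thesis using v i by simp
  qed
  have "F = (\<Sum>i<k. cnj (v $ i) * (x * v $ i))"
    unfolding F_def mult.assoc sum_distrib_left[symmetric] by (rule sum.cong) (simp_all add: row)
  then have FN: "F = x * N" unfolding N_def sum_distrib_left by (simp only: mult.left_commute)
  have "cnj F = (\<Sum>i<k. \<Sum>j<k. v $ i * A $$ (j, i) * cnj (v $ j))"
  proof -
    have "cnj (A $$ (i, j)) = A $$ (j, i)" if "i < k" "j < k" for i j
      using mat_adjoint_index_cnj[OF Aa, of i j] that Ac by simp
    then show ?thesis by (simp add: F_def)
  qed
  also have "\<dots> = (\<Sum>j<k. \<Sum>i<k. v $ i * A $$ (j, i) * cnj (v $ j))" by (rule sum.swap)
  also have "\<dots> = F" by (simp add: F_def mult_ac)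
  finally have cF: "cnj F = F" .
  have cN: "cnj N = N" by (simp add: N_def mult.commute)
  have "N \<noteq> 0"
  proof
    assume "N = 0"
    then have "(\<Sum>i<k. v $ i * cnj (v $ i)) = 0" by (simp add: N_def mult.commute)
    then have "v $ i = 0" if "i < k" for i using sum_norm_zeroD that by blast
    then have "v = 0\<^sub>v k" using v(1) by (intro eq_vecI) auto
    then show False using v(2) by simp
  qed
  moreover have "cnj x * N = x * N" using cF cN FN by (metis complex_cnj_mult)
  ultimately have "cnj x = x" by simp
  then show ?thesis by (simp add: complex_eq_iff)
qed

lemma char_poly_proots:
  fixes A :: "complex mat"
  assumes "A \<in> carrier_mat k k"
  shows "char_poly A = (\<Prod>x\<in>#proots (char_poly A). [:- x, 1:])" "size (proots (char_poly A)) = k"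
  using complex_poly_decompose_multiset[of "char_poly A"] degree_monic_char_poly[OF assms]
  by (simp_all add: size_proots_complex)

lemma hermf_mf:
  assumes "X \<in> hermitian_mats n"
  shows "hermf (mf (entries X))"
  unfolding hermf_def
proof (intro allI)
  fix x y
  have X: "X \<in> carrier_mat n n" "mat_adjoint X = X" using assms by (auto simp: hermitian_mats_def)
  show "cnj (mf (entries X) x y) = mf (entries X) y x"
    using X(1) mat_adjoint_index_cnj[OF X(2), of x y] by (cases "x < n \<and> y < n") (auto simp: mf_entries)
qed

lemma eigenvalues_desc:
  assumes A: "A \<in> hermitian_mats k"
  shows "length (eigenvalues_desc A) = k"
    "char_poly A = (\<Prod>i<k. [:- complex_of_real (eigenvalues_desc A ! i), 1:])"
    "i \<le> j \<Longrightarrow> j < k \<Longrightarrow> eigenvalues_desc A ! j \<le> eigenvalues_desc A ! i"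
proof -
  have Ac: "A \<in> carrier_mat k k" using A by (simp add: hermitian_mats_def)
  note p = char_poly_proots[OF Ac]
  have m: "mset (eigenvalues_desc A) = image_mset Re (proots (char_poly A))" by (simp add: eigenvalues_desc_def)
  then show len: "length (eigenvalues_desc A) = k" using p(2) by (metis size_image_mset size_mset)
  have nz: "char_poly A \<noteq> 0" using degree_monic_char_poly[OF Ac] by auto
  have "image_mset (\<lambda>x. complex_of_real (Re x)) (proots (char_poly A)) = image_mset (\<lambda>x. x) (proots (char_poly A))"
    by (rule image_mset_cong) (use hermitian_root_real[OF A] nz in auto)
  then have r: "proots (char_poly A) = image_mset complex_of_real (mset (eigenvalues_desc A))"
    unfolding m by (simp add: multiset.map_comp comp_def)
  have "char_poly A = prod_list (map (\<lambda>x. [:- complex_of_real x, 1:]) (eigenvalues_desc A))"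
    by (subst p(1), subst r) (simp add: multiset.map_comp comp_def flip: mset_map prod_mset_prod_list)
  also have "\<dots> = (\<Prod>i<k. [:- complex_of_real (eigenvalues_desc A ! i), 1:])"
    by (simp add: prod.list_conv_set_nth len atLeast0LessThan)
  finally show "char_poly A = (\<Prod>i<k. [:- complex_of_real (eigenvalues_desc A ! i), 1:])" .
  show "eigenvalues_desc A ! j \<le> eigenvalues_desc A ! i" if "i \<le> j" "j < k"
  proof -
    have "length (sorted_list_of_multiset (image_mset Re (proots (char_poly A)))) = k"
      using len by (simp add: eigenvalues_desc_def)
    then show ?thesis using that by (auto simp: eigenvalues_desc_def rev_nth intro!: sorted_nth_mono)
  qed
qed

lemma eigenvalues_desc_eq_iff:
  assumes "A \<in> hermitian_mats k" "B \<in> hermitian_mats k"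
  shows "char_poly A = char_poly B \<longleftrightarrow> (\<forall>i<k. eigenvalues_desc A ! i = eigenvalues_desc B ! i)"
  using eigenvalues_desc(2)[OF assms(1)] eigenvalues_desc(2)[OF assms(2)] by (auto simp: eigenvalues_desc_def)

lemma orbit_char_poly:
  assumes "A \<in> orbit n lam"
  shows "char_poly A = (\<Prod>i\<in>{1..n}. [:- complex_of_real (lam i), 1:])"
proof -
  have A: "A \<in> carrier_mat n n" and p: "proots (char_poly A) = image_mset (\<lambda>i. complex_of_real (lam i)) (mset_set {1..n})"
    using assms by (auto simp: orbit_def hermitian_mats_def)
  show ?thesis
    by (subst char_poly_proots(1)[OF A], subst p) (simp add: prod_unfold_prod_mset multiset.map_comp comp_def)
qed

text \<open>Row \<open>n\<close> of the triangle is the spectrum, so membership in the orbit is the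
  condition at \<open>j = n\<close>; in the other rows a sorted list of eigenvalues carries the same
  information as the characteristic polynomial.\<close>

lemma gc_fiber_char_poly:
  assumes A0: "A0 \<in> orbit n lam"
  shows "gc_fiber n lam (gc_map n A0) =
    {A \<in> hermitian_mats n. \<forall>j\<le>n. char_poly (upper_left j A) = char_poly (upper_left j A0)}"
proof (intro equalityI subsetI)
  fix A assume A: "A \<in> gc_fiber n lam (gc_map n A0)"
  then have o: "A \<in> orbit n lam" and g: "gc_map n A = gc_map n A0" by (auto simp: gc_fiber_def)
  have h: "A \<in> hermitian_mats n" "A0 \<in> hermitian_mats n" using o A0 by (auto simp: orbit_def)
  have "char_poly (upper_left j A) = char_poly (upper_left j A0)" if j: "j \<le> n" for j
  proof (cases "j = n")
    case True
    have "upper_left n B = B" if "B \<in> hermitian_mats n" for B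
      using that by (auto simp: upper_left_def hermitian_mats_def intro!: eq_matI)
    then show ?thesis using True h orbit_char_poly[OF o] orbit_char_poly[OF A0] by simp
  next
    case False
    have "eigenvalues_desc (upper_left j A) ! i = eigenvalues_desc (upper_left j A0) ! i" if "i < j" for i
      using fun_cong[OF g, of "(Suc i, j)"] that j False by (simp add: gc_map_def)
    then show ?thesis using eigenvalues_desc_eq_iff[OF upper_left_hermitian[OF h(1) j] upper_left_hermitian[OF h(2) j]] by simp
  qed
  then show "A \<in> {A \<in> hermitian_mats n. \<forall>j\<le>n. char_poly (upper_left j A) = char_poly (upper_left j A0)}"
    using h by simp
next
  fix A assume "A \<in> {A \<in> hermitian_mats n. \<forall>j\<le>n. char_poly (upper_left j A) = char_poly (upper_left j A0)}"
  then have h: "A \<in> hermitian_mats n" and c: "\<And>j. j \<le> n \<Longrightarrow> char_poly (upper_left j A) = char_poly (upper_left j A0)" by auto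
  have h0: "A0 \<in> hermitian_mats n" using A0 by (auto simp: orbit_def)
  have "upper_left n B = B" if "B \<in> hermitian_mats n" for B
    using that by (auto simp: upper_left_def hermitian_mats_def intro!: eq_matI)
  then have "char_poly A = char_poly A0" using c[of n] h h0 by simp
  then have "A \<in> orbit n lam" using A0 h by (simp add: orbit_def)
  moreover have "gc_map n A = gc_map n A0"
    using c by (auto simp: gc_map_def eigenvalues_desc_def intro!: restrict_ext)
  ultimately show "A \<in> gc_fiber n lam (gc_map n A0)" by (simp add: gc_fiber_def)
qed

lemma gc_triangle_char_poly:
  assumes A0: "A0 \<in> orbit n lam" and j: "j \<le> n"
  shows "char_poly (upper_left j A0) = (\<Prod>i\<in>{1..j}. [:- complex_of_real (gc_triangle n lam (gc_map n A0) (i, j)), 1:])"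
proof (cases "j = n")
  case True
  have "upper_left n A0 = A0"
    using A0 by (auto simp: upper_left_def orbit_def hermitian_mats_def intro!: eq_matI)
  then show ?thesis using orbit_char_poly[OF A0] True by (simp add: gc_triangle_def)
next
  case False
  have h: "upper_left j A0 \<in> hermitian_mats j" using upper_left_hermitian[OF _ j] A0 by (simp add: orbit_def)
  have "char_poly (upper_left j A0) = (\<Prod>i<j. [:- complex_of_real (gc_triangle n lam (gc_map n A0) (Suc i, j)), 1:])"
    unfolding eigenvalues_desc(2)[OF h] by (rule prod.cong) (use False j in \<open>auto simp: gc_triangle_def gc_map_def\<close>)
  also have "\<dots> = (\<Prod>i\<in>{1..j}. [:- complex_of_real (gc_triangle n lam (gc_map n A0) (i, j)), 1:])"
    by (rule prod.reindex_bij_witness[of _ "\<lambda>i. i - 1" Suc]) auto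
  finally show ?thesis .
qed

lemma gc_triangle_sorted:
  assumes A0: "A0 \<in> orbit n lam" and dec: "\<And>i j. 1 \<le> i \<Longrightarrow> i < j \<Longrightarrow> j \<le> n \<Longrightarrow> lam i > lam j"
    and i: "1 \<le> i" "i < j" "j \<le> n"
  shows "gc_triangle n lam (gc_map n A0) (Suc i, j) \<le> gc_triangle n lam (gc_map n A0) (i, j)"
proof (cases "j = n")
  case True
  then show ?thesis using dec[of i "Suc i"] i by (simp add: gc_triangle_def)
next
  case False
  have h: "upper_left j A0 \<in> hermitian_mats j" using upper_left_hermitian[OF _ i(3)] A0 by (simp add: orbit_def)
  show ?thesis using eigenvalues_desc(3)[OF h, of "i - 1" i] i False by (simp add: gc_triangle_def gc_map_def)
qed

lemma diamond_at_1: "diamond_at 1 i k = {(i, k)}"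
  by (auto simp: diamond_at_def)

lemma diamond_at_triangle:
  assumes "1 \<le> i" "i + l \<le> k + 1" "k + l \<le> n + 1"
  shows "diamond_at l i k \<subseteq> {(i, j). 1 \<le> i \<and> i \<le> j \<and> j \<le> n}"
  using assms by (auto simp: diamond_at_def)

text \<open>The positions not covered by the given diamonds become diamonds of size 1. Neighbouring
  positions are distinct, so no single position contains both, and the equalities are still exactly
  those inside the given diamonds.\<close>

lemma gc_pattern_of_diamonds:
  assumes diamonds: "equalities_form_diamonds n T s l"
    and sorted: "\<And>i j. 1 \<le> i \<Longrightarrow> i < j \<Longrightarrow> j \<le> n \<Longrightarrow> T (Suc i, j) \<le> T (i, j)"
  obtains s' L I K where "gc_pattern n s' T L I K" "s \<le> s'" "\<And>r. r < s \<Longrightarrow> L r = l r" "\<And>r. s \<le> r \<Longrightarrow> L r = 1"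
proof -
  obtain D where D: "\<forall>r<s. is_diamond n (l r) (D r)" "disjoint_family_on D {..<s}"
    "\<And>p q. triangle_neighbours n p q \<Longrightarrow> T p = T q \<longleftrightarrow> (\<exists>r<s. p \<in> D r \<and> q \<in> D r)"
    using diamonds unfolding equalities_form_diamonds_def by blast
  have "\<forall>r<s. \<exists>ik. 1 \<le> fst ik \<and> fst ik + l r \<le> snd ik + 1 \<and> snd ik + l r \<le> n + 1 \<and> D r = diamond_at (l r) (fst ik) (snd ik)"
    using D(1) by (simp add: is_diamond_def)
  then obtain ik where ik: "\<And>r. r < s \<Longrightarrow> 1 \<le> fst (ik r) \<and> fst (ik r) + l r \<le> snd (ik r) + 1 \<and>
      snd (ik r) + l r \<le> n + 1 \<and> D r = diamond_at (l r) (fst (ik r)) (snd (ik r))"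
    by metis
  define Tr where "Tr = {(i, j). 1 \<le> i \<and> i \<le> j \<and> j \<le> n}"
  \<comment> \<open>The uncovered positions, numbered by \<open>g\<close> and appended after the
    given diamonds.\<close>
  define U where "U = Tr - (\<Union>r<s. D r)"
  have "Tr \<subseteq> {..n} \<times> {..n}" by (auto simp: Tr_def)
  then have "finite U" unfolding U_def by (intro finite_Diff) (rule finite_subset, auto)
  then obtain g where g: "bij_betw g {0..<card U} U" using ex_bij_betw_nat_finite by blast
  define s' where "s' = s + card U"
  define L where "L r = (if r < s then l r else 1)" for r
  define I where "I r = (if r < s then fst (ik r) else fst (g (r - s)))" for r
  define K where "K r = (if r < s then snd (ik r) else snd (g (r - s)))" for r
  define E where "E r = diamond_at (L r) (I r) (K r)" for r
  have E1: "E r = D r" if "r < s" for r using ik[OF that] that by (simp add: E_def L_def I_def K_def)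
  have E2: "E r = {g (r - s)}" if "s \<le> r" for r using that by (simp add: E_def L_def I_def K_def diamond_at_1[simplified])
  have gU: "g (r - s) \<in> U" if "s \<le> r" "r < s'" for r
    using bij_betwE[OF g] that by (auto simp: s'_def)
  have DT: "D r \<subseteq> Tr" if "r < s" for r
    using diamond_at_triangle[of "fst (ik r)" "l r" "snd (ik r)" n] ik[OF that] by (simp add: Tr_def)
  have LIK: "1 \<le> L r \<and> 1 \<le> I r \<and> I r + L r \<le> K r + 1 \<and> K r + L r \<le> n + 1" if r: "r < s'" for r
  proof (cases "r < s")
    case True
    then show ?thesis using D(1) ik[OF True] by (auto simp: L_def I_def K_def is_diamond_def)
  next
    case False
    then have "g (r - s) \<in> Tr" using gU[of r] r by (simp add: U_def)
    then show ?thesis using False by (auto simp: L_def I_def K_def Tr_def split: prod.splits)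
  qed
  have "gc_pattern n s' T L I K"
  proof
    show "disjoint_family_on (\<lambda>r. diamond_at (L r) (I r) (K r)) {..<s'}"
      unfolding E_def[symmetric] disjoint_family_on_def
    proof (intro ballI impI)
      fix r q assume r: "r \<in> {..<s'}" and q: "q \<in> {..<s'}" and ne: "r \<noteq> q"
      have *: "E r \<inter> E q = {}" if "r < s" "s \<le> q" "q < s'" for r q
        using E1[OF that(1)] E2[OF that(2)] gU[OF that(2,3)] that(1) by (auto simp: U_def)
      consider "r < s" "q < s" | "r < s" "s \<le> q" | "s \<le> r" "q < s" | "s \<le> r" "s \<le> q" by linarith
      then show "E r \<inter> E q = {}"
      proof cases
        case 1
        then show ?thesis using D(2) ne E1 by (auto simp: disjoint_family_on_def)
      next
        case 2
        then show ?thesis using * q by simp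
      next
        case 3
        then show ?thesis using *[of q r] r by auto
      next
        case 4
        have "g (r - s) \<noteq> g (q - s)"
        proof
          assume "g (r - s) = g (q - s)"
          then have "r - s = q - s"
            using inj_onD[OF bij_betw_imp_inj_on[OF g]] 4 r q by (auto simp: s'_def)
          then show False using ne 4 by simp
        qed
        then show ?thesis using E2 4 by simp
      qed
    qed
    show "(\<Union>r<s'. diamond_at (L r) (I r) (K r)) = {(i, j). 1 \<le> i \<and> i \<le> j \<and> j \<le> n}"
      unfolding E_def[symmetric] Tr_def[symmetric]
    proof (intro equalityI subsetI)
      fix p assume "p \<in> (\<Union>r<s'. E r)"
      then obtain r where r: "r < s'" "p \<in> E r" by blast
      show "p \<in> Tr"
      proof (cases "r < s")
        case True
        then show ?thesis using r E1 DT by blast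
      next
        case False
        then show ?thesis using r E2[of r] gU[of r] by (simp add: U_def)
      qed
    next
      fix p assume p: "p \<in> Tr"
      show "p \<in> (\<Union>r<s'. E r)"
      proof (cases "p \<in> (\<Union>r<s. D r)")
        case True
        then obtain r where "r < s" "p \<in> D r" by blast
        then have "r < s'" "p \<in> E r" by (simp_all add: s'_def E1)
        then show ?thesis by blast
      next
        case False
        then have "p \<in> U" using p by (simp add: U_def)
        then obtain i where "i < card U" "p = g i" using bij_betw_imp_surj_on[OF g] by force
        then have "s + i < s'" "p \<in> E (s + i)" by (simp_all add: s'_def E2)
        then show ?thesis by blast
      qed
    qed
    show "T p = T q \<longleftrightarrow> (\<exists>r<s'. p \<in> diamond_at (L r) (I r) (K r) \<and> q \<in> diamond_at (L r) (I r) (K r))"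
      if pq: "triangle_neighbours n p q" for p q
      unfolding E_def[symmetric] D(3)[OF pq]
    proof
      assume "\<exists>r<s. p \<in> D r \<and> q \<in> D r"
      then obtain r where "r < s" "p \<in> D r" "q \<in> D r" by blast
      then have "r < s'" "p \<in> E r" "q \<in> E r" by (simp_all add: s'_def E1)
      then show "\<exists>r<s'. p \<in> E r \<and> q \<in> E r" by blast
    next
      assume "\<exists>r<s'. p \<in> E r \<and> q \<in> E r"
      then obtain r where r: "r < s'" "p \<in> E r" "q \<in> E r" by blast
      have "p \<noteq> q" using pq by (auto simp: triangle_neighbours_def split: prod.splits)
      then have "r < s" using r E2[of r] by (cases "r < s") auto
      then show "\<exists>r<s. p \<in> D r \<and> q \<in> D r" using r E1 by blast
    qed
  qed (use LIK sorted in auto)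
  then show thesis by (rule that) (simp_all add: s'_def L_def)
qed

lemma (in gc_param) Fib_eq:
  assumes A0: "A0 = mf (entries X0)" and X0: "X0 \<in> hermitian_mats n"
  shows "Fib = {X \<in> hermitian_mats n. \<forall>j\<le>n. char_poly (upper_left j X) = char_poly (upper_left j X0)}"
proof -
  have sub: "submat j (mf (entries X)) = upper_left j X" if "X \<in> carrier_mat n n" "j \<le> n" for X j
    using that by (auto simp: upper_left_def mf_entries intro!: eq_matI)
  have herm: "hermf (mf (entries X)) \<longleftrightarrow> X \<in> hermitian_mats n" if X: "X \<in> carrier_mat n n" for X
  proof
    assume h: "hermf (mf (entries X))"
    have "cnj (X $$ (y, x)) = X $$ (x, y)" if "x < n" "y < n" for x y
    proof -
      have "cnj (mf (entries X) y x) = mf (entries X) x y" using h unfolding hermf_def by blast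
      then show ?thesis using that X by (simp add: mf_entries)
    qed
    then show "X \<in> hermitian_mats n" using X by (auto simp: hermitian_mats_def intro!: eq_matI)
  next
    assume "X \<in> hermitian_mats n"
    then show "hermf (mf (entries X))" by (rule hermf_mf)
  qed
  have X0c: "X0 \<in> carrier_mat n n" using X0 by (simp add: hermitian_mats_def)
  have pol: "pol j = char_poly (upper_left j X0)" if "j \<le> n" for j
    using char0[OF that] sub[OF X0c that] A0 by simp
  show ?thesis
  proof (intro equalityI subsetI)
    fix X assume X: "X \<in> Fib"
    note x = Fib_mf[OF X]
    show "X \<in> {X \<in> hermitian_mats n. \<forall>j\<le>n. char_poly (upper_left j X) = char_poly (upper_left j X0)}"
      using herm[OF x(2)] fibD(1)[OF x(1)] fib_char_poly[OF x(1)] sub[OF x(2)] pol by simp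
  next
    fix X assume "X \<in> {X \<in> hermitian_mats n. \<forall>j\<le>n. char_poly (upper_left j X) = char_poly (upper_left j X0)}"
    then have X: "X \<in> hermitian_mats n" "\<And>j. j \<le> n \<Longrightarrow> char_poly (upper_left j X) = char_poly (upper_left j X0)" by auto
    have Xc: "X \<in> carrier_mat n n" using X(1) by (simp add: hermitian_mats_def)
    have "fib (mf (entries X))"
      by (rule fib_of_char_poly) (use herm[OF Xc] X sub[OF Xc] pol in auto)
    then show "X \<in> Fib" using Xc by (simp add: Fib_def)
  qed
qed

theorem mainTheorem4:
  fixes n s :: nat and lam :: "nat \<Rightarrow> real" and Lam :: "nat \<times> nat \<Rightarrow> real" and l :: "nat \<Rightarrow> nat"
  assumes decreasing: "\<And>i j. 1 \<le> i \<Longrightarrow> i < j \<Longrightarrow> j \<le> n \<Longrightarrow> lam i > lam j"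
    and positive: "\<And>i. 1 \<le> i \<Longrightarrow> i \<le> n \<Longrightarrow> lam i > 0"
    and Lam_value: "Lam \<in> gc_map n ` orbit n lam"
    and s_pos: "s \<ge> 1"
    and diamonds: "equalities_form_diamonds n (gc_triangle n lam Lam) s l"
  shows "orbit_submanifold n lam (n * (n - 1) div 2) (gc_fiber n lam Lam) \<and>
    lagrangian n (gc_fiber n lam Lam) \<and>
    diffeomorphic (entries ` gc_fiber n lam Lam)
      (finprod_set s (\<lambda>r. entries ` SU (l r)) \<times>
       finprod_set (n * (n - 1) div 2 - (\<Sum>r<s. ((l r)\<^sup>2 - 1))) (\<lambda>_. sphere (0::complex) 1))"
proof -
  obtain X0 where X0: "X0 \<in> orbit n lam" and Lam: "Lam = gc_map n X0" using Lam_value by blast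
  have h0: "X0 \<in> hermitian_mats n" using X0 by (simp add: orbit_def)
  define T where "T = gc_triangle n lam Lam"
  obtain s' L I K where pat: "gc_pattern n s' T L I K" and ss: "s \<le> s'"
    and L: "\<And>r. r < s \<Longrightarrow> L r = l r" "\<And>r. s \<le> r \<Longrightarrow> L r = 1"
    by (rule gc_pattern_of_diamonds[OF diamonds[folded T_def]])
      (use gc_triangle_sorted[OF X0 decreasing] in \<open>simp_all add: T_def Lam\<close>)
  interpret gc_pattern n s' T L I K by (rule pat)
  \<comment> \<open>The number of phases that survive. \<open>sum_L\<close> identifies it with the
    dimension of the torus in the statement and shows that the subtraction there is not
    truncated.\<close>
  define m where "m = card {r. r < s' \<and> top r < n}"
  have "finite {r. r < s' \<and> top r < n}" by simp
  from ex_bij_betw_nat_finite[OF this] obtain e where e: "bij_betw e {..<m} {r. r < s' \<and> top r < n}"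
    by (auto simp: m_def atLeast0LessThan)
  define A0 where "A0 = mf (entries X0)"
  have Xc: "X0 \<in> carrier_mat n n" using h0 by (auto simp: hermitian_mats_def)
  interpret gc_param n s' T L I K A0 s m e
  proof unfold_locales
    show "hermf A0" unfolding A0_def by (rule hermf_mf[OF h0])
    show "char_poly (submat j A0) = pol j" if "j \<le> n" for j
    proof -
      have "submat j A0 = upper_left j X0"
        using that Xc by (auto simp: A0_def upper_left_def mf_entries intro!: eq_matI)
      then show ?thesis unfolding pol_def using gc_triangle_char_poly[OF X0 that] by (simp add: T_def Lam)
    qed
  qed (use ss L e in auto)
  have fiber: "gc_fiber n lam Lam = Fib"
    unfolding Lam gc_fiber_char_poly[OF X0] using Fib_eq[OF A0_def h0] by simp
  have "(\<Sum>r<s. (l r)\<^sup>2 - 1) + m = n * (n - 1) div 2" using sum_L L(1) by simp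
  then have "n * (n - 1) div 2 - (\<Sum>r<s. (l r)\<^sup>2 - 1) = m" by simp
  moreover have "finprod_set s (\<lambda>r. entries ` SU (L r)) = finprod_set s (\<lambda>r. entries ` SU (l r))"
    unfolding finprod_set_def using L(1) by auto
  ultimately have target: "finprod_set s (\<lambda>r. entries ` SU (l r)) \<times>
       finprod_set (n * (n - 1) div 2 - (\<Sum>r<s. ((l r)\<^sup>2 - 1))) (\<lambda>_. sphere (0::complex) 1) = Target"
    by (simp add: Target_def)
  have "gc_fiber n lam Lam \<subseteq> orbit n lam" by (auto simp: gc_fiber_def)
  then show ?thesis
    unfolding orbit_submanifold_def target
    using submanifold_Fib lagrangian_Fib diffeomorphic_Fib by (simp add: fiber)
qed

end
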